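(* Let $R$ be a commutative noetherian ring of Krull dimension at least one, let $\mathfrak{n}$ be a non-minimal prime ideal of $R$, and suppose $R$ contains an element $x$ such that $\{r\in R\mid rx=0\}=(x)$ (in particular $x^2=0$). Let $E$ be the injective hull of $R/\mathfrak{n}$ over $R$, and let $J$ be the complex of $R$-modules $$J=\quad \cdots\longrightarrow 0\longrightarrow E\xrightarrow{\ x\ }E\xrightarrow{\ x\ }E\xrightarrow{\ x\ }\cdots$$ with $J^n=0$ for $n<0$, $J^n=E$ for $n\geqslant 0$, and every differential $J^n\to J^{n+1}$ with $n\geqslant 0$ given by multiplication by $x$. (One has $\mathrm{H}^i(J)=0$ for $i\neq 0$.) Set $M=\mathrm{H}^0(J)=\{e\in E\mid xe=0\}$, viewed as a complex concentrated in degree $0$, and let $\iota\colon M\to J$ be the inclusion, which is a minimal injective resolution of $M$ over $R$. Let $$X=\prod_{i\in\mathbb{Z}}\Sigma^iM\quad\text{and}\quad I=\prod_{i\in\mathbb{Z}}\Sigma^iJ,$$ viewed as complexes of $R$-modules. Then the following statements hold. (1) The complex $I$ is semi-injective and minimal. (2) The natural map $\prod_{i\in\mathbb{Z}}\Sigma^i\iota\colon X\to I$ is a quasi-isomorphism. (3) $\operatorname{supp}_R X=\{\mathfrak{n}\}\subsetneq \operatorname{ass}_R I^n$ for each integer $n$. (4) For each integer $n$ and any prime $\mathfrak{p}$ in $\operatorname{ass}_R I^n$ with $\mathfrak{p}\neq\mathfrak{n}$, the complex of injective $R_{\mathfrak{p}}$-modules $I_{\mathfrak{p}}$ is acyclic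 but not contractible, and hence not homotopically injective (as a complex of $R_{\mathfrak{p}}$-modules).
   Context: Complexes are graded cohomologically (differentials raise degree by one) and may be unbounded. $\Sigma^i$ denotes the $i$th suspension (shift) of a complex, so that $(\Sigma^iY)^n=Y^{n+i}$, with the usual sign $(-1)^i$ on the differential. For a commutative noetherian ring $R$ and a prime $\mathfrak{p}\in\operatorname{Spec}R$, let $k(\mathfrak{p})=R_{\mathfrak{p}}/\mathfrak{p}R_{\mathfrak{p}}$. The support of a complex $X$ of $R$-modules is (Foxby's "small support") $$\operatorname{supp}_R X=\{\mathfrak{p}\in\operatorname{Spec}R\mid \mathrm{H}(X\otimes^{\mathbf L}_R k(\mathfrak{p}))\neq 0\}.$$ For an $R$-module $N$, $\operatorname{ass}_R N$ is the set of associated primes of $N$, i.e. the primes of $R$ that are the annihilator of some element of $N$. A complex $I$ of $R$-modules is homotopically injective if $\operatorname{Hom}_R(-,I)$ preserves quasi-isomorphisms. It is semi-injective if it is homotopically injective and each $R$-module $I^n$ is injective. A complex $I$ of injective modules, with differential $\partial$, is minimal if the extension $\operatorname{Ker}(\partial^n)\subseteq I^n$ is essential for each integer $n$. The same definitions apply over any commutative noetherian ring, such as $R_{\mathfrak{p}}$. *)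

theory Defs
  imports "HOL-Library.Extended_Real" "HOL-Algebra.Ring_Divisibility" "HOL-Algebra.Module"
begin

text \<open>
  Modules are the carrier-based modules of \<^theory>\<open>HOL-Algebra.Module\<close>.  Its record type
  \<open>('a, 'b) module\<close> extends \<open>'b ring\<close>, so it has the fields \<open>mult\<close> and \<open>one\<close>; they play no role
  for a module and are left undefined in the constructions below.
\<close>


section \<open>Modules\<close>

definition self_module :: "('a, 'r) ring_scheme \<Rightarrow> ('a, 'a) module" where
  "self_module R = \<lparr>carrier = carrier R, monoid.mult = monoid.mult R, one = one R,
     ring.zero = ring.zero R, ring.add = ring.add R, smult = monoid.mult R\<rparr>"

definition restrict_scalars :: "('a \<Rightarrow> 'c) \<Rightarrow> ('c, 'm) module \<Rightarrow> ('a, 'm) module" where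
  "restrict_scalars \<phi> M = \<lparr>carrier = carrier M, monoid.mult = monoid.mult M, one = one M,
     ring.zero = ring.zero M, ring.add = ring.add M, smult = (\<lambda>r y. \<phi> r \<odot>\<^bsub>M\<^esub> y)\<rparr>"

definition zero_module :: "('a, 'm) module \<Rightarrow> ('a, 'm) module" where
  "zero_module M = M\<lparr>carrier := {\<zero>\<^bsub>M\<^esub>}\<rparr>"

definition quot_module :: "('a, 'm) module \<Rightarrow> 'm set \<Rightarrow> ('a, 'm set) module" where
  "quot_module M N = \<lparr>carrier = a_rcosets\<^bsub>M\<^esub> N, monoid.mult = undefined, one = undefined,
     ring.zero = N, ring.add = set_add M, smult = (\<lambda>r A. \<Union>a\<in>A. N +>\<^bsub>M\<^esub> (r \<odot>\<^bsub>M\<^esub> a))\<rparr>"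

definition prod_module :: "('i \<Rightarrow> ('a, 'm) module) \<Rightarrow> ('a, 'i \<Rightarrow> 'm) module" where
  "prod_module M = \<lparr>carrier = {u. \<forall>i. u i \<in> carrier (M i)}, monoid.mult = undefined, one = undefined,
     ring.zero = (\<lambda>i. \<zero>\<^bsub>M i\<^esub>), ring.add = (\<lambda>u v i. u i \<oplus>\<^bsub>M i\<^esub> v i),
     smult = (\<lambda>r u i. r \<odot>\<^bsub>M i\<^esub> u i)\<rparr>"

definition direct_sum_module :: "('i \<Rightarrow> ('a, 'm) module) \<Rightarrow> ('a, 'i \<Rightarrow> 'm) module" where
  "direct_sum_module M = (prod_module M)
     \<lparr>carrier := {u \<in> carrier (prod_module M). finite {i. u i \<noteq> \<zero>\<^bsub>M i\<^esub>}}\<rparr>"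

definition mod_hom ::
    "('a, 'r) ring_scheme \<Rightarrow> ('a, 'm) module \<Rightarrow> ('a, 'n) module \<Rightarrow> ('m \<Rightarrow> 'n) set" where
  "mod_hom R M N = {f \<in> carrier M \<rightarrow> carrier N.
     (\<forall>x\<in>carrier M. \<forall>y\<in>carrier M. f (x \<oplus>\<^bsub>M\<^esub> y) = f x \<oplus>\<^bsub>N\<^esub> f y) \<and>
     (\<forall>r\<in>carrier R. \<forall>x\<in>carrier M. f (r \<odot>\<^bsub>M\<^esub> x) = r \<odot>\<^bsub>N\<^esub> f x)}"

text \<open>In the module \<open>Hom R M N\<close>, homomorphisms are made extensional, so that they are equal when
  they agree on \<open>carrier M\<close>.\<close>

definition hom_module ::
    "('a, 'r) ring_scheme \<Rightarrow> ('a, 'm) module \<Rightarrow> ('a, 'n) module \<Rightarrow> ('a, 'm \<Rightarrow> 'n) module" where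
  "hom_module R M N = \<lparr>carrier = mod_hom R M N \<inter> extensional (carrier M),
     monoid.mult = undefined, one = undefined,
     ring.zero = (\<lambda>x\<in>carrier M. \<zero>\<^bsub>N\<^esub>),
     ring.add = (\<lambda>f g. \<lambda>x\<in>carrier M. f x \<oplus>\<^bsub>N\<^esub> g x),
     smult = (\<lambda>r f. \<lambda>x\<in>carrier M. r \<odot>\<^bsub>N\<^esub> f x)\<rparr>"

definition annihilator :: "('a, 'r) ring_scheme \<Rightarrow> ('a, 'm) module \<Rightarrow> 'm \<Rightarrow> 'a set" where
  "annihilator R M m = {r \<in> carrier R. r \<odot>\<^bsub>M\<^esub> m = \<zero>\<^bsub>M\<^esub>}"

definition ass :: "('a, 'r) ring_scheme \<Rightarrow> ('a, 'm) module \<Rightarrow> 'a set set" where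
  "ass R M = {p. primeideal p R \<and> (\<exists>m\<in>carrier M. p = annihilator R M m)}"

definition essential_submodule :: "('a, 'r) ring_scheme \<Rightarrow> 'm set \<Rightarrow> ('a, 'm) module \<Rightarrow> bool" where
  "essential_submodule R N M \<longleftrightarrow> submodule N R M \<and>
     (\<forall>L. submodule L R M \<and> L \<noteq> {\<zero>\<^bsub>M\<^esub>} \<longrightarrow> N \<inter> L \<noteq> {\<zero>\<^bsub>M\<^esub>})"

text \<open>
  HOL cannot quantify over types inside a formula, so injectivity is relative to the type \<open>'t\<close> in
  which the test modules live.  By Baer's criterion the type \<open>'a\<close> of the ring already suffices:
  the ideals of \<open>R\<close> and \<open>R\<close> itself live there.  Asserting injectivity in full means asserting it
  for an arbitrary \<open>'t\<close>.
\<close>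

definition injective_module ::
    "'t itself \<Rightarrow> ('a, 'r) ring_scheme \<Rightarrow> ('a, 'm) module \<Rightarrow> bool" where
  "injective_module T R E \<longleftrightarrow> module R E \<and>
     (\<forall>(M :: ('a, 't) module) (N :: ('a, 't) module) f g.
        module R M \<and> module R N \<and> f \<in> mod_hom R M N \<and> inj_on f (carrier M) \<and> g \<in> mod_hom R M E
        \<longrightarrow> (\<exists>h\<in>mod_hom R N E. \<forall>m\<in>carrier M. h (f m) = g m))"

definition injective_hull ::
    "'t itself \<Rightarrow> ('a, 'r) ring_scheme \<Rightarrow> ('a, 'n) module \<Rightarrow> ('a, 'm) module \<Rightarrow> bool" where
  "injective_hull T R N E \<longleftrightarrow> injective_module T R E \<and>
     (\<exists>j\<in>mod_hom R N E. inj_on j (carrier N) \<and> essential_submodule R (j ` carrier N) E)"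

definition free_module :: "('a, 'r) ring_scheme \<Rightarrow> ('a, 'm) module \<Rightarrow> bool" where
  "free_module R M \<longleftrightarrow> module R M \<and>
     (\<exists>B\<subseteq>carrier M. \<forall>m\<in>carrier M. \<exists>!c. c \<in> B \<rightarrow>\<^sub>E carrier R \<and>
        finite {b\<in>B. c b \<noteq> \<zero>\<^bsub>R\<^esub>} \<and>
        m = (\<Oplus>\<^bsub>M\<^esub> b\<in>{b\<in>B. c b \<noteq> \<zero>\<^bsub>R\<^esub>}. c b \<odot>\<^bsub>M\<^esub> b))"


subsection \<open>Tensor products\<close>

definition free_on :: "('a, 'r) ring_scheme \<Rightarrow> 'b set \<Rightarrow> ('a, 'b \<Rightarrow> 'a) module" where
  "free_on R A = \<lparr>carrier = {c. (\<forall>b. c b \<in> carrier R) \<and> (\<forall>b. b \<notin> A \<longrightarrow> c b = \<zero>\<^bsub>R\<^esub>) \<and>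
       finite {b. c b \<noteq> \<zero>\<^bsub>R\<^esub>}},
     monoid.mult = undefined, one = undefined, ring.zero = (\<lambda>b. \<zero>\<^bsub>R\<^esub>),
     ring.add = (\<lambda>c d b. c b \<oplus>\<^bsub>R\<^esub> d b), smult = (\<lambda>r c b. r \<otimes>\<^bsub>R\<^esub> c b)\<rparr>"

definition generator :: "('a, 'r) ring_scheme \<Rightarrow> 'b \<Rightarrow> 'b \<Rightarrow> 'a" where
  "generator R b = (\<lambda>c. if c = b then \<one>\<^bsub>R\<^esub> else \<zero>\<^bsub>R\<^esub>)"

definition submodule_span ::
    "('a, 'r) ring_scheme \<Rightarrow> ('a, 'm) module \<Rightarrow> 'm set \<Rightarrow> 'm set" where
  "submodule_span R M S = \<Inter>{N. submodule N R M \<and> S \<subseteq> N}"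

definition tensor_relations ::
    "('a, 'r) ring_scheme \<Rightarrow> ('a, 'm) module \<Rightarrow> ('a, 'n) module \<Rightarrow> ('m \<times> 'n \<Rightarrow> 'a) set" where
  "tensor_relations R M N = (let F = free_on R (carrier M \<times> carrier N); g = generator R in
     submodule_span R F
      ({g (m \<oplus>\<^bsub>M\<^esub> m', n) \<ominus>\<^bsub>F\<^esub> (g (m, n) \<oplus>\<^bsub>F\<^esub> g (m', n)) | m m' n.
          m \<in> carrier M \<and> m' \<in> carrier M \<and> n \<in> carrier N} \<union>
       {g (m, n \<oplus>\<^bsub>N\<^esub> n') \<ominus>\<^bsub>F\<^esub> (g (m, n) \<oplus>\<^bsub>F\<^esub> g (m, n')) | m n n'.
          m \<in> carrier M \<and> n \<in> carrier N \<and> n' \<in> carrier N} \<union>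
       {g (r \<odot>\<^bsub>M\<^esub> m, n) \<ominus>\<^bsub>F\<^esub> (r \<odot>\<^bsub>F\<^esub> g (m, n)) | r m n.
          r \<in> carrier R \<and> m \<in> carrier M \<and> n \<in> carrier N} \<union>
       {g (m, r \<odot>\<^bsub>N\<^esub> n) \<ominus>\<^bsub>F\<^esub> (r \<odot>\<^bsub>F\<^esub> g (m, n)) | r m n.
          r \<in> carrier R \<and> m \<in> carrier M \<and> n \<in> carrier N}))"

definition tensor ::
    "('a, 'r) ring_scheme \<Rightarrow> ('a, 'm) module \<Rightarrow> ('a, 'n) module \<Rightarrow> ('a, ('m \<times> 'n \<Rightarrow> 'a) set) module" where
  "tensor R M N = quot_module (free_on R (carrier M \<times> carrier N)) (tensor_relations R M N)"

definition pure_tensor ::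
    "('a, 'r) ring_scheme \<Rightarrow> ('a, 'm) module \<Rightarrow> ('a, 'n) module \<Rightarrow> 'm \<Rightarrow> 'n \<Rightarrow> ('m \<times> 'n \<Rightarrow> 'a) set" where
  "pure_tensor R M N m n = tensor_relations R M N
     +>\<^bsub>free_on R (carrier M \<times> carrier N)\<^esub> generator R (m, n)"

text \<open>\<open>f \<otimes> g : M \<otimes> N \<rightarrow> M' \<otimes> N'\<close>\<close>

definition tensor_map ::
    "('a, 'r) ring_scheme \<Rightarrow> ('a, 'm) module \<Rightarrow> ('a, 'n) module \<Rightarrow>
     ('a, 'm2) module \<Rightarrow> ('a, 'n2) module \<Rightarrow> ('m \<Rightarrow> 'm2) \<Rightarrow> ('n \<Rightarrow> 'n2) \<Rightarrow>
     ('m \<times> 'n \<Rightarrow> 'a) set \<Rightarrow> ('m2 \<times> 'n2 \<Rightarrow> 'a) set" where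
  "tensor_map R M N M' N' f g =
     (THE h. h \<in> carrier (hom_module R (tensor R M N) (tensor R M' N')) \<and>
        (\<forall>m\<in>carrier M. \<forall>n\<in>carrier N.
           h (pure_tensor R M N m n) = pure_tensor R M' N' (f m) (g n)))"


section \<open>Complexes\<close>

text \<open>\<open>diff C n\<close> goes from \<open>obj C n\<close> to \<open>obj C (n + 1)\<close>.\<close>

record ('a, 'm) cochain =
  obj :: "int \<Rightarrow> ('a, 'm) module"
  diff :: "int \<Rightarrow> 'm \<Rightarrow> 'm"

definition cochain_complex :: "('a, 'r) ring_scheme \<Rightarrow> ('a, 'm) cochain \<Rightarrow> bool" where
  "cochain_complex R C \<longleftrightarrow>
     (\<forall>n. module R (obj C n) \<and> diff C n \<in> mod_hom R (obj C n) (obj C (n + 1)) \<and>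
        (\<forall>y\<in>carrier (obj C n). diff C (n + 1) (diff C n y) = \<zero>\<^bsub>obj C (n + 1 + 1)\<^esub>))"

definition cycles :: "('a, 'm) cochain \<Rightarrow> int \<Rightarrow> 'm set" where
  "cycles C n = {y \<in> carrier (obj C n). diff C n y = \<zero>\<^bsub>obj C (n + 1)\<^esub>}"

definition boundaries :: "('a, 'm) cochain \<Rightarrow> int \<Rightarrow> 'm set" where
  "boundaries C n = diff C (n - 1) ` carrier (obj C (n - 1))"

definition cohomology :: "('a, 'm) cochain \<Rightarrow> int \<Rightarrow> ('a, 'm set) module" where
  "cohomology C n = quot_module ((obj C n)\<lparr>carrier := cycles C n\<rparr>) (boundaries C n)"

definition acyclic_complex :: "('a, 'm) cochain \<Rightarrow> bool" where
  "acyclic_complex C \<longleftrightarrow> (\<forall>n. carrier (cohomology C n) = {\<zero>\<^bsub>cohomology C n\<^esub>})"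

definition chain_map ::
    "('a, 'r) ring_scheme \<Rightarrow> ('a, 'm) cochain \<Rightarrow> ('a, 'n) cochain \<Rightarrow> (int \<Rightarrow> 'm \<Rightarrow> 'n) \<Rightarrow> bool" where
  "chain_map R C D f \<longleftrightarrow> (\<forall>n. f n \<in> mod_hom R (obj C n) (obj D n) \<and>
     (\<forall>y\<in>carrier (obj C n). f (n + 1) (diff C n y) = diff D n (f n y)))"

definition cohomology_map ::
    "('a, 'n) cochain \<Rightarrow> (int \<Rightarrow> 'm \<Rightarrow> 'n) \<Rightarrow> int \<Rightarrow> 'm set \<Rightarrow> 'n set" where
  "cohomology_map D f n A = (\<Union>a\<in>A. boundaries D n +>\<^bsub>obj D n\<^esub> f n a)"

definition quasi_iso ::
    "('a, 'r) ring_scheme \<Rightarrow> ('a, 'm) cochain \<Rightarrow> ('a, 'n) cochain \<Rightarrow> (int \<Rightarrow> 'm \<Rightarrow> 'n) \<Rightarrow> bool" where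
  "quasi_iso R C D f \<longleftrightarrow> chain_map R C D f \<and>
     (\<forall>n. bij_betw (cohomology_map D f n) (carrier (cohomology C n)) (carrier (cohomology D n)))"

definition contractible_complex :: "('a, 'r) ring_scheme \<Rightarrow> ('a, 'm) cochain \<Rightarrow> bool" where
  "contractible_complex R C \<longleftrightarrow>
     (\<exists>s. (\<forall>n. s n \<in> mod_hom R (obj C n) (obj C (n - 1))) \<and>
        (\<forall>n. \<forall>y\<in>carrier (obj C n). diff C (n - 1) (s n y) \<oplus>\<^bsub>obj C n\<^esub> s (n + 1) (diff C n y) = y))"

definition stalk_complex :: "('a, 'm) module \<Rightarrow> ('a, 'm) cochain" where
  "stalk_complex M = \<lparr>obj = (\<lambda>n. if n = 0 then M else zero_module M), diff = (\<lambda>n y. \<zero>\<^bsub>M\<^esub>)\<rparr>"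

text \<open>\<open>signed M k y\<close> is \<open>(-1)^k y\<close>.\<close>

definition signed :: "('a, 'm) module \<Rightarrow> int \<Rightarrow> 'm \<Rightarrow> 'm" where
  "signed M k y = (if even k then y else \<ominus>\<^bsub>M\<^esub> y)"

definition shift_complex :: "int \<Rightarrow> ('a, 'm) cochain \<Rightarrow> ('a, 'm) cochain" where
  "shift_complex i C = \<lparr>obj = (\<lambda>n. obj C (n + i)),
     diff = (\<lambda>n y. signed (obj C (n + i + 1)) i (diff C (n + i) y))\<rparr>"

definition shift_map :: "int \<Rightarrow> (int \<Rightarrow> 'm \<Rightarrow> 'n) \<Rightarrow> int \<Rightarrow> 'm \<Rightarrow> 'n" where
  "shift_map i f n = f (n + i)"

definition prod_complex :: "('i \<Rightarrow> ('a, 'm) cochain) \<Rightarrow> ('a, 'i \<Rightarrow> 'm) cochain" where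
  "prod_complex C = \<lparr>obj = (\<lambda>n. prod_module (\<lambda>i. obj (C i) n)),
     diff = (\<lambda>n u i. diff (C i) n (u i))\<rparr>"

definition prod_map :: "('i \<Rightarrow> int \<Rightarrow> 'm \<Rightarrow> 'n) \<Rightarrow> int \<Rightarrow> ('i \<Rightarrow> 'm) \<Rightarrow> ('i \<Rightarrow> 'n)" where
  "prod_map f n u = (\<lambda>i. f i n (u i))"

text \<open>
  The complex \<open>Hom R X Y\<close>: in degree \<open>n\<close> it is the product of the modules
  \<open>Hom R (X\<^sup>i) (Y\<^sup>i\<^sup>+\<^sup>n)\<close> over all \<open>i\<close>, and its differential sends \<open>\<phi>\<close> to
  \<open>d \<circ> \<phi> - (-1)^n (\<phi> \<circ> d)\<close>.
\<close>

definition hom_complex ::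
    "('a, 'r) ring_scheme \<Rightarrow> ('a, 'm) cochain \<Rightarrow> ('a, 'n) cochain \<Rightarrow> ('a, int \<Rightarrow> 'm \<Rightarrow> 'n) cochain" where
  "hom_complex R X Y = \<lparr>obj = (\<lambda>n. prod_module (\<lambda>i. hom_module R (obj X i) (obj Y (i + n)))),
     diff = (\<lambda>n \<phi> i. \<lambda>y\<in>carrier (obj X i).
       diff Y (i + n) (\<phi> i y) \<ominus>\<^bsub>obj Y (i + n + 1)\<^esub>
         signed (obj Y (i + n + 1)) n (\<phi> (i + 1) (diff X i y)))\<rparr>"

text \<open>Precomposition with \<open>f : X \<rightarrow> Y\<close>, as a map \<open>Hom R Y I \<rightarrow> Hom R X I\<close>; it does not
  depend on the degree.\<close>

definition hom_precomp ::
    "('a, 'm) cochain \<Rightarrow> (int \<Rightarrow> 'm \<Rightarrow> 'n) \<Rightarrow> int \<Rightarrow> (int \<Rightarrow> 'n \<Rightarrow> 'k) \<Rightarrow> (int \<Rightarrow> 'm \<Rightarrow> 'k)" where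
  "hom_precomp X f n \<phi> = (\<lambda>i. \<lambda>y\<in>carrier (obj X i). \<phi> i (f i y))"

text \<open>The type \<open>'t\<close> holds the test complexes, as for \<^const>\<open>injective_module\<close>: the property in
  full is the assertion for an arbitrary \<open>'t\<close>, and a single \<open>'t\<close> for which it fails refutes it.\<close>

definition homotopically_injective ::
    "'t itself \<Rightarrow> ('a, 'r) ring_scheme \<Rightarrow> ('a, 'm) cochain \<Rightarrow> bool" where
  "homotopically_injective T R I \<longleftrightarrow>
     (\<forall>(X :: ('a, 't) cochain) (Y :: ('a, 't) cochain) f.
        cochain_complex R X \<and> cochain_complex R Y \<and> quasi_iso R X Y f \<longrightarrow>
        quasi_iso R (hom_complex R Y I) (hom_complex R X I) (hom_precomp X f))"

definition semi_injective ::
    "'t itself \<Rightarrow> 'u itself \<Rightarrow> ('a, 'r) ring_scheme \<Rightarrow> ('a, 'm) cochain \<Rightarrow> bool" where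
  "semi_injective T U R I \<longleftrightarrow> cochain_complex R I \<and>
     homotopically_injective U R I \<and> (\<forall>n. injective_module T R (obj I n))"

definition minimal_complex :: "('a, 'r) ring_scheme \<Rightarrow> ('a, 'm) cochain \<Rightarrow> bool" where
  "minimal_complex R I \<longleftrightarrow> (\<forall>n. essential_submodule R (cycles I n) (obj I n))"

definition minimal_injective_resolution ::
    "'t itself \<Rightarrow> ('a, 'r) ring_scheme \<Rightarrow> ('a, 'n) module \<Rightarrow> ('a, 'm) cochain \<Rightarrow>
     (int \<Rightarrow> 'n \<Rightarrow> 'm) \<Rightarrow> bool" where
  "minimal_injective_resolution T R M J \<iota> \<longleftrightarrow> cochain_complex R J \<and>
     (\<forall>n. injective_module T R (obj J n)) \<and> (\<forall>n<0. carrier (obj J n) = {\<zero>\<^bsub>obj J n\<^esub>}) \<and>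
     quasi_iso R (stalk_complex M) J \<iota> \<and> minimal_complex R J"


section \<open>The derived tensor product with a module\<close>

definition tensor_complex ::
    "('a, 'r) ring_scheme \<Rightarrow> ('a, 'm) cochain \<Rightarrow> ('a, 'n) cochain \<Rightarrow>
     ('a, int \<Rightarrow> ('m \<times> 'n \<Rightarrow> 'a) set) cochain" where
  "tensor_complex R X Y =
    \<lparr>obj = (\<lambda>n. direct_sum_module (\<lambda>i. tensor R (obj X i) (obj Y (n - i)))),
     diff = (\<lambda>n u j. let T = tensor R (obj X j) (obj Y (n + 1 - j)) in
       tensor_map R (obj X (j - 1)) (obj Y (n + 1 - j)) (obj X j) (obj Y (n + 1 - j))
         (diff X (j - 1)) (\<lambda>y. y) (u (j - 1))
       \<oplus>\<^bsub>T\<^esub> signed T j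
         (tensor_map R (obj X j) (obj Y (n - j)) (obj X j) (obj Y (n + 1 - j))
           (\<lambda>y. y) (diff Y (n - j)) (u j)))\<rparr>"

definition is_free_resolution ::
    "('a, 'r) ring_scheme \<Rightarrow> ('a, 'n) module \<Rightarrow> ('a, 'm) cochain \<Rightarrow> bool" where
  "is_free_resolution R N F \<longleftrightarrow> cochain_complex R F \<and> (\<forall>n. free_module R (obj F n)) \<and>
     (\<forall>n>0. carrier (obj F n) = {\<zero>\<^bsub>obj F n\<^esub>}) \<and>
     (\<exists>\<epsilon>. quasi_iso R F (stalk_complex N) \<epsilon>)"

text \<open>
  The derived tensor product \<open>X \<otimes>\<^sup>L N\<close> is \<open>X \<otimes> F\<close> for a free resolution \<open>F\<close> of \<open>N\<close>.  The
  resolution is an arbitrary choice, which affects the result only up to quasi-isomorphism.  Its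
  modules live in the type \<open>('a + 'n) list \<Rightarrow> 'a\<close>, which is large enough for a resolution to
  exist: a free module whose rank is at most the cardinality of the infinite type
  \<open>('a + 'n) list\<close> has at most that many elements, so that its submodules are generated by at
  most that many elements, and it is realised there by functions of finite support.
\<close>

definition free_resolution ::
    "('a, 'r) ring_scheme \<Rightarrow> ('a, 'n) module \<Rightarrow> ('a, ('a + 'n) list \<Rightarrow> 'a) cochain" where
  "free_resolution R N = (SOME F. is_free_resolution R N F)"

definition derived_tensor ::
    "('a, 'r) ring_scheme \<Rightarrow> ('a, 'm) cochain \<Rightarrow> ('a, 'n) module \<Rightarrow>
     ('a, int \<Rightarrow> ('m \<times> (('a + 'n) list \<Rightarrow> 'a) \<Rightarrow> 'a) set) cochain" where
  "derived_tensor R X N = tensor_complex R X (free_resolution R N)"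


section \<open>Localization at a prime ideal\<close>

definition frac_rel ::
    "('a, 'r) ring_scheme \<Rightarrow> 'a set \<Rightarrow> ('a, 'm) module \<Rightarrow> (('m \<times> 'a) \<times> ('m \<times> 'a)) set" where
  "frac_rel R p M = {((m, s), (m', s')).
     m \<in> carrier M \<and> m' \<in> carrier M \<and> s \<in> carrier R - p \<and> s' \<in> carrier R - p \<and>
     (\<exists>u\<in>carrier R - p. u \<odot>\<^bsub>M\<^esub> (s' \<odot>\<^bsub>M\<^esub> m \<ominus>\<^bsub>M\<^esub> s \<odot>\<^bsub>M\<^esub> m') = \<zero>\<^bsub>M\<^esub>)}"

definition frac ::
    "('a, 'r) ring_scheme \<Rightarrow> 'a set \<Rightarrow> ('a, 'm) module \<Rightarrow> 'm \<Rightarrow> 'a \<Rightarrow> ('m \<times> 'a) set" where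
  "frac R p M m s = frac_rel R p M `` {(m, s)}"

definition loc_ring :: "('a, 'r) ring_scheme \<Rightarrow> 'a set \<Rightarrow> ('a \<times> 'a) set ring" where
  "loc_ring R p = (let fr = frac R p (self_module R) in
    \<lparr>carrier = (carrier R \<times> (carrier R - p)) // frac_rel R p (self_module R),
     monoid.mult = (\<lambda>A B. \<Union>(a, s)\<in>A. \<Union>(b, t)\<in>B. fr (a \<otimes>\<^bsub>R\<^esub> b) (s \<otimes>\<^bsub>R\<^esub> t)),
     one = fr \<one>\<^bsub>R\<^esub> \<one>\<^bsub>R\<^esub>,
     ring.zero = fr \<zero>\<^bsub>R\<^esub> \<one>\<^bsub>R\<^esub>,
     ring.add = (\<lambda>A B. \<Union>(a, s)\<in>A. \<Union>(b, t)\<in>B. fr (t \<otimes>\<^bsub>R\<^esub> a \<oplus>\<^bsub>R\<^esub> s \<otimes>\<^bsub>R\<^esub> b) (s \<otimes>\<^bsub>R\<^esub> t))\<rparr>)"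

definition loc_module ::
    "('a, 'r) ring_scheme \<Rightarrow> 'a set \<Rightarrow> ('a, 'm) module \<Rightarrow> (('a \<times> 'a) set, ('m \<times> 'a) set) module" where
  "loc_module R p M =
    \<lparr>carrier = (carrier M \<times> (carrier R - p)) // frac_rel R p M,
     monoid.mult = undefined, one = undefined,
     ring.zero = frac R p M \<zero>\<^bsub>M\<^esub> \<one>\<^bsub>R\<^esub>,
     ring.add = (\<lambda>A B. \<Union>(m, s)\<in>A. \<Union>(m', t)\<in>B.
       frac R p M (t \<odot>\<^bsub>M\<^esub> m \<oplus>\<^bsub>M\<^esub> s \<odot>\<^bsub>M\<^esub> m') (s \<otimes>\<^bsub>R\<^esub> t)),
     smult = (\<lambda>A B. \<Union>(a, s)\<in>A. \<Union>(m, t)\<in>B. frac R p M (a \<odot>\<^bsub>M\<^esub> m) (s \<otimes>\<^bsub>R\<^esub> t))\<rparr>"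

definition loc_complex ::
    "('a, 'r) ring_scheme \<Rightarrow> 'a set \<Rightarrow> ('a, 'm) cochain \<Rightarrow> (('a \<times> 'a) set, ('m \<times> 'a) set) cochain" where
  "loc_complex R p C = \<lparr>obj = (\<lambda>n. loc_module R p (obj C n)),
     diff = (\<lambda>n A. \<Union>(m, s)\<in>A. frac R p (obj C (n + 1)) (diff C n m) s)\<rparr>"

definition loc_map :: "('a, 'r) ring_scheme \<Rightarrow> 'a set \<Rightarrow> 'a \<Rightarrow> ('a \<times> 'a) set" where
  "loc_map R p a = frac R p (self_module R) a \<one>\<^bsub>R\<^esub>"

definition loc_prime :: "('a, 'r) ring_scheme \<Rightarrow> 'a set \<Rightarrow> ('a \<times> 'a) set set" where
  "loc_prime R p = Idl\<^bsub>loc_ring R p\<^esub> (loc_map R p ` p)"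

definition residue_field :: "('a, 'r) ring_scheme \<Rightarrow> 'a set \<Rightarrow> ('a \<times> 'a) set set ring" where
  "residue_field R p = loc_ring R p Quot loc_prime R p"

definition residue_module ::
    "('a, 'r) ring_scheme \<Rightarrow> 'a set \<Rightarrow> ('a, ('a \<times> 'a) set set) module" where
  "residue_module R p = restrict_scalars (\<lambda>r. loc_prime R p +>\<^bsub>loc_ring R p\<^esub> loc_map R p r)
     (self_module (residue_field R p))"


section \<open>Support and dimension\<close>

definition supp :: "('a, 'r) ring_scheme \<Rightarrow> ('a, 'm) cochain \<Rightarrow> 'a set set" where
  "supp R X = {p. primeideal p R \<and> \<not> acyclic_complex (derived_tensor R X (residue_module R p))}"

definition minimal_prime :: "'a set \<Rightarrow> ('a, 'r) ring_scheme \<Rightarrow> bool" where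
  "minimal_prime p R \<longleftrightarrow> primeideal p R \<and> (\<forall>q. primeideal q R \<and> q \<subseteq> p \<longrightarrow> q = p)"

definition krull_dim :: "('a, 'r) ring_scheme \<Rightarrow> ereal" where
  "krull_dim R = (SUP l\<in>{l. \<exists>P :: nat \<Rightarrow> 'a set.
     (\<forall>i\<le>l. primeideal (P i) R) \<and> (\<forall>i<l. P i \<subset> P (Suc i))}. ereal (real l))"


section \<open>The complex given by multiplication with an element\<close>

definition mult_complex :: "'a \<Rightarrow> ('a, 'm) module \<Rightarrow> ('a, 'm) cochain" where
  "mult_complex x E = \<lparr>obj = (\<lambda>n. if n < 0 then zero_module E else E),
     diff = (\<lambda>n e. if n < 0 then \<zero>\<^bsub>E\<^esub> else x \<odot>\<^bsub>E\<^esub> e)\<rparr>"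

end

theory Submission
  imports Defs
begin

text \<open>
 Maps from an acyclic complex to a bounded below complex of injectives are null-homotopic, and in a
 product this can be seen in each coordinate, so \<open>I\<close> is semi-injective.  It is minimal because \<open>x\<^sup>2 = 0\<close>
 makes every multiple \<open>x u\<close> a cycle.  For \<open>t \<in> nn\<close> outside a smaller prime no power of \<open>t\<close> kills \<open>E\<close>, so
 a product of copies of \<open>E\<close> has associated primes \<open>p\<close> without \<open>t\<close>; since the cohomology of \<open>I\<close> is
 \<open>t\<close>-torsion, \<open>I\<^sub>p\<close> is acyclic.  For the support, some element of \<open>R\<close> acts invertibly on one of \<open>M\<close> and
 \<open>k(p)\<close> and locally nilpotently on the other if \<open>p \<noteq> nn\<close>.  For \<open>p = nn\<close> one divides \<open>R / (x)\<close> by a maximal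
 regular sequence (locally at \<open>nn\<close>), after which \<open>k(nn)\<close> embeds into the quotient.
\<close>

text \<open>The hypothesis tests injectivity of \<open>E\<close> only on modules in the type of the
  ring, whereas the conclusion speaks of arbitrary test types. The bridge is Baer's condition, which
  mentions ideals only; it is also the form in which injectivity passes to products and, since
  \<open>R\<close> is noetherian, to localizations. Of the hull only an element \<open>e0\<close>
  with annihilator \<open>nn\<close> and essentiality of \<open>R e0\<close> are kept. Over a
  noetherian ring they imply that elements outside \<open>nn\<close> act injectively on
  \<open>E\<close> and that each element of \<open>nn\<close> acts locally nilpotently. By Baer's
  condition \<open>E\<close> can be divided by ring elements: \<open>b e = w\<close> is solvable as
  soon as \<open>r b = 0\<close> implies \<open>r w = 0\<close>. The hypothesis on \<open>x\<close>
  turns this into exactness of \<open>J\<close> in positive degrees. Support and associated primes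
  differ because each degree of \<open>I\<close> is an infinite product of copies of
  \<open>E\<close>, in which one element can escape all powers of \<open>t\<close>. In the
  cohomology, and in \<open>X\<close>, just one coordinate survives in each degree, so each class is
  killed by some power of \<open>t\<close>. For the same reason \<open>X\<close> is, degree by
  degree, a copy of \<open>M\<close> with zero differential, and its support is that of
  \<open>M\<close>.\<close>

abbreviation (input) mult_sub ("_ \<otimes>\<^sub>_ _" [70, 1000, 71] 70) where "x \<otimes>\<^sub>M y \<equiv> x \<otimes>\<^bsub>M\<^esub> y"
abbreviation (input) add_sub ("_ \<oplus>\<^sub>_ _" [65, 1000, 66] 65) where "x \<oplus>\<^sub>M y \<equiv> x \<oplus>\<^bsub>M\<^esub> y"
abbreviation (input) minus_sub ("_ \<ominus>\<^sub>_ _" [65, 1000, 66] 65) where "x \<ominus>\<^sub>M y \<equiv> x \<ominus>\<^bsub>M\<^esub> y"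
abbreviation (input) inv_sub ("\<ominus>\<^sub>_ _" [1000, 81] 80) where "\<ominus>\<^sub>M x \<equiv> \<ominus>\<^bsub>M\<^esub> x"
abbreviation (input) smult_sub ("_ \<odot>\<^sub>_ _" [70, 1000, 71] 70) where "r \<odot>\<^sub>M y \<equiv> r \<odot>\<^bsub>M\<^esub> y"
abbreviation (input) zero_sub ("\<zero>\<^sub>_" [1000] 1000) where "\<zero>\<^sub>M \<equiv> \<zero>\<^bsub>M\<^esub>"
abbreviation (input) one_sub ("\<one>\<^sub>_" [1000] 1000) where "\<one>\<^sub>M \<equiv> \<one>\<^bsub>M\<^esub>"

section \<open>Modules and homomorphisms\<close>

lemma mod_homI:
 assumes "!!x. x\<in>carrier M ==> f x\<in>carrier N"
  and "!!x y. x\<in>carrier M ==> y\<in>carrier M ==> f (x \<oplus>\<^sub>M y) = f x \<oplus>\<^sub>N f y"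
  and "!!r x. r\<in>carrier R ==> x\<in>carrier M ==> f (r \<odot>\<^sub>M x) = r \<odot>\<^sub>N f x"
 shows "f\<in>mod_hom R M N" using assms by (auto simp: mod_hom_def)

lemma hom_closed: "f\<in>mod_hom R M N ==> x\<in>carrier M ==> f x\<in>carrier N"
 by (auto simp: mod_hom_def)

lemma hom_add:
 "f\<in>mod_hom R M N ==> x\<in>carrier M ==> y\<in>carrier M ==> f (x \<oplus>\<^sub>M y) = f x \<oplus>\<^sub>N f y"
 by (auto simp: mod_hom_def)

lemma hom_smult:
 "f\<in>mod_hom R M N ==> r\<in>carrier R ==> x\<in>carrier M ==> f (r \<odot>\<^sub>M x) = r \<odot>\<^sub>N f x"
 by (auto simp: mod_hom_def)

lemma hom_zero:
 assumes "module R M" "module R N" "f\<in>mod_hom R M N"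
 shows "f \<zero>\<^sub>M = \<zero>\<^sub>N"
proof -
 interpret M: module R M by fact
 interpret N: module R N by fact
 have "f (\<zero>\<^sub>R \<odot>\<^sub>M \<zero>\<^sub>M) = \<zero>\<^sub>R \<odot>\<^sub>N f \<zero>\<^sub>M"
  using assms(3) by (intro hom_smult) auto
 then show ?thesis using hom_closed[OF assms(3)] by simp
qed

lemma hom_neg:
 assumes "module R M" "module R N" "f\<in>mod_hom R M N" "x\<in>carrier M"
 shows "f (\<ominus>\<^sub>M x) = \<ominus>\<^sub>N f x"
proof -
 interpret M: module R M by fact
 interpret N: module R N by fact
 have "f (\<ominus>\<^sub>M x) \<oplus>\<^sub>N f x = f (\<ominus>\<^sub>M x \<oplus>\<^sub>M x)" using assms by (simp add: hom_add[OF assms(3)])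
 also have "... = \<zero>\<^sub>N" using assms hom_zero[OF assms(1-3)] by (simp add: M.M.l_neg)
 finally show ?thesis using assms hom_closed[OF assms(3)] by (metis M.M.a_inv_closed N.M.minus_equality)
qed

lemma hom_minus:
 assumes "module R M" "module R N" "f\<in>mod_hom R M N" "x\<in>carrier M" "y\<in>carrier M"
 shows "f (x \<ominus>\<^sub>M y) = f x \<ominus>\<^sub>N f y"
proof -
 interpret M: module R M by fact
 show ?thesis using assms by (simp add: a_minus_def hom_add[OF assms(3)] hom_neg[OF assms(1-3)])
qed

lemma hom_id: "(%x. x)\<in>mod_hom R M M"
 by (auto simp: mod_hom_def)

lemma hom_comp:
 "f\<in>mod_hom R M N ==> g\<in>mod_hom R N P ==> (%x. g (f x))\<in>mod_hom R M P"
 by (auto simp: mod_hom_def Pi_iff)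

lemma hom_cong:
 assumes "module R M" "f\<in>mod_hom R M N" "!!x. x\<in>carrier M ==> f x = g x"
 shows "g\<in>mod_hom R M N"
proof -
 interpret M: module R M by fact
 show ?thesis using assms(2,3) by (auto simp: mod_hom_def Pi_iff)
qed

lemma hom_zero_map:
 assumes "module R N"
 shows "(%x. \<zero>\<^sub>N)\<in>mod_hom R M N"
proof -
 interpret N: module R N by fact
 show ?thesis by (auto simp: mod_hom_def)
qed

lemma hom_add_map:
 assumes "module R N" "f\<in>mod_hom R M N" "g\<in>mod_hom R M N"
 shows "(%x. f x \<oplus>\<^sub>N g x)\<in>mod_hom R M N"
proof -
 interpret N: module R N by fact
 show ?thesis using assms(2,3) by (auto simp: mod_hom_def Pi_iff N.M.a_ac N.smult_r_distr)
qed

lemma hom_smult_map: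
 assumes "module R N" "f\<in>mod_hom R M N" "r\<in>carrier R"
 shows "(%x. r \<odot>\<^sub>N f x)\<in>mod_hom R M N"
proof -
 interpret N: module R N by fact
 show ?thesis using assms(2,3) by (auto simp: mod_hom_def Pi_iff N.smult_r_distr simp flip: N.smult_assoc1)
   (simp add: N.R.m_comm)
qed

lemma hom_neg_map:
 assumes "module R N" "f\<in>mod_hom R M N"
 shows "(%x. \<ominus>\<^sub>N f x)\<in>mod_hom R M N"
proof -
 interpret N: module R N by fact
 show ?thesis using assms(2) by (auto simp: mod_hom_def Pi_iff N.smult_r_minus N.M.minus_add)
qed

lemma hom_minus_map:
 assumes "module R N" "f\<in>mod_hom R M N" "g\<in>mod_hom R M N"
 shows "(%x. f x \<ominus>\<^sub>N g x)\<in>mod_hom R M N"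
 using hom_add_map[OF assms(1,2) hom_neg_map[OF assms(1,3)]] by (simp add: a_minus_def)

lemma hom_smult_self:
 assumes "module R M" "r\<in>carrier R"
 shows "(%x. r \<odot>\<^sub>M x)\<in>mod_hom R M M" by (rule hom_smult_map[OF assms(1) hom_id assms(2)])

lemma hom_finsum:
 assumes "module R M" "module R N" "f\<in>mod_hom R M N" "finite A" "g\<in>A \<rightarrow> carrier M"
 shows "f (\<Oplus>\<^bsub>M\<^esub> a\<in>A. g a) = (\<Oplus>\<^bsub>N\<^esub> a\<in>A. f (g a))"
proof -
 interpret M: module R M by fact
 interpret N: module R N by fact
 show ?thesis using assms(4,5)
 proof (induction A rule: finite_induct)
  case empty
  then show ?case using hom_zero[OF assms(1-3)] by simp
 next
  case (insert a A)
  then have "g\<in>A \<rightarrow> carrier M" "g a\<in>carrier M" "(%a. f (g a))\<in>A \<rightarrow> carrier N" "f (g a)\<in>carrier N"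
   using hom_closed[OF assms(3)] by auto
  then show ?case using insert by (simp add: hom_add[OF assms(3)])
 qed
qed

lemma hom_incl:
 "H <= carrier M ==> (%x. x)\<in>mod_hom R (M\<lparr>carrier := H\<rparr>) M" by (auto simp: mod_hom_def Pi_iff)

lemma submodule_module:
 "module R M ==> submodule H R M ==> module R (M\<lparr>carrier := H\<rparr>)" by (rule submodule.submodule_is_module)

lemma submodule_mem:
 assumes "module R M" "submodule H R M"
 shows "H <= carrier M" "\<zero>\<^sub>M\<in>H" "!!a. a\<in>H ==> \<ominus>\<^sub>M a\<in>H"
  "!!r a. r\<in>carrier R ==> a\<in>H ==> r \<odot>\<^sub>M a\<in>H"
  "!!a b. a\<in>H ==> b\<in>H ==> a \<oplus>\<^sub>M b\<in>H"
  "!!a b. a\<in>H ==> b\<in>H ==> a \<ominus>\<^sub>M b\<in>H"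
proof -
 interpret M: module R M by fact
 show *: "H <= carrier M" "!!a. a\<in>H ==> \<ominus>\<^sub>M a\<in>H"
  "!!r a. r\<in>carrier R ==> a\<in>H ==> r \<odot>\<^sub>M a\<in>H"
  "!!a b. a\<in>H ==> b\<in>H ==> a \<oplus>\<^sub>M b\<in>H" using M.submoduleE[OF assms(2)] by auto
 show "!!a b. a\<in>H ==> b\<in>H ==> a \<ominus>\<^sub>M b\<in>H" by (simp add: a_minus_def *)
 obtain h where "h\<in>H" using M.submoduleE(2)[OF assms(2)] by auto
 then show "\<zero>\<^sub>M\<in>H" using *(1) *(3)[of "\<zero>\<^sub>R" h] by auto
qed

text \<open>Additive inverses are a definite description over the carrier, so passing to a smaller
  carrier could change them; they agree because a submodule contains the inverses of its
  elements.\<close>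

lemma restrict_a_inv:
 assumes "module R M" "submodule H R M" "x\<in>H"
 shows "\<ominus>\<^bsub>M\<lparr>carrier := H\<rparr>\<^esub> x = \<ominus>\<^sub>M x"
proof -
 interpret M: module R M by fact
 interpret H: module R "M\<lparr>carrier := H\<rparr>" by (rule submodule_module[OF assms(1,2)])
 have "\<ominus>\<^sub>M x\<in>H" using submodule_mem[OF assms(1,2)] assms(3) by auto
 then show ?thesis using H.M.minus_equality[of "\<ominus>\<^sub>M x" x] submodule_mem(1)[OF assms(1,2)] assms(3) by (auto simp: M.M.l_neg)
qed

lemma zero_submodule:
 assumes "module R M"
 shows "submodule {\<zero>\<^sub>M} R M"
proof -
 interpret M: module R M by fact
 show ?thesis by (rule M.submoduleI) auto
qed

lemma zero_module_module: "module R M ==> module R (zero_module M)"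
 unfolding zero_module_def by (intro submodule_module zero_submodule)

lemma zero_module_simps [simp]:
 "carrier (zero_module M) = {\<zero>\<^sub>M}" "\<zero>\<^bsub>zero_module M\<^esub> = \<zero>\<^sub>M"
 "add (zero_module M) = add M" "smult (zero_module M) = smult M" by (auto simp: zero_module_def)

lemma self_module_simps [simp]:
 "carrier (self_module R) = carrier R" "\<zero>\<^bsub>self_module R\<^esub> = \<zero>\<^sub>R"
 "add (self_module R) = add R" "smult (self_module R) = mult R" by (auto simp: self_module_def)

lemma a_inv_eqI:
 assumes "carrier M = carrier N" "add M = add N" "zero M = zero N"
 shows "a_inv M = a_inv N" using assms by (auto simp: a_inv_def m_inv_def)

lemma abelian_group_eqI:
 assumes "abelian_group M" "carrier M = carrier N" "add M = add N" "zero M = zero N"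
 shows "abelian_group N"
proof -
 interpret M: abelian_group M by fact
 show ?thesis by (rule abelian_groupI) (auto simp flip: assms(2-4) simp: M.a_ac intro: M.l_neg bexI[where x="\<ominus>\<^sub>M _"])
qed

lemma module_self:
 assumes "cring R"
 shows "module R (self_module R)"
proof -
 interpret cring R by fact
 have "abelian_group (self_module R)" by (rule abelian_group_eqI[OF abelian_group_axioms]) auto
 then show ?thesis by (intro moduleI) (auto simp: assms l_distr r_distr m_assoc)
qed

lemma self_module_a_inv [simp]: "a_inv (self_module R) = a_inv R"
 by (rule a_inv_eqI) auto

lemma submodule_self_ideal:
 assumes "cring R" "ideal I R"
 shows "submodule I R (self_module R)"
proof -
 interpret M: module R "self_module R" by (rule module_self[OF assms(1)])
 interpret I: ideal I R by fact
 show ?thesis by (rule M.submoduleI) (auto simp: I.I_l_closed I.a_inv_closed I.a_subset[THEN subsetD])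
qed

lemma prod_module_simps [simp]:
 "carrier (prod_module M) = {u. ALL i. u i\<in>carrier (M i)}" "\<zero>\<^bsub>prod_module M\<^esub> = (%i. \<zero>\<^bsub>M i\<^esub>)"
 "u \<oplus>\<^bsub>prod_module M\<^esub> v = (%i. u i \<oplus>\<^bsub>M i\<^esub> v i)" "r \<odot>\<^bsub>prod_module M\<^esub> u = (%i. r \<odot>\<^bsub>M i\<^esub> u i)"
 by (auto simp: prod_module_def)

lemma prod_module_module:
 assumes "cring R" "!!i. module R (M i)"
 shows "module R (prod_module M)"
proof -
 interpret cring R by fact
 note ab = module.axioms(2)[OF assms(2)]
 show ?thesis
 proof (rule moduleI[OF assms(1)])
  show "abelian_group (prod_module M)"
  proof (rule abelian_groupI)
   fix u assume "u\<in>carrier (prod_module M)"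
   then show "EX v:carrier (prod_module M). v \<oplus>\<^bsub>prod_module M\<^esub> u = \<zero>\<^bsub>prod_module M\<^esub>"
    by (intro bexI[where x="%i. \<ominus>\<^bsub>M i\<^esub> u i"])
     (auto simp: abelian_group.l_neg[OF ab] abelian_group.a_inv_closed[OF ab])
  qed (use abelian_monoid.a_closed[OF abelian_group.axioms(1)[OF ab]] abelian_monoid.zero_closed[OF abelian_group.axioms(1)[OF ab]]
    abelian_monoid.a_assoc[OF abelian_group.axioms(1)[OF ab]] abelian_monoid.a_comm[OF abelian_group.axioms(1)[OF ab]]
    abelian_monoid.l_zero[OF abelian_group.axioms(1)[OF ab]] in auto)
 qed (auto simp: module.smult_closed[OF assms(2)] module.smult_l_distr[OF assms(2)] module.smult_r_distr[OF assms(2)]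
   module.smult_assoc1[OF assms(2)] module.smult_one[OF assms(2)])
qed

lemma prod_module_a_inv:
 assumes "cring R" "!!i. module R (M i)" "u\<in>carrier (prod_module M)"
 shows "\<ominus>\<^bsub>prod_module M\<^esub> u = (%i. \<ominus>\<^bsub>M i\<^esub> u i)"
proof -
 interpret P: module R "prod_module M" by (rule prod_module_module[OF assms(1,2)])
 note ab = module.axioms(2)[OF assms(2)]
 show ?thesis by (rule P.M.minus_equality) (use assms(3) in "auto simp: abelian_group.l_neg[OF ab] abelian_group.a_inv_closed[OF ab]")
qed

lemma prod_module_minus:
 assumes "cring R" "!!i. module R (M i)" "v\<in>carrier (prod_module M)"
 shows "u \<ominus>\<^bsub>prod_module M\<^esub> v = (%i. u i \<ominus>\<^bsub>M i\<^esub> v i)"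
 using prod_module_a_inv[OF assms] by (simp add: a_minus_def)

lemma prod_module_proj: "(%u. u i)\<in>mod_hom R (prod_module M) (M i)"
 by (auto simp: mod_hom_def)

lemma module_neg_zero: "module R M ==> \<ominus>\<^sub>M \<zero>\<^sub>M = \<zero>\<^sub>M"
 by (metis abelian_group.axioms(1) abelian_group.minus_equality abelian_monoid.l_zero abelian_monoid.zero_closed module.axioms(2))

lemma direct_sum_submodule:
 assumes "cring R" "!!i. module R (M i)"
 shows "submodule {u\<in>carrier (prod_module M). finite {i. u i ~= \<zero>\<^bsub>M i\<^esub>}} R (prod_module M)"
proof -
 interpret P: module R "prod_module M" by (rule prod_module_module[OF assms])
 note ab = module.axioms(2)[OF assms(2)]
 note am = abelian_group.axioms(1)[OF ab]
 show ?thesis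
 proof (rule P.submoduleI)
  fix u assume u: "u\<in>{u\<in>carrier (prod_module M). finite {i. u i ~= \<zero>\<^bsub>M i\<^esub>}}"
  then have "{i. \<ominus>\<^bsub>M i\<^esub> u i ~= \<zero>\<^bsub>M i\<^esub>} <= {i. u i ~= \<zero>\<^bsub>M i\<^esub>}"
   using module_neg_zero[OF assms(2)] by auto
  then show "\<ominus>\<^bsub>prod_module M\<^esub> u\<in>{u\<in>carrier (prod_module M). finite {i. u i ~= \<zero>\<^bsub>M i\<^esub>}}"
   using u finite_subset by (auto simp: prod_module_a_inv[OF assms] abelian_group.a_inv_closed[OF ab])
 next
  fix u v assume uv: "u\<in>{u\<in>carrier (prod_module M). finite {i. u i ~= \<zero>\<^bsub>M i\<^esub>}}"
   "v\<in>{u\<in>carrier (prod_module M). finite {i. u i ~= \<zero>\<^bsub>M i\<^esub>}}"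
  then have "{i. u i \<oplus>\<^bsub>M i\<^esub> v i ~= \<zero>\<^bsub>M i\<^esub>} <= {i. u i ~= \<zero>\<^bsub>M i\<^esub>} \<union> {i. v i ~= \<zero>\<^bsub>M i\<^esub>}"
   using abelian_monoid.l_zero[OF am] abelian_monoid.zero_closed[OF am] by auto
  then show "u \<oplus>\<^bsub>prod_module M\<^esub> v\<in>{u\<in>carrier (prod_module M). finite {i. u i ~= \<zero>\<^bsub>M i\<^esub>}}"
   using uv by (auto intro: finite_subset simp: abelian_monoid.a_closed[OF am])
 next
  fix r u assume u: "r\<in>carrier R" "u\<in>{u\<in>carrier (prod_module M). finite {i. u i ~= \<zero>\<^bsub>M i\<^esub>}}"
  then have "{i. r \<odot>\<^bsub>M i\<^esub> u i ~= \<zero>\<^bsub>M i\<^esub>} <= {i. u i ~= \<zero>\<^bsub>M i\<^esub>}"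
   using module.smult_r_null[OF assms(2)] by auto
  then show "r \<odot>\<^bsub>prod_module M\<^esub> u\<in>{u\<in>carrier (prod_module M). finite {i. u i ~= \<zero>\<^bsub>M i\<^esub>}}"
   using u by (auto intro: finite_subset simp: module.smult_closed[OF assms(2)])
 qed (auto simp: abelian_monoid.zero_closed[OF am])
qed

lemma direct_sum_module_module:
 assumes "cring R" "!!i. module R (M i)"
 shows "module R (direct_sum_module M)" unfolding direct_sum_module_def by (intro submodule_module prod_module_module direct_sum_submodule assms)

lemma direct_sum_module_simps [simp]:
 "carrier (direct_sum_module M) = {u. (ALL i. u i\<in>carrier (M i)) & finite {i. u i ~= \<zero>\<^bsub>M i\<^esub>}}"
 "\<zero>\<^bsub>direct_sum_module M\<^esub> = (%i. \<zero>\<^bsub>M i\<^esub>)"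
 "u \<oplus>\<^bsub>direct_sum_module M\<^esub> v = (%i. u i \<oplus>\<^bsub>M i\<^esub> v i)" "r \<odot>\<^bsub>direct_sum_module M\<^esub> u = (%i. r \<odot>\<^bsub>M i\<^esub> u i)"
 by (auto simp: direct_sum_module_def)

lemma hom_module_simps [simp]:
 "carrier (hom_module R M N) = mod_hom R M N \<inter> extensional (carrier M)"
 "\<zero>\<^bsub>hom_module R M N\<^esub> = (\<lambda>x\<in>carrier M. \<zero>\<^sub>N)"
 "f \<oplus>\<^bsub>hom_module R M N\<^esub> g = (\<lambda>x\<in>carrier M. f x \<oplus>\<^sub>N g x)"
 "r \<odot>\<^bsub>hom_module R M N\<^esub> f = (\<lambda>x\<in>carrier M. r \<odot>\<^sub>N f x)" by (auto simp: hom_module_def)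

lemma hom_restrict:
 "module R M ==> f\<in>mod_hom R M N ==> (\<lambda>x\<in>carrier M. f x)\<in>mod_hom R M N \<inter> extensional (carrier M)"
 using hom_cong[of R M f N "\<lambda>x\<in>carrier M. f x"] by auto

lemma hom_module_closed: "f\<in>carrier (hom_module R M N) ==> x\<in>carrier M ==> f x\<in>carrier N"
 using hom_closed by auto

lemma hom_module_module:
 assumes "cring R" "module R M" "module R N"
 shows "module R (hom_module R M N)"
proof -
 interpret M: module R M by fact
 interpret N: module R N by fact
 let ?H = "hom_module R M N"
 have I: "(\<lambda>x\<in>carrier M. f x)\<in>carrier ?H" if "f\<in>mod_hom R M N" for f using hom_restrict[OF assms(2) that] by simp
 have hom: "f\<in>mod_hom R M N" if "f\<in>carrier ?H" for f using that by simp
 have eqI: "(\<lambda>x\<in>carrier M. f x) = g" if "g\<in>carrier ?H" "!!x. x\<in>carrier M ==> f x = g x" for f g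
  using that by (intro extensionalityI[of _ "carrier M"]) auto
 note cl = hom_module_closed[of _ R M N]
 show ?thesis
 proof (rule moduleI[OF assms(1)])
  show "abelian_group ?H"
  proof (rule abelian_groupI)
   fix f g assume "f\<in>carrier ?H" "g\<in>carrier ?H"
   then show "f \<oplus>\<^sub>?H g\<in>carrier ?H" unfolding hom_module_simps(3) by (intro I hom_add_map[OF assms(3)] hom)
  next
   fix f g h assume "f\<in>carrier ?H" "g\<in>carrier ?H" "h\<in>carrier ?H"
   then show "f \<oplus>\<^sub>?H g \<oplus>\<^sub>?H h = f \<oplus>\<^sub>?H (g \<oplus>\<^sub>?H h)"
    unfolding hom_module_simps(3) by (intro restrict_ext) (simp add: cl N.M.a_assoc del: hom_module_simps)
  next
   fix f g assume "f\<in>carrier ?H" "g\<in>carrier ?H"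
   then show "f \<oplus>\<^sub>?H g = g \<oplus>\<^sub>?H f"
    unfolding hom_module_simps(3) by (intro restrict_ext) (simp add: cl N.M.a_comm del: hom_module_simps)
  next
   show "\<zero>\<^sub>?H\<in>carrier ?H" unfolding hom_module_simps(2) by (intro I hom_zero_map[OF assms(3)])
  next
   fix f assume f: "f\<in>carrier ?H"
   then show "\<zero>\<^sub>?H \<oplus>\<^sub>?H f = f" unfolding hom_module_simps(2,3) by (intro eqI) (simp_all add: cl del: hom_module_simps)
   have "(\<lambda>x\<in>carrier M. \<ominus>\<^sub>N f x) \<oplus>\<^sub>?H f = \<zero>\<^sub>?H" unfolding hom_module_simps(2,3) using f
    by (intro restrict_ext) (simp add: cl N.M.l_neg del: hom_module_simps)
   then show "EX g:carrier ?H. g \<oplus>\<^sub>?H f = \<zero>\<^sub>?H" using I[OF hom_neg_map[OF assms(3) hom[OF f]]] by blast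
  qed
 next
  fix r f assume "r\<in>carrier R" "f\<in>carrier ?H"
  then show "r \<odot>\<^sub>?H f\<in>carrier ?H" unfolding hom_module_simps(4) by (intro I hom_smult_map[OF assms(3)] hom)
 next
  fix f assume "f\<in>carrier ?H"
  then show "\<one>\<^sub>R \<odot>\<^sub>?H f = f" unfolding hom_module_simps(4) by (intro eqI) (simp_all add: cl del: hom_module_simps)
 next
  fix r s f assume "r\<in>carrier R" "s\<in>carrier R" "f\<in>carrier ?H"
  then show "(r \<oplus>\<^sub>R s) \<odot>\<^sub>?H f = (r \<odot>\<^sub>?H f) \<oplus>\<^sub>?H (s \<odot>\<^sub>?H f)"
   "(r \<otimes>\<^sub>R s) \<odot>\<^sub>?H f = r \<odot>\<^sub>?H (s \<odot>\<^sub>?H f)" unfolding hom_module_simps(3,4)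
   by (intro restrict_ext; simp add: cl N.smult_l_distr N.smult_assoc1 del: hom_module_simps)+
 next
  fix r f g assume "r\<in>carrier R" "g\<in>carrier ?H" "f\<in>carrier ?H"
  then show "r \<odot>\<^sub>?H (f \<oplus>\<^sub>?H g) = (r \<odot>\<^sub>?H f) \<oplus>\<^sub>?H (r \<odot>\<^sub>?H g)"
   unfolding hom_module_simps(3,4) by (intro restrict_ext) (simp add: cl N.smult_r_distr del: hom_module_simps)
 qed
qed

lemma hom_module_a_inv:
 assumes "cring R" "module R M" "module R N" "f\<in>carrier (hom_module R M N)"
 shows "\<ominus>\<^bsub>hom_module R M N\<^esub> f = (\<lambda>x\<in>carrier M. \<ominus>\<^sub>N f x)"
proof -
 interpret N: module R N by fact
 interpret P: module R "hom_module R M N" by (rule hom_module_module[OF assms(1-3)])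
 have "(\<lambda>x\<in>carrier M. \<ominus>\<^sub>N f x)\<in>carrier (hom_module R M N)"
  using assms(4) hom_restrict[OF assms(2) hom_neg_map[OF assms(3), of f M]] by simp
 moreover have "(\<lambda>x\<in>carrier M. \<ominus>\<^sub>N f x) \<oplus>\<^bsub>hom_module R M N\<^esub> f = \<zero>\<^bsub>hom_module R M N\<^esub>"
  unfolding hom_module_simps(2,3) using hom_module_closed[OF assms(4)] by (intro restrict_ext) (simp add: N.M.l_neg)
 ultimately show ?thesis using assms(4) by (intro P.M.minus_equality)
qed

subsection \<open>Quotient modules\<close>

lemma restrict_coset [simp]: "N +>\<^bsub>M\<lparr>carrier := H\<rparr>\<^esub> a = N +>\<^bsub>M\<^esub> a"
 by (simp add: a_r_coset_def r_coset_def)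

lemma submodule_abelian_subgroup:
 assumes "module R M" "submodule N R M"
 shows "abelian_subgroup N M"
proof -
 interpret M: module R M by fact
 interpret N: submodule N R M by fact
 show ?thesis by (rule abelian_subgroupI3) (auto intro: additive_subgroupI N.subgroup_axioms M.abelian_group_axioms)
qed

lemma coset_eq_iff:
 assumes "module R M" "submodule N R M" "x\<in>carrier M" "y\<in>carrier M"
 shows "N +>\<^bsub>M\<^esub> x = N +>\<^bsub>M\<^esub> y \<longleftrightarrow> x \<ominus>\<^sub>M y\<in>N"
proof -
 interpret M: module R M by fact
 interpret N: abelian_subgroup N M by (rule submodule_abelian_subgroup[OF assms(1,2)])
 have "x \<ominus>\<^sub>M y\<in>N \<longleftrightarrow> x\<in>N +>\<^bsub>M\<^esub> y"
  using N.a_rcos_module[of y x] assms(3,4) by (simp add: a_minus_def)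
 then show ?thesis using assms(3,4) N.a_rcos_self[of x] M.M.a_repr_independence[OF _ _ N.a_subgroup, of x y] by auto
qed

lemma quot_module_simps [simp]:
 "carrier (quot_module M N) = a_rcosets\<^bsub>M\<^esub> N" "\<zero>\<^bsub>quot_module M N\<^esub> = N"
 "add (quot_module M N) = set_add M"
 "r \<odot>\<^bsub>quot_module M N\<^esub> A = (\<Union>a\<in>A. N +>\<^bsub>M\<^esub> (r \<odot>\<^sub>M a))" by (auto simp: quot_module_def)

lemma UN_const_on: "A ~= {} ==> (!!a. a\<in>A ==> f a = c) ==> (\<Union>a\<in>A. f a) = c"
 by auto

lemma coset_mem:
 assumes "module R M" "submodule N R M" "x\<in>carrier M" "a\<in>N +>\<^bsub>M\<^esub> x"
 shows "a\<in>carrier M" "a \<ominus>\<^sub>M x\<in>N"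
proof -
 interpret M: module R M by fact
 interpret N: abelian_subgroup N M by (rule submodule_abelian_subgroup[OF assms(1,2)])
 show "a\<in>carrier M" using assms(3,4) M.M.a_r_coset_subset_G[OF N.a_subset] by blast
 then show "a \<ominus>\<^sub>M x\<in>N" using N.a_rcos_module[of x a] assms(3,4) by (simp add: a_minus_def)
qed

lemma coset_self:
 assumes "module R M" "submodule N R M" "x\<in>carrier M"
 shows "x\<in>N +>\<^bsub>M\<^esub> x"
proof -
 interpret M: module R M by fact
 interpret N: abelian_subgroup N M by (rule submodule_abelian_subgroup[OF assms(1,2)])
 show ?thesis by (rule N.a_rcos_self[OF assms(3)])
qed

text \<open>Operations on cosets are unions over representatives; this evaluates them.\<close>

lemma UN_coset:
 assumes "module R M" "submodule N R M" "x\<in>carrier M"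
  and "!!a. a\<in>carrier M ==> a \<ominus>\<^sub>M x\<in>N ==> f a = f x"
 shows "(\<Union>a\<in>N +>\<^bsub>M\<^esub> x. f a) = f x"
proof (rule UN_const_on)
 show "N +>\<^bsub>M\<^esub> x ~= {}" using coset_self[OF assms(1-3)] by blast
 show "f a = f x" if "a\<in>N +>\<^bsub>M\<^esub> x" for a using assms(4) coset_mem[OF assms(1-3) that] .
qed

lemma coset_zero:
 assumes "module R M" "submodule N R M"
 shows "N +>\<^bsub>M\<^esub> \<zero>\<^sub>M = N"
proof -
 interpret M: module R M by fact
 show ?thesis using submodule_mem(1)[OF assms] by (rule M.a_coset_add_zero)
qed

lemma coset_eq_zero_iff:
 assumes "module R M" "submodule N R M" "x\<in>carrier M"
 shows "N +>\<^bsub>M\<^esub> x = N \<longleftrightarrow> x\<in>N"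
proof -
 interpret M: module R M by fact
 show ?thesis using coset_eq_iff[OF assms M.M.zero_closed] coset_zero[OF assms(1,2)] assms(3) by (simp add: a_minus_def module_neg_zero[OF assms(1)])
qed

lemma mem_quot_module: "A\<in>carrier (quot_module M N) \<longleftrightarrow> (EX x:carrier M. A = N +>\<^bsub>M\<^esub> x)"
 by (auto simp: A_RCOSETS_def')

lemma quot_module_add:
 assumes "module R M" "submodule N R M" "x\<in>carrier M" "y\<in>carrier M"
 shows "(N +>\<^bsub>M\<^esub> x) \<oplus>\<^bsub>quot_module M N\<^esub> (N +>\<^bsub>M\<^esub> y) = N +>\<^bsub>M\<^esub> (x \<oplus>\<^sub>M y)"
proof -
 interpret N: abelian_subgroup N M by (rule submodule_abelian_subgroup[OF assms(1,2)])
 show ?thesis using N.a_rcos_sum[OF assms(3,4)] by simp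
qed

lemma quot_module_smult:
 assumes "module R M" "submodule N R M" "x\<in>carrier M" "r\<in>carrier R"
 shows "r \<odot>\<^bsub>quot_module M N\<^esub> (N +>\<^bsub>M\<^esub> x) = N +>\<^bsub>M\<^esub> (r \<odot>\<^sub>M x)" unfolding quot_module_simps
proof (rule UN_coset[OF assms(1-3)])
 interpret M: module R M by fact
 fix a assume a: "a\<in>carrier M" "a \<ominus>\<^sub>M x\<in>N"
 have "r \<odot>\<^sub>M a \<ominus>\<^sub>M r \<odot>\<^sub>M x = r \<odot>\<^sub>M (a \<ominus>\<^sub>M x)"
  using a assms(3,4) by (simp add: a_minus_def M.smult_r_distr M.smult_r_minus)
 then show "N +>\<^bsub>M\<^esub> (r \<odot>\<^sub>M a) = N +>\<^bsub>M\<^esub> (r \<odot>\<^sub>M x)"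
  using a assms submodule_mem(4)[OF assms(1,2)] by (simp add: coset_eq_iff[OF assms(1,2)])
qed

lemma quot_module_module:
 assumes "module R M" "submodule N R M"
 shows "module R (quot_module M N)"
proof -
 interpret M: module R M by fact
 note add = quot_module_add[OF assms] and smult = quot_module_smult[OF assms] and mem = mem_quot_module[of _ M N]
 have zero: "\<zero>\<^bsub>quot_module M N\<^esub> = N +>\<^bsub>M\<^esub> \<zero>\<^sub>M" using coset_zero[OF assms] by simp
 have cl: "N +>\<^bsub>M\<^esub> x\<in>carrier (quot_module M N)" if "x\<in>carrier M" for x using that mem by blast
 note del = quot_module_simps[simp del]
 show ?thesis
 proof (rule moduleI)
  show "cring R" by (rule M.R.is_cring)
  show "abelian_group (quot_module M N)"
  proof (rule abelian_groupI)
   fix A assume "A\<in>carrier (quot_module M N)"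
   then obtain x where x: "x\<in>carrier M" "A = N +>\<^bsub>M\<^esub> x" using mem by auto
   then show "EX B:carrier (quot_module M N). B \<oplus>\<^bsub>quot_module M N\<^esub> A = \<zero>\<^bsub>quot_module M N\<^esub>"
    by (intro bexI[OF _ cl[of "\<ominus>\<^sub>M x"]]) (simp_all add: add zero M.M.l_neg del: quot_module_simps)
  qed (auto simp: mem add zero M.M.a_ac cl simp del: quot_module_simps)
 qed (auto simp: mem add smult zero M.smult_l_distr M.smult_r_distr M.smult_assoc1 cl simp del: quot_module_simps)
qed

lemma quot_proj_hom:
 assumes "module R M" "submodule N R M"
 shows "(%x. N +>\<^bsub>M\<^esub> x)\<in>mod_hom R M (quot_module M N)" by (rule mod_homI)
  (auto simp: mem_quot_module quot_module_add[OF assms] quot_module_smult[OF assms] simp del: quot_module_simps)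

lemma submodule_restrict:
 assumes "module R M" "submodule H R M" "submodule N R M" "N <= H"
 shows "submodule N R (M\<lparr>carrier := H\<rparr>)"
proof -
 interpret H: module R "M\<lparr>carrier := H\<rparr>" by (rule submodule_module[OF assms(1,2)])
 show ?thesis by (rule H.submoduleI) (use assms(4) submodule_mem[OF assms(1,3)] restrict_a_inv[OF assms(1,2)] in auto)
qed

lemma kernel_submodule:
 assumes "module R M" "module R N" "f\<in>mod_hom R M N"
 shows "submodule {x\<in>carrier M. f x = \<zero>\<^sub>N} R M"
proof -
 interpret M: module R M by fact
 interpret N: module R N by fact
 show ?thesis by (rule M.submoduleI)
   (auto simp: hom_zero[OF assms] hom_neg[OF assms] hom_add[OF assms(3)] hom_smult[OF assms(3)]
    module_neg_zero[OF assms(2)])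
qed

lemma image_submodule:
 assumes "module R M" "module R N" "f\<in>mod_hom R M N"
 shows "submodule (f ` carrier M) R N"
proof -
 interpret M: module R M by fact
 interpret N: module R N by fact
 show ?thesis
 proof (rule N.submoduleI)
  show "f ` carrier M <= carrier N" using hom_closed[OF assms(3)] by auto
  show "\<zero>\<^sub>N\<in>f ` carrier M" using hom_zero[OF assms] M.M.zero_closed by (metis imageI)
  fix a assume "a\<in>f ` carrier M"
  then obtain x where x: "x\<in>carrier M" "a = f x" by auto
  then show "\<ominus>\<^sub>N a\<in>f ` carrier M" using hom_neg[OF assms x(1)] M.M.a_inv_closed by (metis imageI)
  show "r \<odot>\<^sub>N a\<in>f ` carrier M" if "r\<in>carrier R" for r
   using hom_smult[OF assms(3) that x(1)] M.smult_closed[OF that x(1)] x(2) by (metis imageI)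
  show "a \<oplus>\<^sub>N b\<in>f ` carrier M" if b: "b\<in>f ` carrier M" for b
  proof -
   obtain y where "y\<in>carrier M" "b = f y" using b by auto
   then show ?thesis using hom_add[OF assms(3) x(1)] x M.M.a_closed by (metis imageI)
  qed
 qed
qed

section \<open>Complexes and quasi-isomorphisms\<close>

lemma complexI:
 assumes "!!n. module R (obj C n)" "!!n. diff C n\<in>mod_hom R (obj C n) (obj C (n + 1))"
  and "!!n y. y\<in>carrier (obj C n) ==> diff C (n + 1) (diff C n y) = \<zero>\<^bsub>obj C (n + 1 + 1)\<^esub>"
 shows "cochain_complex R C" using assms by (auto simp: cochain_complex_def)

lemma complexD:
 assumes "cochain_complex R C"
 shows "module R (obj C n)" "diff C n\<in>mod_hom R (obj C n) (obj C (n + 1))"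
  "diff C (n - 1)\<in>mod_hom R (obj C (n - 1)) (obj C n)"
  "y\<in>carrier (obj C n) ==> diff C (n + 1) (diff C n y) = \<zero>\<^bsub>obj C (n + 1 + 1)\<^esub>"
  "y\<in>carrier (obj C (n - 1)) ==> diff C n (diff C (n - 1) y) = \<zero>\<^bsub>obj C (n + 1)\<^esub>"
proof -
 show "module R (obj C n)" "diff C n\<in>mod_hom R (obj C n) (obj C (n + 1))"
  "y\<in>carrier (obj C n) ==> diff C (n + 1) (diff C n y) = \<zero>\<^bsub>obj C (n + 1 + 1)\<^esub>"
  using assms by (auto simp: cochain_complex_def)
 have "diff C (n - 1)\<in>mod_hom R (obj C (n - 1)) (obj C (n - 1 + 1))"
  "y\<in>carrier (obj C (n - 1)) ==> diff C (n - 1 + 1) (diff C (n - 1) y) = \<zero>\<^bsub>obj C (n - 1 + 1 + 1)\<^esub>"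
  using assms by (auto simp only: cochain_complex_def)
 then show "diff C (n - 1)\<in>mod_hom R (obj C (n - 1)) (obj C n)"
  "y\<in>carrier (obj C (n - 1)) ==> diff C n (diff C (n - 1) y) = \<zero>\<^bsub>obj C (n + 1)\<^esub>" by simp_all
qed

lemma cycles_submodule: "cochain_complex R C ==> submodule (cycles C n) R (obj C n)"
 unfolding cycles_def by (intro kernel_submodule complexD)

lemma boundaries_submodule: "cochain_complex R C ==> submodule (boundaries C n) R (obj C n)"
 unfolding boundaries_def by (intro image_submodule complexD)

lemma boundaries_subset_cycles: "cochain_complex R C ==> boundaries C n <= cycles C n"
 using complexD(5)[of R C] hom_closed[OF complexD(3)[of R C n]] by (auto simp: boundaries_def cycles_def)

lemma boundaries_submodule_cycles:
 "cochain_complex R C ==> submodule (boundaries C n) R ((obj C n)\<lparr>carrier := cycles C n\<rparr>)"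
 by (intro submodule_restrict complexD(1) cycles_submodule boundaries_submodule boundaries_subset_cycles)

lemma cycles_module: "cochain_complex R C ==> module R ((obj C n)\<lparr>carrier := cycles C n\<rparr>)"
 by (intro submodule_module complexD(1) cycles_submodule)

text \<open>A coset is trivial exactly when its representative is a boundary, so acyclicity can be
  checked on elements without the quotient.\<close>

lemma acyclic_complex_iff:
 assumes "cochain_complex R C"
 shows "acyclic_complex C \<longleftrightarrow> (ALL n. cycles C n <= boundaries C n)"
proof -
 have "carrier (cohomology C n) = {\<zero>\<^bsub>cohomology C n\<^esub>} \<longleftrightarrow> cycles C n <= boundaries C n" for n
 proof -
  let ?M = "(obj C n)\<lparr>carrier := cycles C n\<rparr>"
  note M = cycles_module[OF assms, of n] boundaries_submodule_cycles[OF assms, of n]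
  have "cycles C n ~= {}" using submodule_mem(2)[OF complexD(1)[OF assms] cycles_submodule[OF assms]] by blast
  then have "carrier (cohomology C n) = {\<zero>\<^bsub>cohomology C n\<^esub>} \<longleftrightarrow> (ALL x:cycles C n. boundaries C n +>\<^bsub>?M\<^esub> x = boundaries C n)"
   unfolding cohomology_def quot_module_simps A_RCOSETS_def' by auto
  then show ?thesis using coset_eq_zero_iff[OF M] by auto
 qed
 then show ?thesis by (simp add: acyclic_complex_def)
qed

lemma chain_map_hom: "chain_map R C D f ==> f n\<in>mod_hom R (obj C n) (obj D n)"
 and chain_map_comm: "chain_map R C D f ==> y\<in>carrier (obj C n) ==> f (n + 1) (diff C n y) = diff D n (f n y)"
 by (auto simp: chain_map_def)

lemma chain_map_boundaries:
 assumes "cochain_complex R C" "cochain_complex R D" "chain_map R C D f" "b\<in>boundaries C n"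
 shows "f n b\<in>boundaries D n"
proof -
 obtain y where y: "y\<in>carrier (obj C (n - 1))" "b = diff C (n - 1) y" using assms(4) by (auto simp: boundaries_def)
 have "f (n - 1 + 1) (diff C (n - 1) y) = diff D (n - 1) (f (n - 1) y)" by (rule chain_map_comm[OF assms(3) y(1)])
 moreover have "f (n - 1) y\<in>carrier (obj D (n - 1))" by (rule hom_closed[OF chain_map_hom[OF assms(3)] y(1)])
 ultimately show ?thesis using y(2) by (simp add: boundaries_def)
qed

lemma chain_map_cycles:
 assumes "cochain_complex R C" "cochain_complex R D" "chain_map R C D f" "z\<in>cycles C n"
 shows "f n z\<in>cycles D n"
proof -
 have f: "f m\<in>mod_hom R (obj C m) (obj D m)" for m using assms(3) by (auto simp: chain_map_def)
 have "diff D n (f n z) = f (n + 1) (diff C n z)" using assms(4) chain_map_comm[OF assms(3), of z n] by (auto simp: cycles_def)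
 then show ?thesis using assms(4) hom_closed[OF f] hom_zero[OF complexD(1)[OF assms(1)] complexD(1)[OF assms(2)] f] by (auto simp: cycles_def)
qed

lemma cohomology_map_coset:
 assumes "cochain_complex R C" "cochain_complex R D" "chain_map R C D f" "z\<in>cycles C n"
 shows "cohomology_map D f n (boundaries C n +>\<^bsub>obj C n\<^esub> z) = boundaries D n +>\<^bsub>obj D n\<^esub> f n z"
 unfolding cohomology_map_def
proof (rule UN_coset[OF complexD(1)[OF assms(1)] boundaries_submodule[OF assms(1)]])
 note C = complexD(1)[OF assms(1), of n] and D = complexD(1)[OF assms(2), of n]
 have f: "f n\<in>mod_hom R (obj C n) (obj D n)" using assms(3) by (auto simp: chain_map_def)
 show z: "z\<in>carrier (obj C n)" using assms(4) by (auto simp: cycles_def)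
 fix a assume a: "a\<in>carrier (obj C n)" "a \<ominus>\<^bsub>obj C n\<^esub> z\<in>boundaries C n"
 then show "boundaries D n +>\<^bsub>obj D n\<^esub> f n a = boundaries D n +>\<^bsub>obj D n\<^esub> f n z"
  using chain_map_boundaries[OF assms(1-3) a(2)] hom_minus[OF C D f a(1) z]
   coset_eq_iff[OF D boundaries_submodule[OF assms(2)]] hom_closed[OF f] z by simp
qed

lemma carrier_cohomology:
 "carrier (cohomology C n) = (%z. boundaries C n +>\<^bsub>obj C n\<^esub> z) ` cycles C n" by (auto simp: cohomology_def A_RCOSETS_def')

text \<open>Since the induced map is additive, injectivity need only be tested at zero, and both
  halves of bijectivity become conditions on representatives. The later diagram chases start from
  this form.\<close>

lemma quasi_iso_iff:
 assumes C: "cochain_complex R C" and D: "cochain_complex R D"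
 shows "quasi_iso R C D f \<longleftrightarrow> chain_map R C D f &
  (ALL n. ALL z:cycles C n. f n z\<in>boundaries D n --> z\<in>boundaries C n) &
  (ALL n. ALL w:cycles D n. EX z:cycles C n. w \<ominus>\<^bsub>obj D n\<^esub> f n z\<in>boundaries D n)"
proof (cases "chain_map R C D f")
 case True
 have f: "f n\<in>mod_hom R (obj C n) (obj D n)" for n using True by (auto simp: chain_map_def)
 note CM = complexD(1)[OF C] and DM = complexD(1)[OF D]
 note bC = boundaries_submodule[OF C] and bD = boundaries_submodule[OF D]
 have cyc: "z\<in>carrier (obj C n)" if "z\<in>cycles C n" for z n using that by (auto simp: cycles_def)
 have cycD: "z\<in>carrier (obj D n)" if "z\<in>cycles D n" for z n using that by (auto simp: cycles_def)
 have inj: "inj_on (cohomology_map D f n) (carrier (cohomology C n)) \<longleftrightarrow>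
   (ALL z:cycles C n. f n z\<in>boundaries D n --> z\<in>boundaries C n)" (is "?L \<longleftrightarrow> ?R") for n
 proof
  assume L: ?L
  show ?R
  proof (intro ballI impI)
   fix z assume z: "z\<in>cycles C n" "f n z\<in>boundaries D n"
   have z0: "\<zero>\<^bsub>obj C n\<^esub>\<in>cycles C n" by (rule submodule_mem(2)[OF CM cycles_submodule[OF C]])
   have "cohomology_map D f n (boundaries C n +>\<^bsub>obj C n\<^esub> z) = cohomology_map D f n (boundaries C n +>\<^bsub>obj C n\<^esub> \<zero>\<^bsub>obj C n\<^esub>)"
    using z z0 cycD chain_map_cycles[OF C D True z(1)]
    by (simp add: cohomology_map_coset[OF C D True] coset_eq_zero_iff[OF DM bD] hom_zero[OF CM DM f] coset_zero[OF DM bD])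
   then have "boundaries C n +>\<^bsub>obj C n\<^esub> z = boundaries C n +>\<^bsub>obj C n\<^esub> \<zero>\<^bsub>obj C n\<^esub>"
    using L z(1) z0 by (auto simp: inj_on_def carrier_cohomology)
   then show "z\<in>boundaries C n" using z(1) cyc by (simp add: coset_zero[OF CM bC] coset_eq_zero_iff[OF CM bC])
  qed
 next
  assume R: ?R
  show ?L unfolding carrier_cohomology
  proof (rule inj_onI, elim imageE)
   fix A B z w assume zw: "z\<in>cycles C n" "w\<in>cycles C n" "A = boundaries C n +>\<^bsub>obj C n\<^esub> z" "B = boundaries C n +>\<^bsub>obj C n\<^esub> w"
    and eq: "cohomology_map D f n A = cohomology_map D f n B"
   have "f n z \<ominus>\<^bsub>obj D n\<^esub> f n w\<in>boundaries D n"
    using eq zw hom_closed[OF f cyc] by (simp add: cohomology_map_coset[OF C D True] coset_eq_iff[OF DM bD])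
   then have "f n (z \<ominus>\<^bsub>obj C n\<^esub> w)\<in>boundaries D n" using zw(1,2) cyc by (simp add: hom_minus[OF CM DM f])
   then show "A = B" using R submodule_mem(6)[OF CM cycles_submodule[OF C]] zw cyc by (simp add: coset_eq_iff[OF CM bC])
  qed
 qed
 have surj: "cohomology_map D f n ` carrier (cohomology C n) = carrier (cohomology D n) \<longleftrightarrow>
   (ALL w:cycles D n. EX z:cycles C n. w \<ominus>\<^bsub>obj D n\<^esub> f n z\<in>boundaries D n)" for n
 proof -
  have 1: "cohomology_map D f n ` carrier (cohomology C n) = (%z. boundaries D n +>\<^bsub>obj D n\<^esub> f n z) ` cycles C n"
   by (simp add: carrier_cohomology image_image cohomology_map_coset[OF C D True])
  have 2: "(%z. boundaries D n +>\<^bsub>obj D n\<^esub> f n z) ` cycles C n <= carrier (cohomology D n)"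
   using chain_map_cycles[OF C D True] by (auto simp: carrier_cohomology)
  have 3: "boundaries D n +>\<^bsub>obj D n\<^esub> w = boundaries D n +>\<^bsub>obj D n\<^esub> f n z \<longleftrightarrow> w \<ominus>\<^bsub>obj D n\<^esub> f n z\<in>boundaries D n"
   if "w\<in>cycles D n" "z\<in>cycles C n" for w z using that hom_closed[OF f cyc] cycD by (simp add: coset_eq_iff[OF DM bD])
  have "cohomology_map D f n ` carrier (cohomology C n) = carrier (cohomology D n) \<longleftrightarrow>
    carrier (cohomology D n) <= (%z. boundaries D n +>\<^bsub>obj D n\<^esub> f n z) ` cycles C n" unfolding 1 using 2 by blast
  also have "... \<longleftrightarrow> (ALL w:cycles D n. EX z:cycles C n. boundaries D n +>\<^bsub>obj D n\<^esub> w = boundaries D n +>\<^bsub>obj D n\<^esub> f n z)"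
   unfolding carrier_cohomology by blast
  finally show ?thesis using 3 by simp
 qed
 show ?thesis using True inj surj by (auto simp: quasi_iso_def bij_betw_def)
qed (auto simp: quasi_iso_def)

subsection \<open>Signs, shifts and products\<close>

lemma signed_closed:
 assumes "module R M" "y\<in>carrier M" shows "signed M k y\<in>carrier M"
proof -
 interpret M: module R M by fact
 show ?thesis using assms(2) by (simp add: signed_def)
qed

lemma signed_zero: "module R M ==> signed M k \<zero>\<^sub>M = \<zero>\<^sub>M"
 by (simp add: signed_def module_neg_zero)

lemma signed_eq_zero_iff:
 assumes "module R M" "y\<in>carrier M" shows "signed M k y = \<zero>\<^sub>M \<longleftrightarrow> y = \<zero>\<^sub>M"
proof -
 interpret M: module R M by fact
 have "y = \<zero>\<^sub>M" if "\<ominus>\<^sub>M y = \<zero>\<^sub>M" using that assms(2) M.M.minus_minus module_neg_zero[OF assms(1)] by metis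
 then show ?thesis by (auto simp: signed_def module_neg_zero[OF assms(1)])
qed

lemma signed_signed:
 assumes "module R M" "y\<in>carrier M" shows "signed M k (signed M k y) = y"
proof -
 interpret M: module R M by fact
 show ?thesis using assms(2) by (simp add: signed_def)
qed

lemma hom_signed:
 assumes "module R M" "module R N" "f\<in>mod_hom R M N" "y\<in>carrier M"
 shows "f (signed M k y) = signed N k (f y)" using assms by (simp add: signed_def hom_neg)

lemma hom_signed_map:
 "module R N ==> f\<in>mod_hom R M N ==> (%y. signed N k (f y))\<in>mod_hom R M N"
 by (cases "even k") (auto simp: signed_def intro: hom_neg_map)

lemma signed_pred:
 assumes "module R M" "y\<in>carrier M" shows "signed M (k - 1) y = \<ominus>\<^sub>M signed M k y"
proof -
 interpret M: module R M by fact
 show ?thesis using assms(2) by (simp add: signed_def)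
qed

lemma shift_simps [simp]:
 "obj (shift_complex i C) n = obj C (n + i)"
 "diff (shift_complex i C) n y = signed (obj C (n + i + 1)) i (diff C (n + i) y)" by (auto simp: shift_complex_def)

lemma complex_shift:
 assumes "cochain_complex R C" shows "cochain_complex R (shift_complex i C)"
proof (rule complexI)
 note M = complexD(1)[OF assms] and d = complexD(2)[OF assms]
 have e: "n + 1 + i = n + i + 1" "n + 1 + 1 + i = n + i + 1 + 1" for n by auto
 fix n
 show "module R (obj (shift_complex i C) n)" by (simp add: M)
 have "diff (shift_complex i C) n = (%y. signed (obj C (n + i + 1)) i (diff C (n + i) y))" by auto
 then show dd: "diff (shift_complex i C) n\<in>mod_hom R (obj (shift_complex i C) n) (obj (shift_complex i C) (n + 1))"
  using hom_signed_map[OF M d] by (simp add: e)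
 fix y assume "y\<in>carrier (obj (shift_complex i C) n)"
 then show "diff (shift_complex i C) (n + 1) (diff (shift_complex i C) n y) = \<zero>\<^bsub>obj (shift_complex i C) (n + 1 + 1)\<^esub>"
  using hom_closed[OF d[of "n + i"], of y] complexD(4)[OF assms, of y "n + i"]
  by (simp only: shift_simps e hom_signed[OF M M d]) (simp only: signed_zero[OF M])
qed

lemma prod_simps [simp]:
 "obj (prod_complex C) n = prod_module (%i. obj (C i) n)" "diff (prod_complex C) n u = (%i. diff (C i) n (u i))"
 by (auto simp: prod_complex_def)

lemma complex_prod:
 assumes "cring R" "!!i. cochain_complex R (C i)" shows "cochain_complex R (prod_complex C)"
proof (rule complexI)
 note d = complexD(2)[OF assms(2)]
 fix n
 show "module R (obj (prod_complex C) n)" by (simp add: prod_module_module[OF assms(1)] complexD(1)[OF assms(2)])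
 show "diff (prod_complex C) n\<in>mod_hom R (obj (prod_complex C) n) (obj (prod_complex C) (n + 1))"
  by (rule mod_homI) (auto simp: hom_closed[OF d] hom_add[OF d] hom_smult[OF d])
qed (auto simp: complexD(4)[OF assms(2)])

lemma cycles_prod: "cycles (prod_complex C) n = {u. ALL i. u i\<in>cycles (C i) n}"
 by (auto simp: cycles_def fun_eq_iff)

lemma boundaries_prod: "boundaries (prod_complex C) n = {u. ALL i. u i\<in>boundaries (C i) n}"
proof (rule Set.set_eqI, rule iffI)
 fix u assume "u\<in>{u. ALL i. u i\<in>boundaries (C i) n}"
 then have "ALL i. EX v. v\<in>carrier (obj (C i) (n - 1)) & u i = diff (C i) (n - 1) v" by (auto simp: boundaries_def)
 then obtain v where "ALL i. v i\<in>carrier (obj (C i) (n - 1)) & u i = diff (C i) (n - 1) (v i)" by metis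
 then show "u\<in>boundaries (prod_complex C) n" by (auto simp: boundaries_def fun_eq_iff intro!: image_eqI[where x=v])
qed (auto simp: boundaries_def)

lemma cycles_shift:
 assumes "cochain_complex R C" shows "cycles (shift_complex i C) n = cycles C (n + i)"
proof -
 have e: "n + 1 + i = n + i + 1" by simp
 show ?thesis unfolding cycles_def shift_simps e
  by (rule Collect_cong) (use signed_eq_zero_iff[OF complexD(1)[OF assms] hom_closed[OF complexD(2)[OF assms]]] in blast)
qed

text \<open>The sign commutes with the differential and permutes the source, so it can be absorbed
  there without changing the image.\<close>

lemma boundaries_shift:
 assumes "cochain_complex R C" shows "boundaries (shift_complex i C) n = boundaries C (n + i)"
proof -
 note M = complexD(1)[OF assms]
 have e: "n - 1 + i = n + i - 1" by simp
 note d = complexD(3)[OF assms, of "n + i"]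
 let ?s = "signed (obj C (n + i - 1)) i"
 have eq: "signed (obj C (n + i)) i (diff C (n + i - 1) y) = diff C (n + i - 1) (?s y)"
  if "y\<in>carrier (obj C (n + i - 1))" for y using hom_signed[OF M M d that] by simp
 have "?s ` carrier (obj C (n + i - 1)) = carrier (obj C (n + i - 1))" using signed_closed[OF M] signed_signed[OF M] by (auto simp: image_iff) metis
 then have "boundaries C (n + i) = (%y. diff C (n + i - 1) (?s y)) ` carrier (obj C (n + i - 1))"
  unfolding boundaries_def by (metis image_image)
 then show ?thesis unfolding boundaries_def shift_simps e by (simp add: eq)
qed

lemma minus_eq_zero_iff:
 assumes "module R M" "x\<in>carrier M" "y\<in>carrier M"
 shows "x \<ominus>\<^sub>M y = \<zero>\<^sub>M \<longleftrightarrow> x = y"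
proof -
 interpret M: module R M by fact
 show ?thesis using assms(2,3) M.M.minus_equality[of x "\<ominus>\<^sub>M y"] by (auto simp: a_minus_def M.M.r_neg)
qed

section \<open>Injective modules\<close>

text \<open>Baer's extension condition, with the extension to \<open>R\<close> recorded by its value
  \<open>e\<close> at one. No test type occurs, so the condition carries injectivity from one test
  type to every other.\<close>

definition baer_module :: "('a, 'r) ring_scheme => ('a, 'm) module => bool" where
 "baer_module R E \<longleftrightarrow> module R E &
   (ALL I g. ideal I R & g\<in>mod_hom R ((self_module R)\<lparr>carrier := I\<rparr>) E -->
    (EX e:carrier E. ALL a:I. g a = a \<odot>\<^sub>E e))"

lemma baer_moduleD:
 assumes "baer_module R E" "ideal I R" "g\<in>mod_hom R ((self_module R)\<lparr>carrier := I\<rparr>) E"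
 obtains e where "e\<in>carrier E" "!!a. a\<in>I ==> g a = a \<odot>\<^sub>E e" using assms unfolding baer_module_def by blast

lemma injective_moduleD:
 fixes M N :: "('a, 't) module"
 assumes "injective_module TYPE('t) R E" "module R M" "module R N"
  "f\<in>mod_hom R M N" "inj_on f (carrier M)" "g\<in>mod_hom R M E"
 obtains h where "h\<in>mod_hom R N E" "!!m. m\<in>carrier M ==> h (f m) = g m"
proof -
 note * = conjunct2[OF assms(1)[unfolded injective_module_def], rule_format, of M N f g]
 have "EX h:mod_hom R N E. ALL m:carrier M. h (f m) = g m" by (rule *) (intro conjI assms)
 then show thesis using that by blast
qed

text \<open>An ideal and \<open>R\<close> itself are test modules of the type of the ring; the
  element wanted is the value of the extended map at one.\<close>

lemma injective_imp_baer:
 fixes R :: "('a, 'r) ring_scheme"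
 assumes "injective_module TYPE('a) R E"
 shows "baer_module R E" unfolding baer_module_def
proof (intro conjI allI impI)
 show E: "module R E" using assms by (auto simp: injective_module_def)
 interpret E: module R E by fact
 fix I g assume I: "ideal I R & g\<in>mod_hom R ((self_module R)\<lparr>carrier := I\<rparr>) E"
 let ?S = "self_module R" let ?I = "?S\<lparr>carrier := I\<rparr>"
 have S: "module R ?S" by (rule module_self[OF E.R.is_cring])
 have sub: "submodule I R ?S" using I by (intro submodule_self_ideal E.R.is_cring) auto
 obtain h where h: "h\<in>mod_hom R ?S E" "!!m. m\<in>carrier ?I ==> h m = g m"
  using injective_moduleD[OF assms submodule_module[OF S sub] S hom_incl[OF submodule_mem(1)[OF S sub]] inj_on_id2 conjunct2[OF I]] by blast
 show "EX e:carrier E. ALL a:I. g a = a \<odot>\<^sub>E e"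
 proof (intro bexI ballI)
  show "h \<one>\<^sub>R\<in>carrier E" using hom_closed[OF h(1)] by simp
  fix a assume a: "a\<in>I"
  then have "a\<in>carrier R" using submodule_mem(1)[OF S sub] by auto
  then show "g a = a \<odot>\<^sub>E h \<one>\<^sub>R" using h(2)[of a] a hom_smult[OF h(1), of a "\<one>\<^sub>R"] by simp
 qed
qed

text \<open>Partial homomorphisms are handled through their graphs, so that Zorn's lemma for inclusion applies.\<close>

definition hom_graph :: "('a, 'r) ring_scheme => ('a, 'm) module => ('a, 'n) module => ('m \<times> 'n) set => bool" where
 "hom_graph R N E G \<longleftrightarrow> G <= carrier N \<times> carrier E & (\<zero>\<^sub>N, \<zero>\<^sub>E)\<in>G &
  (ALL a b a' b'. (a, b)\<in>G --> (a', b')\<in>G --> (a \<oplus>\<^sub>N a', b \<oplus>\<^sub>E b')\<in>G) &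
  (ALL r a b. r\<in>carrier R --> (a, b)\<in>G --> (r \<odot>\<^sub>N a, r \<odot>\<^sub>E b)\<in>G) &
  (ALL b. (\<zero>\<^sub>N, b)\<in>G --> b = \<zero>\<^sub>E)"

lemma hom_graphD:
 assumes "hom_graph R N E G"
 shows "G <= carrier N \<times> carrier E" "(\<zero>\<^sub>N, \<zero>\<^sub>E)\<in>G"
  "(a, b)\<in>G ==> (a', b')\<in>G ==> (a \<oplus>\<^sub>N a', b \<oplus>\<^sub>E b')\<in>G"
  "r\<in>carrier R ==> (a, b)\<in>G ==> (r \<odot>\<^sub>N a, r \<odot>\<^sub>E b)\<in>G"
  "(\<zero>\<^sub>N, b)\<in>G ==> b = \<zero>\<^sub>E" using assms unfolding hom_graph_def by simp_all

lemma hom_graph_minus: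
 assumes "module R N" "module R E" "hom_graph R N E G" "(a, b)\<in>G" "(a', b')\<in>G"
 shows "(a \<ominus>\<^sub>N a', b \<ominus>\<^sub>E b')\<in>G"
proof -
 interpret N: module R N by fact
 interpret E: module R E by fact
 have c: "a'\<in>carrier N" "b'\<in>carrier E" using assms(3,5) by (auto simp: hom_graph_def)
 have "((\<ominus>\<^sub>R \<one>\<^sub>R) \<odot>\<^sub>N a', (\<ominus>\<^sub>R \<one>\<^sub>R) \<odot>\<^sub>E b')\<in>G"
  by (intro hom_graphD(4)[OF assms(3)] N.R.a_inv_closed N.R.one_closed assms(5))
 then have "(\<ominus>\<^sub>N a', \<ominus>\<^sub>E b')\<in>G" using c by (simp add: N.smult_l_minus E.smult_l_minus)
 then show ?thesis using assms(3,4) by (simp add: hom_graph_def a_minus_def)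
qed

lemma hom_graph_fun:
 assumes "module R N" "module R E" "hom_graph R N E G" "(a, b)\<in>G" "(a, b')\<in>G"
 shows "b = b'"
proof -
 interpret N: module R N by fact
 interpret E: module R E by fact
 have c: "a\<in>carrier N" "b\<in>carrier E" "b'\<in>carrier E" using assms(3-5) by (auto simp: hom_graph_def)
 have "b \<ominus>\<^sub>E b' = \<zero>\<^sub>E" using hom_graph_minus[OF assms] assms(3) c by (simp add: hom_graph_def N.M.r_neg a_minus_def)
 then show ?thesis using c by (simp add: minus_eq_zero_iff[OF assms(2)])
qed

lemma hom_graph_Union:
 assumes "subset.chain {G. hom_graph R N E G} \<C>" "\<C> ~= {}"
 shows "hom_graph R N E (\<Union>\<C>)"
proof -
 have G: "hom_graph R N E G" if "G\<in>\<C>" for G using assms(1) that by (auto simp: subset.chain_def)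
 have "G <= G' \<or> G' <= G" if "G\<in>\<C>" "G'\<in>\<C>" for G G' using assms(1) that unfolding subset_chain_def by blast
 then have lin: "EX H:\<C>. G <= H & G' <= H" if "G\<in>\<C>" "G'\<in>\<C>" for G G' using that by (meson order_refl)
 show ?thesis unfolding hom_graph_def
 proof (intro conjI allI impI)
  show "\<Union>\<C> <= carrier N \<times> carrier E" using hom_graphD(1)[OF G] by (rule Union_least)
  show "(\<zero>\<^sub>N, \<zero>\<^sub>E)\<in>\<Union>\<C>" using hom_graphD(2)[OF G] assms(2) by auto
 next
  fix a b a' b' assume "(a, b)\<in>\<Union>\<C>" "(a', b')\<in>\<Union>\<C>"
  then obtain K K' where "K\<in>\<C>" "(a, b)\<in>K" "K'\<in>\<C>" "(a', b')\<in>K'" by auto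
  then obtain H where "H\<in>\<C>" "(a, b)\<in>H" "(a', b')\<in>H" using lin[of K K'] by auto
  then show "(a \<oplus>\<^sub>N a', b \<oplus>\<^sub>E b')\<in>\<Union>\<C>" using hom_graphD(3)[OF G[of H]] by blast
 next
  fix r a b assume "r\<in>carrier R" "(a, b)\<in>\<Union>\<C>"
  then show "(r \<odot>\<^sub>N a, r \<odot>\<^sub>E b)\<in>\<Union>\<C>" using hom_graphD(4)[OF G] by blast
 next
  fix b assume "(\<zero>\<^sub>N, b)\<in>\<Union>\<C>"
  then show "b = \<zero>\<^sub>E" using hom_graphD(5)[OF G] by auto
 qed
qed

text \<open>The \<open>r\<close> with \<open>r y\<close> in the current domain form an ideal, on
  which \<open>r\<close> maps linearly to the value at \<open>r y\<close>. Baer's condition turns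
  this map into multiplication by some \<open>e\<close>, and \<open>e\<close> is then a consistent
  value at \<open>y\<close>.\<close>

lemma hom_graph_extend:
 assumes E: "baer_module R E" and N: "module R N" and G: "hom_graph R N E G" and y: "y\<in>carrier N"
 shows "EX G'. hom_graph R N E G' & G <= G' & y\<in>fst ` G'"
proof -
 have ME: "module R E" using E by (auto simp: baer_module_def)
 interpret N: module R N by fact
 interpret E: module R E by fact
 define D where "D = fst ` G"
 define f where "f r = (THE b. (r \<odot>\<^sub>N y, b)\<in>G)" for r
 have GC: "a\<in>carrier N" "b\<in>carrier E" if "(a, b)\<in>G" for a b using G that by (auto simp: hom_graph_def)
 have Gadd: "(a \<oplus>\<^sub>N a', b \<oplus>\<^sub>E b')\<in>G" if "(a, b)\<in>G" "(a', b')\<in>G" for a b a' b'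
  using G that by (simp add: hom_graph_def)
 have Gsm: "(r \<odot>\<^sub>N a, r \<odot>\<^sub>E b)\<in>G" if "r\<in>carrier R" "(a, b)\<in>G" for r a b using G that by (simp add: hom_graph_def)
 have G0: "(\<zero>\<^sub>N, \<zero>\<^sub>E)\<in>G" using G by (simp add: hom_graph_def)
 have Dsub: "submodule D R N"
 proof (rule N.submoduleI)
  show "D <= carrier N" using GC by (auto simp: D_def)
  show "\<zero>\<^sub>N\<in>D" using G0 by (force simp: D_def)
  show smD: "r \<odot>\<^sub>N a\<in>D" if "r\<in>carrier R" "a\<in>D" for r a using that Gsm by (force simp: D_def)
  show "a \<oplus>\<^sub>N b\<in>D" if "a\<in>D" "b\<in>D" for a b using that Gadd by (force simp: D_def)
  show "\<ominus>\<^sub>N a\<in>D" if "a\<in>D" for a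
   using smD[of "\<ominus>\<^sub>R \<one>\<^sub>R" a] that GC by (force simp: D_def N.smult_l_minus)
 qed
 define I where "I = {r\<in>carrier R. r \<odot>\<^sub>N y\<in>D}"
 note Dm = submodule_mem[OF N Dsub]
 have I: "ideal I R"
 proof (rule idealI[OF N.R.ring_axioms])
  show "subgroup I (add_monoid R)"
  proof (rule N.R.add.subgroupI)
   show "I <= carrier R" by (auto simp: I_def)
   have "\<zero>\<^sub>R\<in>I" using Dm(2) y by (simp add: I_def)
   then show "I ~= {}" by auto
   show "\<ominus>\<^sub>R a\<in>I" if "a\<in>I" for a using that Dm(3) y by (simp add: I_def N.smult_l_minus)
   show "a \<oplus>\<^sub>R b\<in>I" if "a\<in>I" "b\<in>I" for a b using that Dm(5) y by (simp add: I_def N.smult_l_distr)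
  qed
  show "r \<otimes>\<^sub>R a\<in>I" "a \<otimes>\<^sub>R r\<in>I" if "a\<in>I" "r\<in>carrier R" for a r
   using that Dm(4) y by (auto simp: I_def N.smult_assoc1 N.R.m_comm[of a r])
 qed
 have phi: "(r \<odot>\<^sub>N y, f r)\<in>G" if "r\<in>I" for r
 proof -
  obtain b where b: "(r \<odot>\<^sub>N y, b)\<in>G" using \<open>r\<in>I\<close> by (auto simp: I_def D_def)
  then show ?thesis unfolding f_def by (rule theI) (rule hom_graph_fun[OF N ME G _ b])
 qed
 note uniq = hom_graph_fun[OF N ME G]
 have IR: "a\<in>carrier R" if "a\<in>I" for a using that by (auto simp: I_def)
 have "f\<in>mod_hom R ((self_module R)\<lparr>carrier := I\<rparr>) E"
 proof (rule mod_homI)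
  fix a b assume ab: "a\<in>carrier ((self_module R)\<lparr>carrier := I\<rparr>)" "b\<in>carrier ((self_module R)\<lparr>carrier := I\<rparr>)"
  then have ab': "a\<in>I" "b\<in>I" "a \<oplus>\<^sub>R b\<in>I" using additive_subgroup.a_closed[OF ideal.axioms(1)[OF I]] by auto
  show "f a\<in>carrier E" using phi[OF ab'(1)] GC by auto
  have "((a \<oplus>\<^sub>R b) \<odot>\<^sub>N y, f a \<oplus>\<^sub>E f b)\<in>G" using Gadd[OF phi phi] ab' IR y by (simp add: N.smult_l_distr)
  then show "f (a \<oplus>\<^bsub>(self_module R)\<lparr>carrier := I\<rparr>\<^esub> b) = f a \<oplus>\<^sub>E f b" using uniq phi[OF ab'(3)] by simp
 next
  fix r a assume ra: "r\<in>carrier R" "a\<in>carrier ((self_module R)\<lparr>carrier := I\<rparr>)"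
  then have ra': "a\<in>I" "r \<otimes>\<^sub>R a\<in>I" using ideal.I_l_closed[OF I] by auto
  have "((r \<otimes>\<^sub>R a) \<odot>\<^sub>N y, r \<odot>\<^sub>E f a)\<in>G"
   using Gsm[OF ra(1) phi[OF ra'(1)]] ra ra' IR y by (simp add: N.smult_assoc1)
  then show "f (r \<odot>\<^bsub>(self_module R)\<lparr>carrier := I\<rparr>\<^esub> a) = r \<odot>\<^sub>E f a" using uniq phi[OF ra'(2)] by simp
 qed
 then obtain e where e: "e\<in>carrier E" "!!a. a\<in>I ==> f a = a \<odot>\<^sub>E e" using baer_moduleD[OF E I] by blast
 define G' where "G' = {(a \<oplus>\<^sub>N r \<odot>\<^sub>N y, b \<oplus>\<^sub>E r \<odot>\<^sub>E e) | a b r. (a, b)\<in>G & r\<in>carrier R}"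
 have G'I: "(a \<oplus>\<^sub>N r \<odot>\<^sub>N y, b \<oplus>\<^sub>E r \<odot>\<^sub>E e)\<in>G'" if "(a, b)\<in>G" "r\<in>carrier R" for a b r
  using that by (auto simp: G'_def)
 have sub: "G <= G'"
 proof (rule subrelI)
  fix a b assume "(a, b)\<in>G"
  then show "(a, b)\<in>G'" using G'I[of a b "\<zero>\<^sub>R"] GC y e(1) by simp
 qed
 have "y\<in>fst ` G'" using G'I[OF G0 N.R.one_closed] y by force
 moreover have "hom_graph R N E G'" unfolding hom_graph_def
 proof (intro conjI allI impI)
  show "G' <= carrier N \<times> carrier E" using GC y e(1) by (auto simp: G'_def)
  show "(\<zero>\<^sub>N, \<zero>\<^sub>E)\<in>G'" using G0 sub by blast
 next
  fix p q p' q' assume "(p, q)\<in>G'" "(p', q')\<in>G'"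
  then obtain a b r a' b' r' where *: "(a, b)\<in>G" "r\<in>carrier R" "(a', b')\<in>G" "r'\<in>carrier R"
   "p = a \<oplus>\<^sub>N r \<odot>\<^sub>N y" "q = b \<oplus>\<^sub>E r \<odot>\<^sub>E e" "p' = a' \<oplus>\<^sub>N r' \<odot>\<^sub>N y" "q' = b' \<oplus>\<^sub>E r' \<odot>\<^sub>E e"
   by (auto simp: G'_def)
  have c: "a\<in>carrier N" "a'\<in>carrier N" "b\<in>carrier E" "b'\<in>carrier E" using GC * by auto
  have "p \<oplus>\<^sub>N p' = (a \<oplus>\<^sub>N a') \<oplus>\<^sub>N (r \<oplus>\<^sub>R r') \<odot>\<^sub>N y" "q \<oplus>\<^sub>E q' = (b \<oplus>\<^sub>E b') \<oplus>\<^sub>E (r \<oplus>\<^sub>R r') \<odot>\<^sub>E e"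
   using * c y e(1) by (simp_all add: N.smult_l_distr N.M.a_ac E.smult_l_distr E.M.a_ac)
  then show "(p \<oplus>\<^sub>N p', q \<oplus>\<^sub>E q')\<in>G'" using G'I[OF Gadd[OF *(1,3)], of "r \<oplus>\<^sub>R r'"] *(2,4) by simp
 next
  fix s p q assume s: "s\<in>carrier R" and "(p, q)\<in>G'"
  then obtain a b r where *: "(a, b)\<in>G" "r\<in>carrier R"
   "p = a \<oplus>\<^sub>N r \<odot>\<^sub>N y" "q = b \<oplus>\<^sub>E r \<odot>\<^sub>E e" by (auto simp: G'_def)
  have "s \<odot>\<^sub>N p = s \<odot>\<^sub>N a \<oplus>\<^sub>N (s \<otimes>\<^sub>R r) \<odot>\<^sub>N y" "s \<odot>\<^sub>E q = s \<odot>\<^sub>E b \<oplus>\<^sub>E (s \<otimes>\<^sub>R r) \<odot>\<^sub>E e"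
   using * s GC[OF *(1)] y e(1) by (simp_all add: N.smult_r_distr N.smult_assoc1 E.smult_r_distr E.smult_assoc1)
  then show "(s \<odot>\<^sub>N p, s \<odot>\<^sub>E q)\<in>G'" using G'I[OF Gsm[OF s *(1)], of "s \<otimes>\<^sub>R r"] *(2) s by simp
 next
  \<comment> \<open>If \<open>a + r y = 0\<close> with \<open>a\<close> in the old domain, then
    \<open>- r\<close> lies in the ideal \<open>I\<close>, and the choice of \<open>e\<close> forces
    the old value at \<open>a\<close> to be \<open>- r e\<close>. So the new value at zero is
    zero.\<close>
  fix q assume "(\<zero>\<^sub>N, q)\<in>G'"
  then obtain a b r where *: "(a, b)\<in>G" "r\<in>carrier R"
   "\<zero>\<^sub>N = a \<oplus>\<^sub>N r \<odot>\<^sub>N y" "q = b \<oplus>\<^sub>E r \<odot>\<^sub>E e" by (auto simp: G'_def)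
  have c: "a\<in>carrier N" "b\<in>carrier E" using GC[OF *(1)] by auto
  have "a = \<ominus>\<^sub>N (r \<odot>\<^sub>N y)" using *(2,3) c y by (metis N.M.minus_equality N.smult_closed)
  then have ra: "(\<ominus>\<^sub>R r) \<odot>\<^sub>N y = a" using *(2) y by (simp add: N.smult_l_minus)
  have "\<ominus>\<^sub>R r\<in>I" using *(1,2) ra by (force simp: I_def D_def)
  then have "(a, (\<ominus>\<^sub>R r) \<odot>\<^sub>E e)\<in>G" using phi[of "\<ominus>\<^sub>R r"] e(2)[of "\<ominus>\<^sub>R r"] ra by simp
  then have "b = (\<ominus>\<^sub>R r) \<odot>\<^sub>E e" using uniq *(1) by blast
  then show "q = \<zero>\<^sub>E" using * e(1) by (simp add: E.smult_l_minus E.M.l_neg)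
 qed
 ultimately show ?thesis using sub by blast
qed

text \<open>Zorn's lemma is applied to the graphs containing that of \<open>g\<close>, transported
  along \<open>f\<close>; the latter is a graph because \<open>f\<close> is injective. A maximal
  graph has full domain, since otherwise \<open>hom_graph_extend\<close> would enlarge it.\<close>

theorem baer_criterion:
 assumes E: "baer_module R E"
 shows "injective_module TYPE('t) R E" unfolding injective_module_def
proof (intro conjI allI impI)
 show ME: "module R E" using E by (auto simp: baer_module_def)
 interpret E: module R E by fact
 fix M N :: "('a, 't) module" and f g
 assume "module R M & module R N & f\<in>mod_hom R M N & inj_on f (carrier M) & g\<in>mod_hom R M E"
 then have M: "module R M" and N: "module R N" and f: "f\<in>mod_hom R M N" "inj_on f (carrier M)" and g: "g\<in>mod_hom R M E" by auto
 interpret M: module R M by fact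
 interpret N: module R N by fact
 define G0 where "G0 = (%m. (f m, g m)) ` carrier M"
 have G0: "hom_graph R N E G0" unfolding hom_graph_def
 proof (intro conjI allI impI)
  show "G0 <= carrier N \<times> carrier E" using hom_closed[OF f(1)] hom_closed[OF g] by (auto simp: G0_def)
  show "(\<zero>\<^sub>N, \<zero>\<^sub>E)\<in>G0"
   using hom_zero[OF M N f(1)] hom_zero[OF M ME g] by (auto simp: G0_def intro!: image_eqI[where x="\<zero>\<^sub>M"])
 next
  fix a b a' b' assume "(a, b)\<in>G0" "(a', b')\<in>G0"
  then obtain m m' where "m\<in>carrier M" "m'\<in>carrier M" "a = f m" "b = g m" "a' = f m'" "b' = g m'" by (auto simp: G0_def)
  then show "(a \<oplus>\<^sub>N a', b \<oplus>\<^sub>E b')\<in>G0"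
   unfolding G0_def by (intro image_eqI[where x="m \<oplus>\<^sub>M m'"]) (auto simp: hom_add[OF f(1)] hom_add[OF g])
 next
  fix r a b assume "r\<in>carrier R" "(a, b)\<in>G0"
  then obtain m where "m\<in>carrier M" "a = f m" "b = g m" "r\<in>carrier R" by (auto simp: G0_def)
  then show "(r \<odot>\<^sub>N a, r \<odot>\<^sub>E b)\<in>G0"
   unfolding G0_def by (intro image_eqI[where x="r \<odot>\<^sub>M m"]) (auto simp: hom_smult[OF f(1)] hom_smult[OF g])
 next
  fix b assume "(\<zero>\<^sub>N, b)\<in>G0"
  then obtain m where m: "m\<in>carrier M" "f m = \<zero>\<^sub>N" "b = g m" by (auto simp: G0_def)
  then have "m = \<zero>\<^sub>M" using f(2) hom_zero[OF M N f(1)] by (auto simp: inj_on_def)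
  then show "b = \<zero>\<^sub>E" using m(3) hom_zero[OF M ME g] by simp
 qed
 define \<A> where "\<A> = {G. hom_graph R N E G & G0 <= G}"
 have "EX G:\<A>. ALL H:\<A>. G <= H --> H = G"
 proof (rule subset_Zorn)
  fix \<C> assume C: "subset.chain \<A> \<C>"
  show "EX U:\<A>. ALL X:\<C>. X <= U"
  \<comment> \<open>The union of the empty chain is empty and hence no graph, so that chain is
    bounded by \<open>G0\<close> instead.\<close>
  proof (cases "\<C> = {}")
   case True
   then show ?thesis using G0 by (intro bexI[of _ G0]) (auto simp: \<A>_def)
  next
   case False
   have "G0 <= \<Union>\<C>" using C False unfolding subset.chain_def \<A>_def by blast
   moreover have "subset.chain {G. hom_graph R N E G} \<C>" using C unfolding subset.chain_def \<A>_def by blast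
   ultimately show ?thesis using hom_graph_Union[OF _ False] by (intro bexI[of _ "\<Union>\<C>"]) (auto simp: \<A>_def)
  qed
 qed
 then obtain G where "G\<in>\<A>" and max: "ALL H:\<A>. G <= H --> H = G" by (rule bexE)
 then have G: "hom_graph R N E G" "G0 <= G" by (simp_all add: \<A>_def)
 have G3: "H = G" if "hom_graph R N E H" "G <= H" for H using max that order_trans[OF G(2) that(2)] by (simp add: \<A>_def)
 have dom: "y\<in>fst ` G" if "y\<in>carrier N" for y using hom_graph_extend[OF E N G(1) that] G3 by blast
 define h where "h y = (THE b. (y, b)\<in>G)" for y
 note uniq = hom_graph_fun[OF N ME G(1)]
 have h: "(y, h y)\<in>G" if "y\<in>carrier N" for y
 proof -
  obtain b where b: "(y, b)\<in>G" using dom[OF \<open>y\<in>carrier N\<close>] by auto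
  then show ?thesis unfolding h_def by (rule theI) (rule uniq[OF _ b])
 qed
 have "h\<in>mod_hom R N E"
 proof (rule mod_homI)
  fix x y assume xy: "x\<in>carrier N" "y\<in>carrier N"
  show "h x\<in>carrier E" using h[OF xy(1)] G(1) by (auto simp: hom_graph_def)
  have "(x \<oplus>\<^sub>N y, h x \<oplus>\<^sub>E h y)\<in>G" using h xy G(1) by (simp add: hom_graph_def)
  then show "h (x \<oplus>\<^sub>N y) = h x \<oplus>\<^sub>E h y" using uniq h[of "x \<oplus>\<^sub>N y"] xy by simp
 next
  fix r x assume xy: "r\<in>carrier R" "x\<in>carrier N"
  then have "(r \<odot>\<^sub>N x, r \<odot>\<^sub>E h x)\<in>G" using h G(1) by (simp add: hom_graph_def)
  then show "h (r \<odot>\<^sub>N x) = r \<odot>\<^sub>E h x" using uniq h[of "r \<odot>\<^sub>N x"] xy by simp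
 qed
 moreover have "h (f m) = g m" if "m\<in>carrier M" for m using that G(2) h[OF hom_closed[OF f(1) that]] uniq by (auto simp: G0_def)
 ultimately show "EX h:mod_hom R N E. ALL m:carrier M. h (f m) = g m" by blast
qed

text \<open>The element is chosen coordinate by coordinate, for an arbitrary index set.\<close>

lemma baer_prod_module:
 assumes "cring R" "!!i. baer_module R (E i)"
 shows "baer_module R (prod_module E)" unfolding baer_module_def
proof (intro conjI allI impI)
 have M: "module R (E i)" for i using assms(2) by (auto simp: baer_module_def)
 show "module R (prod_module E)" by (rule prod_module_module[OF assms(1) M])
 fix I g assume I: "ideal I R & g\<in>mod_hom R ((self_module R)\<lparr>carrier := I\<rparr>) (prod_module E)"
 have "EX e:carrier (E i). ALL a:I. g a i = a \<odot>\<^bsub>E i\<^esub> e" for i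
  using baer_moduleD[OF assms(2), of I "%a. g a i"] I hom_comp[OF _ prod_module_proj[of i R E]] by metis
 then obtain e where "!!i. e i\<in>carrier (E i)" "!!i a. a\<in>I ==> g a i = a \<odot>\<^bsub>E i\<^esub> e i" by metis
 then show "EX e:carrier (prod_module E). ALL a:I. g a = a \<odot>\<^bsub>prod_module E\<^esub> e" by (intro bexI[where x=e]) auto
qed

lemma baer_trivial_module:
 assumes "module R M" "carrier M = {\<zero>\<^sub>M}"
 shows "baer_module R M" unfolding baer_module_def
proof (intro conjI allI impI)
 interpret M: module R M by fact
 fix I g assume I: "ideal I R & g\<in>mod_hom R ((self_module R)\<lparr>carrier := I\<rparr>) M"
 then have "g a = \<zero>\<^sub>M" if "a\<in>I" for a using hom_closed[of g R "(self_module R)\<lparr>carrier := I\<rparr>" M a] that assms(2) by simp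
 moreover have "a\<in>carrier R" if "a\<in>I" for a using I that ideal.Icarr by metis
 ultimately show "EX e:carrier M. ALL a:I. g a = a \<odot>\<^sub>M e" by (intro bexI[where x="\<zero>\<^sub>M"]) auto
qed fact

text \<open>\<open>f\<close> descends to the image of \<open>d\<close> and is extended from there to
  \<open>A'\<close>. Only that image and \<open>A'\<close> serve as test modules, which is why
  \<open>A\<close> may live in another type.\<close>

lemma injective_factor:
 assumes B: "injective_module TYPE('t) R B" and A: "module R A" and A': "module R (A' :: ('a, 't) module)"
  and d: "d\<in>mod_hom R A A'" and f: "f\<in>mod_hom R A B"
  and ker: "!!a. a\<in>carrier A ==> d a = \<zero>\<^sub>A' ==> f a = \<zero>\<^sub>B"
 shows "EX u:mod_hom R A' B. ALL a:carrier A. u (d a) = f a"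
proof -
 have MB: "module R B" using B by (auto simp: injective_module_def)
 interpret A: module R A by fact
 interpret A': module R A' by fact
 interpret B: module R B by fact
 let ?H = "A'\<lparr>carrier := d ` carrier A\<rparr>"
 have H: "submodule (d ` carrier A) R A'" by (rule image_submodule[OF A A' d])
 define g where "g y = f (SOME a. a\<in>carrier A & d a = y)" for y
 have g: "g (d a) = f a" if a: "a\<in>carrier A" for a
 proof -
  define a' where "a' = (SOME a'. a'\<in>carrier A & d a' = d a)"
  have a': "a'\<in>carrier A" "d a' = d a" unfolding a'_def by (metis (mono_tags, lifting) a someI_ex)+
  then have "d (a' \<ominus>\<^sub>A a) = \<zero>\<^sub>A'" using a hom_closed[OF d a] by (simp add: hom_minus[OF A A' d] minus_eq_zero_iff[OF A'])
  then have "f (a' \<ominus>\<^sub>A a) = \<zero>\<^sub>B" using ker a a' by simp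
  then have "f a' = f a" using a a' hom_closed[OF f] by (simp add: hom_minus[OF A MB f] minus_eq_zero_iff[OF MB])
  then show ?thesis by (simp add: g_def a'_def)
 qed
 have "g\<in>mod_hom R ?H B"
 proof (rule mod_homI)
  fix x y assume "x\<in>carrier ?H" "y\<in>carrier ?H"
  then obtain a b where ab: "a\<in>carrier A" "b\<in>carrier A" "x = d a" "y = d b" by auto
  then show "g x\<in>carrier B" using g hom_closed[OF f] by simp
  show "g (x \<oplus>\<^sub>?H y) = g x \<oplus>\<^sub>B g y" using g[of "a \<oplus>\<^sub>A b"] ab by (simp add: hom_add[OF d] hom_add[OF f] g)
 next
  fix r x assume r: "r\<in>carrier R" and "x\<in>carrier ?H"
  then obtain a where a: "a\<in>carrier A" "x = d a" by auto
  then show "g (r \<odot>\<^sub>?H x) = r \<odot>\<^sub>B g x" using g[of "r \<odot>\<^sub>A a"] r by (simp add: hom_smult[OF d] hom_smult[OF f] g)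
 qed
 moreover have "module R ?H" by (rule submodule_module[OF A' H])
 moreover have "(%x. x)\<in>mod_hom R ?H A'" by (rule hom_incl[OF submodule_mem(1)[OF A' H]])
 ultimately obtain h where "h\<in>mod_hom R A' B" "!!m. m\<in>carrier ?H ==> h m = g m"
  using injective_moduleD[OF B _ A' _ inj_on_id2] by blast
 then show ?thesis using g by (intro bexI[where x=h]) auto
qed

section \<open>Homotopically injective complexes\<close>

text \<open>The homotopy is built upwards from the bound: the difference of the given map and \<open>d\<close> after the
 part already found vanishes on the kernel of the differential, so it factors through it.\<close>

lemma null_homotopy_bounded_below:
 fixes C :: "('a, 't) cochain"
 assumes C: "cochain_complex R C" "acyclic_complex C" and T: "cochain_complex R T"
  and inj: "!!i. injective_module TYPE('t) R (obj T i)"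
  and bnd: "!!i. i < N ==> carrier (obj T i) = {\<zero>\<^bsub>obj T i\<^esub>}"
  and f: "chain_map R C T f"
 shows "EX h. ALL i. h i\<in>mod_hom R (obj C i) (obj T (i - 1)) &
  (ALL y:carrier (obj C i). f i y = diff T (i - 1) (h i y) \<oplus>\<^bsub>obj T i\<^esub> h (i + 1) (diff C i y))"
proof -
 note CM = complexD(1)[OF C(1)] and TM = complexD(1)[OF T]
 note dC = complexD(2)[OF C(1)] and dT = complexD(2)[OF T]
 note dC' = complexD(3)[OF C(1)] and dT' = complexD(3)[OF T]
 note hom = chain_map_hom[OF f] and comm = chain_map_comm[OF f]
 \<comment> \<open>\<open>P i h\<close> says that \<open>h\<close>, the component out of degree
   \<open>i\<close>, already gives the right values on boundaries, which is what the next step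
   builds on; \<open>Q\<close> is the homotopy equation in degree \<open>i\<close>.\<close>
 define P where "P i h \<longleftrightarrow> h\<in>mod_hom R (obj C i) (obj T (i - 1)) &
  (ALL y:carrier (obj C (i - 1)). diff T (i - 1) (h (diff C (i - 1) y)) = f i (diff C (i - 1) y))" for i h
 define Q where "Q i h h' \<longleftrightarrow> (ALL y:carrier (obj C i). f i y = diff T (i - 1) (h y) \<oplus>\<^bsub>obj T i\<^esub> h' (diff C i y))" for i h h'
 have step: "EX h'. P (i + 1) h' & Q i h h'" if "P i h" for i h
 proof -
  have h: "h\<in>mod_hom R (obj C i) (obj T (i - 1))"
   and hd: "!!y. y\<in>carrier (obj C (i - 1)) ==> diff T (i - 1) (h (diff C (i - 1) y)) = f i (diff C (i - 1) y)"
   using that by (auto simp: P_def)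
  interpret Ti: module R "obj T i" by (rule TM)
  let ?g = "%y. f i y \<ominus>\<^bsub>obj T i\<^esub> diff T (i - 1) (h y)"
  have dh: "(%y. diff T (i - 1) (h y))\<in>mod_hom R (obj C i) (obj T i)" by (rule hom_comp[OF h dT'])
  have g: "?g\<in>mod_hom R (obj C i) (obj T i)" by (rule hom_minus_map[OF TM hom dh])
  have "?g a = \<zero>\<^bsub>obj T i\<^esub>" if a: "a\<in>carrier (obj C i)" "diff C i a = \<zero>\<^bsub>obj C (i + 1)\<^esub>" for a
  proof -
   have "a\<in>boundaries C i" using C a unfolding acyclic_complex_iff[OF C(1)] by (auto simp: cycles_def)
   then obtain y where y: "y\<in>carrier (obj C (i - 1))" "a = diff C (i - 1) y" by (auto simp: boundaries_def)
   then have "diff T (i - 1) (h a) = f i a" using hd[OF y(1)] by simp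
   then show ?thesis using hom_closed[OF hom a(1)] by (simp add: minus_eq_zero_iff[OF TM])
  qed
  then obtain h' where h': "h'\<in>mod_hom R (obj C (i + 1)) (obj T i)"
   "!!a. a\<in>carrier (obj C i) ==> h' (diff C i a) = ?g a" using injective_factor[OF inj CM CM dC g] by blast
  have "Q i h h'" unfolding Q_def
  proof
   fix y assume y: "y\<in>carrier (obj C i)"
   have cl: "f i y\<in>carrier (obj T i)" "diff T (i - 1) (h y)\<in>carrier (obj T i)" using hom_closed[OF hom y] hom_closed[OF dh y] by auto
   then show "f i y = diff T (i - 1) (h y) \<oplus>\<^bsub>obj T i\<^esub> h' (diff C i y)"
    unfolding h'(2)[OF y] a_minus_def by (simp add: Ti.M.a_lcomm[of _ "f i y"] Ti.M.r_neg)
  qed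
  moreover have "diff T i (h' (diff C i y)) = f (i + 1) (diff C i y)" if y: "y\<in>carrier (obj C i)" for y
  proof -
   interpret T1: module R "obj T (i + 1)" by (rule TM)
   have "diff T i (diff T (i - 1) (h y)) = \<zero>\<^bsub>obj T (i + 1)\<^esub>" by (rule complexD(5)[OF T hom_closed[OF h y]])
   moreover have "diff T i (f i y) = f (i + 1) (diff C i y)" using comm[OF y] by simp
   moreover have "f (i + 1) (diff C i y)\<in>carrier (obj T (i + 1))" by (rule hom_closed[OF hom hom_closed[OF dC y]])
   ultimately show ?thesis unfolding h'(2)[OF y] hom_minus[OF TM TM dT hom_closed[OF hom y] hom_closed[OF dh y]]
    by (simp add: a_minus_def module_neg_zero[OF TM])
  qed
  ultimately show ?thesis using h'(1) by (intro exI[of _ h']) (auto simp: P_def)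
 qed
 have triv: "f i y = \<zero>\<^bsub>obj T i\<^esub>" if "i < N" "y\<in>carrier (obj C i)" for i y
  using hom_closed[OF hom that(2)] bnd[OF that(1)] by simp
 have zmap: "(%y. \<zero>\<^bsub>obj T j\<^esub>)\<in>mod_hom R (obj C i) (obj T j)" for i j by (rule hom_zero_map[OF TM])
 have base: "P N (%y. \<zero>\<^bsub>obj T (N - 1)\<^esub>)" unfolding P_def
 proof (intro conjI ballI zmap)
  fix y assume y: "y\<in>carrier (obj C (N - 1))"
  have "f N (diff C (N - 1) y) = diff T (N - 1) (f (N - 1) y)" using comm[OF y] by simp
  then show "diff T (N - 1) \<zero>\<^bsub>obj T (N - 1)\<^esub> = f N (diff C (N - 1) y)" using triv[OF _ y] by simp
 qed
 \<comment> \<open>\<open>s k\<close> is the component out of degree \<open>N + k\<close>. The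
   clause for \<open>k = 0\<close> fixes the first component to be zero, so that it fits the zero
   maps used below the bound \<open>N\<close>.\<close>
 have "EX s. ALL k. (P (N + int k) (s k) & (k = 0 --> s k = (%y. \<zero>\<^bsub>obj T (N - 1)\<^esub>))) & Q (N + int k) (s k) (s (Suc k))"
 proof (rule dependent_nat_choice)
  show "EX x. P (N + int 0) x & (0 = 0 --> x = (%y. \<zero>\<^bsub>obj T (N - 1)\<^esub>))" using base by simp
  fix h k assume "P (N + int k) h & (k = 0 --> h = (%y. \<zero>\<^bsub>obj T (N - 1)\<^esub>))"
  then have "EX h'. P (N + int k + 1) h' & Q (N + int k) h h'" using step by blast
  moreover have e: "N + int (Suc k) = N + int k + 1" by simp
  ultimately show "EX y. (P (N + int (Suc k)) y & (Suc k = 0 --> y = (%y. \<zero>\<^bsub>obj T (N - 1)\<^esub>))) & Q (N + int k) h y"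
   unfolding e by simp
 qed
 then obtain s where s0: "s 0 = (%y. \<zero>\<^bsub>obj T (N - 1)\<^esub>)" and sP: "!!k. P (N + int k) (s k)"
  and sQ: "!!k. Q (N + int k) (s k) (s (Suc k))" by blast
 define h where "h i = (if i < N then (%y. \<zero>\<^bsub>obj T (i - 1)\<^esub>) else s (nat (i - N)))" for i
 have hlow: "h i = (%y. \<zero>\<^bsub>obj T (i - 1)\<^esub>)" if "i \<le> N" for i using that s0 by (auto simp: h_def)
 show ?thesis
 proof (intro exI[of _ h] allI conjI ballI)
  fix i
  show "h i\<in>mod_hom R (obj C i) (obj T (i - 1))"
  proof (cases "i < N")
   case False
   then have "N + int (nat (i - N)) = i" by simp
   then have "P i (s (nat (i - N)))" using sP[of "nat (i - N)"] by simp
   then show ?thesis using False by (auto simp: h_def P_def)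
  qed (simp add: h_def zmap)
  fix y assume y: "y\<in>carrier (obj C i)"
  show "f i y = diff T (i - 1) (h i y) \<oplus>\<^bsub>obj T i\<^esub> h (i + 1) (diff C i y)"
  proof (cases "i < N")
   case True
   interpret Ti: module R "obj T i" by (rule TM)
   show ?thesis using True triv[OF True y] by (simp add: hlow hom_zero[OF TM TM dT'])
  next
   case False
   then have "N + int (nat (i - N)) = i" "Suc (nat (i - N)) = nat (i + 1 - N)" by auto
   then have "Q i (h i) (h (i + 1))" using sQ[of "nat (i - N)"] False by (simp add: h_def)
   then show ?thesis using y by (simp add: Q_def)
  qed
 qed
qed

definition pair_module :: "('a, 'm) module => ('a, 'n) module => ('a, 'm \<times> 'n) module" where
 "pair_module M N = \<lparr>carrier = carrier M \<times> carrier N, monoid.mult = undefined, one = undefined,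
   ring.zero = (\<zero>\<^sub>M, \<zero>\<^sub>N), ring.add = (%p q. (fst p \<oplus>\<^sub>M fst q, snd p \<oplus>\<^sub>N snd q)),
   smult = (%r p. (r \<odot>\<^sub>M fst p, r \<odot>\<^sub>N snd p))\<rparr>"

lemma pair_module_simps [simp]:
 "carrier (pair_module M N) = carrier M \<times> carrier N" "\<zero>\<^bsub>pair_module M N\<^esub> = (\<zero>\<^sub>M, \<zero>\<^sub>N)"
 "p \<oplus>\<^bsub>pair_module M N\<^esub> q = (fst p \<oplus>\<^sub>M fst q, snd p \<oplus>\<^sub>N snd q)"
 "r \<odot>\<^bsub>pair_module M N\<^esub> p = (r \<odot>\<^sub>M fst p, r \<odot>\<^sub>N snd p)" by (auto simp: pair_module_def)

lemma pair_module_module: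
 assumes "module R M" "module R N" shows "module R (pair_module M N)"
proof -
 interpret M: module R M by fact
 interpret N: module R N by fact
 show ?thesis
 proof (rule moduleI)
  show "abelian_group (pair_module M N)"
  proof (rule abelian_groupI)
   fix p assume "p\<in>carrier (pair_module M N)"
   then show "EX q:carrier (pair_module M N). q \<oplus>\<^bsub>pair_module M N\<^esub> p = \<zero>\<^bsub>pair_module M N\<^esub>"
    by (intro bexI[of _ "(\<ominus>\<^sub>M fst p, \<ominus>\<^sub>N snd p)"]) (auto simp: M.M.l_neg N.M.l_neg)
  qed (auto simp: M.M.a_ac N.M.a_ac)
 qed (auto simp: M.R.is_cring M.smult_l_distr N.smult_l_distr M.smult_r_distr N.smult_r_distr M.smult_assoc1 N.smult_assoc1)
qed

text \<open>The mapping cone, with the sign on the first component. Its elements are pairs, so cones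
  of complexes over \<open>'t\<close> live over \<open>'t \<times> 't\<close>, the test type of the
  null-homotopy assumptions below.\<close>

definition cone_complex :: "('a, 'm) cochain => ('a, 'n) cochain => (int => 'm => 'n) => ('a, 'm \<times> 'n) cochain" where
 "cone_complex X Y f = \<lparr>obj = (%n. pair_module (obj X (n + 1)) (obj Y n)),
   diff = (%n p. (\<ominus>\<^bsub>obj X (n + 1 + 1)\<^esub> diff X (n + 1) (fst p), f (n + 1) (fst p) \<oplus>\<^bsub>obj Y (n + 1)\<^esub> diff Y n (snd p)))\<rparr>"

lemma cone_complex_simps [simp]:
 "obj (cone_complex X Y f) n = pair_module (obj X (n + 1)) (obj Y n)"
 "diff (cone_complex X Y f) n p =
   (\<ominus>\<^bsub>obj X (n + 1 + 1)\<^esub> diff X (n + 1) (fst p), f (n + 1) (fst p) \<oplus>\<^bsub>obj Y (n + 1)\<^esub> diff Y n (snd p))"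
 by (auto simp: cone_complex_def)

lemma complex_cone:
 assumes X: "cochain_complex R X" and Y: "cochain_complex R Y" and f: "chain_map R X Y f"
 shows "cochain_complex R (cone_complex X Y f)"
proof (rule complexI)
 fix n
 note XM = complexD(1)[OF X] and YM = complexD(1)[OF Y]
 note dX = complexD(2)[OF X] and dY = complexD(2)[OF Y] and hom = chain_map_hom[OF f]
 show "module R (obj (cone_complex X Y f) n)" by (simp add: pair_module_module XM YM)
 interpret X2: module R "obj X (2 + n)" by (rule XM)
 interpret Y1: module R "obj Y (n + 1)" by (rule YM)
 interpret Y2: module R "obj Y (n + 1 + 1)" by (rule YM)
 interpret Y2': module R "obj Y (2 + n)" by (rule YM)
 show "diff (cone_complex X Y f) n\<in>mod_hom R (obj (cone_complex X Y f) n) (obj (cone_complex X Y f) (n + 1))"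
 proof (rule mod_homI)
  fix p assume "p\<in>carrier (obj (cone_complex X Y f) n)"
  then have p: "fst p\<in>carrier (obj X (n + 1))" "snd p\<in>carrier (obj Y n)" by auto
  note cl = hom_closed[OF dX p(1)] hom_closed[OF dY p(2)] hom_closed[OF hom p(1)]
  show "diff (cone_complex X Y f) n p\<in>carrier (obj (cone_complex X Y f) (n + 1))" using cl by simp
  {
   fix q assume "q\<in>carrier (obj (cone_complex X Y f) n)"
   then have q: "fst q\<in>carrier (obj X (n + 1))" "snd q\<in>carrier (obj Y n)" by auto
   note cl' = hom_closed[OF dX q(1)] hom_closed[OF dY q(2)] hom_closed[OF hom q(1)]
   show "diff (cone_complex X Y f) n (p \<oplus>\<^bsub>obj (cone_complex X Y f) n\<^esub> q) =
    diff (cone_complex X Y f) n p \<oplus>\<^bsub>obj (cone_complex X Y f) (n + 1)\<^esub> diff (cone_complex X Y f) n q"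
    using cl cl' by (simp add: hom_add[OF dX p(1) q(1)] hom_add[OF dY p(2) q(2)] hom_add[OF hom p(1) q(1)]
      X2.M.minus_add Y1.M.a_ac)
  }
  {
   fix r assume r: "r\<in>carrier R"
   show "diff (cone_complex X Y f) n (r \<odot>\<^bsub>obj (cone_complex X Y f) n\<^esub> p) =
    r \<odot>\<^bsub>obj (cone_complex X Y f) (n + 1)\<^esub> diff (cone_complex X Y f) n p"
    using cl r by (simp add: hom_smult[OF dX r p(1)] hom_smult[OF dY r p(2)] hom_smult[OF hom r p(1)]
      X2.smult_r_minus Y1.smult_r_distr)
  }
 qed
 fix p assume "p\<in>carrier (obj (cone_complex X Y f) n)"
 then have p: "fst p\<in>carrier (obj X (n + 1))" "snd p\<in>carrier (obj Y n)" by auto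
 note cl = hom_closed[OF dX p(1)] hom_closed[OF dY p(2)] hom_closed[OF hom p(1)]
 have 1: "diff X (n + 1 + 1) (\<ominus>\<^bsub>obj X (n + 1 + 1)\<^esub> diff X (n + 1) (fst p)) = \<zero>\<^bsub>obj X (n + 1 + 1 + 1)\<^esub>"
  using hom_neg[OF XM XM dX cl(1)] complexD(4)[OF X p(1)] by (simp only: module_neg_zero[OF XM])
 have 2: "f (n + 1 + 1) (\<ominus>\<^bsub>obj X (n + 1 + 1)\<^esub> diff X (n + 1) (fst p)) = \<ominus>\<^bsub>obj Y (n + 1 + 1)\<^esub> diff Y (n + 1) (f (n + 1) (fst p))"
  using hom_neg[OF XM YM hom cl(1)] chain_map_comm[OF f p(1)] by simp
 have 3: "diff Y (n + 1) (f (n + 1) (fst p) \<oplus>\<^bsub>obj Y (n + 1)\<^esub> diff Y n (snd p)) = diff Y (n + 1) (f (n + 1) (fst p))"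
  using hom_add[OF dY cl(3,2)] complexD(4)[OF Y p(2)] hom_closed[OF dY cl(3)] by (simp only: Y2.M.r_zero)
 show "diff (cone_complex X Y f) (n + 1) (diff (cone_complex X Y f) n p) = \<zero>\<^bsub>obj (cone_complex X Y f) (n + 1 + 1)\<^esub>"
  using hom_closed[OF dY cl(3)] by (simp only: cone_complex_simps fst_conv snd_conv 1 2 3 pair_module_simps module_neg_zero[OF XM] Y2.M.l_neg)
qed

text \<open>For a cycle \<open>(x, y)\<close>, injectivity on cohomology writes
  \<open>x = d x'\<close>, and surjectivity writes the cycle \<open>f x' + y\<close> as
  \<open>f z + d y''\<close> with a cycle \<open>z\<close>. Then \<open>(z - x', y'')\<close> is a
  preimage of \<open>(x, y)\<close>.\<close>

lemma cone_complex_acyclic: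
 assumes X: "cochain_complex R X" and Y: "cochain_complex R Y" and q: "quasi_iso R X Y f"
 shows "acyclic_complex (cone_complex X Y f)"
proof -
 have f: "chain_map R X Y f"
  and inj: "!!n z. z\<in>cycles X n ==> f n z\<in>boundaries Y n ==> z\<in>boundaries X n"
  and surj: "!!n w. w\<in>cycles Y n ==> EX z:cycles X n. w \<ominus>\<^bsub>obj Y n\<^esub> f n z\<in>boundaries Y n"
  using q quasi_iso_iff[OF X Y] by auto
 note XM = complexD(1)[OF X] and YM = complexD(1)[OF Y]
 note dX = complexD(2)[OF X] and dY = complexD(2)[OF Y] and hom = chain_map_hom[OF f]
 show ?thesis unfolding acyclic_complex_iff[OF complex_cone[OF X Y f]]
 proof (intro allI subsetI)
  fix n p assume "p\<in>cycles (cone_complex X Y f) n"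
  then obtain x y where p: "p = (x, y)" and x: "x\<in>carrier (obj X (n + 1))" and y: "y\<in>carrier (obj Y n)"
   and dx: "\<ominus>\<^bsub>obj X (n + 1 + 1)\<^esub> diff X (n + 1) x = \<zero>\<^bsub>obj X (n + 1 + 1)\<^esub>"
   and fx: "f (n + 1) x \<oplus>\<^bsub>obj Y (n + 1)\<^esub> diff Y n y = \<zero>\<^bsub>obj Y (n + 1)\<^esub>" by (cases p) (auto simp: cycles_def)
  interpret X0: module R "obj X n" by (rule XM)
  interpret X1: module R "obj X (n + 1)" by (rule XM)
  interpret X2: module R "obj X (n + 1 + 1)" by (rule XM)
  interpret Y0: module R "obj Y n" by (rule YM)
  interpret Y1: module R "obj Y (n + 1)" by (rule YM)
  have dx0: "diff X (n + 1) x = \<zero>\<^bsub>obj X (n + 1 + 1)\<^esub>"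
   using dx hom_closed[OF dX x] X2.M.minus_minus module_neg_zero[OF XM] by metis
  have fxy: "f (n + 1) x = \<ominus>\<^bsub>obj Y (n + 1)\<^esub> diff Y n y"
   using fx hom_closed[OF hom x] hom_closed[OF dY y] by (metis Y1.M.minus_equality)
  also have "... = diff Y n (\<ominus>\<^bsub>obj Y n\<^esub> y)" using hom_neg[OF YM YM dY y] by simp
  finally have "f (n + 1) x\<in>boundaries Y (n + 1)" using y by (auto simp: boundaries_def)
  then have "x\<in>boundaries X (n + 1)" using inj x dx0 by (simp add: cycles_def)
  then obtain x' where x': "x'\<in>carrier (obj X n)" "x = diff X n x'" by (auto simp: boundaries_def)
  have fx': "f n x'\<in>carrier (obj Y n)" by (rule hom_closed[OF hom x'(1)])
  have "f (n + 1) x = diff Y n (f n x')" using chain_map_comm[OF f x'(1)] x'(2) by simp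
  then have "diff Y n (f n x' \<oplus>\<^bsub>obj Y n\<^esub> y) = \<zero>\<^bsub>obj Y (n + 1)\<^esub>" using fx by (simp add: hom_add[OF dY fx' y])
  then have "f n x' \<oplus>\<^bsub>obj Y n\<^esub> y\<in>cycles Y n" using fx' y by (simp add: cycles_def)
  then obtain z where z: "z\<in>cycles X n" "(f n x' \<oplus>\<^bsub>obj Y n\<^esub> y) \<ominus>\<^bsub>obj Y n\<^esub> f n z\<in>boundaries Y n" using surj by blast
  then obtain y'' where y'': "y''\<in>carrier (obj Y (n - 1))" "(f n x' \<oplus>\<^bsub>obj Y n\<^esub> y) \<ominus>\<^bsub>obj Y n\<^esub> f n z = diff Y (n - 1) y''"
   by (auto simp: boundaries_def)
  have zc: "z\<in>carrier (obj X n)" and dz: "diff X n z = \<zero>\<^bsub>obj X (n + 1)\<^esub>" using z(1) by (auto simp: cycles_def)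
  have fz: "f n z\<in>carrier (obj Y n)" by (rule hom_closed[OF hom zc])
  let ?u = "z \<ominus>\<^bsub>obj X n\<^esub> x'"
  have u: "?u\<in>carrier (obj X n)" using zc x' by simp
  have 1: "\<ominus>\<^bsub>obj X (n + 1)\<^esub> diff X n ?u = x" using hom_minus[OF XM XM dX zc x'(1)] dz x'(2) x by (simp add: a_minus_def)
  have "f n ?u \<oplus>\<^bsub>obj Y n\<^esub> diff Y (n - 1) y'' = (f n z \<oplus>\<^bsub>obj Y n\<^esub> \<ominus>\<^bsub>obj Y n\<^esub> f n x') \<oplus>\<^bsub>obj Y n\<^esub> ((f n x' \<oplus>\<^bsub>obj Y n\<^esub> y) \<oplus>\<^bsub>obj Y n\<^esub> \<ominus>\<^bsub>obj Y n\<^esub> f n z)"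
   using y''(2) hom_minus[OF XM YM hom zc x'(1)] by (simp add: a_minus_def)
  also have "... = (f n z \<oplus>\<^bsub>obj Y n\<^esub> \<ominus>\<^bsub>obj Y n\<^esub> f n z) \<oplus>\<^bsub>obj Y n\<^esub> ((\<ominus>\<^bsub>obj Y n\<^esub> f n x' \<oplus>\<^bsub>obj Y n\<^esub> f n x') \<oplus>\<^bsub>obj Y n\<^esub> y)"
   using fz fx' y by (simp only: Y0.M.a_ac Y0.M.a_closed Y0.M.a_inv_closed)
  also have "... = y" using fz fx' y by (simp add: Y0.M.r_neg Y0.M.l_neg)
  finally have 2: "f n ?u \<oplus>\<^bsub>obj Y n\<^esub> diff Y (n - 1) y'' = y" .
  show "p\<in>boundaries (cone_complex X Y f) n" unfolding boundaries_def
  proof (rule image_eqI[of _ _ "(?u, y'')"])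
   show "p = diff (cone_complex X Y f) (n - 1) (?u, y'')" using 1 2 p by simp
   show "(?u, y'')\<in>carrier (obj (cone_complex X Y f) (n - 1))" using u y'' by simp
  qed
 qed
qed

subsection \<open>The complex of homomorphisms\<close>

lemma hom_complex_simps [simp]:
 "obj (hom_complex R X Y) n = prod_module (%i. hom_module R (obj X i) (obj Y (i + n)))"
 "diff (hom_complex R X Y) n f = (%i. \<lambda>y\<in>carrier (obj X i).
    diff Y (i + n) (f i y) \<ominus>\<^bsub>obj Y (i + n + 1)\<^esub> signed (obj Y (i + n + 1)) n (f (i + 1) (diff X i y)))"
 by (auto simp: hom_complex_def)

lemma hom_complex_carrier:
 "f\<in>carrier (obj (hom_complex R X Y) n) \<longleftrightarrow>
  (ALL i. f i\<in>mod_hom R (obj X i) (obj Y (i + n)) & f i\<in>extensional (carrier (obj X i)))" by auto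

lemma signed_add:
 assumes "module R M" "x\<in>carrier M" "y\<in>carrier M"
 shows "signed M k (x \<oplus>\<^sub>M y) = signed M k x \<oplus>\<^sub>M signed M k y"
proof -
 interpret M: module R M by fact
 show ?thesis using assms(2,3) by (simp add: signed_def M.M.minus_add)
qed

lemma signed_succ:
 assumes "module R M" "y\<in>carrier M" shows "signed M (k + 1) y = \<ominus>\<^sub>M signed M k y"
proof -
 interpret M: module R M by fact
 show ?thesis using assms(2) by (simp add: signed_def)
qed

lemma signed_smult:
 assumes "module R M" "x\<in>carrier M" "r\<in>carrier R"
 shows "signed M k (r \<odot>\<^sub>M x) = r \<odot>\<^sub>M signed M k x"
proof -
 interpret M: module R M by fact
 show ?thesis using assms(2,3) by (simp add: signed_def M.smult_r_minus)
qed

lemma complex_hom: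
 assumes R: "cring R" and X: "cochain_complex R X" and Y: "cochain_complex R Y"
 shows "cochain_complex R (hom_complex R X Y)"
proof (rule complexI)
 fix n
 note XM = complexD(1)[OF X] and YM = complexD(1)[OF Y]
 note dX = complexD(2)[OF X] and dY = complexD(2)[OF Y]
 let ?H = "hom_complex R X Y"
 show "module R (obj ?H n)" by (simp add: prod_module_module[OF R] hom_module_module[OF R XM YM])
 have e: "i + 1 + n = i + n + 1" "i + (n + 1) = i + n + 1" for i by auto
 have comp2: "(%y. signed (obj Y (i + n + 1)) n (f (i + 1) (diff X i y)))\<in>mod_hom R (obj X i) (obj Y (i + n + 1))"
  and comp1: "(%y. diff Y (i + n) (f i y))\<in>mod_hom R (obj X i) (obj Y (i + n + 1))"
  if "f\<in>carrier (obj ?H n)" for f i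
 proof -
  have "f (i + 1)\<in>mod_hom R (obj X (i + 1)) (obj Y (i + n + 1))" "f i\<in>mod_hom R (obj X i) (obj Y (i + n))"
   using that unfolding hom_complex_carrier by (metis e(1), metis)
  then show "(%y. signed (obj Y (i + n + 1)) n (f (i + 1) (diff X i y)))\<in>mod_hom R (obj X i) (obj Y (i + n + 1))"
   "(%y. diff Y (i + n) (f i y))\<in>mod_hom R (obj X i) (obj Y (i + n + 1))"
   by (auto intro!: hom_signed_map[OF YM] hom_comp[OF dX] hom_comp[OF _ dY])
 qed
 have cl: "diff ?H n f\<in>carrier (obj ?H (n + 1))" if "f\<in>carrier (obj ?H n)" for f unfolding hom_complex_carrier hom_complex_simps(2) e
  using hom_restrict[OF XM hom_minus_map[OF YM comp1[OF that] comp2[OF that]]] by blast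
 show "diff ?H n\<in>mod_hom R (obj ?H n) (obj ?H (n + 1))"
 proof (rule mod_homI[OF cl])
  fix f g assume h: "f\<in>carrier (obj ?H n)" "g\<in>carrier (obj ?H n)"
  show "diff ?H n (f \<oplus>\<^bsub>obj ?H n\<^esub> g) = diff ?H n f \<oplus>\<^bsub>obj ?H (n + 1)\<^esub> diff ?H n g"
   unfolding hom_complex_simps prod_module_simps hom_module_simps e
  proof (rule ext, rule restrict_ext)
   fix i y assume y: "y\<in>carrier (obj X i)"
   interpret Y1: module R "obj Y (i + n + 1)" by (rule YM)
   have h1: "f i y\<in>carrier (obj Y (i + n))" "g i y\<in>carrier (obj Y (i + n))"
    "f (i + 1) (diff X i y)\<in>carrier (obj Y (i + n + 1))" "g (i + 1) (diff X i y)\<in>carrier (obj Y (i + n + 1))"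
    using h y hom_closed[OF dX y] e(1) unfolding hom_complex_carrier by (metis hom_closed)+
   note c = hom_closed[OF comp1[OF h(1)] y] hom_closed[OF comp1[OF h(2)] y]
    hom_closed[OF comp2[OF h(1)] y] hom_closed[OF comp2[OF h(2)] y]
   show "diff Y (i + n) ((\<lambda>x\<in>carrier (obj X i). f i x \<oplus>\<^bsub>obj Y (i + n)\<^esub> g i x) y) \<ominus>\<^bsub>obj Y (i + n + 1)\<^esub>
     signed (obj Y (i + n + 1)) n ((\<lambda>x\<in>carrier (obj X (i + 1)). f (i + 1) x \<oplus>\<^bsub>obj Y (i + n + 1)\<^esub> g (i + 1) x) (diff X i y)) =
     (\<lambda>y\<in>carrier (obj X i). diff Y (i + n) (f i y) \<ominus>\<^bsub>obj Y (i + n + 1)\<^esub> signed (obj Y (i + n + 1)) n (f (i + 1) (diff X i y))) y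
     \<oplus>\<^bsub>obj Y (i + n + 1)\<^esub>
     (\<lambda>y\<in>carrier (obj X i). diff Y (i + n) (g i y) \<ominus>\<^bsub>obj Y (i + n + 1)\<^esub> signed (obj Y (i + n + 1)) n (g (i + 1) (diff X i y))) y"
    using y hom_closed[OF dX y] h1 c by (simp add: hom_add[OF dY] signed_add[OF YM] a_minus_def Y1.M.minus_add Y1.M.a_ac)
  qed
 next
  fix r f assume h: "r\<in>carrier R" "f\<in>carrier (obj ?H n)"
  show "diff ?H n (r \<odot>\<^bsub>obj ?H n\<^esub> f) = r \<odot>\<^bsub>obj ?H (n + 1)\<^esub> diff ?H n f"
   unfolding hom_complex_simps prod_module_simps hom_module_simps e
  proof (rule ext, rule restrict_ext)
   fix i y assume y: "y\<in>carrier (obj X i)"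
   interpret Y1: module R "obj Y (i + n + 1)" by (rule YM)
   have h1: "f i y\<in>carrier (obj Y (i + n))"
    "f (i + 1) (diff X i y)\<in>carrier (obj Y (i + n + 1))"
    using h(2) y hom_closed[OF dX y] e(1) unfolding hom_complex_carrier by (metis hom_closed)+
   note c = hom_closed[OF comp1[OF h(2)] y] hom_closed[OF comp2[OF h(2)] y]
   show "diff Y (i + n) ((\<lambda>x\<in>carrier (obj X i). r \<odot>\<^bsub>obj Y (i + n)\<^esub> f i x) y) \<ominus>\<^bsub>obj Y (i + n + 1)\<^esub>
     signed (obj Y (i + n + 1)) n ((\<lambda>x\<in>carrier (obj X (i + 1)). r \<odot>\<^bsub>obj Y (i + n + 1)\<^esub> f (i + 1) x) (diff X i y)) =
     r \<odot>\<^bsub>obj Y (i + n + 1)\<^esub> (\<lambda>y\<in>carrier (obj X i). diff Y (i + n) (f i y) \<ominus>\<^bsub>obj Y (i + n + 1)\<^esub> signed (obj Y (i + n + 1)) n (f (i + 1) (diff X i y))) y"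
    using y hom_closed[OF dX y] h(1) h1 c by (simp add: hom_smult[OF dY] signed_smult[OF YM] a_minus_def Y1.smult_r_distr Y1.smult_r_minus)
  qed
 qed
 fix f assume h: "f\<in>carrier (obj ?H n)"
 have "diff ?H (n + 1) (diff ?H n f) i = \<zero>\<^bsub>obj ?H (n + 1 + 1)\<^esub> i" for i
  unfolding hom_complex_simps prod_module_simps hom_module_simps
 proof (rule restrict_ext)
  fix y assume y: "y\<in>carrier (obj X i)"
  have ee: "i + (n + 1) = i + n + 1" "i + n + 1 + 1 = i + (n + 1) + 1" "i + 1 + n + 1 = i + n + 1 + 1" "i + (n + 1 + 1) = i + n + 1 + 1" "i + 1 + n = i + n + 1" by auto
  interpret Y1: module R "obj Y (i + n + 1)" by (rule YM)
  interpret Y2: module R "obj Y (2 + (i + n))" by (rule YM)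
  have dy: "diff X i y\<in>carrier (obj X (i + 1))" by (rule hom_closed[OF dX y])
  have h1: "f i y\<in>carrier (obj Y (i + n))" "f (i + 1) (diff X i y)\<in>carrier (obj Y (i + n + 1))"
   using h y dy ee(5) unfolding hom_complex_carrier by (metis hom_closed)+
  have "i + 1 + 1 + n = i + n + 1 + 1" by simp
  then have h2: "f (i + 1 + 1)\<in>mod_hom R (obj X (i + 1 + 1)) (obj Y (i + n + 1 + 1))" using h unfolding hom_complex_carrier by metis
  interpret Y3: module R "obj Y (i + n + 1 + 1)" by (rule YM)
  let ?c = "diff Y (i + n + 1) (f (i + 1) (diff X i y))"
  let ?a = "signed (obj Y (i + n + 1 + 1)) n ?c"
  have c: "?c\<in>carrier (obj Y (i + n + 1 + 1))" by (rule hom_closed[OF dY h1(2)])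
  have a: "?a\<in>carrier (obj Y (i + n + 1 + 1))" by (rule signed_closed[OF YM c])
  have 0: "f (i + 1 + 1) (diff X (i + 1) (diff X i y)) = \<zero>\<^bsub>obj Y (i + n + 1 + 1)\<^esub>"
   unfolding complexD(4)[OF X y] by (rule hom_zero[OF XM YM h2])
  have 1: "diff Y (i + n + 1) (diff Y (i + n) (f i y) \<ominus>\<^bsub>obj Y (i + n + 1)\<^esub> signed (obj Y (i + n + 1)) n (f (i + 1) (diff X i y))) =
    \<ominus>\<^bsub>obj Y (i + n + 1 + 1)\<^esub> ?a" unfolding hom_minus[OF YM YM dY hom_closed[OF dY h1(1)] signed_closed[OF YM h1(2)]]
    complexD(4)[OF Y h1(1)] hom_signed[OF YM YM dY h1(2)] unfolding a_minus_def by (rule Y3.M.l_zero[OF Y3.M.a_inv_closed[OF a]])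
  have 2: "?c \<ominus>\<^bsub>obj Y (i + n + 1 + 1)\<^esub> signed (obj Y (i + n + 1 + 1)) n (f (i + 1 + 1) (diff X (i + 1) (diff X i y))) = ?c"
   unfolding 0 signed_zero[OF YM] unfolding a_minus_def module_neg_zero[OF YM] by (rule Y3.M.r_zero[OF c])
  show "diff Y (i + (n + 1)) ((\<lambda>y\<in>carrier (obj X i). diff Y (i + n) (f i y) \<ominus>\<^bsub>obj Y (i + n + 1)\<^esub> signed (obj Y (i + n + 1)) n (f (i + 1) (diff X i y))) y)
    \<ominus>\<^bsub>obj Y (i + (n + 1) + 1)\<^esub> signed (obj Y (i + (n + 1) + 1)) (n + 1)
    ((\<lambda>y\<in>carrier (obj X (i + 1)). diff Y (i + 1 + n) (f (i + 1) y) \<ominus>\<^bsub>obj Y (i + 1 + n + 1)\<^esub> signed (obj Y (i + 1 + n + 1)) n (f (i + 1 + 1) (diff X (i + 1) y))) (diff X i y)) = \<zero>\<^bsub>obj Y (i + (n + 1 + 1))\<^esub>"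
   unfolding ee(1,3,4,5) restrict_apply'[OF y] restrict_apply'[OF dy] 1 2 signed_succ[OF YM c] unfolding a_minus_def Y3.M.minus_minus[OF a]
   by (rule Y3.M.l_neg[OF a])
 qed
 then show "diff ?H (n + 1) (diff ?H n f) = \<zero>\<^bsub>obj ?H (n + 1 + 1)\<^esub>" by (rule ext)
qed


lemma family_restrict_eq_iff:
 "(%i. restrict (g i) (A i)) = (%i. restrict (h i) (A i)) \<longleftrightarrow> (ALL i. ALL y:A i. g i y = h i y)"
 by (metis (no_types, lifting) restrict_apply' restrict_ext)

lemma signed_one: "signed M 1 y = \<ominus>\<^sub>M y"
 by (simp add: signed_def)

text \<open>The factor \<open>(-1)^n\<close> in the differential of the complex of homomorphisms is
  an involution; moved to the other side of the equation it becomes the sign of the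
  \<open>n\<close>-th shift.\<close>

lemma hom_cycles_iff:
 assumes R: "cring R" and X: "cochain_complex R X" and Y: "cochain_complex R Y"
  and f: "f\<in>carrier (obj (hom_complex R X Y) n)"
 shows "f\<in>cycles (hom_complex R X Y) n \<longleftrightarrow> chain_map R X (shift_complex n Y) f"
proof -
 note XM = complexD(1)[OF X] and YM = complexD(1)[OF Y]
 note dX = complexD(2)[OF X] and dY = complexD(2)[OF Y]
 have e: "i + 1 + n = i + n + 1" "i + (n + 1) = i + n + 1" for i by auto
 have hom: "f i\<in>mod_hom R (obj X i) (obj Y (i + n))" for i using f unfolding hom_complex_carrier by blast
 have hom1: "f (i + 1)\<in>mod_hom R (obj X (i + 1)) (obj Y (i + n + 1))" for i using hom[of "i + 1"] unfolding e .
 have "diff Y (i + n) (f i y) \<ominus>\<^bsub>obj Y (i + n + 1)\<^esub> signed (obj Y (i + n + 1)) n (f (i + 1) (diff X i y)) = \<zero>\<^bsub>obj Y (i + n + 1)\<^esub>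
  \<longleftrightarrow> f (i + 1) (diff X i y) = signed (obj Y (i + n + 1)) n (diff Y (i + n) (f i y))" if y: "y\<in>carrier (obj X i)" for i y
 proof -
  have c: "diff Y (i + n) (f i y)\<in>carrier (obj Y (i + n + 1))" "f (i + 1) (diff X i y)\<in>carrier (obj Y (i + n + 1))"
   by (rule hom_closed[OF dY hom_closed[OF hom y]], rule hom_closed[OF hom1 hom_closed[OF dX y]])
  show ?thesis unfolding minus_eq_zero_iff[OF YM c(1) signed_closed[OF YM c(2)]] using signed_signed[OF YM c(1)] signed_signed[OF YM c(2)] by metis
 qed
 moreover have "f\<in>cycles (hom_complex R X Y) n \<longleftrightarrow> (ALL i. ALL y:carrier (obj X i).
   diff Y (i + n) (f i y) \<ominus>\<^bsub>obj Y (i + n + 1)\<^esub> signed (obj Y (i + n + 1)) n (f (i + 1) (diff X i y)) = \<zero>\<^bsub>obj Y (i + n + 1)\<^esub>)"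
 proof -
  have "f\<in>cycles (hom_complex R X Y) n \<longleftrightarrow> diff (hom_complex R X Y) n f = \<zero>\<^bsub>obj (hom_complex R X Y) (n + 1)\<^esub>"
   using f unfolding cycles_def by blast
  then show ?thesis unfolding hom_complex_simps prod_module_simps hom_module_simps e family_restrict_eq_iff .
 qed
 ultimately show ?thesis unfolding chain_map_def shift_simps e using hom by auto
qed

text \<open>With \<open>hom_boundariesD\<close> this identifies boundaries of degree
  \<open>n\<close> with null-homotopic maps into the \<open>n\<close>-th shift. The two conventions
  for homotopies differ by the sign \<open>(-1)^n\<close>, which is why \<open>h\<close> is a signed
  version of \<open>g\<close>.\<close>

lemma hom_boundariesI:
 assumes R: "cring R" and X: "cochain_complex R X" and Y: "cochain_complex R Y"
  and f: "f\<in>carrier (obj (hom_complex R X Y) n)"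
  and g: "!!i. g i\<in>mod_hom R (obj X i) (obj (shift_complex n Y) (i - 1))"
  and eq: "!!i y. y\<in>carrier (obj X i) ==>
   f i y = diff (shift_complex n Y) (i - 1) (g i y) \<oplus>\<^bsub>obj (shift_complex n Y) i\<^esub> g (i + 1) (diff X i y)"
 shows "f\<in>boundaries (hom_complex R X Y) n"
proof -
 note XM = complexD(1)[OF X] and YM = complexD(1)[OF Y]
 note dX = complexD(2)[OF X] and dY = complexD(2)[OF Y]
 define h where "h i = (\<lambda>y\<in>carrier (obj X i). signed (obj Y (i + (n - 1))) n (g i y))" for i
 have e: "i - 1 + n = i + (n - 1)" "i + (n - 1) + 1 = i + n" "i + 1 + (n - 1) = i + n" for i by auto
 have g': "g i\<in>mod_hom R (obj X i) (obj Y (i + (n - 1)))" for i using g[of i] unfolding shift_simps e .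
 have g'': "g (i + 1)\<in>mod_hom R (obj X (i + 1)) (obj Y (i + n))" for i using g'[of "i + 1"] unfolding e .
 have h: "h\<in>carrier (obj (hom_complex R X Y) (n - 1))"
  unfolding hom_complex_carrier h_def using hom_restrict[OF XM hom_signed_map[OF YM g']] by blast
 have dY': "diff Y (i + (n - 1))\<in>mod_hom R (obj Y (i + (n - 1))) (obj Y (i + n))" for i using dY[of "i + (n - 1)"] unfolding e .
 have "diff (hom_complex R X Y) (n - 1) h i = f i" for i unfolding hom_complex_simps e
 proof (rule extensionalityI[OF restrict_extensional])
  show "f i\<in>extensional (carrier (obj X i))" using f unfolding hom_complex_carrier by blast
  fix y assume y: "y\<in>carrier (obj X i)"
  interpret Yn: module R "obj Y (i + n)" by (rule YM)
  note dy = hom_closed[OF dX y]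
  note c = hom_closed[OF g' y] hom_closed[OF g'' dy]
  have "diff Y (i + (n - 1)) (h i y) = signed (obj Y (i + n)) n (diff Y (i + (n - 1)) (g i y))"
   unfolding h_def using y hom_signed[OF YM YM dY' c(1)] by simp
  moreover have "h (i + 1) (diff X i y) = signed (obj Y (i + n)) n (g (i + 1) (diff X i y))" unfolding h_def e using dy by simp
  ultimately have "diff Y (i + (n - 1)) (h i y) \<ominus>\<^bsub>obj Y (i + n)\<^esub> signed (obj Y (i + n)) (n - 1) (h (i + 1) (diff X i y)) =
    signed (obj Y (i + n)) n (diff Y (i + (n - 1)) (g i y)) \<oplus>\<^bsub>obj Y (i + n)\<^esub> g (i + 1) (diff X i y)"
   using c(2) signed_closed[OF YM c(2)] signed_signed[OF YM c(2)] by (simp add: a_minus_def signed_pred[OF YM])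
  also have "... = f i y" using eq[OF y] unfolding shift_simps e by simp
  finally show "(\<lambda>y\<in>carrier (obj X i). diff Y (i + (n - 1)) (h i y) \<ominus>\<^bsub>obj Y (i + n)\<^esub>
    signed (obj Y (i + n)) (n - 1) (h (i + 1) (diff X i y))) y = f i y" using y by simp
 qed
 then have "diff (hom_complex R X Y) (n - 1) h = f" by (rule ext)
 then show ?thesis unfolding boundaries_def using h by blast
qed

lemma hom_boundariesD:
 assumes R: "cring R" and X: "cochain_complex R X" and Y: "cochain_complex R Y"
  and f: "f\<in>boundaries (hom_complex R X Y) n"
 obtains g where "!!i. g i\<in>mod_hom R (obj X i) (obj (shift_complex n Y) (i - 1))"
  "!!i y. y\<in>carrier (obj X i) ==>
   f i y = diff (shift_complex n Y) (i - 1) (g i y) \<oplus>\<^bsub>obj (shift_complex n Y) i\<^esub> g (i + 1) (diff X i y)"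
proof -
 note XM = complexD(1)[OF X] and YM = complexD(1)[OF Y]
 note dX = complexD(2)[OF X] and dY = complexD(2)[OF Y]
 obtain h where h: "h\<in>carrier (obj (hom_complex R X Y) (n - 1))" "f = diff (hom_complex R X Y) (n - 1) h"
  using f unfolding boundaries_def by blast
 have e: "i - 1 + n = i + (n - 1)" "i + (n - 1) + 1 = i + n" "i + 1 + (n - 1) = i + n" for i by auto
 have h': "h i\<in>mod_hom R (obj X i) (obj Y (i + (n - 1)))" for i using h(1) unfolding hom_complex_carrier by blast
 have h'': "h (i + 1)\<in>mod_hom R (obj X (i + 1)) (obj Y (i + n))" for i using h'[of "i + 1"] unfolding e .
 have dY': "diff Y (i + (n - 1))\<in>mod_hom R (obj Y (i + (n - 1))) (obj Y (i + n))" for i using dY[of "i + (n - 1)"] unfolding e .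
 define g where "g i y = signed (obj Y (i + (n - 1))) n (h i y)" for i y
 show thesis
 proof (rule that[of g])
  show "g i\<in>mod_hom R (obj X i) (obj (shift_complex n Y) (i - 1))" for i unfolding shift_simps e g_def by (rule hom_signed_map[OF YM h'])
  fix i y assume y: "y\<in>carrier (obj X i)"
  interpret Yn: module R "obj Y (i + n)" by (rule YM)
  note dy = hom_closed[OF dX y]
  note c = hom_closed[OF h' y] hom_closed[OF h'' dy]
  have "f i y = diff Y (i + (n - 1)) (h i y) \<ominus>\<^bsub>obj Y (i + n)\<^esub> signed (obj Y (i + n)) (n - 1) (h (i + 1) (diff X i y))"
   unfolding h(2) hom_complex_simps e using y by simp
  also have "... = diff Y (i + (n - 1)) (h i y) \<oplus>\<^bsub>obj Y (i + n)\<^esub> signed (obj Y (i + n)) n (h (i + 1) (diff X i y))"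
   using c(2) signed_closed[OF YM c(2)] by (simp add: a_minus_def signed_pred[OF YM])
  also have "... = signed (obj Y (i + n)) n (diff Y (i + (n - 1)) (g i y)) \<oplus>\<^bsub>obj Y (i + n)\<^esub> g (i + 1) (diff X i y)"
   unfolding g_def e hom_signed[OF YM YM dY' c(1)] signed_signed[OF YM hom_closed[OF dY' c(1)]] by (rule refl)
  finally show "f i y = diff (shift_complex n Y) (i - 1) (g i y) \<oplus>\<^bsub>obj (shift_complex n Y) i\<^esub> g (i + 1) (diff X i y)"
   unfolding shift_simps e .
 qed
qed

text \<open>Homotopical injectivity in its usual form for maps out of acyclic complexes. It is the
  form that can be verified coordinate by coordinate in a product.\<close>

definition null_homotopic_maps :: "'t itself => ('a, 'r) ring_scheme => ('a, 'm) cochain => bool" where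
 "null_homotopic_maps U R T \<longleftrightarrow> (\<forall>(C :: ('a, 't) cochain) \<phi>.
   cochain_complex R C & acyclic_complex C & chain_map R C T \<phi> -->
   (\<exists>\<sigma>. ALL i. \<sigma> i\<in>mod_hom R (obj C i) (obj T (i - 1)) &
    (ALL y:carrier (obj C i). \<phi> i y = diff T (i - 1) (\<sigma> i y) \<oplus>\<^bsub>obj T i\<^esub> \<sigma> (i + 1) (diff C i y))))"

lemma null_homotopic_mapsD:
 fixes C :: "('a, 't) cochain"
 assumes "null_homotopic_maps TYPE('t) R T" "cochain_complex R C" "acyclic_complex C" "chain_map R C T f"
 obtains g where "!!i. g i\<in>mod_hom R (obj C i) (obj T (i - 1))"
  "!!i y. y\<in>carrier (obj C i) ==> f i y = diff T (i - 1) (g i y) \<oplus>\<^bsub>obj T i\<^esub> g (i + 1) (diff C i y)"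
proof -
 have "EX g. ALL i. g i\<in>mod_hom R (obj C i) (obj T (i - 1)) &
    (ALL y:carrier (obj C i). f i y = diff T (i - 1) (g i y) \<oplus>\<^bsub>obj T i\<^esub> g (i + 1) (diff C i y))"
  using assms(1)[unfolded null_homotopic_maps_def, rule_format, of C f] assms(2-4) by blast
 then show thesis using that by blast
qed

text \<open>For a quasi-isomorphism \<open>f\<close>, contracting a map out of its cone shows that precomposition with
 \<open>f\<close> is onto, respectively one-to-one, on homotopy classes.\<close>

lemma lift_along_quasi_iso:
 fixes X Y :: "('a, 't) cochain"
 assumes X: "cochain_complex R X" and Y: "cochain_complex R Y" and T: "cochain_complex R T"
  and q: "quasi_iso R X Y f" and null: "null_homotopic_maps TYPE('t \<times> 't) R (shift_complex 1 T)"
  and g: "chain_map R X T g"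
 obtains u h where "chain_map R Y T u" "!!i. h i\<in>mod_hom R (obj X i) (obj T (i - 1))"
  "!!i y. y\<in>carrier (obj X i) ==>
   g i y \<ominus>\<^bsub>obj T i\<^esub> u i (f i y) = diff T (i - 1) (h i y) \<oplus>\<^bsub>obj T i\<^esub> h (i + 1) (diff X i y)"
proof -
 have f: "chain_map R X Y f" using q by (simp add: quasi_iso_def)
 let ?C = "cone_complex X Y f"
 note CC = complex_cone[OF X Y f]
 note XM = complexD(1)[OF X] and YM = complexD(1)[OF Y] and TM = complexD(1)[OF T] and CM = complexD(1)[OF CC]
 note dX = complexD(2)[OF X] and dY = complexD(2)[OF Y] and dT = complexD(2)[OF T]
 note fh = chain_map_hom[OF f] and ph = chain_map_hom[OF g]
 have Xz: "\<zero>\<^bsub>obj X i\<^esub>\<in>carrier (obj X i)" and Yz: "\<zero>\<^bsub>obj Y i\<^esub>\<in>carrier (obj Y i)" for i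
  by (rule submodule_mem(2)[OF XM module.carrier_is_submodule[OF XM]], rule submodule_mem(2)[OF YM module.carrier_is_submodule[OF YM]])
 \<comment> \<open>Projection of the cone to \<open>X\<close> followed by \<open>g\<close>. The
   target is shifted by one because the cone has \<open>X\<close> in degree \<open>i + 1\<close>,
   and the sign of the cone differential is that of the shift.\<close>
 have "chain_map R ?C (shift_complex 1 T) (%i p. g (i + 1) (fst p))" unfolding chain_map_def
 proof (intro allI conjI ballI)
  fix i
  have "fst\<in>mod_hom R (obj ?C i) (obj X (i + 1))" by (rule mod_homI) auto
  then show "(%p. g (i + 1) (fst p))\<in>mod_hom R (obj ?C i) (obj (shift_complex 1 T) i)" unfolding shift_simps by (rule hom_comp[OF _ ph])
  fix p assume "p\<in>carrier (obj ?C i)"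
  then have p: "fst p\<in>carrier (obj X (i + 1))" by auto
  have "g (i + 1 + 1) (\<ominus>\<^bsub>obj X (i + 1 + 1)\<^esub> diff X (i + 1) (fst p)) = \<ominus>\<^bsub>obj T (i + 1 + 1)\<^esub> g (i + 1 + 1) (diff X (i + 1) (fst p))"
   by (rule hom_neg[OF XM TM ph hom_closed[OF dX p]])
  then show "g (i + 1 + 1) (fst (diff ?C i p)) = diff (shift_complex 1 T) i (g (i + 1) (fst p))"
   unfolding shift_simps cone_complex_simps fst_conv chain_map_comm[OF g p] by (simp add: signed_def)
 qed
 then obtain v where v: "!!i. v i\<in>mod_hom R (obj ?C i) (obj (shift_complex 1 T) (i - 1))"
  "!!i p. p\<in>carrier (obj ?C i) ==> g (i + 1) (fst p) =
   diff (shift_complex 1 T) (i - 1) (v i p) \<oplus>\<^bsub>obj (shift_complex 1 T) i\<^esub> v (i + 1) (diff ?C i p)"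
  using null_homotopic_mapsD[OF null CC cone_complex_acyclic[OF X Y q]] by blast
 have vh: "v i\<in>mod_hom R (obj ?C i) (obj T i)" for i using v(1)[of i] by (simp add: shift_complex_def)
 have ve: "g (i + 1) x = \<ominus>\<^bsub>obj T (i + 1)\<^esub> diff T i (v i (x, y)) \<oplus>\<^bsub>obj T (i + 1)\<^esub>
   v (i + 1) (\<ominus>\<^bsub>obj X (i + 1 + 1)\<^esub> diff X (i + 1) x, f (i + 1) x \<oplus>\<^bsub>obj Y (i + 1)\<^esub> diff Y i y)"
  if "x\<in>carrier (obj X (i + 1))" "y\<in>carrier (obj Y i)" for i x y using v(2)[of "(x, y)" i] that
  unfolding shift_simps cone_complex_simps fst_conv snd_conv signed_one diff_add_cancel by simp
 \<comment> \<open>The contraction \<open>v\<close> is split along the two summands of the cone: on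
   \<open>Y\<close> it is the extension \<open>u\<close> of \<open>g\<close> along \<open>f\<close>,
   and on \<open>X\<close> it is, up to sign, the homotopy between \<open>g\<close> and
   \<open>u\<close> after \<open>f\<close>.\<close>
 define u where "u i y = v i (\<zero>\<^bsub>obj X (i + 1)\<^esub>, y)" for i y
 define h where "h i x = \<ominus>\<^bsub>obj T (i - 1)\<^esub> v (i - 1) (x, \<zero>\<^bsub>obj Y (i - 1)\<^esub>)" for i x
 have in0: "(%y. (\<zero>\<^bsub>obj X (i + 1)\<^esub>, y))\<in>mod_hom R (obj Y i) (obj ?C i)" for i
 proof -
  interpret X1: module R "obj X (i + 1)" by (rule XM)
  show ?thesis by (rule mod_homI) auto
 qed
 have in1: "(%x. (x, \<zero>\<^bsub>obj Y i\<^esub>))\<in>mod_hom R (obj X (i + 1)) (obj ?C i)" for i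
 proof -
  interpret Y1: module R "obj Y i" by (rule YM)
  show ?thesis by (rule mod_homI) auto
 qed
 have uh: "u i\<in>mod_hom R (obj Y i) (obj T i)" for i unfolding u_def by (rule hom_comp[OF in0 vh])
 have vx: "(%x. v i (x, \<zero>\<^bsub>obj Y i\<^esub>))\<in>mod_hom R (obj X (i + 1)) (obj T i)" for i by (rule hom_comp[OF in1 vh])
 show thesis
 proof (rule that[of u h])
  show "chain_map R Y T u" unfolding chain_map_def
  proof (intro allI conjI ballI uh)
   fix i y assume y: "y\<in>carrier (obj Y i)"
   interpret T1: module R "obj T (i + 1)" by (rule TM)
   interpret Y1: module R "obj Y (i + 1)" by (rule YM)
   have "\<zero>\<^bsub>obj T (i + 1)\<^esub> = \<ominus>\<^bsub>obj T (i + 1)\<^esub> diff T i (u i y) \<oplus>\<^bsub>obj T (i + 1)\<^esub> u (i + 1) (diff Y i y)"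
    using ve[OF Xz y] hom_closed[OF dY y]
    by (simp only: hom_zero[OF XM TM ph] hom_zero[OF XM XM dX] hom_zero[OF XM YM fh] module_neg_zero[OF XM] Y1.M.l_zero u_def)
   then show "u (i + 1) (diff Y i y) = diff T i (u i y)" using hom_closed[OF dT hom_closed[OF uh y]] hom_closed[OF uh hom_closed[OF dY y]]
    by (metis T1.M.a_inv_closed T1.M.minus_equality T1.M.minus_minus T1.M.a_comm)
  qed
  show "h i\<in>mod_hom R (obj X i) (obj T (i - 1))" for i using hom_neg_map[OF TM vx[of "i - 1"]] by (simp add: h_def[abs_def])
  fix i x assume x: "x\<in>carrier (obj X i)"
  interpret T0: module R "obj T i" by (rule TM)
  interpret X1: module R "obj X (i + 1)" by (rule XM)
  interpret Y0: module R "obj Y i" by (rule YM)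
  interpret C0: module R "obj ?C i" by (rule CM)
  have dx: "diff X i x\<in>carrier (obj X (i + 1))" by (rule hom_closed[OF dX x])
  have fx: "f i x\<in>carrier (obj Y i)" by (rule hom_closed[OF fh x])
  have vx': "v (i - 1) (x, \<zero>\<^bsub>obj Y (i - 1)\<^esub>)\<in>carrier (obj T (i - 1))" using hom_closed[OF vx, of x "i - 1"] x by simp
  have dT': "diff T (i - 1)\<in>mod_hom R (obj T (i - 1)) (obj T i)" by (rule complexD(3)[OF T])
  have dY': "diff Y (i - 1)\<in>mod_hom R (obj Y (i - 1)) (obj Y i)" by (rule complexD(3)[OF Y])
  have split: "(\<ominus>\<^bsub>obj X (i + 1)\<^esub> diff X i x, f i x) = (\<ominus>\<^bsub>obj X (i + 1)\<^esub> diff X i x, \<zero>\<^bsub>obj Y i\<^esub>) \<oplus>\<^bsub>obj ?C i\<^esub> (\<zero>\<^bsub>obj X (i + 1)\<^esub>, f i x)"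
   using dx fx by simp
  have c: "v i (\<ominus>\<^bsub>obj X (i + 1)\<^esub> diff X i x, \<zero>\<^bsub>obj Y i\<^esub>) = \<ominus>\<^bsub>obj T i\<^esub> v i (diff X i x, \<zero>\<^bsub>obj Y i\<^esub>)"
   by (rule hom_neg[OF XM TM vx dx])
  have "g i x = \<ominus>\<^bsub>obj T i\<^esub> diff T (i - 1) (v (i - 1) (x, \<zero>\<^bsub>obj Y (i - 1)\<^esub>)) \<oplus>\<^bsub>obj T i\<^esub> v i (\<ominus>\<^bsub>obj X (i + 1)\<^esub> diff X i x, f i x)"
   using ve[of x "i - 1" "\<zero>\<^bsub>obj Y (i - 1)\<^esub>"] x Yz hom_zero[OF YM YM dY'] fx by simp
  also have "v i (\<ominus>\<^bsub>obj X (i + 1)\<^esub> diff X i x, f i x) = v i (\<ominus>\<^bsub>obj X (i + 1)\<^esub> diff X i x, \<zero>\<^bsub>obj Y i\<^esub>) \<oplus>\<^bsub>obj T i\<^esub> v i (\<zero>\<^bsub>obj X (i + 1)\<^esub>, f i x)"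
   unfolding split by (rule hom_add[OF vh]) (use dx fx in auto)
  also have "... = h (i + 1) (diff X i x) \<oplus>\<^bsub>obj T i\<^esub> u i (f i x)" unfolding c by (simp add: h_def u_def)
  also have "\<ominus>\<^bsub>obj T i\<^esub> diff T (i - 1) (v (i - 1) (x, \<zero>\<^bsub>obj Y (i - 1)\<^esub>)) = diff T (i - 1) (h i x)"
   unfolding h_def by (rule hom_neg[OF TM TM dT' vx', symmetric])
  finally have main: "g i x = diff T (i - 1) (h i x) \<oplus>\<^bsub>obj T i\<^esub> (h (i + 1) (diff X i x) \<oplus>\<^bsub>obj T i\<^esub> u i (f i x))" .
  have h1: "h i x\<in>carrier (obj T (i - 1))"
  proof -
   interpret T': module R "obj T (i - 1)" by (rule TM)
   show ?thesis unfolding h_def using vx' by simp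
  qed
  have h2: "h (i + 1) (diff X i x)\<in>carrier (obj T i)" using hom_closed[OF vx dx] by (simp add: h_def)
  show "g i x \<ominus>\<^bsub>obj T i\<^esub> u i (f i x) = diff T (i - 1) (h i x) \<oplus>\<^bsub>obj T i\<^esub> h (i + 1) (diff X i x)"
   unfolding main a_minus_def using hom_closed[OF dT' h1] h2 hom_closed[OF uh fx] by (simp add: T0.M.a_assoc T0.M.r_neg)
 qed
qed

lemma null_homotopic_of_precomp:
 fixes X Y :: "('a, 't) cochain"
 assumes X: "cochain_complex R X" and Y: "cochain_complex R Y" and T: "cochain_complex R T"
  and q: "quasi_iso R X Y f" and null: "null_homotopic_maps TYPE('t \<times> 't) R T"
  and g: "chain_map R Y T g" and h: "!!i. h i\<in>mod_hom R (obj X i) (obj T (i - 1))"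
  and he: "!!i y. y\<in>carrier (obj X i) ==>
   g i (f i y) = diff T (i - 1) (h i y) \<oplus>\<^bsub>obj T i\<^esub> h (i + 1) (diff X i y)"
 shows "EX v. (ALL i. v i\<in>mod_hom R (obj Y i) (obj T (i - 1))) &
  (ALL i. ALL y:carrier (obj Y i). g i y = diff T (i - 1) (v i y) \<oplus>\<^bsub>obj T i\<^esub> v (i + 1) (diff Y i y))"
proof -
 have f: "chain_map R X Y f" using q by (simp add: quasi_iso_def)
 let ?C = "cone_complex X Y f"
 note CC = complex_cone[OF X Y f]
 note XM = complexD(1)[OF X] and YM = complexD(1)[OF Y] and TM = complexD(1)[OF T]
 note dX = complexD(2)[OF X] and dY = complexD(2)[OF Y] and dT = complexD(2)[OF T]
 note fh = chain_map_hom[OF f] and ph = chain_map_hom[OF g]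
 have h1: "h (i + 1)\<in>mod_hom R (obj X (i + 1)) (obj T i)" for i using h[of "i + 1"] by simp
 \<comment> \<open>The homotopy \<open>h\<close> provides the summand on \<open>X\<close> that makes
   \<open>g\<close> on \<open>Y\<close> extend to a chain map on the cone; contracting this map and
   restricting to \<open>Y\<close> contracts \<open>g\<close>.\<close>
 have "chain_map R ?C T (%i p. g i (snd p) \<oplus>\<^bsub>obj T i\<^esub> h (i + 1) (fst p))" unfolding chain_map_def
 proof (intro allI conjI ballI)
  fix i
  have "fst\<in>mod_hom R (obj ?C i) (obj X (i + 1))" "snd\<in>mod_hom R (obj ?C i) (obj Y i)" by (rule mod_homI; auto)+
  then show "(%p. g i (snd p) \<oplus>\<^bsub>obj T i\<^esub> h (i + 1) (fst p))\<in>mod_hom R (obj ?C i) (obj T i)"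
   by (intro hom_add_map[OF TM] hom_comp[OF _ ph] hom_comp[OF _ h1])
  fix p assume "p\<in>carrier (obj ?C i)"
  then have p: "fst p\<in>carrier (obj X (i + 1))" "snd p\<in>carrier (obj Y i)" by auto
  interpret T1: module R "obj T (i + 1)" by (rule TM)
  note c = hom_closed[OF dX p(1)] hom_closed[OF dY p(2)] hom_closed[OF fh p(1)]
  have 1: "h (i + 1 + 1) (\<ominus>\<^bsub>obj X (i + 1 + 1)\<^esub> diff X (i + 1) (fst p)) = \<ominus>\<^bsub>obj T (i + 1)\<^esub> h (i + 1 + 1) (diff X (i + 1) (fst p))"
   by (rule hom_neg[OF XM TM h1 c(1)])
  have 2: "g (i + 1) (f (i + 1) (fst p) \<oplus>\<^bsub>obj Y (i + 1)\<^esub> diff Y i (snd p)) =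
    (diff T i (h (i + 1) (fst p)) \<oplus>\<^bsub>obj T (i + 1)\<^esub> h (i + 1 + 1) (diff X (i + 1) (fst p))) \<oplus>\<^bsub>obj T (i + 1)\<^esub> diff T i (g i (snd p))"
   unfolding hom_add[OF ph c(3,2)] chain_map_comm[OF g p(2)] he[OF p(1)] by simp
  have 3: "diff T i (g i (snd p) \<oplus>\<^bsub>obj T i\<^esub> h (i + 1) (fst p)) = diff T i (g i (snd p)) \<oplus>\<^bsub>obj T (i + 1)\<^esub> diff T i (h (i + 1) (fst p))"
   by (rule hom_add[OF dT hom_closed[OF ph p(2)] hom_closed[OF h1 p(1)]])
  note cc = hom_closed[OF dT hom_closed[OF ph p(2)]] hom_closed[OF dT hom_closed[OF h1 p(1)]] hom_closed[OF h1 c(1)]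
  show "g (i + 1) (snd (diff ?C i p)) \<oplus>\<^bsub>obj T (i + 1)\<^esub> h (i + 1 + 1) (fst (diff ?C i p)) =
    diff T i (g i (snd p) \<oplus>\<^bsub>obj T i\<^esub> h (i + 1) (fst p))" unfolding cone_complex_simps fst_conv snd_conv 1 2 3
   using cc T1.M.a_assoc T1.M.a_comm T1.M.r_neg T1.M.r_zero T1.M.a_closed T1.M.a_inv_closed by metis
 qed
 then obtain u where u: "!!i. u i\<in>mod_hom R (obj ?C i) (obj T (i - 1))"
  "!!i p. p\<in>carrier (obj ?C i) ==> g i (snd p) \<oplus>\<^bsub>obj T i\<^esub> h (i + 1) (fst p) =
   diff T (i - 1) (u i p) \<oplus>\<^bsub>obj T i\<^esub> u (i + 1) (diff ?C i p)"
  using null_homotopic_mapsD[OF null CC cone_complex_acyclic[OF X Y q]] by blast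
 have in0: "(%y. (\<zero>\<^bsub>obj X (i + 1)\<^esub>, y))\<in>mod_hom R (obj Y i) (obj ?C i)" for i
 proof -
  interpret X1: module R "obj X (i + 1)" by (rule XM)
  show ?thesis by (rule mod_homI) auto
 qed
 show ?thesis
 proof (intro exI[of _ "%i y. u i (\<zero>\<^bsub>obj X (i + 1)\<^esub>, y)"] conjI allI ballI)
  show "(%y. u i (\<zero>\<^bsub>obj X (i + 1)\<^esub>, y))\<in>mod_hom R (obj Y i) (obj T (i - 1))" for i by (rule hom_comp[OF in0 u(1)])
  fix i y assume y: "y\<in>carrier (obj Y i)"
  interpret T0: module R "obj T i" by (rule TM)
  interpret Y1: module R "obj Y (i + 1)" by (rule YM)
  have "(\<zero>\<^bsub>obj X (i + 1)\<^esub>, y)\<in>carrier (obj ?C i)" by (rule hom_closed[OF in0 y])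
  from u(2)[OF this] show "g i y = diff T (i - 1) (u i (\<zero>\<^bsub>obj X (i + 1)\<^esub>, y)) \<oplus>\<^bsub>obj T i\<^esub> u (i + 1) (\<zero>\<^bsub>obj X (i + 1 + 1)\<^esub>, diff Y i y)"
   using hom_closed[OF ph y] hom_closed[OF dY y]
   by (simp only: fst_conv snd_conv cone_complex_simps hom_zero[OF XM TM h1] hom_zero[OF XM XM dX] hom_zero[OF XM YM fh]
     module_neg_zero[OF XM] Y1.M.l_zero T0.M.r_zero)
 qed
qed

text \<open>Cohomology of the complex of homomorphisms in degree \<open>n\<close> is the group of
  homotopy classes of maps into the \<open>n\<close>-th shift of \<open>I\<close>. The first
  assumption on null-homotopies gives injectivity of the induced map, by
  \<open>null_homotopic_of_precomp\<close>, the second surjectivity, by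
  \<open>lift_along_quasi_iso\<close>.\<close>

lemma homotopically_injectiveI:
 assumes R: "cring R" and I: "cochain_complex R I"
  and null: "!!n. null_homotopic_maps TYPE('t \<times> 't) R (shift_complex n I)"
   "!!n. null_homotopic_maps TYPE('t \<times> 't) R (shift_complex 1 (shift_complex n I))"
 shows "homotopically_injective TYPE('t) R I" unfolding homotopically_injective_def
proof (intro allI impI, elim conjE)
 fix X Y :: "('a, 't) cochain" and f
 assume X: "cochain_complex R X" and Y: "cochain_complex R Y" and q: "quasi_iso R X Y f"
 have f: "chain_map R X Y f" using q by (simp add: quasi_iso_def)
 note XM = complexD(1)[OF X] and YM = complexD(1)[OF Y] and IM = complexD(1)[OF I]
 note dX = complexD(2)[OF X] and dY = complexD(2)[OF Y] and dI = complexD(2)[OF I]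
 note fh = chain_map_hom[OF f]
 let ?HX = "hom_complex R X I" let ?HY = "hom_complex R Y I" let ?g = "hom_precomp X f"
 note HX = complex_hom[OF R X I] and HY = complex_hom[OF R Y I]
 note SI = complex_shift[OF I]
 have gi: "?g n u i y = u i (f i y)" if "y\<in>carrier (obj X i)" for n u i y using that by (simp add: hom_precomp_def)
 have gc: "?g n u\<in>carrier (obj ?HX n)" if "u\<in>carrier (obj ?HY n)" for n u
 proof -
  have "u i\<in>mod_hom R (obj Y i) (obj I (i + n))" for i using that unfolding hom_complex_carrier by blast
  then show ?thesis unfolding hom_complex_carrier hom_precomp_def using hom_restrict[OF XM hom_comp[OF fh]] by blast
 qed
 have cm: "chain_map R ?HY ?HX ?g" unfolding chain_map_def
 proof (intro allI conjI ballI)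
  fix n
  show "?g n\<in>mod_hom R (obj ?HY n) (obj ?HX n)"
  proof (rule mod_homI[OF gc])
   fix u v assume "u\<in>carrier (obj ?HY n)" "v\<in>carrier (obj ?HY n)"
   show "?g n (u \<oplus>\<^bsub>obj ?HY n\<^esub> v) = ?g n u \<oplus>\<^bsub>obj ?HX n\<^esub> ?g n v"
    unfolding hom_precomp_def hom_complex_simps prod_module_simps hom_module_simps by (rule ext, rule restrict_ext) (simp add: hom_closed[OF fh])
  next
   fix r u assume "u\<in>carrier (obj ?HY n)"
   show "?g n (r \<odot>\<^bsub>obj ?HY n\<^esub> u) = r \<odot>\<^bsub>obj ?HX n\<^esub> ?g n u"
    unfolding hom_precomp_def hom_complex_simps prod_module_simps hom_module_simps by (rule ext, rule restrict_ext) (simp add: hom_closed[OF fh])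
  qed
  fix u assume "u\<in>carrier (obj ?HY n)"
  show "?g (n + 1) (diff ?HY n u) = diff ?HX n (?g n u)" unfolding hom_precomp_def hom_complex_simps
   by (rule ext, rule restrict_ext) (simp add: hom_closed[OF fh] hom_closed[OF dX] chain_map_comm[OF f])
 qed
 show "quasi_iso R ?HY ?HX ?g" unfolding quasi_iso_iff[OF HY HX]
 proof (intro conjI allI ballI impI cm)
  fix n v assume v: "v\<in>cycles ?HY n" and b: "?g n v\<in>boundaries ?HX n"
  have vc: "v\<in>carrier (obj ?HY n)" using v unfolding cycles_def by blast
  have vm: "chain_map R Y (shift_complex n I) v" using v unfolding hom_cycles_iff[OF R Y I vc] .
  obtain h where h: "!!i. h i\<in>mod_hom R (obj X i) (obj (shift_complex n I) (i - 1))"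
   "!!i y. y\<in>carrier (obj X i) ==>
    ?g n v i y = diff (shift_complex n I) (i - 1) (h i y) \<oplus>\<^bsub>obj (shift_complex n I) i\<^esub> h (i + 1) (diff X i y)"
   by (rule hom_boundariesD[OF R X I b]) blast
  have he: "v i (f i y) = diff (shift_complex n I) (i - 1) (h i y) \<oplus>\<^bsub>obj (shift_complex n I) i\<^esub> h (i + 1) (diff X i y)"
   if "y\<in>carrier (obj X i)" for i y using h(2)[OF that] unfolding gi[OF that] .
  have "EX k. (ALL i. k i\<in>mod_hom R (obj Y i) (obj (shift_complex n I) (i - 1))) &
   (ALL i. ALL y:carrier (obj Y i). v i y = diff (shift_complex n I) (i - 1) (k i y) \<oplus>\<^bsub>obj (shift_complex n I) i\<^esub> k (i + 1) (diff Y i y))"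
   by (rule null_homotopic_of_precomp[OF X Y SI q null(1) vm h(1) he])
  then obtain k where "ALL i. k i\<in>mod_hom R (obj Y i) (obj (shift_complex n I) (i - 1))"
   "ALL i. ALL y:carrier (obj Y i). v i y = diff (shift_complex n I) (i - 1) (k i y) \<oplus>\<^bsub>obj (shift_complex n I) i\<^esub> k (i + 1) (diff Y i y)"
   by (elim exE conjE)
  note k = this[rule_format]
  show "v\<in>boundaries ?HY n" by (rule hom_boundariesI[OF R Y I vc k])
 next
  fix n u assume u: "u\<in>cycles ?HX n"
  have uc: "u\<in>carrier (obj ?HX n)" using u unfolding cycles_def by blast
  have um: "chain_map R X (shift_complex n I) u" using u unfolding hom_cycles_iff[OF R X I uc] .
  obtain v w where v: "chain_map R Y (shift_complex n I) v"
   and w: "!!i. w i\<in>mod_hom R (obj X i) (obj (shift_complex n I) (i - 1))"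
   "!!i y. y\<in>carrier (obj X i) ==> u i y \<ominus>\<^bsub>obj (shift_complex n I) i\<^esub> v i (f i y) =
    diff (shift_complex n I) (i - 1) (w i y) \<oplus>\<^bsub>obj (shift_complex n I) i\<^esub> w (i + 1) (diff X i y)"
   by (rule lift_along_quasi_iso[OF X Y SI q null(2) um]) blast
  \<comment> \<open>Homomorphisms in \<open>hom_module\<close> have to be extensional, so
    \<open>v\<close> is cut down to the carriers.\<close>
  define \<chi> where "\<chi> i = (\<lambda>y\<in>carrier (obj Y i). v i y)" for i
  have \<chi>c: "\<chi>\<in>carrier (obj ?HY n)"
   unfolding hom_complex_carrier \<chi>_def using hom_restrict[OF YM chain_map_hom[OF v]] by (simp add: shift_complex_def)
  have \<chi>m: "chain_map R Y (shift_complex n I) \<chi>" unfolding chain_map_def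
  proof (intro allI conjI ballI)
   show "\<chi> i\<in>mod_hom R (obj Y i) (obj (shift_complex n I) i)" for i
    unfolding \<chi>_def using hom_restrict[OF YM chain_map_hom[OF v]] by blast
   show "\<chi> (i + 1) (diff Y i y) = diff (shift_complex n I) i (\<chi> i y)" if "y\<in>carrier (obj Y i)" for i y
    using chain_map_comm[OF v that] that hom_closed[OF dY that] by (simp add: \<chi>_def)
  qed
  have "u \<ominus>\<^bsub>obj ?HX n\<^esub> ?g n \<chi>\<in>boundaries ?HX n"
  proof (rule hom_boundariesI[OF R X I _ w(1)])
   interpret H: module R "obj ?HX n" by (rule complexD(1)[OF HX])
   have g\<chi>: "?g n \<chi>\<in>carrier (obj ?HX n)" by (rule gc[OF \<chi>c])
   show "u \<ominus>\<^bsub>obj ?HX n\<^esub> ?g n \<chi>\<in>carrier (obj ?HX n)" by (rule H.M.minus_closed[OF uc g\<chi>])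
   fix i y assume y: "y\<in>carrier (obj X i)"
   have hm: "module R (hom_module R (obj X j) (obj I (j + n)))" for j by (rule hom_module_module[OF R XM IM])
   have gci: "?g n \<chi> i\<in>carrier (hom_module R (obj X i) (obj I (i + n)))" using g\<chi> unfolding hom_complex_simps prod_module_simps by blast
   have "(u \<ominus>\<^bsub>obj ?HX n\<^esub> ?g n \<chi>) i y = u i y \<ominus>\<^bsub>obj I (i + n)\<^esub> ?g n \<chi> i y"
    using prod_module_minus[OF R hm g\<chi>[unfolded hom_complex_simps], of u] hom_module_a_inv[OF R XM IM gci] y
    unfolding hom_complex_simps by (simp add: a_minus_def)
   also have "... = diff (shift_complex n I) (i - 1) (w i y) \<oplus>\<^bsub>obj (shift_complex n I) i\<^esub> w (i + 1) (diff X i y)"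
    using w(2)[OF y] hom_closed[OF fh y] unfolding gi[OF y] \<chi>_def by (simp add: shift_complex_def)
   finally show "(u \<ominus>\<^bsub>obj ?HX n\<^esub> ?g n \<chi>) i y =
    diff (shift_complex n I) (i - 1) (w i y) \<oplus>\<^bsub>obj (shift_complex n I) i\<^esub> w (i + 1) (diff X i y)" .
  qed
  moreover have "\<chi>\<in>cycles ?HY n" using \<chi>m unfolding hom_cycles_iff[OF R Y I \<chi>c] .
  ultimately show "\<exists>\<chi>\<in>cycles ?HY n. u \<ominus>\<^bsub>obj ?HX n\<^esub> ?g n \<chi>\<in>boundaries ?HX n" by blast
 qed
qed

text \<open>A shift of a product is a product of shifts only up to the junk values of its differential outside
 the carrier, so the coordinates of a product are described by a relation.\<close>

definition coordinates :: "('a, 'i => 'm) cochain => ('i => ('a, 'm) cochain) => bool" where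
 "coordinates T B \<longleftrightarrow> (ALL i. obj T i = prod_module (%k. obj (B k) i)) &
   (ALL i. ALL u:carrier (obj T i). ALL k. diff T i u k = diff (B k) i (u k))"

lemma coordinates_prod: "coordinates (prod_complex B) B"
 by (auto simp: coordinates_def)

lemma coordinates_shift:
 assumes R: "cring R" and B: "!!k. cochain_complex R (B k)" and c: "coordinates T B"
 shows "coordinates (shift_complex n T) (%k. shift_complex n (B k))"
proof -
 have o: "obj T i = prod_module (%k. obj (B k) i)" for i using c by (simp add: coordinates_def)
 have d: "diff T i u = (%k. diff (B k) i (u k))" if "u\<in>carrier (obj T i)" for i u using c that by (auto simp: coordinates_def)
 have "signed (prod_module (%k. obj (B k) (i + n + 1))) n (%k. diff (B k) (i + n) (u k)) k =
   signed (obj (B k) (i + n + 1)) n (diff (B k) (i + n) (u k))" if "!!k. u k\<in>carrier (obj (B k) (i + n))" for i u k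
 proof -
  have "(%k. diff (B k) (i + n) (u k))\<in>carrier (prod_module (%k. obj (B k) (i + n + 1)))"
   using hom_closed[OF complexD(2)[OF B] that] by simp
  from prod_module_a_inv[OF R complexD(1)[OF B] this] show ?thesis by (simp add: signed_def)
 qed
 then show ?thesis unfolding coordinates_def shift_simps o by (simp add: d o)
qed

text \<open>A homotopy is constructed for each coordinate separately and the results are combined.
  The lower bound may therefore depend on \<open>k\<close>, and \<open>T\<close> itself may be
  unbounded in both directions.\<close>

lemma null_homotopic_maps_coordinates:
 assumes R: "cring R" and B: "!!k. cochain_complex R (B k)" and c: "coordinates T B"
  and inj: "!!k i. injective_module TYPE('t) R (obj (B k) i)"
  and bnd: "!!k. EX N. ALL i<N. carrier (obj (B k) i) = {\<zero>\<^bsub>obj (B k) i\<^esub>}"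
 shows "null_homotopic_maps TYPE('t) R T" unfolding null_homotopic_maps_def
proof (intro allI impI, elim conjE)
 fix C :: "('a, 't) cochain" and f
 assume C: "cochain_complex R C" "acyclic_complex C" and f: "chain_map R C T f"
 have o: "obj T i = prod_module (%k. obj (B k) i)" for i using c by (simp add: coordinates_def)
 have d: "diff T i u k = diff (B k) i (u k)" if "u\<in>carrier (obj T i)" for i u k using c that by (auto simp: coordinates_def)
 have fh: "f i\<in>mod_hom R (obj C i) (prod_module (%k. obj (B k) i))" for i using chain_map_hom[OF f, of i] by (simp add: o)
 have "EX g. ALL i. g i\<in>mod_hom R (obj C i) (obj (B k) (i - 1)) &
  (ALL y:carrier (obj C i). f i y k = diff (B k) (i - 1) (g i y) \<oplus>\<^bsub>obj (B k) i\<^esub> g (i + 1) (diff C i y))" for k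
 proof -
  obtain N where N: "!!i. i < N ==> carrier (obj (B k) i) = {\<zero>\<^bsub>obj (B k) i\<^esub>}" using bnd[of k] by blast
  have "chain_map R C (B k) (%i y. f i y k)" unfolding chain_map_def
  proof (intro allI conjI ballI)
   show "(%y. f i y k)\<in>mod_hom R (obj C i) (obj (B k) i)" for i using hom_comp[OF fh prod_module_proj[of k]] .
   show "f (i + 1) (diff C i y) k = diff (B k) i (f i y k)" if "y\<in>carrier (obj C i)" for i y
    using chain_map_comm[OF f that] d[OF hom_closed[OF chain_map_hom[OF f] that]] by simp
  qed
  from null_homotopy_bounded_below[OF C B inj N this] show ?thesis by simp
 qed
 then obtain s where s: "!!k i. s k i\<in>mod_hom R (obj C i) (obj (B k) (i - 1))"
  "!!k i y. y\<in>carrier (obj C i) ==> f i y k = diff (B k) (i - 1) (s k i y) \<oplus>\<^bsub>obj (B k) i\<^esub> s k (i + 1) (diff C i y)"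
  by metis
 have sc: "s k i y\<in>carrier (obj (B k) (i - 1))" if "y\<in>carrier (obj C i)" for k i y by (rule hom_closed[OF s(1) that])
 show "EX g. ALL i. g i\<in>mod_hom R (obj C i) (obj T (i - 1)) &
  (ALL y:carrier (obj C i). f i y = diff T (i - 1) (g i y) \<oplus>\<^bsub>obj T i\<^esub> g (i + 1) (diff C i y))"
 proof (intro exI[of _ "%i y k. s k i y"] allI conjI ballI)
  fix i
  show h: "(%y k. s k i y)\<in>mod_hom R (obj C i) (obj T (i - 1))"
   unfolding o by (rule mod_homI) (simp_all add: sc hom_add[OF s(1)] hom_smult[OF s(1)])
  fix y assume y: "y\<in>carrier (obj C i)"
  show "f i y = diff T (i - 1) (%k. s k i y) \<oplus>\<^bsub>obj T i\<^esub> (%k. s k (i + 1) (diff C i y))"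
  proof
   fix k
   have "diff T (i - 1) (%k. s k i y) k = diff (B k) (i - 1) (s k i y)" by (rule d[OF hom_closed[OF h y]])
   then show "f i y k = (diff T (i - 1) (%k. s k i y) \<oplus>\<^bsub>obj T i\<^esub> (%k. s k (i + 1) (diff C i y))) k"
    using s(2)[OF y] by (simp add: o)
  qed
 qed
qed

section \<open>Free modules and tensor products\<close>

lemma free_on_restrict:
 "free_on R A = (prod_module (%_. self_module R))\<lparr>carrier := {c. (ALL b. c b\<in>carrier R) & (ALL b. b ~: A --> c b = \<zero>\<^sub>R) & finite {b. c b ~= \<zero>\<^sub>R}}\<rparr>"
 by (simp add: free_on_def prod_module_def)

lemma free_on_simps [simp]:
 "carrier (free_on R A) = {c. (ALL b. c b\<in>carrier R) & (ALL b. b ~: A --> c b = \<zero>\<^sub>R) & finite {b. c b ~= \<zero>\<^sub>R}}"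
 "\<zero>\<^bsub>free_on R A\<^esub> = (%b. \<zero>\<^sub>R)" "c \<oplus>\<^bsub>free_on R A\<^esub> d = (%b. c b \<oplus>\<^sub>R d b)"
 "r \<odot>\<^bsub>free_on R A\<^esub> c = (%b. r \<otimes>\<^sub>R c b)" by (auto simp: free_on_def)

lemma free_on_module:
 assumes "cring R" shows "module R (free_on R A)" unfolding free_on_restrict
proof (rule submodule_module)
 interpret cring R by fact
 have M: "module R (self_module R)" by (rule module_self[OF assms])
 show P: "module R (prod_module (%_. self_module R))" by (rule prod_module_module[OF assms M])
 interpret P: module R "prod_module (%_. self_module R)" by (rule P)
 have sub: "submodule {u\<in>carrier (prod_module (%_. self_module R)). finite {i. u i ~= \<zero>\<^bsub>self_module R\<^esub>}} R (prod_module (%_. self_module R))"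
  by (rule direct_sum_submodule[OF assms M])
 note s = submodule_mem[OF P sub]
 show "submodule {c. (ALL b. c b\<in>carrier R) & (ALL b. b ~: A --> c b = \<zero>\<^sub>R) & finite {b. c b ~= \<zero>\<^sub>R}} R (prod_module (%_. self_module R))"
 proof (rule P.submoduleI)
  fix c assume c: "c\<in>{c. (ALL b. c b\<in>carrier R) & (ALL b. b ~: A --> c b = \<zero>\<^sub>R) & finite {b. c b ~= \<zero>\<^sub>R}}"
  then have "\<ominus>\<^bsub>prod_module (%_. self_module R)\<^esub> c = (%b. \<ominus>\<^sub>R c b)"
   using prod_module_a_inv[OF assms M, of c] by simp
  then show "\<ominus>\<^bsub>prod_module (%_. self_module R)\<^esub> c\<in>{c. (ALL b. c b\<in>carrier R) & (ALL b. b ~: A --> c b = \<zero>\<^sub>R) & finite {b. c b ~= \<zero>\<^sub>R}}"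
   using s(3)[of c] c by simp
  fix d assume "d\<in>{c. (ALL b. c b\<in>carrier R) & (ALL b. b ~: A --> c b = \<zero>\<^sub>R) & finite {b. c b ~= \<zero>\<^sub>R}}"
  then show "c \<oplus>\<^bsub>prod_module (%_. self_module R)\<^esub> d\<in>{c. (ALL b. c b\<in>carrier R) & (ALL b. b ~: A --> c b = \<zero>\<^sub>R) & finite {b. c b ~= \<zero>\<^sub>R}}"
   using s(5)[of c d] c by simp
 next
  fix r c assume "r\<in>carrier R" "c\<in>{c. (ALL b. c b\<in>carrier R) & (ALL b. b ~: A --> c b = \<zero>\<^sub>R) & finite {b. c b ~= \<zero>\<^sub>R}}"
  then show "r \<odot>\<^bsub>prod_module (%_. self_module R)\<^esub> c\<in>{c. (ALL b. c b\<in>carrier R) & (ALL b. b ~: A --> c b = \<zero>\<^sub>R) & finite {b. c b ~= \<zero>\<^sub>R}}"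
   using s(4)[of r c] by simp
 qed auto
qed

lemma generator_carrier: "cring R ==> b\<in>A ==> generator R b\<in>carrier (free_on R A)"
 by (auto simp: generator_def cring_def ring.ring_simprules)

lemma finsum_superset:
 assumes "module R M" "finite T" "S <= T" "!!b. b\<in>S ==> g b\<in>carrier M" "!!b. b\<in>T - S ==> g b = \<zero>\<^sub>M"
 shows "(\<Oplus>\<^bsub>M\<^esub> b\<in>S. g b) = (\<Oplus>\<^bsub>M\<^esub> b\<in>T. g b)"
proof -
 interpret M: module R M by fact
 have "g b\<in>carrier M" if "b\<in>T" for b using that assms(4,5)[of b] by (cases "b\<in>S") auto
 then show ?thesis using assms(2,3,5) by (intro M.M.add.finprod_mono_neutral_cong_left) auto
qed

lemma finsum_single:
 assumes "module R M" "finite S" "b\<in>S" "g b\<in>carrier M" "!!b'. b'\<in>S ==> b' ~= b ==> g b' = \<zero>\<^sub>M"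
 shows "(\<Oplus>\<^bsub>M\<^esub> b\<in>S. g b) = g b"
proof -
 interpret M: module R M by fact
 have "(\<Oplus>\<^bsub>M\<^esub> b\<in>{b}. g b) = (\<Oplus>\<^bsub>M\<^esub> b\<in>S. g b)" using assms by (intro finsum_superset[OF assms(1)]) auto
 then show ?thesis using assms(4) by simp
qed

lemma finsum_closed_mod: "module R M ==> (!!b. b\<in>S ==> g b\<in>carrier M) ==> (\<Oplus>\<^bsub>M\<^esub> b\<in>S. g b)\<in>carrier M"
 by (rule abelian_monoid.finsum_closed[OF abelian_group.axioms(1)[OF module.axioms(2)]]) auto

lemma finsum_add_mod:
 assumes "module R M" "!!b. b\<in>S ==> g b\<in>carrier M" "!!b. b\<in>S ==> h b\<in>carrier M"
 shows "(\<Oplus>\<^bsub>M\<^esub> b\<in>S. g b \<oplus>\<^sub>M h b) = (\<Oplus>\<^bsub>M\<^esub> b\<in>S. g b) \<oplus>\<^sub>M (\<Oplus>\<^bsub>M\<^esub> b\<in>S. h b)"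
 using assms by (intro abelian_monoid.finsum_addf[OF abelian_group.axioms(1)[OF module.axioms(2)[OF assms(1)]]]) auto

lemma finsum_cong_mod:
 assumes "module R M" "!!b. b\<in>S ==> g b\<in>carrier M" "!!b. b\<in>S ==> g b = h b"
 shows "(\<Oplus>\<^bsub>M\<^esub> b\<in>S. g b) = (\<Oplus>\<^bsub>M\<^esub> b\<in>S. h b)"
proof -
 interpret M: module R M by fact
 show ?thesis using assms(2,3) by (intro M.M.finsum_cong') auto
qed

lemma finsum_mem_submodule:
 assumes "module R M" "submodule H R M" "finite S" "!!b. b\<in>S ==> g b\<in>H"
 shows "(\<Oplus>\<^bsub>M\<^esub> b\<in>S. g b)\<in>H"
proof -
 interpret M: module R M by fact
 note h = submodule_mem[OF assms(1,2)]
 show ?thesis using assms(3,4)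
 proof (induction S rule: finite_induct)
  case (insert b S)
  then have "g\<in>S \<rightarrow> carrier M" "g b\<in>carrier M" using h(1) by auto
  then show ?case using insert h(5) by simp
 qed (use h in simp)
qed

definition lin_ext :: "('a, 'r) ring_scheme => ('a, 'm) module => ('b => 'm) => ('b => 'a) => 'm" where
 "lin_ext R N \<phi> c = (\<Oplus>\<^bsub>N\<^esub> b\<in>{b. c b ~= \<zero>\<^sub>R}. c b \<odot>\<^sub>N \<phi> b)"

text \<open>The defining sum runs over the support of \<open>c\<close>; enlarging it to any finite
  set allows two elements to be expanded over one index set.\<close>

lemma lin_ext_eq:
 assumes "module R N" "finite S" "S <= A" "c\<in>carrier (free_on R A)" "{b. c b ~= \<zero>\<^sub>R} <= S" "!!b. b\<in>A ==> \<phi> b\<in>carrier N"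
 shows "lin_ext R N \<phi> c = (\<Oplus>\<^bsub>N\<^esub> b\<in>S. c b \<odot>\<^sub>N \<phi> b)"
proof -
 interpret N: module R N by fact
 show ?thesis unfolding lin_ext_def
 proof (rule finsum_superset[OF assms(1,2,5)])
  fix b assume "b\<in>{b. c b ~= \<zero>\<^sub>R}"
  then show "c b \<odot>\<^sub>N \<phi> b\<in>carrier N" using assms(3-6) by (intro N.smult_closed) auto
 next
  fix b assume "b\<in>S - {b. c b ~= \<zero>\<^sub>R}"
  then show "c b \<odot>\<^sub>N \<phi> b = \<zero>\<^sub>N" using assms(3,6) N.smult_l_null[of "\<phi> b"] by auto
 qed
qed

lemma free_on_supp:
 assumes "c\<in>carrier (free_on R A)" shows "finite {b. c b ~= \<zero>\<^sub>R}" "{b. c b ~= \<zero>\<^sub>R} <= A" "c b\<in>carrier R"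
 using assms by auto

lemma lin_ext_hom:
 assumes N: "module R N" and \<phi>: "!!b. b\<in>A ==> \<phi> b\<in>carrier N"
 shows "lin_ext R N \<phi>\<in>mod_hom R (free_on R A) N"
proof -
 interpret N: module R N by fact
 have cl: "lin_ext R N \<phi> c\<in>carrier N" if c: "c\<in>carrier (free_on R A)" for c unfolding lin_ext_def
  by (rule finsum_closed_mod[OF N]) (intro N.smult_closed free_on_supp(3)[OF c] \<phi> subsetD[OF free_on_supp(2)[OF c]])
 show ?thesis
 proof (rule mod_homI[OF cl])
  fix c d assume c: "c\<in>carrier (free_on R A)" and d: "d\<in>carrier (free_on R A)"
  interpret F: module R "free_on R A" by (rule free_on_module[OF N.R.is_cring])
  let ?S = "{b. c b ~= \<zero>\<^sub>R} \<union> {b. d b ~= \<zero>\<^sub>R}"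
  have S: "finite ?S" "?S <= A" using free_on_supp[OF c] free_on_supp[OF d] by auto
  have cd: "c \<oplus>\<^bsub>free_on R A\<^esub> d\<in>carrier (free_on R A)" using c d by (rule F.M.a_closed)
  have cin: "!!b. c b\<in>carrier R" "!!b. d b\<in>carrier R" using free_on_supp[OF c] free_on_supp[OF d] by auto
  have "{b. (c \<oplus>\<^bsub>free_on R A\<^esub> d) b ~= \<zero>\<^sub>R} <= ?S" by auto
  then have "lin_ext R N \<phi> (c \<oplus>\<^bsub>free_on R A\<^esub> d) = (\<Oplus>\<^bsub>N\<^esub> b\<in>?S. (c \<oplus>\<^bsub>free_on R A\<^esub> d) b \<odot>\<^sub>N \<phi> b)"
   by (rule lin_ext_eq[OF N S cd _ \<phi>])
  also have "... = (\<Oplus>\<^bsub>N\<^esub> b\<in>?S. c b \<odot>\<^sub>N \<phi> b \<oplus>\<^sub>N d b \<odot>\<^sub>N \<phi> b)"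
   using S(2) cin \<phi> by (intro finsum_cong_mod[OF N]) (auto simp: N.smult_l_distr subset_iff)
  also have "... = (\<Oplus>\<^bsub>N\<^esub> b\<in>?S. c b \<odot>\<^sub>N \<phi> b) \<oplus>\<^sub>N (\<Oplus>\<^bsub>N\<^esub> b\<in>?S. d b \<odot>\<^sub>N \<phi> b)"
   using S(2) cin \<phi> by (intro finsum_add_mod[OF N]) (auto simp: subset_iff)
  also have "... = lin_ext R N \<phi> c \<oplus>\<^sub>N lin_ext R N \<phi> d"
   using lin_ext_eq[where \<phi>=\<phi>, OF N S c _ \<phi>] lin_ext_eq[where \<phi>=\<phi>, OF N S d _ \<phi>] by auto
  finally show "lin_ext R N \<phi> (c \<oplus>\<^bsub>free_on R A\<^esub> d) = lin_ext R N \<phi> c \<oplus>\<^sub>N lin_ext R N \<phi> d" .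
 next
  fix r c assume r: "r\<in>carrier R" and c: "c\<in>carrier (free_on R A)"
  interpret F: module R "free_on R A" by (rule free_on_module[OF N.R.is_cring])
  let ?S = "{b. c b ~= \<zero>\<^sub>R}"
  have S: "finite ?S" "?S <= A" using free_on_supp[OF c] by auto
  have rc: "r \<odot>\<^bsub>free_on R A\<^esub> c\<in>carrier (free_on R A)" using r c by (rule F.smult_closed)
  have cin: "!!b. c b\<in>carrier R" using free_on_supp[OF c] by auto
  have "{b. (r \<odot>\<^bsub>free_on R A\<^esub> c) b ~= \<zero>\<^sub>R} <= ?S" using r by auto
  then have "lin_ext R N \<phi> (r \<odot>\<^bsub>free_on R A\<^esub> c) = (\<Oplus>\<^bsub>N\<^esub> b\<in>?S. (r \<odot>\<^bsub>free_on R A\<^esub> c) b \<odot>\<^sub>N \<phi> b)"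
   by (rule lin_ext_eq[OF N S rc _ \<phi>])
  also have "... = (\<Oplus>\<^bsub>N\<^esub> b\<in>?S. r \<odot>\<^sub>N (c b \<odot>\<^sub>N \<phi> b))"
   using S(2) cin \<phi> r by (intro finsum_cong_mod[OF N]) (auto simp: N.smult_assoc1 subset_iff)
  also have "... = r \<odot>\<^sub>N lin_ext R N \<phi> c"
   unfolding lin_ext_def using S cin \<phi> r by (intro N.finsum_smult_ldistr[symmetric]) (auto simp: subset_iff)
  finally show "lin_ext R N \<phi> (r \<odot>\<^bsub>free_on R A\<^esub> c) = r \<odot>\<^sub>N lin_ext R N \<phi> c" .
 qed
qed

lemma lin_ext_generator:
 assumes N: "module R N" and b: "b\<in>A" and \<phi>: "!!b. b\<in>A ==> \<phi> b\<in>carrier N"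
 shows "lin_ext R N \<phi> (generator R b) = \<phi> b"
proof -
 interpret N: module R N by fact
 have "lin_ext R N \<phi> (generator R b) = (\<Oplus>\<^bsub>N\<^esub> b'\<in>{b}. generator R b b' \<odot>\<^sub>N \<phi> b')"
  by (rule lin_ext_eq[OF N _ _ generator_carrier[OF N.R.is_cring b] _ \<phi>]) (use b in "auto simp: generator_def")
 then show ?thesis using b \<phi> by (simp add: generator_def)
qed

lemma free_on_expand:
 assumes R: "cring R" and c: "c\<in>carrier (free_on R A)"
 shows "c = lin_ext R (free_on R A) (generator R) c"
proof
 fix b
 interpret R: cring R by fact
 have F: "module R (free_on R A)" by (rule free_on_module[OF R])
 have S: "module R (self_module R)" by (rule module_self[OF R])
 interpret F: module R "free_on R A" by fact
 note sc = free_on_supp[OF c]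
 have ev: "(%c. c b)\<in>mod_hom R (free_on R A) (self_module R)" by (rule mod_homI) auto
 have g: "c b' \<odot>\<^bsub>free_on R A\<^esub> generator R b'\<in>carrier (free_on R A)" if "b'\<in>A" for b'
  by (intro F.smult_closed generator_carrier[OF R that] sc(3))
 have "lin_ext R (free_on R A) (generator R) c b = (\<Oplus>\<^bsub>self_module R\<^esub> b'\<in>{b. c b ~= \<zero>\<^sub>R}. (c b' \<odot>\<^bsub>free_on R A\<^esub> generator R b') b)"
  unfolding lin_ext_def by (rule hom_finsum[OF F S ev sc(1)]) (intro funcsetI g subsetD[OF sc(2)])
 also have "... = (\<Oplus>\<^bsub>self_module R\<^esub> b'\<in>insert b {b. c b ~= \<zero>\<^sub>R}. (c b' \<odot>\<^bsub>free_on R A\<^esub> generator R b') b)"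
  using sc by (intro finsum_superset[OF S]) (auto simp: generator_def)
 also have "... = (c b \<odot>\<^bsub>free_on R A\<^esub> generator R b) b" using sc by (intro finsum_single[OF S]) (auto simp: generator_def)
 also have "... = c b" using sc(3)[of b] by (simp add: generator_def)
 finally show "c b = lin_ext R (free_on R A) (generator R) c b" by simp
qed

lemma hom_inverse:
 assumes M: "module R M" and N: "module R N" and f: "f\<in>mod_hom R M N"
  and bij: "bij_betw f (carrier M) (carrier N)"
 obtains g where "g\<in>mod_hom R N M" "!!x. x\<in>carrier M ==> g (f x) = x" "!!y. y\<in>carrier N ==> f (g y) = y"
proof -
 interpret M: module R M by fact
 let ?g = "inv_into (carrier M) f"
 have fg: "f (?g y) = y" and g: "?g y\<in>carrier M" if "y\<in>carrier N" for y
  using bij that by (auto simp: bij_betw_def intro: f_inv_into_f inv_into_into)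
 have gf: "?g (f x) = x" if "x\<in>carrier M" for x using bij that by (auto simp: bij_betw_def)
 show thesis
 proof (rule that[OF _ gf fg])
  show "?g\<in>mod_hom R N M"
  proof (rule mod_homI[OF g])
   fix x y assume "x\<in>carrier N" "y\<in>carrier N"
   then show "?g (x \<oplus>\<^sub>N y) = ?g x \<oplus>\<^sub>M ?g y" using gf[of "?g x \<oplus>\<^sub>M ?g y"] g fg by (simp add: hom_add[OF f])
  next
   fix r x assume "r\<in>carrier R" "x\<in>carrier N"
   then show "?g (r \<odot>\<^sub>N x) = r \<odot>\<^sub>M ?g x" using gf[of "r \<odot>\<^sub>M ?g x"] g fg by (simp add: hom_smult[OF f])
  qed
 qed
qed

lemma ex1_unique: "\<exists>!x. P x ==> P a ==> P b ==> a = b"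
 by blast

text \<open>The coordinate map \<open>f\<close> is inverse to linear extension of the inclusion of
  the basis: uniqueness in \<open>free_module\<close> is injectivity of that extension, existence
  its surjectivity. Coefficient functions are extensional on \<open>B\<close> there, while those of
  \<open>free_on\<close> are zero off \<open>B\<close>, hence the restrictions.\<close>

lemma free_module_coordinates:
 assumes F: "free_module R F"
 obtains B f where "B <= carrier F" "f\<in>mod_hom R F (free_on R B)"
  "!!b. b\<in>B ==> f b = generator R b"
  "!!m. m\<in>carrier F ==> m = lin_ext R F (%b. b) (f m)"
proof -
 have M: "module R F" using F by (simp add: free_module_def)
 interpret M: module R F by fact
 obtain B where B: "B <= carrier F" and ex1': "ALL m:carrier F. \<exists>!c. c\<in>B \<rightarrow>\<^sub>E carrier R &
    finite {b\<in>B. c b ~= \<zero>\<^sub>R} & m = (\<Oplus>\<^bsub>F\<^esub> b\<in>{b\<in>B. c b ~= \<zero>\<^sub>R}. c b \<odot>\<^sub>F b)"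
  using F unfolding free_module_def by (elim conjE exE)
 note ex1 = bspec[OF ex1']
 have Bc: "!!b. b\<in>B ==> b\<in>carrier F" using B by blast
 let ?\<kappa> = "lin_ext R F (%b. b)"
 have \<kappa>: "?\<kappa>\<in>mod_hom R (free_on R B) F" by (rule lin_ext_hom[OF M Bc])
 have FB: "module R (free_on R B)" by (rule free_on_module[OF M.R.is_cring])
 have ext: "restrict c B\<in>B \<rightarrow>\<^sub>E carrier R & finite {b\<in>B. restrict c B b ~= \<zero>\<^sub>R} &
   ?\<kappa> c = (\<Oplus>\<^bsub>F\<^esub> b\<in>{b\<in>B. restrict c B b ~= \<zero>\<^sub>R}. restrict c B b \<odot>\<^sub>F b)" if c: "c\<in>carrier (free_on R B)" for c
 proof -
  have S: "{b\<in>B. restrict c B b ~= \<zero>\<^sub>R} = {b. c b ~= \<zero>\<^sub>R}" using c by auto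
  have "?\<kappa> c = (\<Oplus>\<^bsub>F\<^esub> b\<in>{b. c b ~= \<zero>\<^sub>R}. restrict c B b \<odot>\<^sub>F b)"
   unfolding lin_ext_def using c Bc by (intro finsum_cong_mod[OF M]) (auto intro!: M.smult_closed)
  then show ?thesis unfolding S using c by auto
 qed
 have "bij_betw ?\<kappa> (carrier (free_on R B)) (carrier F)" unfolding bij_betw_def
 proof
  show "inj_on ?\<kappa> (carrier (free_on R B))"
  proof (rule inj_onI)
   fix c d assume c: "c\<in>carrier (free_on R B)" and d: "d\<in>carrier (free_on R B)" and eq: "?\<kappa> c = ?\<kappa> d"
   have "restrict c B = restrict d B" by (rule ex1_unique[OF ex1[OF hom_closed[OF \<kappa> c]], OF ext[OF c]]) (use ext[OF d] eq in simp)
   then have "c b = d b" if "b\<in>B" for b using that by (metis restrict_apply')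
   moreover have "c b = d b" if "b ~: B" for b using that c d by simp
   ultimately show "c = d" by blast
  qed
  show "?\<kappa> ` carrier (free_on R B) = carrier F"
  proof
   show "?\<kappa> ` carrier (free_on R B) <= carrier F" using hom_closed[OF \<kappa>] by blast
   show "carrier F <= ?\<kappa> ` carrier (free_on R B)"
   proof
    fix m assume m: "m\<in>carrier F"
    obtain c where c: "c\<in>B \<rightarrow>\<^sub>E carrier R" "finite {b\<in>B. c b ~= \<zero>\<^sub>R}" "m = (\<Oplus>\<^bsub>F\<^esub> b\<in>{b\<in>B. c b ~= \<zero>\<^sub>R}. c b \<odot>\<^sub>F b)"
     using ex1_implies_ex[OF ex1[OF m]] by (elim exE conjE)
    let ?c = "%b. if b\<in>B then c b else \<zero>\<^sub>R"
    have S: "{b. ?c b ~= \<zero>\<^sub>R} = {b\<in>B. c b ~= \<zero>\<^sub>R}" by auto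
    have "?c\<in>carrier (free_on R B)" using c(1,2) unfolding free_on_simps mem_Collect_eq S by auto
    moreover have "m = ?\<kappa> ?c" unfolding lin_ext_def S c(3) using c(1) Bc by (intro finsum_cong_mod[OF M]) (auto intro!: M.smult_closed)
    ultimately show "m\<in>?\<kappa> ` carrier (free_on R B)" by blast
   qed
  qed
 qed
 then obtain f where f: "f\<in>mod_hom R F (free_on R B)" "!!c. c\<in>carrier (free_on R B) ==> f (?\<kappa> c) = c"
  "!!m. m\<in>carrier F ==> ?\<kappa> (f m) = m" using hom_inverse[OF FB M \<kappa>] by blast
 show thesis
 proof (rule that[OF B f(1)])
  show "f b = generator R b" if "b\<in>B" for b
   using f(2)[OF generator_carrier[OF M.R.is_cring that]] lin_ext_generator[OF M that, of "%b. b"] Bc by simp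
  show "m = ?\<kappa> (f m)" if "m\<in>carrier F" for m using f(3)[OF that] by simp
 qed
qed

text \<open>Preimages of the values on a basis are chosen arbitrarily and extended linearly.\<close>

lemma free_module_projective:
 assumes F: "free_module R F" and M: "module R M" and N: "module R N"
  and p: "p\<in>mod_hom R M N" and g: "g\<in>mod_hom R F N" and im: "!!x. x\<in>carrier F ==> g x\<in>p ` carrier M"
 obtains h where "h\<in>mod_hom R F M" "!!x. x\<in>carrier F ==> p (h x) = g x"
proof -
 have FM: "module R F" using F by (simp add: free_module_def)
 obtain B u where B: "B <= carrier F" and u: "u\<in>mod_hom R F (free_on R B)"
  and ue: "!!m. m\<in>carrier F ==> m = lin_ext R F (%b. b) (u m)" using free_module_coordinates[OF F] by metis
 interpret M: module R M by fact
 interpret F: module R F by fact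
 define f where "f b = (SOME m. m\<in>carrier M & p m = g b)" for b
 have f: "f b\<in>carrier M" "p (f b) = g b" if b: "b\<in>B" for b
 proof -
  have "EX m. m\<in>carrier M & p m = g b" using im[of b] B b by force
  from someI_ex[OF this] show "f b\<in>carrier M" "p (f b) = g b" unfolding f_def by auto
 qed
 have l: "lin_ext R M f\<in>mod_hom R (free_on R B) M" by (rule lin_ext_hom[OF M f(1)])
 have "(%x. lin_ext R M f (u x))\<in>mod_hom R F M" by (rule hom_comp[OF u l])
 moreover have "p (lin_ext R M f (u x)) = g x" if x: "x\<in>carrier F" for x
 proof -
  let ?c = "u x" let ?S = "{b. ?c b ~= \<zero>\<^sub>R}"
  have c: "?c\<in>carrier (free_on R B)" by (rule hom_closed[OF u x])
  note sc = free_on_supp[OF c]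
  have bS: "b\<in>B" if "b\<in>?S" for b using sc(2) that by blast
  have bF: "b\<in>carrier F" if "b\<in>?S" for b using B bS[OF that] by blast
  have "p (lin_ext R M f ?c) = (\<Oplus>\<^bsub>N\<^esub> b\<in>?S. p (?c b \<odot>\<^sub>M f b))"
   unfolding lin_ext_def by (rule hom_finsum[OF M N p sc(1)]) (intro funcsetI M.smult_closed sc(3) f(1) bS)
  also have "... = (\<Oplus>\<^bsub>N\<^esub> b\<in>?S. g (?c b \<odot>\<^sub>F b))"
  proof (rule finsum_cong_mod[OF N])
   fix b assume b: "b\<in>?S"
   show "p (?c b \<odot>\<^sub>M f b)\<in>carrier N" by (rule hom_closed[OF p M.smult_closed[OF sc(3) f(1)[OF bS[OF b]]]])
   show "p (?c b \<odot>\<^sub>M f b) = g (?c b \<odot>\<^sub>F b)"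
    by (simp only: hom_smult[OF p sc(3) f(1)[OF bS[OF b]]] hom_smult[OF g sc(3) bF[OF b]] f(2)[OF bS[OF b]])
  qed
  also have "... = g (lin_ext R F (%b. b) ?c)"
   unfolding lin_ext_def by (rule hom_finsum[OF FM N g sc(1), symmetric]) (intro funcsetI F.smult_closed sc(3) bF)
  also have "... = g x" using ue[OF x] by simp
  finally show ?thesis .
 qed
 ultimately show thesis by (rule that)
qed

subsection \<open>Tensor products\<close>

lemma submodule_span_submodule:
 assumes M: "module R M" and S: "S <= carrier M"
 shows "submodule (submodule_span R M S) R M" "S <= submodule_span R M S"
  "!!N. submodule N R M ==> S <= N ==> submodule_span R M S <= N"
proof -
 interpret M: module R M by fact
 note sm = submodule_mem[OF M]
 show "S <= submodule_span R M S" "!!N. submodule N R M ==> S <= N ==> submodule_span R M S <= N"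
  by (auto simp: submodule_span_def)
 show "submodule (submodule_span R M S) R M"
 proof (rule M.submoduleI)
  show "submodule_span R M S <= carrier M" using M.carrier_is_submodule S by (auto simp: submodule_span_def)
 qed (auto simp: submodule_span_def sm)
qed

definition bilinear_map ::
  "('a, 'r) ring_scheme => ('a, 'm) module => ('a, 'n) module => ('a, 'p) module => ('m => 'n => 'p) => bool" where
 "bilinear_map R M N P \<beta> \<longleftrightarrow> (ALL n:carrier N. (%m. \<beta> m n)\<in>mod_hom R M P) & (ALL m:carrier M. \<beta> m\<in>mod_hom R N P)"

text \<open>The third item is the existence half of the universal property: the linear extension of
  \<open>f\<close> to the free module kills the four kinds of relations, hence the submodule they
  span, and so descends to cosets.\<close>

lemma tensor_facts:
 assumes M: "module R M" and N: "module R N"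
 shows "submodule (tensor_relations R M N) R (free_on R (carrier M \<times> carrier N))"
  and "bilinear_map R M N (tensor R M N) (pure_tensor R M N)"
  and "!!P f. module R P ==> bilinear_map R M N P f ==>
   EX h:mod_hom R (tensor R M N) P. ALL m:carrier M. ALL n:carrier N. h (pure_tensor R M N m n) = f m n"
proof -
 interpret M: module R M by fact
 interpret N: module R N by fact
 note R = M.R.is_cring
 let ?F = "free_on R (carrier M \<times> carrier N)" let ?g = "generator R"
 have F: "module R ?F" by (rule free_on_module[OF R])
 interpret F: module R ?F by fact
 define Rel where "Rel = {?g (m \<oplus>\<^sub>M m', n) \<ominus>\<^sub>?F (?g (m, n) \<oplus>\<^sub>?F ?g (m', n)) | m m' n.
     m\<in>carrier M & m'\<in>carrier M & n\<in>carrier N} \<union>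
    {?g (m, n \<oplus>\<^sub>N n') \<ominus>\<^sub>?F (?g (m, n) \<oplus>\<^sub>?F ?g (m, n')) | m n n'.
     m\<in>carrier M & n\<in>carrier N & n'\<in>carrier N} \<union>
    {?g (r \<odot>\<^sub>M m, n) \<ominus>\<^sub>?F (r \<odot>\<^sub>?F ?g (m, n)) | r m n.
     r\<in>carrier R & m\<in>carrier M & n\<in>carrier N} \<union>
    {?g (m, r \<odot>\<^sub>N n) \<ominus>\<^sub>?F (r \<odot>\<^sub>?F ?g (m, n)) | r m n.
     r\<in>carrier R & m\<in>carrier M & n\<in>carrier N}"
 let ?K = "tensor_relations R M N"
 have K: "?K = submodule_span R ?F Rel" unfolding tensor_relations_def Let_def Rel_def by (rule refl)
 have g: "?g (m, n)\<in>carrier ?F" if "m\<in>carrier M" "n\<in>carrier N" for m n by (rule generator_carrier[OF R]) (use that in simp)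
 note cl = F.M.minus_closed F.M.a_closed F.smult_closed g M.M.a_closed N.M.a_closed M.smult_closed N.smult_closed
 have Rel: "Rel <= carrier ?F" unfolding Rel_def by (intro Un_least subsetI; clarify; intro cl; assumption?)
 note span = submodule_span_submodule[OF F Rel, folded K]
 show sub: "submodule ?K R ?F" by (rule span(1))
 have T: "tensor R M N = quot_module ?F ?K" by (simp add: tensor_def)
 have pt: "pure_tensor R M N m n = ?K +>\<^bsub>?F\<^esub> ?g (m, n)" for m n by (simp add: pure_tensor_def)
 let ?u = "%x. ?K +>\<^bsub>?F\<^esub> x"
 have u: "?u\<in>mod_hom R ?F (tensor R M N)" unfolding T by (rule quot_proj_hom[OF F sub])
 have eqI: "?u x = ?u y" if "x\<in>carrier ?F" "y\<in>carrier ?F" "x \<ominus>\<^sub>?F y\<in>Rel" for x y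
  using that span(2) coset_eq_iff[OF F sub that(1,2)] by blast
 show "bilinear_map R M N (tensor R M N) (pure_tensor R M N)" unfolding bilinear_map_def pt
 proof (intro conjI ballI mod_homI)
  fix m n assume "m\<in>carrier M" "n\<in>carrier N"
  then show "?u (?g (m, n))\<in>carrier (tensor R M N)" "?u (?g (m, n))\<in>carrier (tensor R M N)" using hom_closed[OF u g] by auto
 next
  fix n m m' assume h: "n\<in>carrier N" "m\<in>carrier M" "m'\<in>carrier M"
  have "?u (?g (m \<oplus>\<^sub>M m', n)) = ?u (?g (m, n) \<oplus>\<^sub>?F ?g (m', n))"
   by (rule eqI; (intro cl h)?) (use h in "unfold Rel_def, blast")
  then show "?u (?g (m \<oplus>\<^sub>M m', n)) = ?u (?g (m, n)) \<oplus>\<^bsub>tensor R M N\<^esub> ?u (?g (m', n))"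
   using hom_add[OF u g g] h by simp
 next
  fix n n' m assume h: "m\<in>carrier M" "n\<in>carrier N" "n'\<in>carrier N"
  have "?u (?g (m, n \<oplus>\<^sub>N n')) = ?u (?g (m, n) \<oplus>\<^sub>?F ?g (m, n'))"
   by (rule eqI; (intro cl h)?) (use h in "unfold Rel_def, blast")
  then show "?u (?g (m, n \<oplus>\<^sub>N n')) = ?u (?g (m, n)) \<oplus>\<^bsub>tensor R M N\<^esub> ?u (?g (m, n'))"
   using hom_add[OF u g g] h by simp
 next
  fix n r m assume h: "n\<in>carrier N" "r\<in>carrier R" "m\<in>carrier M"
  have "?u (?g (r \<odot>\<^sub>M m, n)) = ?u (r \<odot>\<^sub>?F ?g (m, n))" by (rule eqI; (intro cl h)?) (use h in "unfold Rel_def, blast")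
  then show "?u (?g (r \<odot>\<^sub>M m, n)) = r \<odot>\<^bsub>tensor R M N\<^esub> ?u (?g (m, n))" using hom_smult[OF u _ g] h by simp
 next
  fix m r n assume h: "m\<in>carrier M" "r\<in>carrier R" "n\<in>carrier N"
  have "?u (?g (m, r \<odot>\<^sub>N n)) = ?u (r \<odot>\<^sub>?F ?g (m, n))" by (rule eqI; (intro cl h)?) (use h in "unfold Rel_def, blast")
  then show "?u (?g (m, r \<odot>\<^sub>N n)) = r \<odot>\<^bsub>tensor R M N\<^esub> ?u (?g (m, n))" using hom_smult[OF u _ g] h by simp
 qed
 fix P :: "('a, 'p) module" and f
 assume P: "module R P" and f: "bilinear_map R M N P f"
 interpret P: module R P by fact
 have f1: "(%m. f m n)\<in>mod_hom R M P" if "n\<in>carrier N" for n using f that by (simp add: bilinear_map_def)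
 have f2: "f m\<in>mod_hom R N P" if "m\<in>carrier M" for m using f that by (simp add: bilinear_map_def)
 have fc: "f m n\<in>carrier P" if "m\<in>carrier M" "n\<in>carrier N" for m n by (rule hom_closed[OF f2[OF that(1)] that(2)])
 let ?l = "lin_ext R P (%(m, n). f m n)"
 have l: "?l\<in>mod_hom R ?F P" by (rule lin_ext_hom[OF P]) (auto simp: fc)
 have lg: "?l (?g (m, n)) = f m n" if "m\<in>carrier M" "n\<in>carrier N" for m n
  by (subst lin_ext_generator[OF P, where A = "carrier M \<times> carrier N"]) (use that fc in auto)
 have "Rel <= {x\<in>carrier ?F. ?l x = \<zero>\<^sub>P}"
 proof
  fix x assume x: "x\<in>Rel"
  have "?l x = \<zero>\<^sub>P" using x unfolding Rel_def Un_iff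
  proof (elim disjE)
   assume "x\<in>{?g (m \<oplus>\<^sub>M m', n) \<ominus>\<^sub>?F (?g (m, n) \<oplus>\<^sub>?F ?g (m', n)) | m m' n. m\<in>carrier M & m'\<in>carrier M & n\<in>carrier N}"
   then obtain m m' n where h: "x = ?g (m \<oplus>\<^sub>M m', n) \<ominus>\<^sub>?F (?g (m, n) \<oplus>\<^sub>?F ?g (m', n))" "m\<in>carrier M" "m'\<in>carrier M" "n\<in>carrier N" by blast
   show ?thesis unfolding h(1) using h(2-4) hom_minus[OF F P l g F.M.a_closed[OF g g], of "m \<oplus>\<^sub>M m'" n m n m' n]
     hom_add[OF l g g, of m n m' n] hom_add[OF f1, of n m m'] lg fc by (simp add: minus_eq_zero_iff[OF P])
  next
   assume "x\<in>{?g (m, n \<oplus>\<^sub>N n') \<ominus>\<^sub>?F (?g (m, n) \<oplus>\<^sub>?F ?g (m, n')) | m n n'. m\<in>carrier M & n\<in>carrier N & n'\<in>carrier N}"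
   then obtain m n n' where h: "x = ?g (m, n \<oplus>\<^sub>N n') \<ominus>\<^sub>?F (?g (m, n) \<oplus>\<^sub>?F ?g (m, n'))" "m\<in>carrier M" "n\<in>carrier N" "n'\<in>carrier N" by blast
   show ?thesis unfolding h(1) using h(2-4) hom_minus[OF F P l g F.M.a_closed[OF g g], of m "n \<oplus>\<^sub>N n'" m n m n']
     hom_add[OF l g g, of m n m n'] hom_add[OF f2, of m n n'] lg fc by (simp add: minus_eq_zero_iff[OF P])
  next
   assume "x\<in>{?g (r \<odot>\<^sub>M m, n) \<ominus>\<^sub>?F (r \<odot>\<^sub>?F ?g (m, n)) | r m n. r\<in>carrier R & m\<in>carrier M & n\<in>carrier N}"
   then obtain r m n where h: "x = ?g (r \<odot>\<^sub>M m, n) \<ominus>\<^sub>?F (r \<odot>\<^sub>?F ?g (m, n))" "r\<in>carrier R" "m\<in>carrier M" "n\<in>carrier N" by blast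
   show ?thesis unfolding h(1) using h(2-4) hom_minus[OF F P l g F.smult_closed[OF _ g], of "r \<odot>\<^sub>M m" n r m n]
     hom_smult[OF l _ g, of r m n] hom_smult[OF f1, of n r m] lg fc by (simp add: minus_eq_zero_iff[OF P])
  next
   assume "x\<in>{?g (m, r \<odot>\<^sub>N n) \<ominus>\<^sub>?F (r \<odot>\<^sub>?F ?g (m, n)) | r m n. r\<in>carrier R & m\<in>carrier M & n\<in>carrier N}"
   then obtain r m n where h: "x = ?g (m, r \<odot>\<^sub>N n) \<ominus>\<^sub>?F (r \<odot>\<^sub>?F ?g (m, n))" "r\<in>carrier R" "m\<in>carrier M" "n\<in>carrier N" by blast
   show ?thesis unfolding h(1) using h(2-4) hom_minus[OF F P l g F.smult_closed[OF _ g], of m "r \<odot>\<^sub>N n" r m n]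
     hom_smult[OF l _ g, of r m n] hom_smult[OF f2, of m r n] lg fc by (simp add: minus_eq_zero_iff[OF P])
  qed
  then show "x\<in>{x\<in>carrier ?F. ?l x = \<zero>\<^sub>P}" using x Rel by blast
 qed
 then have ker: "?l x = \<zero>\<^sub>P" if "x\<in>?K" for x using span(3)[OF kernel_submodule[OF F P l]] that by blast
 have qm: "EX h:mod_hom R (quot_module ?F ?K) P. ALL x:carrier ?F. h (?u x) = ?l x"
 proof -
  define h where "h A = ?l (SOME x. x\<in>carrier ?F & A = ?u x)" for A
  have h: "h (?u x) = ?l x" if x: "x\<in>carrier ?F" for x
  proof -
   define y where "y = (SOME y. y\<in>carrier ?F & ?u x = ?u y)"
   have "EX y. y\<in>carrier ?F & ?u x = ?u y" using x by blast
   from someI_ex[OF this] have y: "y\<in>carrier ?F" "?u x = ?u y" unfolding y_def by blast+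
   then have "?l (x \<ominus>\<^sub>?F y) = \<zero>\<^sub>P" using coset_eq_iff[OF F sub x y(1)] ker by blast
   then have "?l x = ?l y" unfolding hom_minus[OF F P l x y(1)] minus_eq_zero_iff[OF P hom_closed[OF l x] hom_closed[OF l y(1)]] .
   then show ?thesis by (simp add: h_def y_def)
  qed
  have "h\<in>mod_hom R (quot_module ?F ?K) P"
  proof (rule mod_homI)
   fix A B assume A: "A\<in>carrier (quot_module ?F ?K)" and B: "B\<in>carrier (quot_module ?F ?K)"
   obtain a where a: "a\<in>carrier ?F" "A = ?u a" using A unfolding mem_quot_module by blast
   obtain b where b: "b\<in>carrier ?F" "B = ?u b" using B unfolding mem_quot_module by blast
   show "h A\<in>carrier P" unfolding a(2) h[OF a(1)] by (rule hom_closed[OF l a(1)])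
   show "h (A \<oplus>\<^bsub>quot_module ?F ?K\<^esub> B) = h A \<oplus>\<^sub>P h B"
    unfolding a(2) b(2) quot_module_add[OF F sub a(1) b(1)] h[OF a(1)] h[OF b(1)] h[OF F.M.a_closed[OF a(1) b(1)]] by (rule hom_add[OF l a(1) b(1)])
  next
   fix r A assume r: "r\<in>carrier R" and A: "A\<in>carrier (quot_module ?F ?K)"
   obtain a where a: "a\<in>carrier ?F" "A = ?u a" using A unfolding mem_quot_module by blast
   show "h (r \<odot>\<^bsub>quot_module ?F ?K\<^esub> A) = r \<odot>\<^sub>P h A"
    unfolding a(2) quot_module_smult[OF F sub a(1) r] h[OF a(1)] h[OF F.smult_closed[OF r a(1)]] by (rule hom_smult[OF l r a(1)])
  qed
  then show ?thesis using h by blast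
 qed
 then show "EX h:mod_hom R (tensor R M N) P. ALL m:carrier M. ALL n:carrier N. h (pure_tensor R M N m n) = f m n"
  unfolding T pt using lg g by metis
qed

section \<open>Localization at a prime ideal\<close>

lemma cring_idealI:
 assumes R: "cring R" and "I <= carrier R" "\<zero>\<^sub>R\<in>I" and "!!a b. a\<in>I ==> b\<in>I ==> a \<oplus>\<^sub>R b\<in>I"
  and mult: "!!r a. r\<in>carrier R ==> a\<in>I ==> r \<otimes>\<^sub>R a\<in>I"
 shows "ideal I R"
proof -
 interpret R: cring R by (rule R)
 show ?thesis
 proof (rule idealI[OF R.ring_axioms])
  show "subgroup I (add_monoid R)"
  proof (rule R.add.subgroupI)
   show "\<ominus>\<^sub>R a\<in>I" if "a\<in>I" for a using mult[OF R.a_inv_closed[OF R.one_closed] that] that assms(2) by (auto simp: R.l_minus)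
  qed (use assms in auto)
  show "r \<otimes>\<^sub>R a\<in>I" "a \<otimes>\<^sub>R r\<in>I" if "a\<in>I" "r\<in>carrier R" for a r
   using mult[OF that(2,1)] R.m_comm[of a r] that assms(2) by auto
 qed
qed

lemma annihilator_ideal:
 assumes M: "module R M" and m: "m\<in>carrier M"
 shows "ideal (annihilator R M m) R"
proof -
 interpret M: module R M by (rule M)
 show ?thesis by (rule cring_idealI[OF M.R.is_cring]) (use m in "auto simp: annihilator_def M.smult_l_distr M.smult_assoc1")
qed

text \<open>Sending \<open>r b\<close> to \<open>r w\<close> is well defined on the multiples of
  \<open>b\<close> in \<open>R / I\<close>, by the last assumption; Baer's condition extends it to
  \<open>R / I\<close>, and \<open>e\<close> is the image of one. The divisions in \<open>E\<close>
  come from here, with \<open>I\<close> listing what has to kill the result.\<close>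

lemma baer_lift:
 assumes E: "baer_module R E" and I: "ideal I R" and b: "b\<in>carrier R" and w: "w\<in>carrier E"
  and z: "!!r. r\<in>carrier R ==> r \<otimes>\<^sub>R b\<in>I ==> r \<odot>\<^sub>E w = \<zero>\<^sub>E"
 obtains e where "e\<in>carrier E" "b \<odot>\<^sub>E e = w" "!!r. r\<in>I ==> r \<odot>\<^sub>E e = \<zero>\<^sub>E"
proof -
 have M: "module R E" using E by (simp add: baer_module_def)
 interpret E: module R E by (rule M)
 interpret I: ideal I R by (rule I)
 let ?SM = "self_module R"
 have S: "module R ?SM" by (rule module_self[OF E.R.is_cring])
 have sub: "submodule I R ?SM" by (rule submodule_self_ideal[OF E.R.is_cring I])
 have Qm: "module R (quot_module ?SM I)" by (rule quot_module_module[OF S sub])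
 let ?d = "%r. I +>\<^bsub>?SM\<^esub> (r \<otimes>\<^sub>R b)"
 have d: "?d\<in>mod_hom R ?SM (quot_module ?SM I)"
 proof (rule hom_comp[OF _ quot_proj_hom[OF S sub]])
  show "(%r. r \<otimes>\<^sub>R b)\<in>mod_hom R ?SM ?SM" using b by (intro mod_homI) (auto simp: E.R.l_distr E.R.m_assoc)
 qed
 have f: "(%r. r \<odot>\<^sub>E w)\<in>mod_hom R ?SM E" using w by (intro mod_homI) (auto simp: E.smult_l_distr E.smult_assoc1)
 have "EX g:mod_hom R (quot_module ?SM I) E. ALL r:carrier ?SM. g (?d r) = r \<odot>\<^sub>E w"
 proof (rule injective_factor[OF baer_criterion[OF E] S Qm d f])
  fix r assume "r\<in>carrier ?SM" "?d r = \<zero>\<^bsub>quot_module ?SM I\<^esub>"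
  then show "r \<odot>\<^sub>E w = \<zero>\<^sub>E" using b coset_eq_zero_iff[OF S sub, of "r \<otimes>\<^sub>R b"] z by simp
 qed
 then obtain g where g: "g\<in>mod_hom R (quot_module ?SM I) E" "!!r. r\<in>carrier R ==> g (?d r) = r \<odot>\<^sub>E w" by auto
 define e where "e = g (I +>\<^bsub>?SM\<^esub> \<one>\<^sub>R)"
 have one_q: "I +>\<^bsub>?SM\<^esub> \<one>\<^sub>R\<in>carrier (quot_module ?SM I)" unfolding mem_quot_module by auto
 have re: "r \<odot>\<^sub>E e = g (I +>\<^bsub>?SM\<^esub> r)" if r: "r\<in>carrier R" for r
  using hom_smult[OF g(1) r one_q] quot_module_smult[OF S sub _ r, of "\<one>\<^sub>R"] r by (simp add: e_def)
 show thesis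
 proof (rule that)
  show "e\<in>carrier E" unfolding e_def by (rule hom_closed[OF g(1) one_q])
  show "b \<odot>\<^sub>E e = w" using re[OF b] g(2)[OF E.R.one_closed] b w by simp
  fix r assume r: "r\<in>I"
  show "r \<odot>\<^sub>E e = \<zero>\<^sub>E"
   using re[OF I.Icarr[OF r]] coset_eq_zero_iff[OF S sub, of r] r I.Icarr[OF r] hom_zero[OF Qm M g(1)] by simp
 qed
qed

locale localization_at = R: cring R + P: primeideal p R for R :: "('a, 'r) ring_scheme" and p
begin

abbreviation S where "S \<equiv> carrier R - p"
abbreviation L where "L \<equiv> loc_ring R p"
abbreviation LM where "LM \<equiv> loc_module R p"

lemma S_one: "\<one>\<^sub>R\<in>S"
 using P.I_notcarr P.one_imp_carrier by auto

lemma S_mult: "s\<in>S ==> t\<in>S ==> s \<otimes>\<^sub>R t\<in>S"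
 using P.I_prime by auto

lemma S_carrier: "s\<in>S ==> s\<in>carrier R"
 by simp

lemma frac_rel_iff:
 assumes "module R M"
 shows "((m, s), (m', s'))\<in>frac_rel R p M \<longleftrightarrow>
  m\<in>carrier M & m'\<in>carrier M & s\<in>S & s'\<in>S & (EX u:S. (u \<otimes>\<^sub>R s') \<odot>\<^sub>M m = (u \<otimes>\<^sub>R s) \<odot>\<^sub>M m')"
proof -
 interpret M: module R M by fact
 have "u \<odot>\<^sub>M (s' \<odot>\<^sub>M m \<ominus>\<^sub>M s \<odot>\<^sub>M m') = \<zero>\<^sub>M \<longleftrightarrow> (u \<otimes>\<^sub>R s') \<odot>\<^sub>M m = (u \<otimes>\<^sub>R s) \<odot>\<^sub>M m'"
  if h: "m\<in>carrier M" "m'\<in>carrier M" "s\<in>S" "s'\<in>S" "u\<in>S" for u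
 proof -
  have "u \<odot>\<^sub>M (s' \<odot>\<^sub>M m \<ominus>\<^sub>M s \<odot>\<^sub>M m') = (u \<otimes>\<^sub>R s') \<odot>\<^sub>M m \<ominus>\<^sub>M (u \<otimes>\<^sub>R s) \<odot>\<^sub>M m'"
   using h by (simp add: a_minus_def M.smult_r_distr M.smult_r_minus M.smult_assoc1)
  then show ?thesis using h by (simp add: minus_eq_zero_iff[OF assms])
 qed
 then show ?thesis unfolding frac_rel_def by auto
qed

lemma frac_rel_equiv:
 assumes "module R M" shows "equiv (carrier M \<times> S) (frac_rel R p M)"
proof -
 interpret M: module R M by fact
 note iff = frac_rel_iff[OF assms]
 show ?thesis
 proof (rule equivI)
  show "frac_rel R p M <= (carrier M \<times> S) \<times> (carrier M \<times> S)" by (auto simp: frac_rel_def)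
  show "refl_on (carrier M \<times> S) (frac_rel R p M)" by (rule refl_onI) (use S_one in "auto simp: iff")
  show "sym (frac_rel R p M)"
  proof (rule symI)
   fix x y assume "(x, y)\<in>frac_rel R p M"
   then show "(y, x)\<in>frac_rel R p M" by (cases x; cases y) (auto simp: iff intro: sym)
  qed
  show "trans (frac_rel R p M)"
  proof (rule transI)
   fix x y z assume xy: "(x, y)\<in>frac_rel R p M" and yz: "(y, z)\<in>frac_rel R p M"
   obtain m s m' s' m'' s'' where e: "x = (m, s)" "y = (m', s')" "z = (m'', s'')" by (cases x; cases y; cases z)
   obtain u v where u: "u\<in>S" "(u \<otimes>\<^sub>R s') \<odot>\<^sub>M m = (u \<otimes>\<^sub>R s) \<odot>\<^sub>M m'"
    and v: "v\<in>S" "(v \<otimes>\<^sub>R s'') \<odot>\<^sub>M m' = (v \<otimes>\<^sub>R s') \<odot>\<^sub>M m''"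
    and c: "m\<in>carrier M" "m'\<in>carrier M" "m''\<in>carrier M" "s\<in>S" "s'\<in>S" "s''\<in>S" using xy yz unfolding e iff by auto
   note cc = S_carrier[OF u(1)] S_carrier[OF v(1)] S_carrier[OF c(4)] S_carrier[OF c(5)] S_carrier[OF c(6)]
   have "((u \<otimes>\<^sub>R v \<otimes>\<^sub>R s') \<otimes>\<^sub>R s'') \<odot>\<^sub>M m = (v \<otimes>\<^sub>R s'') \<odot>\<^sub>M ((u \<otimes>\<^sub>R s') \<odot>\<^sub>M m)"
    using cc c(1) by (simp flip: M.smult_assoc1 add: R.m_ac)
   also have "... = (u \<otimes>\<^sub>R s) \<odot>\<^sub>M ((v \<otimes>\<^sub>R s'') \<odot>\<^sub>M m')"
    unfolding u(2) using cc c(2) by (simp flip: M.smult_assoc1 add: R.m_ac)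
   also have "... = ((u \<otimes>\<^sub>R v \<otimes>\<^sub>R s') \<otimes>\<^sub>R s) \<odot>\<^sub>M m''"
    unfolding v(2) using cc c(3) by (simp flip: M.smult_assoc1 add: R.m_ac)
   finally show "(x, z)\<in>frac_rel R p M" unfolding e iff using c S_mult[OF S_mult[OF u(1) v(1)] c(5)] by blast
  qed
 qed
qed

lemma frac_eq_iff:
 assumes "module R M" "m\<in>carrier M" "m'\<in>carrier M" "s\<in>S" "s'\<in>S"
 shows "frac R p M m s = frac R p M m' s' \<longleftrightarrow> (EX u:S. (u \<otimes>\<^sub>R s') \<odot>\<^sub>M m = (u \<otimes>\<^sub>R s) \<odot>\<^sub>M m')"
 unfolding frac_def using eq_equiv_class_iff[OF frac_rel_equiv[OF assms(1)], of "(m, s)" "(m', s')"] assms(2-)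
 by (simp add: frac_rel_iff[OF assms(1)])

lemma mem_frac_iff: "module R M ==> x\<in>frac R p M m s \<longleftrightarrow> ((m, s), x)\<in>frac_rel R p M"
 by (auto simp: frac_def)

text \<open>Operations on fractions are unions over all representatives; they can be evaluated at
  one of them once independence of the choice is known.\<close>

lemma UN_frac:
 assumes M: "module R M" and "m\<in>carrier M" "s\<in>S"
  and "!!m' s' u. m'\<in>carrier M ==> s'\<in>S ==> u\<in>S ==> (u \<otimes>\<^sub>R s') \<odot>\<^sub>M m = (u \<otimes>\<^sub>R s) \<odot>\<^sub>M m' ==> f m' s' = f m s"
 shows "(\<Union>(m', s')\<in>frac R p M m s. f m' s') = f m s"
proof (rule UN_const_on)
 have "((m, s), (m, s))\<in>frac_rel R p M" unfolding frac_rel_iff[OF M] using assms(2,3) S_one by blast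
 then show "frac R p M m s ~= {}" by (auto simp: frac_def)
 fix x assume x: "x\<in>frac R p M m s"
 obtain m' s' where "x = (m', s')" by (cases x)
 then show "(case x of (m', s') => f m' s') = f m s" using x assms(4) unfolding mem_frac_iff[OF M] by (auto simp: frac_rel_iff[OF M])
qed

lemma loc_carrier:
 "A\<in>carrier (LM M) \<longleftrightarrow> (EX m:carrier M. EX s:S. A = frac R p M m s)"
 by (auto simp: loc_module_def frac_def quotient_def)

lemma frac_closed: "m\<in>carrier M ==> s\<in>S ==> frac R p M m s\<in>carrier (LM M)"
 unfolding loc_carrier by blast

lemma frac_cancel:
 assumes "module R M" "m\<in>carrier M" "s\<in>S" "u\<in>S"
 shows "frac R p M (u \<odot>\<^sub>M m) (u \<otimes>\<^sub>R s) = frac R p M m s"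
proof -
 interpret M: module R M by fact
 note c = assms(2) S_carrier[OF assms(3)] S_carrier[OF assms(4)]
 have "(\<one>\<^sub>R \<otimes>\<^sub>R s) \<odot>\<^sub>M (u \<odot>\<^sub>M m) = (\<one>\<^sub>R \<otimes>\<^sub>R (u \<otimes>\<^sub>R s)) \<odot>\<^sub>M m"
  using c by (simp flip: M.smult_assoc1 add: R.m_ac)
 then show ?thesis using frac_eq_iff[OF assms(1) M.smult_closed[OF c(3,1)] c(1) S_mult[OF assms(4,3)] assms(3)] S_one by blast
qed

text \<open>Expanding both fractions to one denominator reduces sums to
  \<open>frac_add_same\<close>.\<close>

lemma loc_module_common:
 assumes M: "module R M" and "A\<in>carrier (LM M)" "B\<in>carrier (LM M)"
 obtains m m' s where "m\<in>carrier M" "m'\<in>carrier M" "s\<in>S" "A = frac R p M m s" "B = frac R p M m' s"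
proof -
 interpret M: module R M by fact
 obtain m s m' t where h: "m\<in>carrier M" "s\<in>S" "A = frac R p M m s" "m'\<in>carrier M" "t\<in>S" "B = frac R p M m' t"
  using assms(2,3) unfolding loc_carrier by blast
 have "A = frac R p M (t \<odot>\<^sub>M m) (t \<otimes>\<^sub>R s)" "B = frac R p M (s \<odot>\<^sub>M m') (t \<otimes>\<^sub>R s)"
  using frac_cancel[OF M h(1,2,5)] frac_cancel[OF M h(4,5,2)] h(3,6) R.m_comm[OF S_carrier[OF h(2)] S_carrier[OF h(5)]] by auto
 then show thesis using that M.smult_closed[OF S_carrier[OF h(5)] h(1)] M.smult_closed[OF S_carrier[OF h(2)] h(4)] S_mult[OF h(5,2)] by blast
qed

lemma frac_add:
 assumes M: "module R M" and c: "m\<in>carrier M" "s\<in>S" "m'\<in>carrier M" "t\<in>S"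
 shows "frac R p M m s \<oplus>\<^bsub>LM M\<^esub> frac R p M m' t = frac R p M (t \<odot>\<^sub>M m \<oplus>\<^sub>M s \<odot>\<^sub>M m') (s \<otimes>\<^sub>R t)"
proof -
 interpret M: module R M by fact
 have cong: "frac R p M (t1 \<odot>\<^sub>M m1 \<oplus>\<^sub>M s1 \<odot>\<^sub>M m1') (s1 \<otimes>\<^sub>R t1) = frac R p M (t \<odot>\<^sub>M m \<oplus>\<^sub>M s \<odot>\<^sub>M m') (s \<otimes>\<^sub>R t)"
  if h: "m1\<in>carrier M" "s1\<in>S" "u\<in>S" "(u \<otimes>\<^sub>R s1) \<odot>\<^sub>M m = (u \<otimes>\<^sub>R s) \<odot>\<^sub>M m1"
   "m1'\<in>carrier M" "t1\<in>S" "v\<in>S" "(v \<otimes>\<^sub>R t1) \<odot>\<^sub>M m' = (v \<otimes>\<^sub>R t) \<odot>\<^sub>M m1'" for m1 s1 u m1' t1 v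
 proof -
  note cc = S_carrier[OF c(2)] S_carrier[OF c(4)] S_carrier[OF h(2)] S_carrier[OF h(3)] S_carrier[OF h(6)] S_carrier[OF h(7)]
  have "((u \<otimes>\<^sub>R v) \<otimes>\<^sub>R (s \<otimes>\<^sub>R t)) \<odot>\<^sub>M (t1 \<odot>\<^sub>M m1 \<oplus>\<^sub>M s1 \<odot>\<^sub>M m1') =
    (v \<otimes>\<^sub>R t \<otimes>\<^sub>R t1) \<odot>\<^sub>M ((u \<otimes>\<^sub>R s) \<odot>\<^sub>M m1) \<oplus>\<^sub>M (u \<otimes>\<^sub>R s \<otimes>\<^sub>R s1) \<odot>\<^sub>M ((v \<otimes>\<^sub>R t) \<odot>\<^sub>M m1')"
   using cc h(1,5) by (simp flip: M.smult_assoc1 add: M.smult_r_distr R.m_ac)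
  also have "... = ((u \<otimes>\<^sub>R v) \<otimes>\<^sub>R (s1 \<otimes>\<^sub>R t1)) \<odot>\<^sub>M (t \<odot>\<^sub>M m \<oplus>\<^sub>M s \<odot>\<^sub>M m')"
   unfolding h(4,8)[symmetric] using cc c(1,3) by (simp flip: M.smult_assoc1 add: M.smult_r_distr R.m_ac)
  finally show ?thesis using cc c h S_mult[OF h(3,7)] S_mult[OF h(2,6)] S_mult[OF c(2,4)]
   by (subst frac_eq_iff[OF M]) (auto intro!: bexI[of _ "u \<otimes>\<^sub>R v"])
 qed
 have "frac R p M m s \<oplus>\<^bsub>LM M\<^esub> frac R p M m' t =
   (\<Union>(m1, s1)\<in>frac R p M m s. \<Union>(m1', t1)\<in>frac R p M m' t. frac R p M (t1 \<odot>\<^sub>M m1 \<oplus>\<^sub>M s1 \<odot>\<^sub>M m1') (s1 \<otimes>\<^sub>R t1))"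
  by (simp add: loc_module_def)
 also have "... = (\<Union>(m1', t1)\<in>frac R p M m' t. frac R p M (t1 \<odot>\<^sub>M m \<oplus>\<^sub>M s \<odot>\<^sub>M m1') (s \<otimes>\<^sub>R t1))"
 proof (rule UN_frac[OF M c(1,2)])
  fix m1 s1 u assume h: "m1\<in>carrier M" "s1\<in>S" "u\<in>S" "(u \<otimes>\<^sub>R s1) \<odot>\<^sub>M m = (u \<otimes>\<^sub>R s) \<odot>\<^sub>M m1"
  have "(\<Union>(m1', t1)\<in>frac R p M m' t. frac R p M (t1 \<odot>\<^sub>M m1 \<oplus>\<^sub>M s1 \<odot>\<^sub>M m1') (s1 \<otimes>\<^sub>R t1)) =
    frac R p M (t \<odot>\<^sub>M m1 \<oplus>\<^sub>M s1 \<odot>\<^sub>M m') (s1 \<otimes>\<^sub>R t)"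
   by (rule UN_frac[OF M c(3,4)]) (use cong[OF h] cong[OF h c(3,4) S_one refl] in simp)
  moreover have "(\<Union>(m1', t1)\<in>frac R p M m' t. frac R p M (t1 \<odot>\<^sub>M m \<oplus>\<^sub>M s \<odot>\<^sub>M m1') (s \<otimes>\<^sub>R t1)) =
    frac R p M (t \<odot>\<^sub>M m \<oplus>\<^sub>M s \<odot>\<^sub>M m') (s \<otimes>\<^sub>R t)"
   by (rule UN_frac[OF M c(3,4)]) (rule cong[OF c(1,2) S_one refl])
  ultimately show "(\<Union>(m1', t1)\<in>frac R p M m' t. frac R p M (t1 \<odot>\<^sub>M m1 \<oplus>\<^sub>M s1 \<odot>\<^sub>M m1') (s1 \<otimes>\<^sub>R t1)) =
    (\<Union>(m1', t1)\<in>frac R p M m' t. frac R p M (t1 \<odot>\<^sub>M m \<oplus>\<^sub>M s \<odot>\<^sub>M m1') (s \<otimes>\<^sub>R t1))"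
   using cong[OF h c(3,4) S_one refl] by simp
 qed
 also have "... = frac R p M (t \<odot>\<^sub>M m \<oplus>\<^sub>M s \<odot>\<^sub>M m') (s \<otimes>\<^sub>R t)"
  by (rule UN_frac[OF M c(3,4)]) (rule cong[OF c(1,2) S_one refl])
 finally show ?thesis .
qed

lemma frac_add_same:
 assumes M: "module R M" and c: "m\<in>carrier M" "m'\<in>carrier M" "s\<in>S"
 shows "frac R p M m s \<oplus>\<^bsub>LM M\<^esub> frac R p M m' s = frac R p M (m \<oplus>\<^sub>M m') s"
proof -
 interpret M: module R M by fact
 have "frac R p M m s \<oplus>\<^bsub>LM M\<^esub> frac R p M m' s = frac R p M (s \<odot>\<^sub>M (m \<oplus>\<^sub>M m')) (s \<otimes>\<^sub>R s)"
  unfolding frac_add[OF M c(1,3,2,3)] using M.smult_r_distr[OF S_carrier[OF c(3)] c(1,2)] by simp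
 then show ?thesis using frac_cancel[OF M M.M.a_closed[OF c(1,2)] c(3,3)] by simp
qed

lemma frac_smult:
 assumes M: "module R M" and c: "a\<in>carrier R" "s\<in>S" "m\<in>carrier M" "t\<in>S"
 shows "frac R p (self_module R) a s \<odot>\<^bsub>LM M\<^esub> frac R p M m t = frac R p M (a \<odot>\<^sub>M m) (s \<otimes>\<^sub>R t)"
proof -
 interpret M: module R M by fact
 have SM: "module R (self_module R)" by (rule module_self[OF R.is_cring])
 have c1: "a\<in>carrier (self_module R)" using c(1) by simp
 have cong: "frac R p M (a1 \<odot>\<^sub>M m1) (s1 \<otimes>\<^sub>R t1) = frac R p M (a \<odot>\<^sub>M m) (s \<otimes>\<^sub>R t)"
  if h: "a1\<in>carrier (self_module R)" "s1\<in>S" "u\<in>S" "(u \<otimes>\<^sub>R s1) \<odot>\<^bsub>self_module R\<^esub> a = (u \<otimes>\<^sub>R s) \<odot>\<^bsub>self_module R\<^esub> a1"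
   "m1\<in>carrier M" "t1\<in>S" "v\<in>S" "(v \<otimes>\<^sub>R t1) \<odot>\<^sub>M m = (v \<otimes>\<^sub>R t) \<odot>\<^sub>M m1" for a1 s1 u m1 t1 v
 proof -
  have h4: "(u \<otimes>\<^sub>R s1) \<otimes>\<^sub>R a = (u \<otimes>\<^sub>R s) \<otimes>\<^sub>R a1" and h1: "a1\<in>carrier R" using h(1,4) by simp_all
  note cc = S_carrier[OF c(2)] S_carrier[OF c(4)] S_carrier[OF h(2)] S_carrier[OF h(3)] S_carrier[OF h(6)] S_carrier[OF h(7)]
  have "((u \<otimes>\<^sub>R v) \<otimes>\<^sub>R (s \<otimes>\<^sub>R t)) \<odot>\<^sub>M (a1 \<odot>\<^sub>M m1) = ((u \<otimes>\<^sub>R s) \<otimes>\<^sub>R a1) \<odot>\<^sub>M ((v \<otimes>\<^sub>R t) \<odot>\<^sub>M m1)"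
   using cc h(5) h1 by (simp flip: M.smult_assoc1 add: R.m_ac)
  also have "... = ((u \<otimes>\<^sub>R v) \<otimes>\<^sub>R (s1 \<otimes>\<^sub>R t1)) \<odot>\<^sub>M (a \<odot>\<^sub>M m)"
   unfolding h4[symmetric] h(8)[symmetric] using cc c(1,3) by (simp flip: M.smult_assoc1 add: R.m_ac)
  finally show ?thesis using cc c h h1 S_mult[OF h(3,7)] S_mult[OF h(2,6)] S_mult[OF c(2,4)]
   by (subst frac_eq_iff[OF M]) (auto intro!: bexI[of _ "u \<otimes>\<^sub>R v"])
 qed
 have "frac R p (self_module R) a s \<odot>\<^bsub>LM M\<^esub> frac R p M m t =
   (\<Union>(a1, s1)\<in>frac R p (self_module R) a s. \<Union>(m1, t1)\<in>frac R p M m t. frac R p M (a1 \<odot>\<^sub>M m1) (s1 \<otimes>\<^sub>R t1))"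
  by (simp add: loc_module_def)
 also have "... = (\<Union>(m1, t1)\<in>frac R p M m t. frac R p M (a \<odot>\<^sub>M m1) (s \<otimes>\<^sub>R t1))"
 proof (rule UN_frac[OF SM c1 c(2)])
  fix a1 s1 u assume h: "a1\<in>carrier (self_module R)" "s1\<in>S" "u\<in>S" "(u \<otimes>\<^sub>R s1) \<odot>\<^bsub>self_module R\<^esub> a = (u \<otimes>\<^sub>R s) \<odot>\<^bsub>self_module R\<^esub> a1"
  have "(\<Union>(m1, t1)\<in>frac R p M m t. frac R p M (a1 \<odot>\<^sub>M m1) (s1 \<otimes>\<^sub>R t1)) = frac R p M (a1 \<odot>\<^sub>M m) (s1 \<otimes>\<^sub>R t)"
   by (rule UN_frac[OF M c(3,4)]) (use cong[OF h] cong[OF h c(3,4) S_one refl] in simp)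
  moreover have "(\<Union>(m1, t1)\<in>frac R p M m t. frac R p M (a \<odot>\<^sub>M m1) (s \<otimes>\<^sub>R t1)) = frac R p M (a \<odot>\<^sub>M m) (s \<otimes>\<^sub>R t)"
   by (rule UN_frac[OF M c(3,4)]) (rule cong[OF c1 c(2) S_one refl])
  ultimately show "(\<Union>(m1, t1)\<in>frac R p M m t. frac R p M (a1 \<odot>\<^sub>M m1) (s1 \<otimes>\<^sub>R t1)) =
    (\<Union>(m1, t1)\<in>frac R p M m t. frac R p M (a \<odot>\<^sub>M m1) (s \<otimes>\<^sub>R t1))" using cong[OF h c(3,4) S_one refl] by simp
 qed
 also have "... = frac R p M (a \<odot>\<^sub>M m) (s \<otimes>\<^sub>R t)" by (rule UN_frac[OF M c(3,4)]) (rule cong[OF c1 c(2) S_one refl])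
 finally show ?thesis .
qed

lemma frac_eq_zero_iff:
 assumes M: "module R M" and c: "m\<in>carrier M" "s\<in>S"
 shows "frac R p M m s = \<zero>\<^bsub>LM M\<^esub> \<longleftrightarrow> (EX u:S. u \<odot>\<^sub>M m = \<zero>\<^sub>M)"
proof -
 interpret M: module R M by fact
 have z: "\<zero>\<^bsub>LM M\<^esub> = frac R p M \<zero>\<^sub>M \<one>\<^sub>R" by (simp add: loc_module_def)
 show ?thesis unfolding z frac_eq_iff[OF M c(1) M.M.zero_closed c(2) S_one] using c by (auto simp: Bex_def)
qed

lemma loc_module_zero: "module R M ==> s\<in>S ==> \<zero>\<^bsub>LM M\<^esub> = frac R p M \<zero>\<^sub>M s"
proof -
 assume M: "module R M" and s: "s\<in>S"
 interpret M: module R M by fact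
 show ?thesis using frac_eq_zero_iff[OF M M.M.zero_closed s] S_one M.smult_r_null[of "\<one>\<^sub>R"] by (metis R.one_closed)
qed

lemma loc_module_abelian_group:
 assumes M: "module R M" shows "abelian_group (LM M)"
proof -
 interpret M: module R M by fact
 show ?thesis
 proof (rule abelian_groupI)
  fix A B assume A: "A\<in>carrier (LM M)" and B: "B\<in>carrier (LM M)"
  obtain m m' s where h: "m\<in>carrier M" "m'\<in>carrier M" "s\<in>S" "A = frac R p M m s" "B = frac R p M m' s"
   by (rule loc_module_common[OF M A B])
  show "A \<oplus>\<^bsub>LM M\<^esub> B\<in>carrier (LM M)"
   unfolding h(4,5) frac_add_same[OF M h(1-3)] by (rule frac_closed[OF M.M.a_closed[OF h(1,2)] h(3)])
  show "A \<oplus>\<^bsub>LM M\<^esub> B = B \<oplus>\<^bsub>LM M\<^esub> A"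
   unfolding h(4,5) frac_add_same[OF M h(1-3)] frac_add_same[OF M h(2,1,3)] M.M.a_comm[OF h(1,2)] ..
  fix C assume C: "C\<in>carrier (LM M)"
  obtain m'' t where g: "m''\<in>carrier M" "t\<in>S" "C = frac R p M m'' t" using C unfolding loc_carrier by blast
  let ?k = "t \<otimes>\<^sub>R s"
  note sm = M.smult_closed[OF S_carrier[OF g(2)] h(1)] M.smult_closed[OF S_carrier[OF g(2)] h(2)] M.smult_closed[OF S_carrier[OF h(3)] g(1)]
  note k = S_mult[OF g(2) h(3)]
  have A': "A = frac R p M (t \<odot>\<^sub>M m) ?k" and B': "B = frac R p M (t \<odot>\<^sub>M m') ?k" and C': "C = frac R p M (s \<odot>\<^sub>M m'') ?k"
   using frac_cancel[OF M h(1,3) g(2)] frac_cancel[OF M h(2,3) g(2)] frac_cancel[OF M g(1,2) h(3)] h(4,5) g(3)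
    R.m_comm[OF S_carrier[OF g(2)] S_carrier[OF h(3)]] by auto
  show "A \<oplus>\<^bsub>LM M\<^esub> B \<oplus>\<^bsub>LM M\<^esub> C = A \<oplus>\<^bsub>LM M\<^esub> (B \<oplus>\<^bsub>LM M\<^esub> C)"
   unfolding A' B' C' frac_add_same[OF M sm(1,2) k] frac_add_same[OF M sm(2,3) k]
    frac_add_same[OF M M.M.a_closed[OF sm(1,2)] sm(3) k] frac_add_same[OF M sm(1) M.M.a_closed[OF sm(2,3)] k] using M.M.a_assoc[OF sm] by simp
 next
  show "\<zero>\<^bsub>LM M\<^esub>\<in>carrier (LM M)" unfolding loc_module_zero[OF M S_one] by (rule frac_closed[OF M.M.zero_closed S_one])
  fix A assume "A\<in>carrier (LM M)"
  then obtain m s where h: "m\<in>carrier M" "s\<in>S" "A = frac R p M m s" unfolding loc_carrier by blast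
  show "\<zero>\<^bsub>LM M\<^esub> \<oplus>\<^bsub>LM M\<^esub> A = A"
   unfolding loc_module_zero[OF M h(2)] h(3) frac_add_same[OF M M.M.zero_closed h(1,2)] using h(1) by simp
  show "EX B:carrier (LM M). B \<oplus>\<^bsub>LM M\<^esub> A = \<zero>\<^bsub>LM M\<^esub>"
  proof (rule bexI[OF _ frac_closed[OF M.M.a_inv_closed[OF h(1)] h(2)]])
   show "frac R p M (\<ominus>\<^sub>M m) s \<oplus>\<^bsub>LM M\<^esub> A = \<zero>\<^bsub>LM M\<^esub>"
    unfolding h(3) frac_add_same[OF M M.M.a_inv_closed[OF h(1)] h(1,2)] M.M.l_neg[OF h(1)] by (rule loc_module_zero[OF M h(2), symmetric])
  qed
 qed
qed

lemma self_mod: "module R (self_module R)"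
 by (rule module_self[OF R.is_cring])

text \<open>The ring of fractions is the localization of \<open>R\<close> as a module over itself,
  operation by operation. Its axioms can thus be taken from the lemmas on
  \<open>loc_module\<close>.\<close>

lemma loc_ring_simps:
 "carrier L = carrier (LM (self_module R))" "add L = add (LM (self_module R))" "zero L = zero (LM (self_module R))"
 "mult L = smult (LM (self_module R))" "one L = frac R p (self_module R) \<one>\<^sub>R \<one>\<^sub>R"
 by (simp_all add: loc_ring_def loc_module_def Let_def)

lemma loc_ring_carrier: "A\<in>carrier L \<longleftrightarrow> (EX a:carrier R. EX s:S. A = frac R p (self_module R) a s)"
 unfolding loc_ring_simps loc_carrier by simp

lemma loc_frac_smult_closed:
 assumes "module R M" "A\<in>carrier L" "B\<in>carrier (LM M)"
 shows "A \<odot>\<^bsub>LM M\<^esub> B\<in>carrier (LM M)"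
proof -
 interpret M: module R M by fact
 obtain a s where a: "a\<in>carrier R" "s\<in>S" "A = frac R p (self_module R) a s" using assms(2) unfolding loc_ring_carrier by blast
 obtain m t where m: "m\<in>carrier M" "t\<in>S" "B = frac R p M m t" using assms(3) unfolding loc_carrier by blast
 show ?thesis unfolding a(3) m(3) frac_smult[OF assms(1) a(1,2) m(1,2)] by (rule frac_closed[OF M.smult_closed[OF a(1) m(1)] S_mult[OF a(2) m(2)]])
qed

lemma loc_smult_assoc:
 assumes M: "module R M" and "A\<in>carrier L" "B\<in>carrier L" "C\<in>carrier (LM M)"
 shows "(A \<otimes>\<^sub>L B) \<odot>\<^bsub>LM M\<^esub> C = A \<odot>\<^bsub>LM M\<^esub> (B \<odot>\<^bsub>LM M\<^esub> C)"
proof -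
 interpret M: module R M by fact
 obtain a s where a: "a\<in>carrier R" "s\<in>S" "A = frac R p (self_module R) a s" using assms(2) unfolding loc_ring_carrier by blast
 obtain b t where b: "b\<in>carrier R" "t\<in>S" "B = frac R p (self_module R) b t" using assms(3) unfolding loc_ring_carrier by blast
 obtain m r where m: "m\<in>carrier M" "r\<in>S" "C = frac R p M m r" using assms(4) unfolding loc_carrier by blast
 have b': "b\<in>carrier (self_module R)" using b(1) by simp
 show ?thesis unfolding a(3) b(3) m(3) loc_ring_simps frac_smult[OF self_mod a(1,2) b' b(2)] frac_smult[OF M b(1,2) m(1,2)]
   frac_smult[OF M a(1,2) M.smult_closed[OF b(1) m(1)] S_mult[OF b(2) m(2)]]
  using frac_smult[OF M R.m_closed[OF a(1) b(1)] S_mult[OF a(2) b(2)] m(1,2)] M.smult_assoc1[OF a(1) b(1) m(1)]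
   R.m_assoc[OF S_carrier[OF a(2)] S_carrier[OF b(2)] S_carrier[OF m(2)]] by simp
qed

lemma loc_smult_l_distr:
 assumes M: "module R M" and "A\<in>carrier L" "B\<in>carrier L" "C\<in>carrier (LM M)"
 shows "(A \<oplus>\<^sub>L B) \<odot>\<^bsub>LM M\<^esub> C = (A \<odot>\<^bsub>LM M\<^esub> C) \<oplus>\<^bsub>LM M\<^esub> (B \<odot>\<^bsub>LM M\<^esub> C)"
proof -
 interpret M: module R M by fact
 obtain a b s where a: "a\<in>carrier (self_module R)" "b\<in>carrier (self_module R)" "s\<in>S"
  "A = frac R p (self_module R) a s" "B = frac R p (self_module R) b s"
  using loc_module_common[OF self_mod] assms(2,3) unfolding loc_ring_simps by blast
 obtain m r where m: "m\<in>carrier M" "r\<in>S" "C = frac R p M m r" using assms(4) unfolding loc_carrier by blast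
 have a': "a\<in>carrier R" "b\<in>carrier R" using a(1,2) by auto
 have ab: "a \<oplus>\<^bsub>self_module R\<^esub> b = a \<oplus>\<^sub>R b" by simp
 show ?thesis unfolding a(4,5) m(3) loc_ring_simps frac_add_same[OF self_mod a(1-3)] ab frac_smult[OF M R.a_closed[OF a'] a(3) m(1,2)]
   frac_smult[OF M a'(1) a(3) m(1,2)] frac_smult[OF M a'(2) a(3) m(1,2)]
   frac_add_same[OF M M.smult_closed[OF a'(1) m(1)] M.smult_closed[OF a'(2) m(1)] S_mult[OF a(3) m(2)]]
   M.smult_l_distr[OF a' m(1)] ..
qed

lemma loc_smult_r_distr:
 assumes M: "module R M" and "A\<in>carrier L" "B\<in>carrier (LM M)" "C\<in>carrier (LM M)"
 shows "A \<odot>\<^bsub>LM M\<^esub> (B \<oplus>\<^bsub>LM M\<^esub> C) = (A \<odot>\<^bsub>LM M\<^esub> B) \<oplus>\<^bsub>LM M\<^esub> (A \<odot>\<^bsub>LM M\<^esub> C)"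
proof -
 interpret M: module R M by fact
 obtain a s where a: "a\<in>carrier R" "s\<in>S" "A = frac R p (self_module R) a s" using assms(2) unfolding loc_ring_carrier by blast
 obtain m m' r where m: "m\<in>carrier M" "m'\<in>carrier M" "r\<in>S" "B = frac R p M m r" "C = frac R p M m' r"
  by (rule loc_module_common[OF M assms(3,4)])
 show ?thesis unfolding a(3) m(4,5) frac_add_same[OF M m(1-3)] frac_smult[OF M a(1,2) M.M.a_closed[OF m(1,2)] m(3)]
   frac_smult[OF M a(1,2) m(1,3)] frac_smult[OF M a(1,2) m(2,3)]
   frac_add_same[OF M M.smult_closed[OF a(1) m(1)] M.smult_closed[OF a(1) m(2)] S_mult[OF a(2) m(3)]]
   M.smult_r_distr[OF a(1) m(1,2)] ..
qed

lemma loc_smult_one: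
 assumes M: "module R M" and "A\<in>carrier (LM M)" shows "\<one>\<^sub>L \<odot>\<^bsub>LM M\<^esub> A = A"
proof -
 interpret M: module R M by fact
 obtain m r where m: "m\<in>carrier M" "r\<in>S" "A = frac R p M m r" using assms(2) unfolding loc_carrier by blast
 show ?thesis unfolding m(3) loc_ring_simps frac_smult[OF M R.one_closed S_one m(1,2)] using m(1,2) by simp
qed

lemma loc_ring_cring: "cring L"
proof -
 have ab: "abelian_group L" by (rule abelian_group_eqI[OF loc_module_abelian_group[OF self_mod]]) (simp_all add: loc_ring_simps)
 have comm: "A \<otimes>\<^sub>L B = B \<otimes>\<^sub>L A" if A: "A\<in>carrier L" and B: "B\<in>carrier L" for A B
 proof -
  obtain a s where a: "a\<in>carrier R" "s\<in>S" "A = frac R p (self_module R) a s" using A unfolding loc_ring_carrier by blast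
  obtain b t where b: "b\<in>carrier R" "t\<in>S" "B = frac R p (self_module R) b t" using B unfolding loc_ring_carrier by blast
  have c: "a\<in>carrier (self_module R)" "b\<in>carrier (self_module R)" using a b by auto
  show ?thesis unfolding a(3) b(3) loc_ring_simps frac_smult[OF self_mod a(1,2) c(2) b(2)] frac_smult[OF self_mod b(1,2) c(1) a(2)]
   using R.m_comm[OF a(1) b(1)] R.m_comm[OF S_carrier[OF a(2)] S_carrier[OF b(2)]] by simp
 qed
 show ?thesis
 proof (rule cringI[OF ab])
  show "comm_monoid L"
  proof (rule comm_monoidI)
   show "A \<otimes>\<^sub>L B\<in>carrier L" if "A\<in>carrier L" "B\<in>carrier L" for A B
    using loc_frac_smult_closed[OF self_mod that(1)] that(2) unfolding loc_ring_simps by blast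
   show "\<one>\<^sub>L\<in>carrier L"  unfolding loc_ring_simps(1,5) by (rule frac_closed[OF _ S_one]) simp
   show "(A \<otimes>\<^sub>L B) \<otimes>\<^sub>L C = A \<otimes>\<^sub>L (B \<otimes>\<^sub>L C)" if "A\<in>carrier L" "B\<in>carrier L" "C\<in>carrier L" for A B C
    using loc_smult_assoc[OF self_mod that(1,2), of C] that(3) unfolding loc_ring_simps by blast
   show "\<one>\<^sub>L \<otimes>\<^sub>L A = A" if "A\<in>carrier L" for A
    using loc_smult_one[OF self_mod, of A] that unfolding loc_ring_simps by blast
  qed (rule comm)
  show "(A \<oplus>\<^sub>L B) \<otimes>\<^sub>L C = A \<otimes>\<^sub>L C \<oplus>\<^sub>L B \<otimes>\<^sub>L C" if "A\<in>carrier L" "B\<in>carrier L" "C\<in>carrier L" for A B C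
   using loc_smult_l_distr[OF self_mod that(1,2), of C] that(3) unfolding loc_ring_simps by blast
 qed
qed

lemma loc_module_module: "module R M ==> module L (LM M)"
 by (rule moduleI[OF loc_ring_cring loc_module_abelian_group loc_frac_smult_closed loc_smult_l_distr loc_smult_r_distr
    loc_smult_assoc loc_smult_one])

lemma loc_hom_frac:
 assumes M: "module R M" and N: "module R N" and f: "f\<in>mod_hom R M N" and c: "m\<in>carrier M" "s\<in>S"
 shows "(\<Union>(m', s')\<in>frac R p M m s. frac R p N (f m') s') = frac R p N (f m) s"
proof (rule UN_frac[OF M c])
 interpret M: module R M by fact
 fix m' s' u assume h: "m'\<in>carrier M" "s'\<in>S" "u\<in>S" "(u \<otimes>\<^sub>R s') \<odot>\<^sub>M m = (u \<otimes>\<^sub>R s) \<odot>\<^sub>M m'"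
 have "f ((u \<otimes>\<^sub>R s') \<odot>\<^sub>M m) = f ((u \<otimes>\<^sub>R s) \<odot>\<^sub>M m')" using h(4) by simp
 then have "(u \<otimes>\<^sub>R s) \<odot>\<^sub>N f m' = (u \<otimes>\<^sub>R s') \<odot>\<^sub>N f m"
  unfolding hom_smult[OF f R.m_closed[OF S_carrier[OF h(3)] S_carrier[OF h(2)]] c(1)]
   hom_smult[OF f R.m_closed[OF S_carrier[OF h(3)] S_carrier[OF c(2)]] h(1)] by simp
 then show "frac R p N (f m') s' = frac R p N (f m) s"
  unfolding frac_eq_iff[OF N hom_closed[OF f h(1)] hom_closed[OF f c(1)] h(2) c(2)] using h(3) by blast
qed

lemma loc_hom:
 assumes M: "module R M" and N: "module R N" and f: "f\<in>mod_hom R M N"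
 shows "(%A. \<Union>(m, s)\<in>A. frac R p N (f m) s)\<in>mod_hom L (LM M) (LM N)"
proof (rule mod_homI)
 interpret M: module R M by fact
 note lf = loc_hom_frac[OF M N f]
 fix A assume A: "A\<in>carrier (LM M)"
 obtain m s where m: "m\<in>carrier M" "s\<in>S" "A = frac R p M m s" using A unfolding loc_carrier by blast
 show "(\<Union>(m, s)\<in>A. frac R p N (f m) s)\<in>carrier (LM N)"
  unfolding m(3) lf[OF m(1,2)] by (rule frac_closed[OF hom_closed[OF f m(1)] m(2)])
 show "(\<Union>(m, s)\<in>a \<odot>\<^bsub>LM M\<^esub> A. frac R p N (f m) s) = a \<odot>\<^bsub>LM N\<^esub> (\<Union>(m, s)\<in>A. frac R p N (f m) s)" if a: "a\<in>carrier L" for a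
 proof -
  obtain b t where b: "b\<in>carrier R" "t\<in>S" "a = frac R p (self_module R) b t" using a unfolding loc_ring_carrier by blast
  show ?thesis unfolding m(3) b(3) frac_smult[OF M b(1,2) m(1,2)] lf[OF M.smult_closed[OF b(1) m(1)] S_mult[OF b(2) m(2)]] lf[OF m(1,2)]
    frac_smult[OF N b(1,2) hom_closed[OF f m(1)] m(2)] hom_smult[OF f b(1) m(1)] ..
 qed
 fix B assume B: "B\<in>carrier (LM M)"
 obtain m m' s where h: "m\<in>carrier M" "m'\<in>carrier M" "s\<in>S" "A = frac R p M m s" "B = frac R p M m' s"
  by (rule loc_module_common[OF M A B])
 show "(\<Union>(m, s)\<in>A \<oplus>\<^bsub>LM M\<^esub> B. frac R p N (f m) s) = (\<Union>(m, s)\<in>A. frac R p N (f m) s) \<oplus>\<^bsub>LM N\<^esub> (\<Union>(m, s)\<in>B. frac R p N (f m) s)"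
  unfolding h(4,5) frac_add_same[OF M h(1-3)] lf[OF M.M.a_closed[OF h(1,2)] h(3)] lf[OF h(1,3)] lf[OF h(2,3)]
   frac_add_same[OF N hom_closed[OF f h(1)] hom_closed[OF f h(2)] h(3)] hom_add[OF f h(1,2)] ..
qed

lemma loc_simps:
 "obj (loc_complex R p C) n = LM (obj C n)"
 "diff (loc_complex R p C) n = (%A. \<Union>(m, s)\<in>A. frac R p (obj C (n + 1)) (diff C n m) s)" by (auto simp: loc_complex_def)

lemma loc_complex_diff_frac:
 assumes "cochain_complex R C" "m\<in>carrier (obj C n)" "s\<in>S"
 shows "diff (loc_complex R p C) n (frac R p (obj C n) m s) = frac R p (obj C (n + 1)) (diff C n m) s" unfolding loc_simps
 by (rule loc_hom_frac[OF complexD(1)[OF assms(1)] complexD(1)[OF assms(1)] complexD(2)[OF assms(1)] assms(2,3)])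

lemma loc_complex_complex:
 assumes C: "cochain_complex R C" shows "cochain_complex L (loc_complex R p C)"
proof (rule complexI)
 fix n
 note CM = complexD(1)[OF C] and dC = complexD(2)[OF C]
 show "module L (obj (loc_complex R p C) n)" unfolding loc_simps by (rule loc_module_module[OF CM])
 show "diff (loc_complex R p C) n\<in>mod_hom L (obj (loc_complex R p C) n) (obj (loc_complex R p C) (n + 1))"
  unfolding loc_simps by (rule loc_hom[OF CM CM dC])
 fix A assume "A\<in>carrier (obj (loc_complex R p C) n)"
 then obtain m s where m: "m\<in>carrier (obj C n)" "s\<in>S" "A = frac R p (obj C n) m s" unfolding loc_simps loc_carrier by blast
 show "diff (loc_complex R p C) (n + 1) (diff (loc_complex R p C) n A) = \<zero>\<^bsub>obj (loc_complex R p C) (n + 1 + 1)\<^esub>"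
  unfolding m(3) loc_complex_diff_frac[OF C m(1,2)] loc_complex_diff_frac[OF C hom_closed[OF dC m(1)] m(2)] complexD(4)[OF C m(1)]
  unfolding loc_simps by (rule loc_module_zero[OF CM m(2), symmetric])
qed

text \<open>The numerator of a cycle \<open>m / s\<close> becomes a cycle of \<open>C\<close> after
  multiplication by some \<open>u\<close> outside \<open>p\<close>, and by \<open>tors\<close> a
  further multiple is a boundary. The factors used are units of the local ring.\<close>

lemma loc_complex_acyclic:
 assumes C: "cochain_complex R C"
  and tors: "!!n z. z\<in>cycles C n ==> EX u:S. u \<odot>\<^bsub>obj C n\<^esub> z\<in>boundaries C n"
 shows "acyclic_complex (loc_complex R p C)" unfolding acyclic_complex_iff[OF loc_complex_complex[OF C]]
proof (intro allI subsetI)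
 fix n A assume A: "A\<in>cycles (loc_complex R p C) n"
 note CM = complexD(1)[OF C] and dC = complexD(2)[OF C] and dC' = complexD(3)[OF C]
 interpret C0: module R "obj C n" by (rule CM)
 interpret C1: module R "obj C (n - 1)" by (rule CM)
 obtain m s where m: "m\<in>carrier (obj C n)" "s\<in>S" "A = frac R p (obj C n) m s"
  using A unfolding cycles_def loc_simps mem_Collect_eq loc_carrier by blast
 have "frac R p (obj C (n + 1)) (diff C n m) s = \<zero>\<^bsub>LM (obj C (n + 1))\<^esub>"
  using A unfolding m(3) cycles_def mem_Collect_eq loc_complex_diff_frac[OF C m(1,2)] unfolding loc_simps by blast
 then obtain u where u: "u\<in>S" "u \<odot>\<^bsub>obj C (n + 1)\<^esub> diff C n m = \<zero>\<^bsub>obj C (n + 1)\<^esub>"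
  unfolding frac_eq_zero_iff[OF CM hom_closed[OF dC m(1)] m(2)] by blast
 have um: "u \<odot>\<^bsub>obj C n\<^esub> m\<in>carrier (obj C n)" by (rule C0.smult_closed[OF S_carrier[OF u(1)] m(1)])
 have "u \<odot>\<^bsub>obj C n\<^esub> m\<in>cycles C n" using um u(2) hom_smult[OF dC S_carrier[OF u(1)] m(1)] by (simp add: cycles_def)
 then obtain v where v: "v\<in>S" "v \<odot>\<^bsub>obj C n\<^esub> (u \<odot>\<^bsub>obj C n\<^esub> m)\<in>boundaries C n" using tors by blast
 then obtain y where y: "y\<in>carrier (obj C (n - 1))" "v \<odot>\<^bsub>obj C n\<^esub> (u \<odot>\<^bsub>obj C n\<^esub> m) = diff C (n - 1) y"
  unfolding boundaries_def by blast
 let ?t = "(v \<otimes>\<^sub>R u) \<otimes>\<^sub>R s"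
 have t: "?t\<in>S" by (rule S_mult[OF S_mult[OF v(1) u(1)] m(2)])
 have "A = frac R p (obj C n) ((v \<otimes>\<^sub>R u) \<odot>\<^bsub>obj C n\<^esub> m) ?t"
  unfolding m(3) by (rule frac_cancel[OF CM m(1,2) S_mult[OF v(1) u(1)], symmetric])
 also have "... = frac R p (obj C n) (diff C (n - 1) y) ?t" unfolding C0.smult_assoc1[OF S_carrier[OF v(1)] S_carrier[OF u(1)] m(1)] y(2) ..
 also have "... = diff (loc_complex R p C) (n - 1) (frac R p (obj C (n - 1)) y ?t)" using loc_complex_diff_frac[OF C y(1) t] by simp
 finally show "A\<in>boundaries (loc_complex R p C) n" unfolding boundaries_def loc_simps(1) using frac_closed[OF y(1) t] by blast
qed


lemma loc_module_zero_closed: "module R M ==> \<zero>\<^bsub>LM M\<^esub>\<in>carrier (LM M)"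
 using abelian_monoid.zero_closed[OF abelian_group.axioms(1)[OF loc_module_abelian_group]] .

lemma frac_scale:
 assumes M: "module R M" and c: "r\<in>carrier R" "m\<in>carrier M" "t\<in>S"
 shows "frac R p (self_module R) r \<one>\<^sub>R \<odot>\<^bsub>LM M\<^esub> frac R p M m t = frac R p M (r \<odot>\<^sub>M m) t"
 unfolding frac_smult[OF M c(1) S_one c(2,3)] using c(3) by simp

lemma loc_map_hom:
 shows "r\<in>carrier R ==> loc_map R p r\<in>carrier L"
  and "r\<in>carrier R ==> r'\<in>carrier R ==> loc_map R p (r \<oplus>\<^sub>R r') = loc_map R p r \<oplus>\<^sub>L loc_map R p r'"
  and "r\<in>carrier R ==> r'\<in>carrier R ==> loc_map R p (r \<otimes>\<^sub>R r') = loc_map R p r \<otimes>\<^sub>L loc_map R p r'"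
  and "loc_map R p \<one>\<^sub>R = \<one>\<^sub>L"
  and "loc_map R p \<zero>\<^sub>R = \<zero>\<^sub>L"
proof -
 show "r\<in>carrier R ==> loc_map R p r\<in>carrier L" unfolding loc_map_def loc_ring_simps(1) by (rule frac_closed[OF _ S_one]) simp
 show "r\<in>carrier R ==> r'\<in>carrier R ==> loc_map R p (r \<oplus>\<^sub>R r') = loc_map R p r \<oplus>\<^sub>L loc_map R p r'"
  using frac_add_same[OF self_mod _ _ S_one, of r r'] by (simp add: loc_map_def loc_ring_simps)
 show "r\<in>carrier R ==> r'\<in>carrier R ==> loc_map R p (r \<otimes>\<^sub>R r') = loc_map R p r \<otimes>\<^sub>L loc_map R p r'"
  using frac_scale[OF self_mod _ _ S_one, of r r'] by (simp add: loc_map_def loc_ring_simps)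
 show "loc_map R p \<zero>\<^sub>R = \<zero>\<^sub>L" using loc_module_zero[OF self_mod S_one] by (simp add: loc_map_def loc_ring_simps)
 show "loc_map R p \<one>\<^sub>R = \<one>\<^sub>L" by (simp add: loc_map_def loc_ring_simps)
qed

text \<open>To extend a map from an ideal \<open>(A)\<close> of fractions to one more generator \<open>b\<close>, subtract the
 extension found so far and clear denominators on the finitely generated ideal \<open>((A) : b)\<close>.\<close>

lemma loc_baer_finite:
 assumes noeth: "noetherian_ring R" and E: "baer_module R E"
  and bb: "ideal bb R" and g: "g\<in>mod_hom R ((self_module R)\<lparr>carrier := bb\<rparr>) (restrict_scalars (loc_map R p) (LM E))"
  and A: "finite A" "A <= bb"
 shows "EX h:carrier (LM E). ALL b:A. g b = loc_map R p b \<odot>\<^bsub>LM E\<^esub> h" using A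
proof (induction A rule: finite_induct)
 case empty
 have "module R E" using E by (simp add: baer_module_def)
 then show ?case using loc_module_zero_closed by blast
next
 case (insert b A)
 interpret N: noetherian_ring R by (rule noeth)
 have M: "module R E" using E by (simp add: baer_module_def)
 interpret E: module R E by fact
 interpret LE: module L "LM E" by (rule loc_module_module[OF M])
 interpret bb: ideal bb R by (rule bb)
 obtain h0 where h0: "h0\<in>carrier (LM E)" "!!a. a\<in>A ==> g a = loc_map R p a \<odot>\<^bsub>LM E\<^esub> h0" using insert by auto
 have b: "b\<in>bb" "b\<in>carrier R" using insert.prems bb.a_subset by auto
 have AR: "A <= carrier R" using insert.prems bb.a_subset by auto
 note lm = loc_map_hom(1) and lm_add = loc_map_hom(2) and lm_mult = loc_map_hom(3)
 have rs: "carrier (restrict_scalars (loc_map R p) (LM E)) = carrier (LM E)"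
  "add (restrict_scalars (loc_map R p) (LM E)) = add (LM E)"
  "smult (restrict_scalars (loc_map R p) (LM E)) = (%r y. loc_map R p r \<odot>\<^bsub>LM E\<^esub> y)"
  by (simp_all add: restrict_scalars_def)
 have gc: "g r\<in>carrier (LM E)" if "r\<in>bb" for r using hom_closed[OF g, of r] that by (simp add: rs)
 have ga: "g (r \<oplus>\<^sub>R r') = g r \<oplus>\<^bsub>LM E\<^esub> g r'" if "r\<in>bb" "r'\<in>bb" for r r' using hom_add[OF g, of r r'] that by (simp add: rs)
 have gs: "g (r \<otimes>\<^sub>R r') = loc_map R p r \<odot>\<^bsub>LM E\<^esub> g r'" if "r\<in>carrier R" "r'\<in>bb" for r r'
  using hom_smult[OF g that(1), of r'] that by (simp add: rs)
 \<comment> \<open>\<open>Z\<close> is where \<open>h0\<close> already represents \<open>g\<close>.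
   It is an ideal containing \<open>A\<close>, hence contains the ideal \<open>cc\<close> generated
   by \<open>A\<close>; below, \<open>K\<close> collects the multiples of \<open>b\<close> that are
   thereby covered.\<close>
 define Z where "Z = {r\<in>bb. g r = loc_map R p r \<odot>\<^bsub>LM E\<^esub> h0}"
 have Z: "ideal Z R"
 proof (rule cring_idealI[OF R.is_cring])
  show "Z <= carrier R" using bb.a_subset by (auto simp: Z_def)
  have "g (\<zero>\<^sub>R \<otimes>\<^sub>R \<zero>\<^sub>R) = loc_map R p \<zero>\<^sub>R \<odot>\<^bsub>LM E\<^esub> g \<zero>\<^sub>R" by (rule gs) auto
  then show "\<zero>\<^sub>R\<in>Z" using h0(1) gc[of "\<zero>\<^sub>R"] by (simp add: Z_def loc_map_hom(5))
  show "a \<oplus>\<^sub>R c\<in>Z" if "a\<in>Z" "c\<in>Z" for a c using that h0(1) lm bb.Icarr by (simp add: Z_def ga lm_add LE.smult_l_distr)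
  show "r \<otimes>\<^sub>R a\<in>Z" if "r\<in>carrier R" "a\<in>Z" for a r
   using that h0(1) lm bb.Icarr by (simp add: Z_def bb.I_l_closed lm_mult gs LE.smult_assoc1)
 qed
 have "A <= Z" using insert.prems h0(2) by (auto simp: Z_def)
 define cc where "cc = Idl\<^bsub>R\<^esub> A"
 have cc: "ideal cc R" unfolding cc_def by (rule R.genideal_ideal[OF AR])
 have ccZ: "cc <= Z" unfolding cc_def by (rule R.genideal_minimal[OF Z \<open>A <= Z\<close>])
 interpret cc: ideal cc R by (rule cc)
 define K where "K = {r\<in>carrier R. r \<otimes>\<^sub>R b\<in>cc}"
 have K: "ideal K R" by (rule cring_idealI[OF R.is_cring]) (use b cc.I_l_closed in "auto simp: K_def R.l_distr R.m_assoc")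
 obtain K0 where K0: "K0 <= carrier R" "finite K0" "K = Idl\<^bsub>R\<^esub> K0" using N.finetely_gen[OF K] by blast
 obtain y s where ys: "y\<in>carrier E" "s\<in>S" "g b \<ominus>\<^bsub>LM E\<^esub> loc_map R p b \<odot>\<^bsub>LM E\<^esub> h0 = frac R p E y s"
  using LE.M.minus_closed[OF gc[OF b(1)] LE.smult_closed[OF lm[OF b(2)] h0(1)]] unfolding loc_carrier by blast
 have tors: "EX c:S. c \<odot>\<^sub>E (r \<odot>\<^sub>E y) = \<zero>\<^sub>E" if r: "r\<in>K" for r
 proof -
  have rR: "r\<in>carrier R" using r by (simp add: K_def)
  have rb: "r \<otimes>\<^sub>R b\<in>Z" by (rule subsetD[OF ccZ]) (use r in "simp add: K_def")
  have "frac R p E (r \<odot>\<^sub>E y) s = loc_map R p r \<odot>\<^bsub>LM E\<^esub> (g b \<ominus>\<^bsub>LM E\<^esub> loc_map R p b \<odot>\<^bsub>LM E\<^esub> h0)"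
   unfolding ys(3) unfolding loc_map_def frac_scale[OF M rR ys(1,2)] ..
  also have "... = loc_map R p r \<odot>\<^bsub>LM E\<^esub> g b \<ominus>\<^bsub>LM E\<^esub> loc_map R p r \<odot>\<^bsub>LM E\<^esub> (loc_map R p b \<odot>\<^bsub>LM E\<^esub> h0)"
   by (rule hom_minus[OF loc_module_module[OF M] loc_module_module[OF M] hom_smult_self[OF loc_module_module[OF M] lm[OF rR]]
      gc[OF b(1)] LE.smult_closed[OF lm[OF b(2)] h0(1)]])
  also have "... = g (r \<otimes>\<^sub>R b) \<ominus>\<^bsub>LM E\<^esub> loc_map R p (r \<otimes>\<^sub>R b) \<odot>\<^bsub>LM E\<^esub> h0"
   using gs[OF rR b(1)] LE.smult_assoc1[OF lm[OF rR] lm[OF b(2)] h0(1)] lm_mult[OF rR b(2)] by simp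
  also have "... = \<zero>\<^bsub>LM E\<^esub>"
  proof -
   have "g (r \<otimes>\<^sub>R b) = loc_map R p (r \<otimes>\<^sub>R b) \<odot>\<^bsub>LM E\<^esub> h0" using rb by (simp add: Z_def)
   then show ?thesis using LE.smult_closed[OF lm h0(1)] rR b(2) by (simp add: minus_eq_zero_iff[OF loc_module_module[OF M]])
  qed
  finally show ?thesis unfolding frac_eq_zero_iff[OF M E.smult_closed[OF rR ys(1)] ys(2)] .
 qed
 \<comment> \<open>Each generator of \<open>K\<close> kills \<open>y\<close> up to a factor outside
   \<open>p\<close>; as \<open>K\<close> is finitely generated, one factor \<open>c\<close> serves
   for all of them.\<close>
 have "EX c:S. ALL r:K0. c \<odot>\<^sub>E (r \<odot>\<^sub>E y) = \<zero>\<^sub>E"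
 proof -
  have "K0 <= K" unfolding K0(3) by (rule R.genideal_self[OF K0(1)])
  with K0(2) show ?thesis
  proof (induction K0 rule: finite_induct)
   case empty
   then show ?case using S_one by blast
  next
   case (insert r K1)
   obtain c where c: "c\<in>S" "!!r. r\<in>K1 ==> c \<odot>\<^sub>E (r \<odot>\<^sub>E y) = \<zero>\<^sub>E" using insert by auto
   obtain d where d: "d\<in>S" "d \<odot>\<^sub>E (r \<odot>\<^sub>E y) = \<zero>\<^sub>E" using tors[of r] insert.prems by auto
   have rc: "r' \<odot>\<^sub>E y\<in>carrier E" if "r'\<in>insert r K1" for r' using that insert.prems ys(1) by (auto simp: K_def)
   have "(c \<otimes>\<^sub>R d) \<odot>\<^sub>E (r' \<odot>\<^sub>E y) = \<zero>\<^sub>E" if r': "r'\<in>insert r K1" for r'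
   proof (cases "r' = r")
    case True
    then show ?thesis using d c(1) rc[OF r'] by (simp add: E.smult_assoc1)
   next
    case False
    then have "c \<odot>\<^sub>E (r' \<odot>\<^sub>E y) = \<zero>\<^sub>E" using c(2) r' by auto
    then show ?thesis using d(1) c(1) rc[OF r'] by (simp add: E.smult_assoc1 R.m_comm[of c d])
   qed
   then show ?case using S_mult[OF c(1) d(1)] by blast
  qed
 qed
 then obtain c where c: "c\<in>S" "!!r. r\<in>K0 ==> c \<odot>\<^sub>E (r \<odot>\<^sub>E y) = \<zero>\<^sub>E" by blast
 define w where "w = c \<odot>\<^sub>E y"
 have w: "w\<in>carrier E" unfolding w_def by (rule E.smult_closed[OF S_carrier[OF c(1)] ys(1)])
 have Kw: "r \<odot>\<^sub>E w = \<zero>\<^sub>E" if "r\<in>K" for r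
 proof -
  have "K0 <= annihilator R E w"
  proof
   fix r assume r: "r\<in>K0"
   then have rR: "r\<in>carrier R" using K0(1) by blast
   have "r \<odot>\<^sub>E w = c \<odot>\<^sub>E (r \<odot>\<^sub>E y)"
    unfolding w_def using rR S_carrier[OF c(1)] ys(1) by (simp flip: E.smult_assoc1 add: R.m_comm)
   then show "r\<in>annihilator R E w" using rR c(2)[OF r] by (simp add: annihilator_def)
  qed
  then have "K <= annihilator R E w" unfolding K0(3) by (rule R.genideal_minimal[OF annihilator_ideal[OF M w]])
  then show ?thesis using that by (auto simp: annihilator_def)
 qed
 \<comment> \<open>\<open>e\<close> is killed by \<open>cc\<close>, so adding the fraction
   \<open>e / (c s)\<close> changes nothing on \<open>A\<close>; and \<open>b e = c y\<close> makes
   it supply exactly the missing value \<open>y / s\<close> at \<open>b\<close>.\<close>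
 obtain e where e: "e\<in>carrier E" and be: "b \<odot>\<^sub>E e = w" and cce: "!!r. r\<in>cc ==> r \<odot>\<^sub>E e = \<zero>\<^sub>E"
  by (rule baer_lift[OF E cc b(2) w]) (use Kw in "auto simp: K_def")
 let ?t = "c \<otimes>\<^sub>R s"
 have t: "?t\<in>S" by (rule S_mult[OF c(1) ys(2)])
 let ?f = "frac R p E e ?t"
 have f: "?f\<in>carrier (LM E)" by (rule frac_closed[OF e t])
 show ?case
 proof (intro bexI[of _ "h0 \<oplus>\<^bsub>LM E\<^esub> ?f"] ballI)
  show "h0 \<oplus>\<^bsub>LM E\<^esub> ?f\<in>carrier (LM E)" by (rule LE.M.a_closed[OF h0(1) f])
  fix a assume a: "a\<in>insert b A"
  then have aR: "a\<in>carrier R" using b(2) AR by auto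
  have sum: "loc_map R p a \<odot>\<^bsub>LM E\<^esub> (h0 \<oplus>\<^bsub>LM E\<^esub> ?f) = loc_map R p a \<odot>\<^bsub>LM E\<^esub> h0 \<oplus>\<^bsub>LM E\<^esub> frac R p E (a \<odot>\<^sub>E e) ?t"
   unfolding LE.smult_r_distr[OF lm[OF aR] h0(1) f] unfolding loc_map_def frac_scale[OF M aR e t] ..
  show "g a = loc_map R p a \<odot>\<^bsub>LM E\<^esub> (h0 \<oplus>\<^bsub>LM E\<^esub> ?f)"
  proof (cases "a = b")
   case True
   have "frac R p E (b \<odot>\<^sub>E e) ?t = g b \<ominus>\<^bsub>LM E\<^esub> loc_map R p b \<odot>\<^bsub>LM E\<^esub> h0"
    unfolding be w_def frac_cancel[OF M ys(1,2) c(1)] ys(3) ..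
   then have "loc_map R p b \<odot>\<^bsub>LM E\<^esub> (h0 \<oplus>\<^bsub>LM E\<^esub> ?f) = loc_map R p b \<odot>\<^bsub>LM E\<^esub> h0 \<oplus>\<^bsub>LM E\<^esub> (g b \<ominus>\<^bsub>LM E\<^esub> loc_map R p b \<odot>\<^bsub>LM E\<^esub> h0)"
    using sum True by simp
   also have "... = g b" using gc[OF b(1)] LE.smult_closed[OF lm[OF b(2)] h0(1)] by (simp add: a_minus_def LE.M.a_lcomm[of _ "g b"] LE.M.r_neg)
   finally show ?thesis using True by simp
  next
   case False
   then have aA: "a\<in>A" using a by simp
   then have "a\<in>cc" unfolding cc_def using R.genideal_self[OF AR] by blast
   then have "a \<odot>\<^sub>E e = \<zero>\<^sub>E" by (rule cce)
   then have "frac R p E (a \<odot>\<^sub>E e) ?t = \<zero>\<^bsub>LM E\<^esub>" using loc_module_zero[OF M t] by argo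
   then show ?thesis unfolding sum h0(2)[OF aA] by (simp only: LE.M.r_zero[OF LE.smult_closed[OF lm[OF aR] h0(1)]])
  qed
 qed
qed

lemma loc_inverse:
 assumes "s\<in>S"
 shows "frac R p (self_module R) \<one>\<^sub>R s\<in>carrier L" "frac R p (self_module R) \<one>\<^sub>R s \<otimes>\<^sub>L loc_map R p s = \<one>\<^sub>L"
proof -
 show "frac R p (self_module R) \<one>\<^sub>R s\<in>carrier L" unfolding loc_ring_simps(1) by (rule frac_closed[OF _ assms]) simp
 have "frac R p (self_module R) \<one>\<^sub>R s \<otimes>\<^sub>L loc_map R p s = frac R p (self_module R) s s"
  using frac_smult[OF self_mod R.one_closed assms _ S_one, of s] assms by (simp add: loc_map_def loc_ring_simps)
 also have "... = frac R p (self_module R) (s \<odot>\<^bsub>self_module R\<^esub> \<one>\<^sub>R) (s \<otimes>\<^sub>R \<one>\<^sub>R)" using assms by simp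
 also have "... = \<one>\<^sub>L" unfolding loc_ring_simps(5) by (rule frac_cancel[OF self_mod _ S_one assms]) simp
 finally show "frac R p (self_module R) \<one>\<^sub>R s \<otimes>\<^sub>L loc_map R p s = \<one>\<^sub>L" .
qed

lemma loc_ring_frac:
 assumes "a\<in>carrier R" "s\<in>S"
 shows "loc_map R p s \<otimes>\<^sub>L frac R p (self_module R) a s = loc_map R p a"
proof -
 have "loc_map R p s \<otimes>\<^sub>L frac R p (self_module R) a s = frac R p (self_module R) (s \<odot>\<^bsub>self_module R\<^esub> a) (s \<otimes>\<^sub>R \<one>\<^sub>R)"
  using frac_scale[OF self_mod S_carrier[OF assms(2)] _ assms(2), of a] assms by (simp add: loc_map_def loc_ring_simps)
 also have "... = loc_map R p a" unfolding loc_map_def by (rule frac_cancel[OF self_mod _ S_one assms(2)]) (use assms in simp)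
 finally show ?thesis .
qed

text \<open>An ideal of the local ring is determined by its contraction \<open>bb\<close> to
  \<open>R\<close>, which is finitely generated. An element representing \<open>g\<close> on
  generators does so on all of \<open>bb\<close>, and then on \<open>aa\<close>, since denominators
  act invertibly.\<close>

theorem loc_module_baer:
 assumes noeth: "noetherian_ring R" and E: "baer_module R E"
 shows "baer_module L (LM E)" unfolding baer_module_def
proof (intro conjI allI impI)
 have M: "module R E" using E by (simp add: baer_module_def)
 show LEm: "module L (LM E)" by (rule loc_module_module[OF M])
 interpret N: noetherian_ring R by (rule noeth)
 interpret LE: module L "LM E" by fact
 fix aa g assume "ideal aa L & g\<in>mod_hom L ((self_module L)\<lparr>carrier := aa\<rparr>) (LM E)"
 then have aa: "ideal aa L" and g: "g\<in>mod_hom L ((self_module L)\<lparr>carrier := aa\<rparr>) (LM E)" by auto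
 interpret aa: ideal aa L by fact
 note lm = loc_map_hom
 define bb where "bb = {r\<in>carrier R. loc_map R p r\<in>aa}"
 have bb: "ideal bb R"
 proof (rule cring_idealI[OF R.is_cring])
  fix r a assume r: "r\<in>carrier R" and a: "a\<in>bb"
  show "r \<otimes>\<^sub>R a\<in>bb" using a r aa.I_l_closed[OF _ lm(1)[OF r], of "loc_map R p a"] by (simp add: bb_def lm(3))
 qed (auto simp: bb_def lm(2,5))
 have bbD: "r\<in>carrier R" "loc_map R p r\<in>aa" if "r\<in>bb" for r using that by (auto simp: bb_def)
 interpret bb: ideal bb R by fact
 have gc: "g A\<in>carrier (LM E)" if "A\<in>aa" for A using hom_closed[OF g] that by simp
 have gs: "g (A \<otimes>\<^sub>L B) = A \<odot>\<^bsub>LM E\<^esub> g B" if "A\<in>carrier L" "B\<in>aa" for A B using hom_smult[OF g that(1), of B] that by simp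
 have ga: "g (A \<oplus>\<^sub>L B) = g A \<oplus>\<^bsub>LM E\<^esub> g B" if "A\<in>aa" "B\<in>aa" for A B using hom_add[OF g, of A B] that by simp
 let ?g = "%r. g (loc_map R p r)"
 have g': "?g\<in>mod_hom R ((self_module R)\<lparr>carrier := bb\<rparr>) (restrict_scalars (loc_map R p) (LM E))"
  by (rule mod_homI) (use bbD lm(1) in "auto simp: restrict_scalars_def gc ga gs lm(2,3)")
 obtain A where A: "A <= carrier R" "finite A" "bb = Idl\<^bsub>R\<^esub> A" using N.finetely_gen[OF bb] by blast
 have Abb: "A <= bb" unfolding A(3) by (rule R.genideal_self[OF A(1)])
 obtain h where h: "h\<in>carrier (LM E)" "!!b. b\<in>A ==> ?g b = loc_map R p b \<odot>\<^bsub>LM E\<^esub> h"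
  using loc_baer_finite[OF noeth E bb g' A(2) Abb] by blast
 define Z where "Z = {r\<in>bb. ?g r = loc_map R p r \<odot>\<^bsub>LM E\<^esub> h}"
 have Z: "ideal Z R"
 proof (rule cring_idealI[OF R.is_cring])
  show "Z <= carrier R" using bb.a_subset by (auto simp: Z_def)
  have "g (\<zero>\<^sub>L \<otimes>\<^sub>L \<zero>\<^sub>L) = \<zero>\<^sub>L \<odot>\<^bsub>LM E\<^esub> g \<zero>\<^sub>L" by (rule gs) auto
  then show "\<zero>\<^sub>R\<in>Z" using h(1) gc[of "\<zero>\<^sub>L"] by (simp add: Z_def lm(5))
  show "a \<oplus>\<^sub>R c\<in>Z" if "a\<in>Z" "c\<in>Z" for a c using that h(1) lm(1) bbD by (simp add: Z_def lm(2) ga LE.smult_l_distr)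
  show "r \<otimes>\<^sub>R a\<in>Z" if "r\<in>carrier R" "a\<in>Z" for a r
   using that h(1) lm(1) bbD by (simp add: Z_def bb.I_l_closed lm(3) gs LE.smult_assoc1)
 qed
 have "A <= Z" using Abb h(2) by (auto simp: Z_def)
 then have bbZ: "bb <= Z" using R.genideal_minimal[OF Z] A(3) by simp
 show "EX e:carrier (LM E). ALL a:aa. g a = a \<odot>\<^bsub>LM E\<^esub> e"
 proof (intro bexI[OF _ h(1)] ballI)
  fix X assume X: "X\<in>aa"
  then have XL: "X\<in>carrier L" by (rule aa.Icarr)
  then obtain a s where as: "a\<in>carrier R" "s\<in>S" "X = frac R p (self_module R) a s" unfolding loc_ring_carrier by blast
  have sL: "loc_map R p s\<in>carrier L" by (rule lm(1)[OF S_carrier[OF as(2)]])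
  note inv = loc_inverse[OF as(2)]
  let ?i = "frac R p (self_module R) \<one>\<^sub>R s"
  have e: "loc_map R p s \<otimes>\<^sub>L X = loc_map R p a" unfolding as(3) by (rule loc_ring_frac[OF as(1,2)])
  then have "loc_map R p a\<in>aa" using aa.I_l_closed[OF X sL] by simp
  then have "a\<in>bb" using as(1) unfolding bb_def by blast
  then have "?g a = loc_map R p a \<odot>\<^bsub>LM E\<^esub> h" using bbZ by (auto simp: Z_def)
  then have eq: "loc_map R p s \<odot>\<^bsub>LM E\<^esub> g X = loc_map R p s \<odot>\<^bsub>LM E\<^esub> (X \<odot>\<^bsub>LM E\<^esub> h)"
   unfolding e[symmetric] gs[OF sL X] LE.smult_assoc1[OF sL XL h(1)] .
  have inj: "?i \<odot>\<^bsub>LM E\<^esub> (loc_map R p s \<odot>\<^bsub>LM E\<^esub> Y) = Y" if "Y\<in>carrier (LM E)" for Y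
   using LE.smult_assoc1[OF inv(1) sL that] inv(2) that by simp
  show "g X = X \<odot>\<^bsub>LM E\<^esub> h"
   using arg_cong[OF eq, of "%Y. ?i \<odot>\<^bsub>LM E\<^esub> Y"] unfolding inj[OF gc[OF X]] inj[OF LE.smult_closed[OF XL h(1)]] .
 qed
qed

end

section \<open>Functoriality of the tensor product\<close>

lemma tensor_module: "module R M ==> module R N ==> module R (tensor R M N)"
 unfolding tensor_def using module.axioms(1) by (intro quot_module_module free_on_module tensor_facts(1))

lemma pure_hom:
 assumes "module R M" "module R N"
 shows "n\<in>carrier N ==> (%m. pure_tensor R M N m n)\<in>mod_hom R M (tensor R M N)"
  "m\<in>carrier M ==> pure_tensor R M N m\<in>mod_hom R N (tensor R M N)"
 using tensor_facts(2)[OF assms] by (simp_all add: bilinear_map_def)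

lemma pure_closed:
 assumes "module R M" "module R N" "m\<in>carrier M" "n\<in>carrier N"
 shows "pure_tensor R M N m n\<in>carrier (tensor R M N)" by (rule hom_closed[OF pure_hom(2)[OF assms(1-3)] assms(4)])

lemma tensor_lift:
 assumes "module R M" "module R N" "module R P" "bilinear_map R M N P f"
 obtains h where "h\<in>mod_hom R (tensor R M N) P" "ALL m:carrier M. ALL n:carrier N. h (pure_tensor R M N m n) = f m n"
 using tensor_facts(3)[OF assms] by (elim bexE)

text \<open>Tensors are finite linear combinations of pure tensors, being cosets of combinations of
  generators. The lemma serves as an induction rule and yields the uniqueness half of the universal
  property.\<close>

lemma tensor_span:
 assumes M: "module R M" and N: "module R N" and H: "submodule H R (tensor R M N)"
  and pure: "!!m n. m\<in>carrier M ==> n\<in>carrier N ==> pure_tensor R M N m n\<in>H"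
  and t: "t\<in>carrier (tensor R M N)"
 shows "t\<in>H"
proof -
 interpret M: module R M by fact
 note R = M.R.is_cring
 let ?F = "free_on R (carrier M \<times> carrier N)" let ?K = "tensor_relations R M N"
 have F: "module R ?F" by (rule free_on_module[OF R])
 have T: "tensor R M N = quot_module ?F ?K" by (simp add: tensor_def)
 have TM: "module R (tensor R M N)" by (rule tensor_module[OF M N])
 interpret F: module R ?F by fact
 have f: "(%x. ?K +>\<^bsub>?F\<^esub> x)\<in>mod_hom R ?F (tensor R M N)" unfolding T by (rule quot_proj_hom[OF F tensor_facts(1)[OF M N]])
 obtain x where x: "x\<in>carrier ?F" "t = ?K +>\<^bsub>?F\<^esub> x" using t unfolding T mem_quot_module by blast
 note sx = free_on_supp[OF x(1)]
 have g: "generator R b\<in>carrier ?F" if "b\<in>{b. x b ~= \<zero>\<^sub>R}" for b by (rule generator_carrier[OF R subsetD[OF sx(2) that]])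
 have "t = ?K +>\<^bsub>?F\<^esub> (lin_ext R ?F (generator R) x)" unfolding x(2) using free_on_expand[OF R x(1)] by simp
 also have "... = (\<Oplus>\<^bsub>tensor R M N\<^esub> b\<in>{b. x b ~= \<zero>\<^sub>R}. ?K +>\<^bsub>?F\<^esub> (x b \<odot>\<^sub>?F generator R b))"
  unfolding lin_ext_def by (rule hom_finsum[OF F TM f sx(1)]) (intro funcsetI F.smult_closed sx(3) g)
 also have "...\<in>H"
 proof (rule finsum_mem_submodule[OF TM H sx(1)])
  fix b assume b: "b\<in>{b. x b ~= \<zero>\<^sub>R}"
  obtain m n where mn: "b = (m, n)" "m\<in>carrier M" "n\<in>carrier N" using subsetD[OF sx(2) b] by auto
  have "?K +>\<^bsub>?F\<^esub> (x b \<odot>\<^sub>?F generator R b) = x b \<odot>\<^bsub>tensor R M N\<^esub> pure_tensor R M N m n"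
   unfolding hom_smult[OF f sx(3) g[OF b]] by (simp add: mn(1) pure_tensor_def)
  then show "?K +>\<^bsub>?F\<^esub> (x b \<odot>\<^sub>?F generator R b)\<in>H" using submodule_mem(4)[OF TM H sx(3) pure[OF mn(2,3)]] by simp
 qed
 finally show ?thesis .
qed

lemma tensor_hom_eq:
 assumes M: "module R M" and N: "module R N" and P: "module R P"
  and h: "h\<in>mod_hom R (tensor R M N) P" "h'\<in>mod_hom R (tensor R M N) P"
  and eq: "!!m n. m\<in>carrier M ==> n\<in>carrier N ==> h (pure_tensor R M N m n) = h' (pure_tensor R M N m n)"
  and t: "t\<in>carrier (tensor R M N)"
 shows "h t = h' t"
proof -
 let ?T = "tensor R M N"
 have T: "module R ?T" by (rule tensor_module[OF M N])
 have dm: "(%t. h t \<ominus>\<^sub>P h' t)\<in>mod_hom R ?T P" by (rule hom_minus_map[OF P h])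
 have iff: "h t \<ominus>\<^sub>P h' t = \<zero>\<^sub>P \<longleftrightarrow> h t = h' t" if "t\<in>carrier ?T" for t
  by (rule minus_eq_zero_iff[OF P hom_closed[OF h(1) that] hom_closed[OF h(2) that]])
 have "pure_tensor R M N m n\<in>{t\<in>carrier ?T. h t \<ominus>\<^sub>P h' t = \<zero>\<^sub>P}" if "m\<in>carrier M" "n\<in>carrier N" for m n
  using pure_closed[OF M N that] iff[OF pure_closed[OF M N that]] eq[OF that] by blast
 then have "t\<in>{t\<in>carrier ?T. h t \<ominus>\<^sub>P h' t = \<zero>\<^sub>P}" by (rule tensor_span[OF M N kernel_submodule[OF T P dm] _ t])
 then show ?thesis using iff by blast
qed

context
 fixes R :: "('a, 'r) ring_scheme" and M :: "('a, 'm) module" and N :: "('a, 'n) module"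
  and M' :: "('a, 'm2) module" and N' :: "('a, 'n2) module"
 assumes M: "module R M" and N: "module R N" and M': "module R M'" and N': "module R N'"
begin

text \<open>\<open>tensor_map\<close> is a definite description among extensional homomorphisms.
  Existence comes from the universal property, restricted to the carrier, and uniqueness from
  \<open>tensor_hom_eq\<close>.\<close>

lemma tensor_map_hom:
 assumes f: "f\<in>mod_hom R M M'" and g: "g\<in>mod_hom R N N'"
 shows "tensor_map R M N M' N' f g\<in>mod_hom R (tensor R M N) (tensor R M' N')"
  "m\<in>carrier M ==> n\<in>carrier N ==>
   tensor_map R M N M' N' f g (pure_tensor R M N m n) = pure_tensor R M' N' (f m) (g n)"
proof -
 let ?T = "tensor R M N" let ?T' = "tensor R M' N'"
 have T: "module R ?T" by (rule tensor_module[OF M N])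
 have T': "module R ?T'" by (rule tensor_module[OF M' N'])
 have bil: "bilinear_map R M N ?T' (%m n. pure_tensor R M' N' (f m) (g n))" unfolding bilinear_map_def
  by (intro conjI ballI hom_comp[OF f pure_hom(1)[OF M' N' hom_closed[OF g]]]
    hom_comp[OF g pure_hom(2)[OF M' N' hom_closed[OF f]]])
 obtain h where h: "h\<in>mod_hom R ?T ?T'"
  "ALL m:carrier M. ALL n:carrier N. h (pure_tensor R M N m n) = pure_tensor R M' N' (f m) (g n)"
  by (rule tensor_lift[OF M N T' bil])
 define P where "P h \<longleftrightarrow> h\<in>carrier (hom_module R ?T ?T') &
    (ALL m:carrier M. ALL n:carrier N. h (pure_tensor R M N m n) = pure_tensor R M' N' (f m) (g n))" for h
 let ?h = "restrict h (carrier ?T)"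
 have "P ?h" unfolding P_def using hom_restrict[OF T h(1)] h(2) pure_closed[OF M N] by simp
 moreover have "h' = ?h" if h': "P h'" for h'
 proof (rule extensionalityI[of _ "carrier ?T"])
  show "h'\<in>extensional (carrier ?T)" using h' by (simp add: P_def)
  show "?h\<in>extensional (carrier ?T)" by simp
  fix t assume t: "t\<in>carrier ?T"
  have "h' t = h t" by (rule tensor_hom_eq[OF M N T' _ h(1) _ t]) (use h' h(2) in "simp_all add: P_def")
  then show "h' t = ?h t" using t by simp
 qed
 moreover have "tensor_map R M N M' N' f g = (THE h. P h)" by (simp add: tensor_map_def P_def)
 ultimately have "P (tensor_map R M N M' N' f g)" by (metis theI)
 then show "tensor_map R M N M' N' f g\<in>mod_hom R ?T ?T'"
  "m\<in>carrier M ==> n\<in>carrier N ==> tensor_map R M N M' N' f g (pure_tensor R M N m n) = pure_tensor R M' N' (f m) (g n)"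
  by (simp_all add: P_def)
qed

lemma tensor_map_eqI:
 assumes f: "f\<in>mod_hom R M M'" and g: "g\<in>mod_hom R N N'" and h: "h\<in>mod_hom R (tensor R M N) (tensor R M' N')"
  and eq: "!!m n. m\<in>carrier M ==> n\<in>carrier N ==> h (pure_tensor R M N m n) = pure_tensor R M' N' (f m) (g n)"
  and t: "t\<in>carrier (tensor R M N)"
 shows "tensor_map R M N M' N' f g t = h t" by (rule tensor_hom_eq[OF M N tensor_module[OF M' N'] tensor_map_hom(1)[OF f g] h _ t])
  (simp add: tensor_map_hom(2)[OF f g] eq)

lemma tensor_map_zero_left:
 assumes f: "f\<in>mod_hom R M M'" and g: "g\<in>mod_hom R N N'" and z: "!!m. m\<in>carrier M ==> f m = \<zero>\<^sub>M'"
  and t: "t\<in>carrier (tensor R M N)"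
 shows "tensor_map R M N M' N' f g t = \<zero>\<^bsub>tensor R M' N'\<^esub>"
 by (rule tensor_map_eqI[OF f g hom_zero_map[OF tensor_module[OF M' N']] _ t])
  (simp add: z hom_zero[OF M' tensor_module[OF M' N'] pure_hom(1)[OF M' N' hom_closed[OF g]]])

lemma tensor_map_zero_right:
 assumes f: "f\<in>mod_hom R M M'" and g: "g\<in>mod_hom R N N'" and z: "!!n. n\<in>carrier N ==> g n = \<zero>\<^sub>N'"
  and t: "t\<in>carrier (tensor R M N)"
 shows "tensor_map R M N M' N' f g t = \<zero>\<^bsub>tensor R M' N'\<^esub>"
 by (rule tensor_map_eqI[OF f g hom_zero_map[OF tensor_module[OF M' N']] _ t])
  (simp add: z hom_zero[OF N' tensor_module[OF M' N'] pure_hom(2)[OF M' N' hom_closed[OF f]]])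

lemma tensor_map_cong:
 assumes f: "f\<in>mod_hom R M M'" and g: "g\<in>mod_hom R N N'" and f': "f'\<in>mod_hom R M M'" and g': "g'\<in>mod_hom R N N'"
  and eq: "!!m. m\<in>carrier M ==> f m = f' m" "!!n. n\<in>carrier N ==> g n = g' n"
  and t: "t\<in>carrier (tensor R M N)"
 shows "tensor_map R M N M' N' f g t = tensor_map R M N M' N' f' g' t"
 by (rule tensor_map_eqI[OF f g tensor_map_hom(1)[OF f' g'] _ t]) (simp add: tensor_map_hom(2)[OF f' g'] eq)

lemma tensor_map_add_right:
 assumes f: "f\<in>mod_hom R M M'" and g: "g\<in>mod_hom R N N'" "g'\<in>mod_hom R N N'"
  and t: "t\<in>carrier (tensor R M N)"
 shows "tensor_map R M N M' N' f (%n. g n \<oplus>\<^sub>N' g' n) t =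
  tensor_map R M N M' N' f g t \<oplus>\<^bsub>tensor R M' N'\<^esub> tensor_map R M N M' N' f g' t"
proof (rule tensor_map_eqI[OF f hom_add_map[OF N' g] _ _ t])
 show "(%t. tensor_map R M N M' N' f g t \<oplus>\<^bsub>tensor R M' N'\<^esub> tensor_map R M N M' N' f g' t)\<in>mod_hom R (tensor R M N) (tensor R M' N')"
  by (rule hom_add_map[OF tensor_module[OF M' N'] tensor_map_hom(1)[OF f g(1)] tensor_map_hom(1)[OF f g(2)]])
 fix m n assume "m\<in>carrier M" "n\<in>carrier N"
 then show "tensor_map R M N M' N' f g (pure_tensor R M N m n) \<oplus>\<^bsub>tensor R M' N'\<^esub> tensor_map R M N M' N' f g' (pure_tensor R M N m n) =
   pure_tensor R M' N' (f m) (g n \<oplus>\<^sub>N' g' n)"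
  using hom_add[OF pure_hom(2)[OF M' N' hom_closed[OF f]] hom_closed[OF g(1)] hom_closed[OF g(2)]]
  by (simp add: tensor_map_hom(2)[OF f g(1)] tensor_map_hom(2)[OF f g(2)])
qed

end

lemma tensor_map_comp:
 assumes M: "module R M" "module R N" "module R M'" "module R N'" "module R M''" "module R N''"
  and f: "f\<in>mod_hom R M M'" and g: "g\<in>mod_hom R N N'" and f': "f'\<in>mod_hom R M' M''" and g': "g'\<in>mod_hom R N' N''"
  and t: "t\<in>carrier (tensor R M N)"
 shows "tensor_map R M' N' M'' N'' f' g' (tensor_map R M N M' N' f g t) =
  tensor_map R M N M'' N'' (%m. f' (f m)) (%n. g' (g n)) t"
proof -
 note tf = tensor_map_hom[OF M(1-4) f g] and tf' = tensor_map_hom[OF M(3-6) f' g']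
 show ?thesis by (rule tensor_map_eqI[OF M(1,2,5,6) hom_comp[OF f f'] hom_comp[OF g g'] hom_comp[OF tf(1) tf'(1)] _ t, symmetric])
   (simp add: tf(2) tf'(2) hom_closed[OF f] hom_closed[OF g])
qed

lemma tensor_map_id:
 assumes M: "module R M" "module R N" and t: "t\<in>carrier (tensor R M N)"
 shows "tensor_map R M N M N (%m. m) (%n. n) t = t" by (rule tensor_map_eqI[OF M M hom_id hom_id hom_id _ t]) simp

lemma tensor_map_smult_left:
 assumes M: "module R M" "module R N" and r: "r\<in>carrier R" and t: "t\<in>carrier (tensor R M N)"
 shows "tensor_map R M N M N (%m. r \<odot>\<^sub>M m) (%n. n) t = r \<odot>\<^bsub>tensor R M N\<^esub> t"
 by (rule tensor_map_eqI[OF M M hom_smult_self[OF M(1) r] hom_id hom_smult_self[OF tensor_module[OF M] r] _ t])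
  (simp add: hom_smult[OF pure_hom(1)[OF M] r])

lemma tensor_map_smult_right:
 assumes M: "module R M" "module R N" and r: "r\<in>carrier R" and t: "t\<in>carrier (tensor R M N)"
 shows "tensor_map R M N M N (%m. m) (%n. r \<odot>\<^sub>N n) t = r \<odot>\<^bsub>tensor R M N\<^esub> t"
 by (rule tensor_map_eqI[OF M M hom_id hom_smult_self[OF M(2) r] hom_smult_self[OF tensor_module[OF M] r] _ t])
  (simp add: hom_smult[OF pure_hom(2)[OF M] r])

subsection \<open>Tensoring with a free module\<close>

text \<open>The tensor product of \<open>A\<close> and \<open>F\<close> is the direct sum of copies
  of \<open>A\<close> indexed by the basis \<open>B\<close>; this is the generation half,
  \<open>tensor_free_independent\<close> the other. Letting the coefficients vanish outside
  \<open>S\<close> allows adding two expansions over the union of their index sets.\<close>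

lemma tensor_free_expand:
 assumes A: "module R A" and F: "module R F" and f: "f\<in>mod_hom R F (free_on R B)" and B: "B <= carrier F"
  and fe: "!!m. m\<in>carrier F ==> m = lin_ext R F (%b. b) (f m)"
  and t: "t\<in>carrier (tensor R A F)"
 shows "EX S a. finite S & S <= B & (ALL b. a b\<in>carrier A) & (ALL b. b ~: S --> a b = \<zero>\<^sub>A) &
  t = (\<Oplus>\<^bsub>tensor R A F\<^esub> b\<in>S. pure_tensor R A F (a b) b)"
proof -
 let ?T = "tensor R A F" let ?p = "pure_tensor R A F"
 have T: "module R ?T" by (rule tensor_module[OF A F])
 interpret A: module R A by fact
 interpret F: module R F by fact
 interpret T: module R ?T by fact
 define rep where "rep t S a \<longleftrightarrow> finite S & S <= B & (ALL b. a b\<in>carrier A) & (ALL b. b ~: S --> a b = \<zero>\<^sub>A) &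
  t = (\<Oplus>\<^bsub>?T\<^esub> b\<in>S. ?p (a b) b)" for t S a
 have pc: "?p x b\<in>carrier ?T" if "x\<in>carrier A" "b\<in>B" for x b by (rule pure_closed[OF A F that(1)]) (use B that(2) in blast)
 have p0: "?p \<zero>\<^sub>A b = \<zero>\<^sub>?T" if "b\<in>B" for b by (rule hom_zero[OF A T pure_hom(1)[OF A F]]) (use B that in blast)
 have enlarge: "rep t S' a" if r: "rep t S a" and S': "S <= S'" "finite S'" "S' <= B" for t S S' a
 proof -
  have "(\<Oplus>\<^bsub>?T\<^esub> b\<in>S. ?p (a b) b) = (\<Oplus>\<^bsub>?T\<^esub> b\<in>S'. ?p (a b) b)"
  proof (rule finsum_superset[OF T S'(2,1)])
   show "?p (a b) b\<in>carrier ?T" if "b\<in>S" for b by (rule pc) (use r that in "auto simp: rep_def")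
   show "?p (a b) b = \<zero>\<^sub>?T" if "b\<in>S' - S" for b
   proof -
    have "a b = \<zero>\<^sub>A" "b\<in>B" using r that S'(3) by (auto simp: rep_def)
    then show ?thesis using p0 by simp
   qed
  qed
  then show ?thesis using r S' by (auto simp: rep_def)
 qed
 have radd: "rep (t \<oplus>\<^sub>?T t') (S \<union> S') (%b. a b \<oplus>\<^sub>A a' b)" if r: "rep t S a" and r': "rep t' S' a'" for t t' S S' a a'
 proof -
  have fin: "finite (S \<union> S')" "S \<union> S' <= B" using r r' by (auto simp: rep_def)
  have 1: "rep t (S \<union> S') a" by (rule enlarge[OF r _ fin]) simp
  have 2: "rep t' (S \<union> S') a'" by (rule enlarge[OF r' _ fin]) simp
  have c: "a b\<in>carrier A" "a' b\<in>carrier A" for b using r r' by (auto simp: rep_def)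
  have te: "t = (\<Oplus>\<^bsub>?T\<^esub> b\<in>S \<union> S'. ?p (a b) b)" "t' = (\<Oplus>\<^bsub>?T\<^esub> b\<in>S \<union> S'. ?p (a' b) b)" using 1 2 by (auto simp: rep_def)
  have "t \<oplus>\<^sub>?T t' = (\<Oplus>\<^bsub>?T\<^esub> b\<in>S \<union> S'. ?p (a b) b \<oplus>\<^sub>?T ?p (a' b) b)"
   unfolding te by (rule finsum_add_mod[OF T, symmetric]) (use fin(2) pc c in blast)+
  also have "... = (\<Oplus>\<^bsub>?T\<^esub> b\<in>S \<union> S'. ?p (a b \<oplus>\<^sub>A a' b) b)"
  proof (rule finsum_cong_mod[OF T])
   fix b assume b: "b\<in>S \<union> S'"
   then have bB: "b\<in>B" "b\<in>carrier F" using fin(2) B by auto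
   show "?p (a b) b \<oplus>\<^sub>?T ?p (a' b) b\<in>carrier ?T" by (intro T.M.a_closed pc c bB)
   show "?p (a b) b \<oplus>\<^sub>?T ?p (a' b) b = ?p (a b \<oplus>\<^sub>A a' b) b" by (rule hom_add[OF pure_hom(1)[OF A F bB(2)] c, symmetric])
  qed
  finally show ?thesis using 1 2 fin c by (auto simp: rep_def)
 qed
 have rsm: "rep (r \<odot>\<^sub>?T t) S (%b. r \<odot>\<^sub>A a b)" if r: "r\<in>carrier R" and rt: "rep t S a" for r t S a
 proof -
  have c: "a b\<in>carrier A" for b using rt by (auto simp: rep_def)
  have S: "finite S" "S <= B" "t = (\<Oplus>\<^bsub>?T\<^esub> b\<in>S. ?p (a b) b)" using rt by (auto simp: rep_def)
  have "r \<odot>\<^sub>?T t = (\<Oplus>\<^bsub>?T\<^esub> b\<in>S. r \<odot>\<^sub>?T ?p (a b) b)"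
   unfolding S(3) by (rule T.finsum_smult_ldistr[OF S(1) r]) (use S(2) pc c in blast)
  also have "... = (\<Oplus>\<^bsub>?T\<^esub> b\<in>S. ?p (r \<odot>\<^sub>A a b) b)"
  proof (rule finsum_cong_mod[OF T])
   fix b assume b: "b\<in>S"
   then have bB: "b\<in>B" "b\<in>carrier F" using S(2) B by auto
   show "r \<odot>\<^sub>?T ?p (a b) b\<in>carrier ?T" by (intro T.smult_closed pc c bB r)
   show "r \<odot>\<^sub>?T ?p (a b) b = ?p (r \<odot>\<^sub>A a b) b" by (rule hom_smult[OF pure_hom(1)[OF A F bB(2)] r c, symmetric])
  qed
  finally show ?thesis using rt r by (auto simp: rep_def)
 qed
 let ?H = "{t\<in>carrier ?T. EX S a. rep t S a}"
 have "submodule ?H R ?T"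
 proof (rule T.submoduleI)
  have "rep \<zero>\<^sub>?T {} (%_. \<zero>\<^sub>A)" by (simp add: rep_def)
  then show "\<zero>\<^sub>?T\<in>?H" by blast
  show "r \<odot>\<^sub>?T t\<in>?H" if "r\<in>carrier R" "t\<in>?H" for r t using that rsm[OF that(1)] T.smult_closed by blast
  show "\<ominus>\<^sub>?T t\<in>?H" if t: "t\<in>?H" for t
  proof -
   obtain S a where "rep t S a" and tc: "t\<in>carrier ?T" using t by blast
   then have "rep ((\<ominus>\<^sub>R \<one>\<^sub>R) \<odot>\<^sub>?T t) S (%b. (\<ominus>\<^sub>R \<one>\<^sub>R) \<odot>\<^sub>A a b)" by (intro rsm) auto
   then show ?thesis using tc by (auto simp: T.smult_l_minus)
  qed
  show "t \<oplus>\<^sub>?T t'\<in>?H" if "t\<in>?H" "t'\<in>?H" for t t' using that radd T.M.a_closed by blast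
 qed auto
 moreover have "?p x m\<in>?H" if x: "x\<in>carrier A" and m: "m\<in>carrier F" for x m
 proof -
  let ?c = "f m" let ?S = "{b. ?c b ~= \<zero>\<^sub>R}"
  have c: "?c\<in>carrier (free_on R B)" by (rule hom_closed[OF f m])
  note sc = free_on_supp[OF c]
  have bF: "b\<in>carrier F" if "b\<in>?S" for b using B subsetD[OF sc(2) that] by blast
  have "?p x m = ?p x (lin_ext R F (%b. b) ?c)" using fe[OF m] by simp
  also have "... = (\<Oplus>\<^bsub>?T\<^esub> b\<in>?S. ?p x (?c b \<odot>\<^sub>F b))"
   unfolding lin_ext_def by (rule hom_finsum[OF F T pure_hom(2)[OF A F x] sc(1)]) (intro funcsetI F.smult_closed sc(3) bF)
  also have "... = (\<Oplus>\<^bsub>?T\<^esub> b\<in>?S. ?p (?c b \<odot>\<^sub>A x) b)"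
  proof (rule finsum_cong_mod[OF T])
   fix b assume b: "b\<in>?S"
   show "?p x (?c b \<odot>\<^sub>F b)\<in>carrier ?T" by (intro pure_closed[OF A F] x F.smult_closed sc(3) bF b)
   show "?p x (?c b \<odot>\<^sub>F b) = ?p (?c b \<odot>\<^sub>A x) b" unfolding hom_smult[OF pure_hom(2)[OF A F x] sc(3) bF[OF b]]
     hom_smult[OF pure_hom(1)[OF A F bF[OF b]] sc(3) x] ..
  qed
  finally have "rep (?p x m) ?S (%b. ?c b \<odot>\<^sub>A x)" using sc x by (auto simp: rep_def)
  then show ?thesis using pure_closed[OF A F x m] by blast
 qed
 ultimately have "t\<in>?H" by (rule tensor_span[OF A F _ _ t])
 then show ?thesis by (auto simp: rep_def)
qed

text \<open>The coefficient at \<open>b\<close> is recovered by the map to \<open>A\<close> that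
  sends the pure tensor of \<open>x\<close> and \<open>f\<close> to \<open>u f b\<close> times
  \<open>x\<close>, where \<open>u f b\<close> is the coordinate of \<open>f\<close> at
  \<open>b\<close>.\<close>

lemma tensor_free_independent:
 assumes A: "module R A" and F: "module R F" and u: "u\<in>mod_hom R F (free_on R B)" and B: "B <= carrier F"
  and ug: "!!b. b\<in>B ==> u b = generator R b"
  and S: "finite S" "S <= B" and a: "!!b. b\<in>S ==> a b\<in>carrier A"
  and z: "(\<Oplus>\<^bsub>tensor R A F\<^esub> b\<in>S. pure_tensor R A F (a b) b) = \<zero>\<^bsub>tensor R A F\<^esub>" and b: "b\<in>S"
 shows "a b = \<zero>\<^sub>A"
proof -
 let ?T = "tensor R A F" let ?p = "pure_tensor R A F"
 have T: "module R ?T" by (rule tensor_module[OF A F])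
 interpret A: module R A by fact
 interpret F: module R F by fact
 have ge: "(%f. u f b)\<in>mod_hom R F (self_module R)" by (rule hom_comp[OF u]) (simp add: mod_hom_def)
 have gc: "u f b\<in>carrier R" if "f\<in>carrier F" for f using hom_closed[OF ge that] by simp
 have bil: "bilinear_map R A F A (%x f. u f b \<odot>\<^sub>A x)" unfolding bilinear_map_def
 proof (intro conjI ballI)
  show "(%x. u f b \<odot>\<^sub>A x)\<in>mod_hom R A A" if "f\<in>carrier F" for f by (rule hom_smult_self[OF A gc[OF that]])
  show "(%f. u f b \<odot>\<^sub>A x)\<in>mod_hom R F A" if x: "x\<in>carrier A" for x
   by (rule hom_comp[OF ge]) (rule mod_homI; use x in \<open>simp add: A.smult_l_distr A.smult_assoc1\<close>)
 qed
 obtain h where "h\<in>mod_hom R ?T A" "ALL x:carrier A. ALL f:carrier F. h (?p x f) = u f b \<odot>\<^sub>A x"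
  by (rule tensor_lift[OF A F A bil])
 note h = this(1) this(2)[rule_format]
 have bF: "b'\<in>carrier F" if "b'\<in>S" for b' using S(2) B that by blast
 have pc: "?p (a b') b'\<in>carrier ?T" if "b'\<in>S" for b' by (rule pure_closed[OF A F a[OF that] bF[OF that]])
 have "\<zero>\<^sub>A = h (\<Oplus>\<^bsub>?T\<^esub> b'\<in>S. ?p (a b') b')" unfolding z by (rule hom_zero[OF T A h(1), symmetric])
 also have "... = (\<Oplus>\<^bsub>A\<^esub> b'\<in>S. h (?p (a b') b'))" by (rule hom_finsum[OF T A h(1) S(1)]) (intro funcsetI pc)
 also have "... = h (?p (a b) b)"
 proof (rule finsum_single[OF A S(1) b])
  show "h (?p (a b) b)\<in>carrier A" by (rule hom_closed[OF h(1) pc[OF b]])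
  fix b' assume b': "b'\<in>S" "b' ~= b"
  have "u b' b = \<zero>\<^sub>R" using ug[of b'] b' S(2) by (auto simp: generator_def)
  then show "h (?p (a b') b') = \<zero>\<^sub>A" using h(2)[OF a[OF b'(1)] bF[OF b'(1)]] a[OF b'(1)] by simp
 qed
 also have "... = a b"
 proof -
  have "u b b = \<one>\<^sub>R" using ug[of b] b S(2) by (auto simp: generator_def)
  then show ?thesis using h(2)[OF a[OF b] bF[OF b]] a[OF b] by simp
 qed
 finally show ?thesis by simp
qed

text \<open>Free modules are flat: expanded along the basis, exactness after tensoring is exactness
  of the given sequence in each coefficient.\<close>

lemma tensor_free_exact:
 assumes F: "free_module R F" and A': "module R A'" and A: "module R A" and A'': "module R A''"
  and f: "f\<in>mod_hom R A' A" and h: "h\<in>mod_hom R A A''"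
  and inj: "!!x. x\<in>carrier A' ==> f x = \<zero>\<^sub>A ==> x = \<zero>\<^sub>A'"
  and mid: "!!x. x\<in>carrier A ==> h x = \<zero>\<^sub>A'' ==> x\<in>f ` carrier A'"
  and surj: "carrier A'' <= h ` carrier A"
 shows "t'\<in>carrier (tensor R A' F) ==> tensor_map R A' F A F f (%y. y) t' = \<zero>\<^bsub>tensor R A F\<^esub> ==> t' = \<zero>\<^bsub>tensor R A' F\<^esub>"
  and "t\<in>carrier (tensor R A F) ==> tensor_map R A F A'' F h (%y. y) t = \<zero>\<^bsub>tensor R A'' F\<^esub> ==>
   t\<in>tensor_map R A' F A F f (%y. y) ` carrier (tensor R A' F)"
  and "t''\<in>carrier (tensor R A'' F) ==> t''\<in>tensor_map R A F A'' F h (%y. y) ` carrier (tensor R A F)"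
proof -
 have FM: "module R F" using F by (simp add: free_module_def)
 obtain B u where B: "B <= carrier F" and u: "u\<in>mod_hom R F (free_on R B)" and ug: "!!b. b\<in>B ==> u b = generator R b"
  and ue: "!!m. m\<in>carrier F ==> m = lin_ext R F (%b. b) (u m)" using free_module_coordinates[OF F] by metis
 note T' = tensor_module[OF A' FM] and T = tensor_module[OF A FM] and T'' = tensor_module[OF A'' FM]
 note ta = tensor_map_hom[OF A' FM A FM f hom_id] and tb = tensor_map_hom[OF A FM A'' FM h hom_id]
 interpret A': module R A' by fact
 have bF: "b\<in>carrier F" if "b\<in>S" "S <= B" for b S using B that by blast
 show "t' = \<zero>\<^bsub>tensor R A' F\<^esub>" if t': "t'\<in>carrier (tensor R A' F)" and z: "tensor_map R A' F A F f (%y. y) t' = \<zero>\<^bsub>tensor R A F\<^esub>"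
 proof -
  obtain S a where S: "finite S" "S <= B" and a: "!!b. a b\<in>carrier A'" and te: "t' = (\<Oplus>\<^bsub>tensor R A' F\<^esub> b\<in>S. pure_tensor R A' F (a b) b)"
   using tensor_free_expand[OF A' FM u B ue t'] by blast
  have "(\<Oplus>\<^bsub>tensor R A F\<^esub> b\<in>S. tensor_map R A' F A F f (%y. y) (pure_tensor R A' F (a b) b)) = \<zero>\<^bsub>tensor R A F\<^esub>"
   unfolding z[symmetric] te by (rule hom_finsum[OF T' T ta(1) S(1), symmetric]) (intro funcsetI pure_closed[OF A' FM a bF[OF _ S(2)]])
  moreover have "(\<Oplus>\<^bsub>tensor R A F\<^esub> b\<in>S. tensor_map R A' F A F f (%y. y) (pure_tensor R A' F (a b) b)) =
    (\<Oplus>\<^bsub>tensor R A F\<^esub> b\<in>S. pure_tensor R A F (f (a b)) b)"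
   by (rule finsum_cong_mod[OF T hom_closed[OF ta(1) pure_closed[OF A' FM a bF[OF _ S(2)]]] ta(2)[OF a bF[OF _ S(2)]]])
  ultimately have "f (a b) = \<zero>\<^sub>A" if "b\<in>S" for b using tensor_free_independent[OF A FM u B ug S hom_closed[OF f a] _ that] by simp
  then have "a b = \<zero>\<^sub>A'" if "b\<in>S" for b using inj[OF a] that by blast
  then have "pure_tensor R A' F (a b) b = \<zero>\<^bsub>tensor R A' F\<^esub>" if "b\<in>S" for b
   using that hom_zero[OF A' T' pure_hom(1)[OF A' FM bF[OF that S(2)]]] by simp
  then have "submodule {\<zero>\<^bsub>tensor R A' F\<^esub>} R (tensor R A' F) ==> t'\<in>{\<zero>\<^bsub>tensor R A' F\<^esub>}"
   unfolding te by (intro finsum_mem_submodule[OF T' _ S(1)]) auto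
  then show ?thesis using zero_submodule[OF T'] by simp
 qed
 show "t\<in>tensor_map R A' F A F f (%y. y) ` carrier (tensor R A' F)"
  if t: "t\<in>carrier (tensor R A F)" and z: "tensor_map R A F A'' F h (%y. y) t = \<zero>\<^bsub>tensor R A'' F\<^esub>"
 proof -
  obtain S a where S: "finite S" "S <= B" and a: "!!b. a b\<in>carrier A" and te: "t = (\<Oplus>\<^bsub>tensor R A F\<^esub> b\<in>S. pure_tensor R A F (a b) b)"
   using tensor_free_expand[OF A FM u B ue t] by blast
  have "(\<Oplus>\<^bsub>tensor R A'' F\<^esub> b\<in>S. tensor_map R A F A'' F h (%y. y) (pure_tensor R A F (a b) b)) = \<zero>\<^bsub>tensor R A'' F\<^esub>"
   unfolding z[symmetric] te by (rule hom_finsum[OF T T'' tb(1) S(1), symmetric]) (intro funcsetI pure_closed[OF A FM a bF[OF _ S(2)]])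
  moreover have "(\<Oplus>\<^bsub>tensor R A'' F\<^esub> b\<in>S. tensor_map R A F A'' F h (%y. y) (pure_tensor R A F (a b) b)) =
    (\<Oplus>\<^bsub>tensor R A'' F\<^esub> b\<in>S. pure_tensor R A'' F (h (a b)) b)"
   by (rule finsum_cong_mod[OF T'' hom_closed[OF tb(1) pure_closed[OF A FM a bF[OF _ S(2)]]] tb(2)[OF a bF[OF _ S(2)]]])
  ultimately have "h (a b) = \<zero>\<^sub>A''" if "b\<in>S" for b using tensor_free_independent[OF A'' FM u B ug S hom_closed[OF h a] _ that] by simp
  then have "ALL b:S. EX x. x\<in>carrier A' & a b = f x" using mid[OF a] by blast
  then obtain a' where a': "!!b. b\<in>S ==> a' b\<in>carrier A'" "!!b. b\<in>S ==> a b = f (a' b)" by metis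
  let ?t = "\<Oplus>\<^bsub>tensor R A' F\<^esub> b\<in>S. pure_tensor R A' F (a' b) b"
  have c: "pure_tensor R A' F (a' b) b\<in>carrier (tensor R A' F)" if "b\<in>S" for b by (rule pure_closed[OF A' FM a'(1)[OF that] bF[OF that S(2)]])
  have "tensor_map R A' F A F f (%y. y) ?t = (\<Oplus>\<^bsub>tensor R A F\<^esub> b\<in>S. tensor_map R A' F A F f (%y. y) (pure_tensor R A' F (a' b) b))"
   by (rule hom_finsum[OF T' T ta(1) S(1)]) (intro funcsetI c)
  also have "... = t" unfolding te by (rule finsum_cong_mod[OF T hom_closed[OF ta(1) c]]) (simp_all add: ta(2)[OF a'(1) bF[OF _ S(2)]] a'(2))
  finally have "t = tensor_map R A' F A F f (%y. y) ?t" by (rule sym)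
  then show ?thesis by (rule image_eqI) (rule finsum_closed_mod[OF T' c])
 qed
 show "t''\<in>tensor_map R A F A'' F h (%y. y) ` carrier (tensor R A F)" if t'': "t''\<in>carrier (tensor R A'' F)"
 proof (rule tensor_span[OF A'' FM image_submodule[OF T T'' tb(1)] _ t''])
  fix m n assume m: "m\<in>carrier A''" and n: "n\<in>carrier F"
  obtain x where x: "x\<in>carrier A" "m = h x" using surj m by blast
  show "pure_tensor R A'' F m n\<in>tensor_map R A F A'' F h (%y. y) ` carrier (tensor R A F)"
   unfolding x(2) tb(2)[OF x(1) n, symmetric] using pure_closed[OF A FM x(1) n] by blast
 qed
qed

subsection \<open>Tensoring with a complex\<close>

abbreviation tensor_diff :: "('a, 'r) ring_scheme => ('a, 'm) module => ('a, 'n) cochain => int =>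
  ('m \<times> 'n => 'a) set => ('m \<times> 'n => 'a) set" where
 "tensor_diff R A F j \<equiv> tensor_map R A (obj F j) A (obj F (j + 1)) (%y. y) (diff F j)"

text \<open>For a free resolution \<open>F\<close> of a module this is the vanishing of all its Tor
  modules with \<open>A\<close>, including the tensor product itself. The middle degree is written
  \<open>j + 1\<close> so that the two differentials compose without rewriting degrees;
  \<open>j\<close> runs through all integers.\<close>

definition tensor_exact :: "('a, 'r) ring_scheme => ('a, 'm) module => ('a, 'n) cochain => bool" where
 "tensor_exact R A F \<longleftrightarrow> (ALL j. ALL t:carrier (tensor R A (obj F (j + 1))).
   tensor_diff R A F (j + 1) t = \<zero>\<^bsub>tensor R A (obj F (j + 1 + 1))\<^esub> -->
   t\<in>tensor_diff R A F j ` carrier (tensor R A (obj F j)))"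

lemma tensor_exactD:
 assumes "tensor_exact R A F" "t\<in>carrier (tensor R A (obj F j))" "tensor_diff R A F j t = \<zero>\<^bsub>tensor R A (obj F (j + 1))\<^esub>"
 obtains w where "w\<in>carrier (tensor R A (obj F (j - 1)))" "t = tensor_map R A (obj F (j - 1)) A (obj F j) (%y. y) (diff F (j - 1)) w"
proof -
 have e: "j - 1 + 1 = j" by simp
 have "t\<in>tensor_diff R A F (j - 1) ` carrier (tensor R A (obj F (j - 1)))"
  using assms(1)[unfolded tensor_exact_def, rule_format, of t "j - 1"] assms(2,3) unfolding e by blast
 then show thesis using that unfolding e by blast
qed

context
 fixes R :: "('a, 'r) ring_scheme" and F :: "('a, 'f) cochain"
 assumes F: "cochain_complex R F"
begin

lemma tensor_diff_hom:
 "module R A ==> tensor_diff R A F j\<in>mod_hom R (tensor R A (obj F j)) (tensor R A (obj F (j + 1)))"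
 by (rule tensor_map_hom(1)[OF _ complexD(1)[OF F] _ complexD(1)[OF F] hom_id complexD(2)[OF F]])

lemma tensor_diff_natural:
 assumes A: "module R A" and A': "module R A'" and f: "f\<in>mod_hom R A A'" and t: "t\<in>carrier (tensor R A (obj F j))"
 shows "tensor_diff R A' F j (tensor_map R A (obj F j) A' (obj F j) f (%y. y) t) =
  tensor_map R A (obj F (j + 1)) A' (obj F (j + 1)) f (%y. y) (tensor_diff R A F j t)"
proof -
 note FM = complexD(1)[OF F] and d = complexD(2)[OF F]
 show ?thesis unfolding tensor_map_comp[OF A FM A' FM A' FM f hom_id hom_id d t]
   tensor_map_comp[OF A FM A FM A' FM hom_id d f hom_id t] ..
qed

lemma tensor_diff_chain_map:
 assumes A: "module R A" and g: "!!j. g j\<in>mod_hom R (obj F j) (obj F j)"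
  and comm: "!!y. y\<in>carrier (obj F j) ==> g (j + 1) (diff F j y) = diff F j (g j y)" and t: "t\<in>carrier (tensor R A (obj F j))"
 shows "tensor_map R A (obj F (j + 1)) A (obj F (j + 1)) (%a. a) (g (j + 1)) (tensor_diff R A F j t) =
  tensor_diff R A F j (tensor_map R A (obj F j) A (obj F j) (%a. a) (g j) t)"
proof -
 note FM = complexD(1)[OF F] and d = complexD(2)[OF F]
 show ?thesis unfolding tensor_map_comp[OF A FM A FM A FM hom_id d hom_id g t]
   tensor_map_comp[OF A FM A FM A FM hom_id g hom_id d t]
  by (rule tensor_map_cong[OF A FM A FM hom_id hom_comp[OF d g] hom_id hom_comp[OF g d] refl comm t])
qed

lemma tensor_diff_diff:
 assumes A: "module R A" and t: "t\<in>carrier (tensor R A (obj F j))"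
 shows "tensor_diff R A F (j + 1) (tensor_diff R A F j t) = \<zero>\<^bsub>tensor R A (obj F (j + 1 + 1))\<^esub>"
proof -
 note FM = complexD(1)[OF F] and d = complexD(2)[OF F]
 show ?thesis unfolding tensor_map_comp[OF A FM A FM A FM hom_id d hom_id d t]
  by (rule tensor_map_zero_right[OF A FM A FM hom_id hom_comp[OF d d] complexD(4)[OF F] t])
qed

text \<open>Part of the long exact sequence: tensoring the short exact sequence with
  \<open>F\<close> stays exact in each degree because \<open>F\<close> is free there, and acyclicity
  of two of the complexes forces that of the third by a diagram chase.\<close>

lemma tensor_exact_sub:
 assumes free: "!!j. free_module R (obj F j)" and A': "module R A'" and A: "module R A" and A'': "module R A''"
  and f: "f\<in>mod_hom R A' A" and g: "g\<in>mod_hom R A A''"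
  and inj: "!!x. x\<in>carrier A' ==> f x = \<zero>\<^sub>A ==> x = \<zero>\<^sub>A'"
  and comp: "!!x. x\<in>carrier A' ==> g (f x) = \<zero>\<^sub>A''"
  and mid: "!!x. x\<in>carrier A ==> g x = \<zero>\<^sub>A'' ==> x\<in>f ` carrier A'"
  and surj: "carrier A'' <= g ` carrier A"
  and ex: "tensor_exact R A F" "tensor_exact R A'' F"
 shows "tensor_exact R A' F" unfolding tensor_exact_def
proof (intro allI ballI impI)
 fix j z assume z: "z\<in>carrier (tensor R A' (obj F (j + 1)))"
  and dz: "tensor_diff R A' F (j + 1) z = \<zero>\<^bsub>tensor R A' (obj F (j + 1 + 1))\<^esub>"
 note FM = complexD(1)[OF F]
 note T' = tensor_module[OF A' FM] and T = tensor_module[OF A FM] and T'' = tensor_module[OF A'' FM]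
 let ?a = "%j. tensor_map R A' (obj F j) A (obj F j) f (%y. y)"
 let ?b = "%j. tensor_map R A (obj F j) A'' (obj F j) g (%y. y)"
 have a: "?a j\<in>mod_hom R (tensor R A' (obj F j)) (tensor R A (obj F j))" for j by (rule tensor_map_hom(1)[OF A' FM A FM f hom_id])
 have b: "?b j\<in>mod_hom R (tensor R A (obj F j)) (tensor R A'' (obj F j))" for j by (rule tensor_map_hom(1)[OF A FM A'' FM g hom_id])
 have fe1: "t = \<zero>\<^bsub>tensor R A' (obj F j)\<^esub>" if "t\<in>carrier (tensor R A' (obj F j))" "?a j t = \<zero>\<^bsub>tensor R A (obj F j)\<^esub>" for j t
  by (rule tensor_free_exact(1)[OF free A' A A'' f g inj mid surj that])
 have fe2: "t\<in>?a j ` carrier (tensor R A' (obj F j))" if "t\<in>carrier (tensor R A (obj F j))" "?b j t = \<zero>\<^bsub>tensor R A'' (obj F j)\<^esub>" for j t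
  by (rule tensor_free_exact(2)[OF free A' A A'' f g inj mid surj that])
 have fe3: "t\<in>?b j ` carrier (tensor R A (obj F j))" if "t\<in>carrier (tensor R A'' (obj F j))" for j t
  by (rule tensor_free_exact(3)[OF free A' A A'' f g inj mid surj that])
 have ba: "?b j (?a j t) = \<zero>\<^bsub>tensor R A'' (obj F j)\<^esub>" if "t\<in>carrier (tensor R A' (obj F j))" for j t
  unfolding tensor_map_comp[OF A' FM A FM A'' FM f hom_id g hom_id that]
  by (rule tensor_map_zero_left[OF A' FM A'' FM hom_comp[OF f g] hom_id comp that])
 note nat_a = tensor_diff_natural[OF A' A f] and nat_b = tensor_diff_natural[OF A A'' g]
 have "tensor_diff R A F (j + 1) (?a (j + 1) z) = \<zero>\<^bsub>tensor R A (obj F (j + 1 + 1))\<^esub>"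
  unfolding nat_a[OF z] dz by (rule hom_zero[OF T' T a])
 then obtain w where w: "w\<in>carrier (tensor R A (obj F j))" "?a (j + 1) z = tensor_diff R A F j w"
  using ex(1) hom_closed[OF a z] unfolding tensor_exact_def by blast
 have bw: "?b j w\<in>carrier (tensor R A'' (obj F j))" by (rule hom_closed[OF b w(1)])
 have "tensor_diff R A'' F j (?b j w) = \<zero>\<^bsub>tensor R A'' (obj F (j + 1))\<^esub>"
  unfolding nat_b[OF w(1)] w(2)[symmetric] by (rule ba[OF z])
 then obtain v'' where v'': "v''\<in>carrier (tensor R A'' (obj F (j - 1)))"
  "?b j w = tensor_map R A'' (obj F (j - 1)) A'' (obj F j) (%y. y) (diff F (j - 1)) v''" by (rule tensor_exactD[OF ex(2) bw])
 obtain v where v: "v\<in>carrier (tensor R A (obj F (j - 1)))" "v'' = ?b (j - 1) v" using fe3[OF v''(1)] by (rule imageE) (rule that)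
 have e: "j - 1 + 1 = j" by simp
 \<comment> \<open>\<open>w\<close> has the right differential but may fail to come from
   \<open>A'\<close>. Its image in \<open>A''\<close> is a cycle, hence bounds; subtracting the lift
   \<open>?dv\<close> of that image moves \<open>w\<close> into the image of \<open>A'\<close>
   without changing its differential.\<close>
 let ?dv = "tensor_map R A (obj F (j - 1)) A (obj F j) (%y. y) (diff F (j - 1)) v"
 have dvc: "?dv\<in>carrier (tensor R A (obj F j))" using hom_closed[OF tensor_diff_hom[OF A, of "j - 1"] v(1)] unfolding e .
 have "?b j w = ?b j ?dv" using nat_b[OF v(1)] v''(2) unfolding v(2) e by simp
 then have "?b j (w \<ominus>\<^bsub>tensor R A (obj F j)\<^esub> ?dv) = \<zero>\<^bsub>tensor R A'' (obj F j)\<^esub>"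
  unfolding hom_minus[OF T T'' b w(1) dvc] using minus_eq_zero_iff[OF T'' bw hom_closed[OF b dvc]] by simp
 moreover have wd: "w \<ominus>\<^bsub>tensor R A (obj F j)\<^esub> ?dv\<in>carrier (tensor R A (obj F j))"
  using submodule_mem(6)[OF T module.carrier_is_submodule[OF T] w(1) dvc] .
 ultimately obtain z' where z': "z'\<in>carrier (tensor R A' (obj F j))" "w \<ominus>\<^bsub>tensor R A (obj F j)\<^esub> ?dv = ?a j z'"
  using fe2 by blast
 have ddv: "tensor_diff R A F j ?dv = \<zero>\<^bsub>tensor R A (obj F (j + 1))\<^esub>" using tensor_diff_diff[OF A v(1)] unfolding e .
 have dzc: "tensor_diff R A' F j z'\<in>carrier (tensor R A' (obj F (j + 1)))" by (rule hom_closed[OF tensor_diff_hom[OF A'] z'(1)])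
 interpret T1: module R "tensor R A (obj F (j + 1))" by (rule T)
 have "?a (j + 1) (tensor_diff R A' F j z') = tensor_diff R A F j (w \<ominus>\<^bsub>tensor R A (obj F j)\<^esub> ?dv)"
  unfolding z'(2) nat_a[OF z'(1)] ..
 also have "... = ?a (j + 1) z" unfolding hom_minus[OF T T tensor_diff_hom[OF A] w(1) dvc] ddv w(2)[symmetric]
  unfolding a_minus_def module_neg_zero[OF T] by (rule T1.M.r_zero[OF hom_closed[OF a z]])
 finally have "?a (j + 1) (tensor_diff R A' F j z' \<ominus>\<^bsub>tensor R A' (obj F (j + 1))\<^esub> z) = \<zero>\<^bsub>tensor R A (obj F (j + 1))\<^esub>"
  unfolding hom_minus[OF T' T a dzc z] using minus_eq_zero_iff[OF T hom_closed[OF a dzc] hom_closed[OF a z]] by simp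
 then have "tensor_diff R A' F j z' \<ominus>\<^bsub>tensor R A' (obj F (j + 1))\<^esub> z = \<zero>\<^bsub>tensor R A' (obj F (j + 1))\<^esub>"
  by (rule fe1[OF submodule_mem(6)[OF T' module.carrier_is_submodule[OF T'] dzc z]])
 then have "z = tensor_diff R A' F j z'" using minus_eq_zero_iff[OF T' dzc z] by simp
 then show "z\<in>tensor_diff R A' F j ` carrier (tensor R A' (obj F j))" using z'(1) by blast
qed

text \<open>Exactness passes to direct summands: a cycle is pushed to \<open>A'\<close>, bounded
  there, and the bounding element is brought back by \<open>g\<close>.\<close>

lemma tensor_exact_retract:
 assumes A: "module R A" and A': "module R A'" and f: "f\<in>mod_hom R A A'" and g: "g\<in>mod_hom R A' A"
  and gf: "!!x. x\<in>carrier A ==> g (f x) = x" and ex: "tensor_exact R A' F"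
 shows "tensor_exact R A F" unfolding tensor_exact_def
proof (intro allI ballI impI)
 fix j z assume z: "z\<in>carrier (tensor R A (obj F (j + 1)))"
  and dz: "tensor_diff R A F (j + 1) z = \<zero>\<^bsub>tensor R A (obj F (j + 1 + 1))\<^esub>"
 note FM = complexD(1)[OF F]
 note T' = tensor_module[OF A' FM] and T = tensor_module[OF A FM]
 let ?f = "%j. tensor_map R A (obj F j) A' (obj F j) f (%y. y)"
 let ?g = "%j. tensor_map R A' (obj F j) A (obj F j) g (%y. y)"
 have fm: "?f j\<in>mod_hom R (tensor R A (obj F j)) (tensor R A' (obj F j))" for j by (rule tensor_map_hom(1)[OF A FM A' FM f hom_id])
 have gm: "?g j\<in>mod_hom R (tensor R A' (obj F j)) (tensor R A (obj F j))" for j by (rule tensor_map_hom(1)[OF A' FM A FM g hom_id])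
 have "tensor_diff R A' F (j + 1) (?f (j + 1) z) = \<zero>\<^bsub>tensor R A' (obj F (j + 1 + 1))\<^esub>"
  unfolding tensor_diff_natural[OF A A' f z] dz by (rule hom_zero[OF T T' fm])
 then obtain w where w: "w\<in>carrier (tensor R A' (obj F j))" "?f (j + 1) z = tensor_diff R A' F j w"
  using ex hom_closed[OF fm z] unfolding tensor_exact_def by blast
 have "z = ?g (j + 1) (?f (j + 1) z)" unfolding tensor_map_comp[OF A FM A' FM A FM f hom_id g hom_id z]
  using tensor_map_cong[OF A FM A FM hom_comp[OF f g] hom_id hom_id hom_id gf refl z] tensor_map_id[OF A FM z] by simp
 also have "... = tensor_diff R A F j (?g j w)" unfolding w(2) tensor_diff_natural[OF A' A g w(1)] ..
 finally show "z\<in>tensor_diff R A F j ` carrier (tensor R A (obj F j))" using hom_closed[OF gm w(1)] by blast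
qed

text \<open>Tensoring preserves homotopies, and a null-homotopic map sends cycles to
  boundaries.\<close>

lemma tensor_homotopy:
 assumes A: "module R A" and g: "!!j. g j\<in>mod_hom R (obj F j) (obj F j)" and h: "!!j. h j\<in>mod_hom R (obj F j) (obj F (j - 1))"
  and eq: "!!j y. y\<in>carrier (obj F j) ==> g j y = diff F (j - 1) (h j y) \<oplus>\<^bsub>obj F j\<^esub> h (j + 1) (diff F j y)"
  and t: "t\<in>carrier (tensor R A (obj F (j + 1)))"
  and dt: "tensor_diff R A F (j + 1) t = \<zero>\<^bsub>tensor R A (obj F (j + 1 + 1))\<^esub>"
 shows "tensor_map R A (obj F (j + 1)) A (obj F (j + 1)) (%a. a) (g (j + 1)) t\<in>tensor_diff R A F j ` carrier (tensor R A (obj F j))"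
proof -
 note FM = complexD(1)[OF F] and d = complexD(2)[OF F]
 have T: "module R (tensor R A (obj F j))" for j by (rule tensor_module[OF A FM])
 have h1: "h (j + 1)\<in>mod_hom R (obj F (j + 1)) (obj F j)" for j using h[of "j + 1"] by simp
 have eq1: "g (j + 1) y = diff F j (h (j + 1) y) \<oplus>\<^bsub>obj F (j + 1)\<^esub> h (j + 1 + 1) (diff F (j + 1) y)" if "y\<in>carrier (obj F (j + 1))" for y
  using eq[OF that] by simp
 interpret T1: module R "tensor R A (obj F (j + 1))" by (rule T)
 let ?ht = "tensor_map R A (obj F (j + 1)) A (obj F j) (%a. a) (h (j + 1)) t"
 have ht: "?ht\<in>carrier (tensor R A (obj F j))" by (rule hom_closed[OF tensor_map_hom(1)[OF A FM A FM hom_id h1] t])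
 have "tensor_map R A (obj F (j + 1)) A (obj F (j + 1)) (%a. a) (g (j + 1)) t =
   tensor_map R A (obj F (j + 1)) A (obj F (j + 1)) (%a. a) (%y. diff F j (h (j + 1) y) \<oplus>\<^bsub>obj F (j + 1)\<^esub> h (j + 1 + 1) (diff F (j + 1) y)) t"
  by (rule tensor_map_cong[OF A FM A FM hom_id g hom_id hom_add_map[OF FM hom_comp[OF h1 d] hom_comp[OF d h1]] refl eq1 t])
 also have "... = tensor_map R A (obj F (j + 1)) A (obj F (j + 1)) (%a. a) (%y. diff F j (h (j + 1) y)) t
   \<oplus>\<^bsub>tensor R A (obj F (j + 1))\<^esub> tensor_map R A (obj F (j + 1)) A (obj F (j + 1)) (%a. a) (%y. h (j + 1 + 1) (diff F (j + 1) y)) t"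
  by (rule tensor_map_add_right[OF A FM A FM hom_id hom_comp[OF h1 d] hom_comp[OF d h1] t])
 also have "tensor_map R A (obj F (j + 1)) A (obj F (j + 1)) (%a. a) (%y. diff F j (h (j + 1) y)) t = tensor_diff R A F j ?ht"
  by (rule tensor_map_comp[OF A FM A FM A FM hom_id h1 hom_id d t, symmetric])
 also have "tensor_map R A (obj F (j + 1)) A (obj F (j + 1)) (%a. a) (%y. h (j + 1 + 1) (diff F (j + 1) y)) t =
   tensor_map R A (obj F (j + 1 + 1)) A (obj F (j + 1)) (%a. a) (h (j + 1 + 1)) (tensor_diff R A F (j + 1) t)"
  by (rule tensor_map_comp[OF A FM A FM A FM hom_id d hom_id h1 t, symmetric])
 also have "... = \<zero>\<^bsub>tensor R A (obj F (j + 1))\<^esub>" unfolding dt by (rule hom_zero[OF T T tensor_map_hom(1)[OF A FM A FM hom_id h1]])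
 also have "tensor_diff R A F j ?ht \<oplus>\<^bsub>tensor R A (obj F (j + 1))\<^esub> \<zero>\<^bsub>tensor R A (obj F (j + 1))\<^esub> = tensor_diff R A F j ?ht"
  by (rule T1.M.r_zero[OF hom_closed[OF tensor_diff_hom[OF A] ht]])
 finally show ?thesis using ht by blast
qed

text \<open>Multiplication by \<open>s\<close> can be moved across the tensor sign. Writing a cycle
  as \<open>s\<close> times another cycle, through the inverse of \<open>s\<close> on
  \<open>A\<close>, makes it an image under a null-homotopic map of \<open>F\<close>.\<close>

lemma tensor_exact_of_bijective:
 assumes A: "module R A" and s: "s\<in>carrier R" and h: "!!j. h j\<in>mod_hom R (obj F j) (obj F (j - 1))"
  and eq: "!!j y. y\<in>carrier (obj F j) ==> s \<odot>\<^bsub>obj F j\<^esub> y = diff F (j - 1) (h j y) \<oplus>\<^bsub>obj F j\<^esub> h (j + 1) (diff F j y)"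
  and bij: "bij_betw (%a. s \<odot>\<^sub>A a) (carrier A) (carrier A)"
 shows "tensor_exact R A F" unfolding tensor_exact_def
proof (intro allI ballI impI)
 fix j z assume z: "z\<in>carrier (tensor R A (obj F (j + 1)))"
  and dz: "tensor_diff R A F (j + 1) z = \<zero>\<^bsub>tensor R A (obj F (j + 1 + 1))\<^esub>"
 note FM = complexD(1)[OF F]
 note T = tensor_module[OF A FM]
 have sA: "(%a. s \<odot>\<^sub>A a)\<in>mod_hom R A A" by (rule hom_smult_self[OF A s])
 obtain \<rho> where \<rho>: "\<rho>\<in>mod_hom R A A" "!!y. y\<in>carrier A ==> s \<odot>\<^sub>A \<rho> y = y"
  using hom_inverse[OF A A sA bij] by metis
 let ?r = "%j. tensor_map R A (obj F j) A (obj F j) \<rho> (%y. y)"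
 have rm: "?r j\<in>mod_hom R (tensor R A (obj F j)) (tensor R A (obj F j))" for j by (rule tensor_map_hom(1)[OF A FM A FM \<rho>(1) hom_id])
 have rz: "?r (j + 1) z\<in>carrier (tensor R A (obj F (j + 1)))" by (rule hom_closed[OF rm z])
 have drz: "tensor_diff R A F (j + 1) (?r (j + 1) z) = \<zero>\<^bsub>tensor R A (obj F (j + 1 + 1))\<^esub>"
  unfolding tensor_diff_natural[OF A A \<rho>(1) z] dz by (rule hom_zero[OF T T rm])
 have "z = tensor_map R A (obj F (j + 1)) A (obj F (j + 1)) (%a. s \<odot>\<^sub>A a) (%y. y) (?r (j + 1) z)"
  unfolding tensor_map_comp[OF A FM A FM A FM \<rho>(1) hom_id sA hom_id z]
  using tensor_map_cong[OF A FM A FM hom_comp[OF \<rho>(1) sA] hom_id hom_id hom_id \<rho>(2) refl z] tensor_map_id[OF A FM z] by simp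
 also have "... = tensor_map R A (obj F (j + 1)) A (obj F (j + 1)) (%a. a) (%y. s \<odot>\<^bsub>obj F (j + 1)\<^esub> y) (?r (j + 1) z)"
  unfolding tensor_map_smult_left[OF A FM s rz] tensor_map_smult_right[OF A FM s rz] ..
 also have "...\<in>tensor_diff R A F j ` carrier (tensor R A (obj F j))"
  by (rule tensor_homotopy[where g = "%j y. s \<odot>\<^bsub>obj F j\<^esub> y", OF A hom_smult_self[OF FM s] h eq rz drz])
 finally show "z\<in>tensor_diff R A F j ` carrier (tensor R A (obj F j))" .
qed

lemma tensor_torsion:
 assumes A: "module R A" and N: "module R N" and s: "s\<in>carrier R"
  and tors: "!!a. a\<in>carrier A ==> EX k::nat. (s [^]\<^bsub>R\<^esub> k) \<odot>\<^sub>A a = \<zero>\<^sub>A" and t: "t\<in>carrier (tensor R A N)"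
 shows "EX k::nat. (s [^]\<^bsub>R\<^esub> k) \<odot>\<^bsub>tensor R A N\<^esub> t = \<zero>\<^bsub>tensor R A N\<^esub>"
proof -
 let ?T = "tensor R A N"
 have T: "module R ?T" by (rule tensor_module[OF A N])
 interpret T: module R ?T by fact
 let ?H = "{t\<in>carrier ?T. EX k::nat. (s [^]\<^bsub>R\<^esub> k) \<odot>\<^sub>?T t = \<zero>\<^sub>?T}"
 have sk: "s [^]\<^bsub>R\<^esub> (k::nat)\<in>carrier R" for k using s by simp
 have up: "(s [^]\<^bsub>R\<^esub> (k + l)) \<odot>\<^sub>?T t = \<zero>\<^sub>?T" "(s [^]\<^bsub>R\<^esub> (l + k)) \<odot>\<^sub>?T t = \<zero>\<^sub>?T"
  if "t\<in>carrier ?T" "(s [^]\<^bsub>R\<^esub> k) \<odot>\<^sub>?T t = \<zero>\<^sub>?T" for t and k l :: nat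
 proof -
  have "s [^]\<^bsub>R\<^esub> (l + k) = s [^]\<^bsub>R\<^esub> l \<otimes>\<^sub>R s [^]\<^bsub>R\<^esub> k" using s by (simp add: T.R.nat_pow_mult)
  then show "(s [^]\<^bsub>R\<^esub> (l + k)) \<odot>\<^sub>?T t = \<zero>\<^sub>?T" using that sk by (simp add: T.smult_assoc1)
  then show "(s [^]\<^bsub>R\<^esub> (k + l)) \<odot>\<^sub>?T t = \<zero>\<^sub>?T" by (simp add: add.commute)
 qed
 have "submodule ?H R ?T"
 proof (rule T.submoduleI)
  show "\<zero>\<^sub>?T\<in>?H" using sk by auto
  show "\<ominus>\<^sub>?T t\<in>?H" if tH: "t\<in>?H" for t
  proof -
   obtain k :: nat where "t\<in>carrier ?T" "(s [^]\<^bsub>R\<^esub> k) \<odot>\<^sub>?T t = \<zero>\<^sub>?T" using tH by blast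
   then have "\<ominus>\<^sub>?T t\<in>carrier ?T" "(s [^]\<^bsub>R\<^esub> k) \<odot>\<^sub>?T (\<ominus>\<^sub>?T t) = \<zero>\<^sub>?T"
    using sk[of k] by (simp_all add: T.smult_r_minus module_neg_zero[OF T])
   then show ?thesis by blast
  qed
  show "t \<oplus>\<^sub>?T u\<in>?H" if tH: "t\<in>?H" and uH: "u\<in>?H" for t u
  proof -
   obtain k l :: nat where *: "t\<in>carrier ?T" "(s [^]\<^bsub>R\<^esub> k) \<odot>\<^sub>?T t = \<zero>\<^sub>?T" "u\<in>carrier ?T" "(s [^]\<^bsub>R\<^esub> l) \<odot>\<^sub>?T u = \<zero>\<^sub>?T"
    using tH uH by blast
   then have "(s [^]\<^bsub>R\<^esub> (k + l)) \<odot>\<^sub>?T (t \<oplus>\<^sub>?T u) = \<zero>\<^sub>?T" using sk[of "k + l"] up by (simp add: T.smult_r_distr)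
   then show ?thesis using * by blast
  qed
  show "r \<odot>\<^sub>?T t\<in>?H" if r: "r\<in>carrier R" and tH: "t\<in>?H" for r t
  proof -
   obtain k :: nat where *: "t\<in>carrier ?T" "(s [^]\<^bsub>R\<^esub> k) \<odot>\<^sub>?T t = \<zero>\<^sub>?T" using tH by blast
   have "(s [^]\<^bsub>R\<^esub> k) \<odot>\<^sub>?T (r \<odot>\<^sub>?T t) = r \<odot>\<^sub>?T ((s [^]\<^bsub>R\<^esub> k) \<odot>\<^sub>?T t)"
    using T.smult_assoc1[OF sk r *(1)] T.smult_assoc1[OF r sk *(1)] T.R.m_comm[OF sk r] by metis
   then have "(s [^]\<^bsub>R\<^esub> k) \<odot>\<^sub>?T (r \<odot>\<^sub>?T t) = \<zero>\<^sub>?T" using * r by simp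
   then show ?thesis using * r by blast
  qed
 qed auto
 moreover have "pure_tensor R A N a n\<in>?H" if a: "a\<in>carrier A" and n: "n\<in>carrier N" for a n
 proof -
  obtain k :: nat where k: "(s [^]\<^bsub>R\<^esub> k) \<odot>\<^sub>A a = \<zero>\<^sub>A" using tors[OF a] by blast
  have "(s [^]\<^bsub>R\<^esub> k) \<odot>\<^sub>?T pure_tensor R A N a n = \<zero>\<^sub>?T"
   using hom_smult[OF pure_hom(1)[OF A N n] sk a, of k] k hom_zero[OF A T pure_hom(1)[OF A N n]] by simp
  then show ?thesis using pure_closed[OF A N a n] by blast
 qed
 ultimately have "t\<in>?H" by (rule tensor_span[OF A N _ _ t])
 then show ?thesis by blast
qed

text \<open>Up to homotopy \<open>g\<close> inverts \<open>s\<close> on \<open>F\<close>. By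
  induction on the power of \<open>s\<close> killing \<open>z\<close>, the cycle \<open>s z\<close>
  is a boundary, and \<open>z\<close> is the sum of \<open>z - g (s z)\<close>, a boundary by the
  homotopy, and of the boundary \<open>g (s z)\<close>.\<close>

lemma tensor_exact_of_torsion:
 assumes A: "module R A" and s: "s\<in>carrier R" and g: "!!j. g j\<in>mod_hom R (obj F j) (obj F j)"
  and comm: "!!j y. y\<in>carrier (obj F j) ==> g (j + 1) (diff F j y) = diff F j (g j y)"
  and h: "!!j. h j\<in>mod_hom R (obj F j) (obj F (j - 1))"
  and eq: "!!j y. y\<in>carrier (obj F j) ==>
   y \<ominus>\<^bsub>obj F j\<^esub> g j (s \<odot>\<^bsub>obj F j\<^esub> y) = diff F (j - 1) (h j y) \<oplus>\<^bsub>obj F j\<^esub> h (j + 1) (diff F j y)"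
  and tors: "!!a. a\<in>carrier A ==> EX k::nat. (s [^]\<^bsub>R\<^esub> k) \<odot>\<^sub>A a = \<zero>\<^sub>A"
 shows "tensor_exact R A F" unfolding tensor_exact_def
proof (intro allI ballI impI)
 fix j z assume z: "z\<in>carrier (tensor R A (obj F (j + 1)))"
  and dz: "tensor_diff R A F (j + 1) z = \<zero>\<^bsub>tensor R A (obj F (j + 1 + 1))\<^esub>"
 note FM = complexD(1)[OF F]
 have T: "module R (tensor R A (obj F j))" for j by (rule tensor_module[OF A FM])
 let ?T = "tensor R A (obj F (j + 1))"
 interpret T: module R ?T by (rule T)
 interpret F1: module R "obj F (j + 1)" by (rule FM)
 let ?B = "tensor_diff R A F j ` carrier (tensor R A (obj F j))"
 have B: "submodule ?B R ?T" by (rule image_submodule[OF T T tensor_diff_hom[OF A]])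
 let ?g = "%j. tensor_map R A (obj F j) A (obj F j) (%a. a) (g j)"
 have gm: "?g j\<in>mod_hom R (tensor R A (obj F j)) (tensor R A (obj F j))" for j by (rule tensor_map_hom(1)[OF A FM A FM hom_id g])
 have sF: "(%y. s \<odot>\<^bsub>obj F j\<^esub> y)\<in>mod_hom R (obj F j) (obj F j)" for j by (rule hom_smult_self[OF FM s])
 have gs: "(%y. g j (s \<odot>\<^bsub>obj F j\<^esub> y))\<in>mod_hom R (obj F j) (obj F j)" for j by (rule hom_comp[OF sF g])
 have main: "z\<in>?B" if "z\<in>carrier ?T" "tensor_diff R A F (j + 1) z = \<zero>\<^bsub>tensor R A (obj F (j + 1 + 1))\<^esub>"
  "(s [^]\<^bsub>R\<^esub> k) \<odot>\<^sub>?T z = \<zero>\<^sub>?T" for z and k :: nat using that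
 proof (induction k arbitrary: z)
  case 0
  then show ?case using submodule_mem(2)[OF T B] by simp
 next
  case (Suc k)
  note z = Suc.prems(1) and dz = Suc.prems(2)
  let ?sz = "s \<odot>\<^sub>?T z"
  have sz: "?sz\<in>carrier ?T" using s z by simp
  have "tensor_diff R A F (j + 1) ?sz = \<zero>\<^bsub>tensor R A (obj F (j + 1 + 1))\<^esub>"
   unfolding hom_smult[OF tensor_diff_hom[OF A] s z] dz by (rule module.smult_r_null[OF T s])
  moreover have "(s [^]\<^bsub>R\<^esub> k) \<odot>\<^sub>?T ?sz = \<zero>\<^sub>?T" using Suc.prems(3) s z by (simp add: T.smult_assoc1)
  ultimately have "?sz\<in>?B" using Suc.IH[OF sz] by blast
  then obtain w where w: "w\<in>carrier (tensor R A (obj F j))" "?sz = tensor_diff R A F j w" by blast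
  have gB: "?g (j + 1) ?sz\<in>?B"
  proof -
   have "?g (j + 1) (tensor_diff R A F j w) = tensor_diff R A F j (?g j w)" by (rule tensor_diff_chain_map[OF A g comm w(1)])
   then show ?thesis unfolding w(2) using hom_closed[OF gm w(1)] by blast
  qed
  have hB: "tensor_map R A (obj F (j + 1)) A (obj F (j + 1)) (%a. a) (%y. y \<ominus>\<^bsub>obj F (j + 1)\<^esub> g (j + 1) (s \<odot>\<^bsub>obj F (j + 1)\<^esub> y)) z\<in>?B"
   by (rule tensor_homotopy[where g = "%j y. y \<ominus>\<^bsub>obj F j\<^esub> g j (s \<odot>\<^bsub>obj F j\<^esub> y)", OF A hom_minus_map[OF FM hom_id gs] h eq z dz])
  have "z = tensor_map R A (obj F (j + 1)) A (obj F (j + 1)) (%a. a) (%y. (y \<ominus>\<^bsub>obj F (j + 1)\<^esub> g (j + 1) (s \<odot>\<^bsub>obj F (j + 1)\<^esub> y)) \<oplus>\<^bsub>obj F (j + 1)\<^esub> g (j + 1) (s \<odot>\<^bsub>obj F (j + 1)\<^esub> y)) z"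
  proof -
   have "(y \<ominus>\<^bsub>obj F (j + 1)\<^esub> g (j + 1) (s \<odot>\<^bsub>obj F (j + 1)\<^esub> y)) \<oplus>\<^bsub>obj F (j + 1)\<^esub> g (j + 1) (s \<odot>\<^bsub>obj F (j + 1)\<^esub> y) = y"
    if y: "y\<in>carrier (obj F (j + 1))" for y using y hom_closed[OF gs y] by (simp add: a_minus_def F1.M.a_assoc F1.M.l_neg)
   then show ?thesis using tensor_map_cong[OF A FM A FM hom_id hom_add_map[OF FM hom_minus_map[OF FM hom_id gs] gs] hom_id hom_id refl _ z]
     tensor_map_id[OF A FM z] by simp
  qed
  also have "... = tensor_map R A (obj F (j + 1)) A (obj F (j + 1)) (%a. a) (%y. y \<ominus>\<^bsub>obj F (j + 1)\<^esub> g (j + 1) (s \<odot>\<^bsub>obj F (j + 1)\<^esub> y)) z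
    \<oplus>\<^sub>?T tensor_map R A (obj F (j + 1)) A (obj F (j + 1)) (%a. a) (%y. g (j + 1) (s \<odot>\<^bsub>obj F (j + 1)\<^esub> y)) z"
   by (rule tensor_map_add_right[OF A FM A FM hom_id hom_minus_map[OF FM hom_id gs] gs z])
  also have "tensor_map R A (obj F (j + 1)) A (obj F (j + 1)) (%a. a) (%y. g (j + 1) (s \<odot>\<^bsub>obj F (j + 1)\<^esub> y)) z = ?g (j + 1) ?sz"
   unfolding tensor_map_smult_right[OF A FM s z, symmetric] by (rule tensor_map_comp[OF A FM A FM A FM hom_id sF hom_id g z, symmetric])
  finally show ?case using submodule_mem(5)[OF T B hB gB] by simp
 qed
 obtain k :: nat where "(s [^]\<^bsub>R\<^esub> k) \<odot>\<^sub>?T z = \<zero>\<^sub>?T" using tensor_torsion[OF A FM s tors z] by blast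
 then show "z\<in>?B" by (rule main[OF z dz])
qed

end

section \<open>Free resolutions\<close>

lemma stalk_simps:
 "obj (stalk_complex M) n = (if n = 0 then M else zero_module M)" "diff (stalk_complex M) n y = \<zero>\<^sub>M" by (simp_all add: stalk_complex_def)

lemma complex_stalk:
 assumes M: "module R M" shows "cochain_complex R (stalk_complex M)"
proof (rule complexI)
 interpret M: module R M by fact
 fix n
 show "module R (obj (stalk_complex M) n)" using M zero_module_module[OF M] by (simp add: stalk_simps)
 show "diff (stalk_complex M) n\<in>mod_hom R (obj (stalk_complex M) n) (obj (stalk_complex M) (n + 1))" by (rule mod_homI) (auto simp: stalk_simps)
qed (auto simp: stalk_simps)

lemma stalk_cycles: "module R M ==> cycles (stalk_complex M) n = carrier (obj (stalk_complex M) n)"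
 by (auto simp: cycles_def stalk_simps)

lemma stalk_boundaries:
 assumes M: "module R M" shows "boundaries (stalk_complex M) n = {\<zero>\<^sub>M}"
proof -
 interpret M: module R M by fact
 have "carrier (obj (stalk_complex M) (n - 1)) ~= {}" by (auto simp: stalk_simps intro: M.M.zero_closed)
 then show ?thesis by (auto simp: boundaries_def stalk_simps)
qed

text \<open>The quasi-isomorphism amounts to its component in degree zero, the augmentation
  \<open>e\<close>. Since \<open>F\<close> vanishes in degree one, all of \<open>F\<close> in degree
  zero consists of cycles.\<close>

lemma free_resolution_facts:
 assumes N: "module R N" and F: "is_free_resolution R N F"
 obtains e where "cochain_complex R F" "!!j. free_module R (obj F j)" "!!j. j > 0 ==> carrier (obj F j) = {\<zero>\<^bsub>obj F j\<^esub>}"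
  "e\<in>mod_hom R (obj F 0) N" "carrier N <= e ` carrier (obj F 0)"
  "!!y. y\<in>carrier (obj F 0) ==> e y = \<zero>\<^sub>N \<longleftrightarrow> y\<in>boundaries F 0"
  "!!j y. j ~= 0 ==> y\<in>cycles F j ==> y\<in>boundaries F j"
proof -
 interpret N: module R N by fact
 have C: "cochain_complex R F" and free: "!!j. free_module R (obj F j)"
  and pos: "!!j. j > 0 ==> carrier (obj F j) = {\<zero>\<^bsub>obj F j\<^esub>}" using F by (auto simp: is_free_resolution_def)
 obtain f where "quasi_iso R F (stalk_complex N) f" using F unfolding is_free_resolution_def by blast
 then have cm: "chain_map R F (stalk_complex N) f"
  and inj: "!!n z. z\<in>cycles F n ==> f n z\<in>boundaries (stalk_complex N) n ==> z\<in>boundaries F n"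
  and surj: "!!n w. w\<in>cycles (stalk_complex N) n ==> EX z:cycles F n. w \<ominus>\<^bsub>obj (stalk_complex N) n\<^esub> f n z\<in>boundaries (stalk_complex N) n"
  using quasi_iso_iff[OF C complex_stalk[OF N]] by auto
 note b = stalk_boundaries[OF N] and c = stalk_cycles[OF N]
 have e: "f 0\<in>mod_hom R (obj F 0) N" using chain_map_hom[OF cm, of 0] by (simp add: stalk_simps)
 have cyc0: "y\<in>cycles F 0" if y: "y\<in>carrier (obj F 0)" for y using hom_closed[OF complexD(2)[OF C] y] pos[of 1] y by (simp add: cycles_def)
 show thesis
 proof (rule that[OF C free pos e])
  show "carrier N <= f 0 ` carrier (obj F 0)"
  proof
   fix w assume w: "w\<in>carrier N"
   then obtain z where z: "z\<in>cycles F 0" "w \<ominus>\<^sub>N f 0 z = \<zero>\<^sub>N" using surj[of w 0] unfolding b c by (auto simp: stalk_simps)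
   have zc: "z\<in>carrier (obj F 0)" using z(1) by (simp add: cycles_def)
   then have "w = f 0 z" using z(2) minus_eq_zero_iff[OF N w hom_closed[OF e zc]] by simp
   then show "w\<in>f 0 ` carrier (obj F 0)" using zc by blast
  qed
  show "f 0 y = \<zero>\<^sub>N \<longleftrightarrow> y\<in>boundaries F 0" if y: "y\<in>carrier (obj F 0)" for y
   using inj[OF cyc0[OF y]] chain_map_boundaries[OF C complex_stalk[OF N] cm, of y 0] unfolding b by blast
  show "y\<in>boundaries F j" if j: "j ~= 0" and y: "y\<in>cycles F j" for j y
  proof (rule inj[OF y])
   have "y\<in>carrier (obj F j)" using y by (simp add: cycles_def)
   then show "f j y\<in>boundaries (stalk_complex N) j" using hom_closed[OF chain_map_hom[OF cm], of y j] j unfolding b by (simp add: stalk_simps)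
  qed
 qed
qed

context
 fixes R :: "('a, 'r) ring_scheme" and N :: "('a, 'n) module" and F :: "('a, 'f) cochain" and e
 assumes N: "module R N" and C: "cochain_complex R F" and free: "!!j. free_module R (obj F j)"
  and pos: "!!j. j > 0 ==> carrier (obj F j) = {\<zero>\<^bsub>obj F j\<^esub>}"
  and e: "e\<in>mod_hom R (obj F 0) N" and e_surj: "carrier N <= e ` carrier (obj F 0)"
  and e_ker: "!!y. y\<in>carrier (obj F 0) ==> e y = \<zero>\<^sub>N \<longleftrightarrow> y\<in>boundaries F 0"
  and exact: "!!j y. j ~= 0 ==> y\<in>cycles F j ==> y\<in>boundaries F j"
begin

text \<open>Uniqueness in the comparison of resolutions. The homotopy is built downwards from degree
  zero: each component lifts, through the differential, an error that lies in the boundaries, by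
  projectivity of free modules.\<close>

lemma resolution_null_homotopy:
 assumes g: "chain_map R F F g" and eg: "!!y. y\<in>carrier (obj F 0) ==> e (g 0 y) = \<zero>\<^sub>N"
 obtains h where "!!j. h j\<in>mod_hom R (obj F j) (obj F (j - 1))"
  "!!j y. y\<in>carrier (obj F j) ==> g j y = diff F (j - 1) (h j y) \<oplus>\<^bsub>obj F j\<^esub> h (j + 1) (diff F j y)"
proof -
 note FM = complexD(1)[OF C] and d = complexD(2)[OF C] and d' = complexD(3)[OF C]
 note gh = chain_map_hom[OF g] and gc = chain_map_comm[OF g]
 \<comment> \<open>\<open>h'\<close> is the component from degree \<open>j + 1\<close> to
   \<open>j\<close>. \<open>P\<close> says that the error left in degree \<open>j\<close> consists
   of boundaries, so that the next component can be lifted; \<open>Q\<close> is the homotopy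
   equation.\<close>
 define P where "P j h' \<longleftrightarrow> h'\<in>mod_hom R (obj F (j + 1)) (obj F j) &
  (ALL y:carrier (obj F j). g j y \<ominus>\<^bsub>obj F j\<^esub> h' (diff F j y)\<in>boundaries F j)" for j h'
 define Q where "Q j h' h \<longleftrightarrow> (ALL y:carrier (obj F j). g j y = diff F (j - 1) (h y) \<oplus>\<^bsub>obj F j\<^esub> h' (diff F j y))" for j h' h
 have step: "EX h. P (j - 1) h & Q j h' h" if P: "P j h'" and j: "j \<le> 0" for j h'
 proof -
  interpret F0: module R "obj F j" by (rule FM)
  have h': "h'\<in>mod_hom R (obj F (j + 1)) (obj F j)" using P by (simp add: P_def)
  have hd: "(%y. h' (diff F j y))\<in>mod_hom R (obj F j) (obj F j)" by (rule hom_comp[OF d h'])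
  have f: "(%y. g j y \<ominus>\<^bsub>obj F j\<^esub> h' (diff F j y))\<in>mod_hom R (obj F j) (obj F j)"
   by (rule hom_minus_map[OF FM gh hd])
  have im: "g j y \<ominus>\<^bsub>obj F j\<^esub> h' (diff F j y)\<in>diff F (j - 1) ` carrier (obj F (j - 1))" if "y\<in>carrier (obj F j)" for y
   using P that by (simp add: P_def boundaries_def)
  obtain h where h: "h\<in>mod_hom R (obj F j) (obj F (j - 1))"
   "!!y. y\<in>carrier (obj F j) ==> diff F (j - 1) (h y) = g j y \<ominus>\<^bsub>obj F j\<^esub> h' (diff F j y)"
   by (rule free_module_projective[OF free FM FM d' f im]) (assumption, blast)
  have "Q j h' h" unfolding Q_def
  proof
   fix y assume y: "y\<in>carrier (obj F j)"
   show "g j y = diff F (j - 1) (h y) \<oplus>\<^bsub>obj F j\<^esub> h' (diff F j y)"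
    unfolding h(2)[OF y] using hom_closed[OF gh y] hom_closed[OF hd y] by (simp add: a_minus_def F0.M.a_assoc F0.M.l_neg)
  qed
  moreover have "P (j - 1) h" unfolding P_def
  proof (intro conjI ballI)
   show "h\<in>mod_hom R (obj F (j - 1 + 1)) (obj F (j - 1))" using h(1) by simp
   fix y assume y: "y\<in>carrier (obj F (j - 1))"
   have dy: "diff F (j - 1) y\<in>carrier (obj F j)" by (rule hom_closed[OF d' y])
   have dz: "diff F j (diff F (j - 1) y) = \<zero>\<^bsub>obj F (j + 1)\<^esub>" by (rule complexD(5)[OF C y])
   note c1 = hom_closed[OF gh y] hom_closed[OF h(1) dy] hom_closed[OF gh dy]
   interpret F1: module R "obj F (j - 1)" by (rule FM)
   have gc': "diff F (j - 1) (g (j - 1) y) = g j (diff F (j - 1) y)" using gc[OF y] by simp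
   have "diff F (j - 1) (g (j - 1) y \<ominus>\<^bsub>obj F (j - 1)\<^esub> h (diff F (j - 1) y)) = \<zero>\<^bsub>obj F j\<^esub>"
    unfolding hom_minus[OF FM FM d' c1(1,2)] h(2)[OF dy] dz gc' hom_zero[OF FM FM h']
    using c1(3) by (simp add: a_minus_def module_neg_zero[OF FM] F0.M.r_neg)
   then have "g (j - 1) y \<ominus>\<^bsub>obj F (j - 1)\<^esub> h (diff F (j - 1) y)\<in>cycles F (j - 1)"
    using F1.M.minus_closed[OF c1(1,2)] by (simp add: cycles_def)
   then show "g (j - 1) y \<ominus>\<^bsub>obj F (j - 1)\<^esub> h (diff F (j - 1 ) y)\<in>boundaries F (j - 1)" using exact j by simp
  qed
  ultimately show ?thesis by blast
 qed
 have zmap: "(%y. \<zero>\<^bsub>obj F j\<^esub>)\<in>mod_hom R (obj F i) (obj F j)" for i j by (rule hom_zero_map[OF FM])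
 have base: "P 0 (%y. \<zero>\<^bsub>obj F 0\<^esub>)" unfolding P_def
 proof (intro conjI ballI zmap)
  interpret F0: module R "obj F 0" by (rule FM)
  fix y assume y: "y\<in>carrier (obj F 0)"
  have gy: "g 0 y\<in>carrier (obj F 0)" by (rule hom_closed[OF gh y])
  have "g 0 y\<in>boundaries F 0" using e_ker[OF gy] eg[OF y] by simp
  then show "g 0 y \<ominus>\<^bsub>obj F 0\<^esub> \<zero>\<^bsub>obj F 0\<^esub>\<in>boundaries F 0" using gy by (simp add: a_minus_def module_neg_zero[OF FM])
 qed
 have "EX s. ALL k. (P (- int k) (s k) & (k = 0 --> s k = (%y. \<zero>\<^bsub>obj F 0\<^esub>))) & Q (- int k) (s k) (s (Suc k))"
 proof (rule dependent_nat_choice)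
  show "EX x. P (- int 0) x & (0 = 0 --> x = (%y. \<zero>\<^bsub>obj F 0\<^esub>))" using base by simp
  fix h' k assume "P (- int k) h' & (k = 0 --> h' = (%y. \<zero>\<^bsub>obj F 0\<^esub>))"
  then have "EX h. P (- int k - 1) h & Q (- int k) h' h" using step by simp
  moreover have e: "- int (Suc k) = - int k - 1" by simp
  ultimately show "EX h. (P (- int (Suc k)) h & (Suc k = 0 --> h = (%y. \<zero>\<^bsub>obj F 0\<^esub>))) & Q (- int k) h' h"
   unfolding e by simp
 qed
 then obtain s where s0: "s 0 = (%y. \<zero>\<^bsub>obj F 0\<^esub>)" and sP: "!!k. P (- int k) (s k)" and sQ: "!!k. Q (- int k) (s k) (s (Suc k))"
  by blast
 \<comment> \<open>\<open>s k\<close> is the component out of degree \<open>1 - k\<close>, whence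
   the index \<open>1 - j\<close>. It starts with the zero map out of degree one, matching the zero
   maps above.\<close>
 define h where "h j = (if j > 1 then (%y. \<zero>\<^bsub>obj F (j - 1)\<^esub>) else s (nat (1 - j)))" for j
 have hpos: "h j = (%y. \<zero>\<^bsub>obj F (j - 1)\<^esub>)" if "j \<ge> 1" for j using that s0 by (auto simp: h_def)
 have hm: "h j\<in>mod_hom R (obj F j) (obj F (j - 1))" for j
 proof (cases "j > 1")
  case False
  then have "P (j - 1) (s (nat (1 - j)))" using sP[of "nat (1 - j)"] by simp
  then show ?thesis using False by (simp add: P_def h_def)
 qed (simp add: h_def zmap)
 have "g j y = diff F (j - 1) (h j y) \<oplus>\<^bsub>obj F j\<^esub> h (j + 1) (diff F j y)" if y: "y\<in>carrier (obj F j)" for j y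
 proof (cases "j > 0")
  case True
  interpret F0: module R "obj F j" by (rule FM)
  have "g j y = \<zero>\<^bsub>obj F j\<^esub>" using hom_closed[OF gh y] pos[OF True] by simp
  then show ?thesis using True by (simp add: hpos hom_zero[OF FM FM d'])
 next
  case False
  then have "- int (nat (- j)) = j" "h (j + 1) = s (nat (- j))" "h j = s (Suc (nat (- j)))" by (auto simp: h_def Suc_nat_eq_nat_zadd1)
  then have "Q j (h (j + 1)) (h j)" using sQ[of "nat (- j)"] by simp
  then show ?thesis using y by (simp add: Q_def)
 qed
 then show thesis using that hm by blast
qed

text \<open>Existence in the comparison of resolutions, for an endomorphism of \<open>N\<close>:
  degree zero is lifted along \<open>e\<close>, lower degrees along the differentials.
  \<open>P\<close> records that boundaries are mapped to boundaries, which makes the next lift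
  possible.\<close>

lemma resolution_lift:
 assumes f: "f\<in>mod_hom R N N"
 obtains g where "chain_map R F F g" "!!y. y\<in>carrier (obj F 0) ==> e (g 0 y) = f (e y)"
proof -
 note FM = complexD(1)[OF C] and d = complexD(2)[OF C] and d' = complexD(3)[OF C]
 define P where "P j g \<longleftrightarrow> g\<in>mod_hom R (obj F j) (obj F j) &
  (ALL y:carrier (obj F (j - 1)). g (diff F (j - 1) y)\<in>boundaries F j)" for j g
 define Q where "Q j g g' \<longleftrightarrow> (ALL y:carrier (obj F (j - 1)). diff F (j - 1) (g' y) = g (diff F (j - 1) y))" for j g g'
 have step: "EX g'. P (j - 1) g' & Q j g g'" if P: "P j g" and j: "j \<le> 0" for j g
 proof -
  have g: "g\<in>mod_hom R (obj F j) (obj F j)" using P by (simp add: P_def)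
  have gd: "(%y. g (diff F (j - 1) y))\<in>mod_hom R (obj F (j - 1)) (obj F j)" by (rule hom_comp[OF d' g])
  have im: "g (diff F (j - 1) y)\<in>diff F (j - 1) ` carrier (obj F (j - 1))" if "y\<in>carrier (obj F (j - 1))" for y
   using P that by (simp add: P_def boundaries_def)
  obtain g' where g': "g'\<in>mod_hom R (obj F (j - 1)) (obj F (j - 1))"
   "!!y. y\<in>carrier (obj F (j - 1)) ==> diff F (j - 1) (g' y) = g (diff F (j - 1) y)"
   by (rule free_module_projective[OF free FM FM d' gd im]) (assumption, blast)
  have "P (j - 1) g'" unfolding P_def
  proof (intro conjI ballI g'(1))
   fix y assume y: "y\<in>carrier (obj F (j - 1 - 1))"
   have dy: "diff F (j - 1 - 1) y\<in>carrier (obj F (j - 1))" by (rule hom_closed[OF d' y])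
   have "diff F (j - 1) (diff F (j - 1 - 1) y) = \<zero>\<^bsub>obj F j\<^esub>" using complexD(5)[OF C y] by simp
   then have "diff F (j - 1) (g' (diff F (j - 1 - 1) y)) = \<zero>\<^bsub>obj F j\<^esub>" unfolding g'(2)[OF dy] using hom_zero[OF FM FM g] by simp
   then have "g' (diff F (j - 1 - 1) y)\<in>cycles F (j - 1)" using hom_closed[OF g'(1) dy] by (simp add: cycles_def)
   then show "g' (diff F (j - 1 - 1) y)\<in>boundaries F (j - 1)" using exact j by simp
  qed
  moreover have "Q j g g'" using g'(2) by (simp add: Q_def)
  ultimately show ?thesis by blast
 qed
 have "f (e y)\<in>e ` carrier (obj F 0)" if "y\<in>carrier (obj F 0)" for y using e_surj hom_closed[OF f hom_closed[OF e that]] by blast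
 then obtain g0 where g0: "g0\<in>mod_hom R (obj F 0) (obj F 0)" "!!y. y\<in>carrier (obj F 0) ==> e (g0 y) = f (e y)"
  using free_module_projective[OF free FM N e hom_comp[OF e f]] by blast
 have base: "P 0 g0" unfolding P_def
 proof (intro conjI ballI g0(1))
  fix y assume y: "y\<in>carrier (obj F (0 - 1))"
  have dy: "diff F (0 - 1) y\<in>carrier (obj F 0)" by (rule hom_closed[OF d' y])
  have "diff F (0 - 1) y\<in>boundaries F 0" using y by (auto simp: boundaries_def)
  then have "e (diff F (0 - 1) y) = \<zero>\<^sub>N" using e_ker[OF dy] by simp
  then have "e (g0 (diff F (0 - 1) y)) = \<zero>\<^sub>N" unfolding g0(2)[OF dy] using hom_zero[OF N N f] by simp
  then show "g0 (diff F (0 - 1) y)\<in>boundaries F 0" using e_ker[OF hom_closed[OF g0(1) dy]] by simp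
 qed
 have "EX s. ALL k. (P (- int k) (s k) & (k = 0 --> s k = g0)) & Q (- int k) (s k) (s (Suc k))"
 proof (rule dependent_nat_choice)
  show "EX x. P (- int 0) x & (0 = 0 --> x = g0)" using base by simp
  fix g k assume "P (- int k) g & (k = 0 --> g = g0)"
  then have "EX g'. P (- int k - 1) g' & Q (- int k) g g'" using step by simp
  moreover have e: "- int (Suc k) = - int k - 1" by simp
  ultimately show "EX g'. (P (- int (Suc k)) g' & (Suc k = 0 --> g' = g0)) & Q (- int k) g g'" unfolding e by simp
 qed
 then obtain s where s0: "s 0 = g0" and sP: "!!k. P (- int k) (s k)" and sQ: "!!k. Q (- int k) (s k) (s (Suc k))" by blast
 define g where "g j = (if j > 0 then (%y. \<zero>\<^bsub>obj F j\<^esub>) else s (nat (- j)))" for j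
 have gm: "g j\<in>mod_hom R (obj F j) (obj F j)" for j
 proof (cases "j > 0")
  case False
  then have "P j (s (nat (- j)))" using sP[of "nat (- j)"] by simp
  then show ?thesis using False by (simp add: P_def g_def)
 qed (simp add: g_def hom_zero_map[OF FM])
 have "g (j + 1) (diff F j y) = diff F j (g j y)" if y: "y\<in>carrier (obj F j)" for j y
 proof (cases "j \<ge> 0")
  case True
  then have "carrier (obj F (j + 1)) = {\<zero>\<^bsub>obj F (j + 1)\<^esub>}" using pos by simp
  then show ?thesis using hom_closed[OF gm hom_closed[OF d y]] hom_closed[OF d hom_closed[OF gm y]] by simp
 next
  case False
  then have "- int (nat (- j - 1)) = j + 1" "g (j + 1) = s (nat (- j - 1))" "g j = s (Suc (nat (- j - 1)))" by (auto simp: g_def Suc_nat_eq_nat_zadd1)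
  then have "Q (j + 1) (g (j + 1)) (g j)" using sQ[of "nat (- j - 1)"] by simp
  then show ?thesis using y by (simp add: Q_def)
 qed
 then have "chain_map R F F g" using gm by (simp add: chain_map_def)
 moreover have "g 0 = g0" using s0 by (simp add: g_def)
 ultimately show thesis using that g0(2) by simp
qed

text \<open>If \<open>s\<close> kills \<open>N\<close>, multiplication by \<open>s\<close> lifts the zero map, so it is null-homotopic on the resolution.\<close>

lemma resolution_smult_null:
 assumes s: "s\<in>carrier R" and zero: "!!y. y\<in>carrier N ==> s \<odot>\<^sub>N y = \<zero>\<^sub>N"
  and A: "module R A" and bij: "bij_betw (%a. s \<odot>\<^sub>A a) (carrier A) (carrier A)"
 shows "tensor_exact R A F"
proof -
 note FM = complexD(1)[OF C] and d = complexD(2)[OF C]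
 have cm: "chain_map R F F (%j y. s \<odot>\<^bsub>obj F j\<^esub> y)"
  unfolding chain_map_def by (intro allI conjI ballI hom_smult_self[OF FM s]) (simp add: hom_smult[OF d s])
 have "e (s \<odot>\<^bsub>obj F 0\<^esub> y) = \<zero>\<^sub>N" if y: "y\<in>carrier (obj F 0)" for y
  unfolding hom_smult[OF e s y] by (rule zero[OF hom_closed[OF e y]])
 then obtain h where h: "!!j. h j\<in>mod_hom R (obj F j) (obj F (j - 1))"
  "!!j y. y\<in>carrier (obj F j) ==> s \<odot>\<^bsub>obj F j\<^esub> y = diff F (j - 1) (h j y) \<oplus>\<^bsub>obj F j\<^esub> h (j + 1) (diff F j y)"
  using resolution_null_homotopy[OF cm] by blast
 show ?thesis by (rule tensor_exact_of_bijective[OF C A s h bij])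
qed

text \<open>If \<open>s\<close> acts bijectively on \<open>N\<close>, a lift of its inverse is inverse to it up to homotopy.\<close>

lemma resolution_smult_iso:
 assumes s: "s\<in>carrier R" and bij: "bij_betw (%y. s \<odot>\<^sub>N y) (carrier N) (carrier N)"
  and A: "module R A" and tors: "!!a. a\<in>carrier A ==> EX k::nat. (s [^]\<^bsub>R\<^esub> k) \<odot>\<^sub>A a = \<zero>\<^sub>A"
 shows "tensor_exact R A F"
proof -
 note FM = complexD(1)[OF C] and d = complexD(2)[OF C]
 obtain f where f: "f\<in>mod_hom R N N" "!!y. y\<in>carrier N ==> f (s \<odot>\<^sub>N y) = y"
  using hom_inverse[OF N N hom_smult_self[OF N s] bij] by metis
 obtain g where g: "chain_map R F F g" "!!y. y\<in>carrier (obj F 0) ==> e (g 0 y) = f (e y)"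
  using resolution_lift[OF f(1)] by blast
 note gm = chain_map_hom[OF g(1)] and gc = chain_map_comm[OF g(1)]
 have sF: "(%y. s \<odot>\<^bsub>obj F j\<^esub> y)\<in>mod_hom R (obj F j) (obj F j)" for j by (rule hom_smult_self[OF FM s])
 have gs: "(%y. g j (s \<odot>\<^bsub>obj F j\<^esub> y))\<in>mod_hom R (obj F j) (obj F j)" for j by (rule hom_comp[OF sF gm])
 have cm: "chain_map R F F (%j y. y \<ominus>\<^bsub>obj F j\<^esub> g j (s \<odot>\<^bsub>obj F j\<^esub> y))" unfolding chain_map_def
 proof (intro allI conjI ballI hom_minus_map[OF FM hom_id gs])
  fix j y assume y: "y\<in>carrier (obj F j)"
  have "g (j + 1) (s \<odot>\<^bsub>obj F (j + 1)\<^esub> diff F j y) = diff F j (g j (s \<odot>\<^bsub>obj F j\<^esub> y))"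
   unfolding hom_smult[OF d s y, symmetric] by (rule gc[OF hom_closed[OF sF y]])
  then show "diff F j y \<ominus>\<^bsub>obj F (j + 1)\<^esub> g (j + 1) (s \<odot>\<^bsub>obj F (j + 1)\<^esub> diff F j y) = diff F j (y \<ominus>\<^bsub>obj F j\<^esub> g j (s \<odot>\<^bsub>obj F j\<^esub> y))"
   unfolding hom_minus[OF FM FM d y hom_closed[OF gs y]] by simp
 qed
 have "e (y \<ominus>\<^bsub>obj F 0\<^esub> g 0 (s \<odot>\<^bsub>obj F 0\<^esub> y)) = \<zero>\<^sub>N" if y: "y\<in>carrier (obj F 0)" for y
  unfolding hom_minus[OF FM N e y hom_closed[OF gs y]] g(2)[OF hom_closed[OF sF y]] hom_smult[OF e s y]
   f(2)[OF hom_closed[OF e y]] using minus_eq_zero_iff[OF N hom_closed[OF e y] hom_closed[OF e y]] by simp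
 then obtain h where h: "!!j. h j\<in>mod_hom R (obj F j) (obj F (j - 1))"
  "!!j y. y\<in>carrier (obj F j) ==> y \<ominus>\<^bsub>obj F j\<^esub> g j (s \<odot>\<^bsub>obj F j\<^esub> y) = diff F (j - 1) (h j y) \<oplus>\<^bsub>obj F j\<^esub> h (j + 1) (diff F j y)"
  using resolution_null_homotopy[OF cm] by blast
 show ?thesis by (rule tensor_exact_of_torsion[OF C A s gm gc h tors])
qed

text \<open>Right exactness at degree \<open>0\<close>: a bilinear map on \<open>A \<times> N\<close> gives a map on \<open>A \<otimes> F\<^sup>0\<close> vanishing on boundaries.\<close>

lemma tensor_exact_bilinear_zero:
 assumes A: "module R A" and P: "module R P" and ex: "tensor_exact R A F" and g: "bilinear_map R A N P g"
  and a: "a\<in>carrier A" and y: "y\<in>carrier N"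
 shows "g a y = \<zero>\<^sub>P"
proof -
 note FM = complexD(1)[OF C] and d = complexD(2)[OF C]
 have g1: "(%m. g m n)\<in>mod_hom R A P" if "n\<in>carrier N" for n using g that by (simp add: bilinear_map_def)
 have g2: "g m\<in>mod_hom R N P" if "m\<in>carrier A" for m using g that by (simp add: bilinear_map_def)
 have bil: "bilinear_map R A (obj F 0) P (%a f. g a (e f))"
  unfolding bilinear_map_def by (intro conjI ballI g1 hom_closed[OF e] hom_comp[OF e g2])
 obtain h where "h\<in>mod_hom R (tensor R A (obj F 0)) P"
  "ALL a:carrier A. ALL f:carrier (obj F 0). h (pure_tensor R A (obj F 0) a f) = g a (e f)" by (rule tensor_lift[OF A FM P bil])
 note h = this(1) this(2)[rule_format]
 have T: "module R (tensor R A (obj F j))" for j by (rule tensor_module[OF A FM])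
 have d1: "diff F (- 1)\<in>mod_hom R (obj F (- 1)) (obj F 0)" using d[of "- 1"] by simp
 have td: "tensor_map R A (obj F (- 1)) A (obj F 0) (%y. y) (diff F (- 1))\<in>mod_hom R (tensor R A (obj F (- 1))) (tensor R A (obj F 0))"
  by (rule tensor_map_hom(1)[OF A FM A FM hom_id d1])
 have hd: "h (tensor_map R A (obj F (- 1)) A (obj F 0) (%y. y) (diff F (- 1)) t) = \<zero>\<^sub>P" if t: "t\<in>carrier (tensor R A (obj F (- 1)))" for t
 proof (rule tensor_hom_eq[OF A FM P hom_comp[OF td h(1)] hom_zero_map[OF P] _ t])
  fix m n assume m: "m\<in>carrier A" and n: "n\<in>carrier (obj F (- 1))"
  have dn: "diff F (- 1) n\<in>carrier (obj F 0)" by (rule hom_closed[OF d1 n])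
  have "diff F (- 1) n\<in>boundaries F 0" using n by (auto simp: boundaries_def)
  then have "e (diff F (- 1) n) = \<zero>\<^sub>N" using e_ker[OF dn] by simp
  then show "h (tensor_map R A (obj F (- 1)) A (obj F 0) (%y. y) (diff F (- 1)) (pure_tensor R A (obj F (- 1)) m n)) = \<zero>\<^sub>P"
   unfolding tensor_map_hom(2)[OF A FM A FM hom_id d1 m n] h(2)[OF m dn] using hom_zero[OF N P g2[OF m]] by simp
 qed
 obtain f where f: "f\<in>carrier (obj F 0)" "y = e f" using e_surj y by blast
 let ?t = "pure_tensor R A (obj F 0) a f"
 have t: "?t\<in>carrier (tensor R A (obj F 0))" by (rule pure_closed[OF A FM a f(1)])
 \<comment> \<open>As \<open>F\<close> vanishes in degree one, every element of degree zero in the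
   tensor product is a cycle, hence by \<open>ex\<close> a boundary, on which \<open>h\<close>
   vanishes.\<close>
 have p1: "carrier (obj F 1) = {\<zero>\<^bsub>obj F 1\<^esub>}" using pos by simp
 have d0: "diff F 0\<in>mod_hom R (obj F 0) (obj F 1)" using d[of 0] by simp
 have "tensor_diff R A F 0 ?t = \<zero>\<^bsub>tensor R A (obj F (0 + 1))\<^esub>"
  by (rule tensor_map_zero_right[OF A FM A FM hom_id d _ t]) (use hom_closed[OF d0] p1 in simp)
 then obtain w where w: "w\<in>carrier (tensor R A (obj F (0 - 1)))"
  "?t = tensor_map R A (obj F (0 - 1)) A (obj F 0) (%y. y) (diff F (0 - 1)) w" by (rule tensor_exactD[OF ex t])
 have "h ?t = \<zero>\<^sub>P" using hd[of w] w by simp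
 then show ?thesis using h(2)[OF a f(1)] f(2) by simp
qed

end

subsection \<open>Existence of free resolutions\<close>

text \<open>A finitely supported function is a finite list of pairs, and such lists over \<open>'b list \<times> 'a\<close> are
 coded by lists over \<open>'b\<close> with the help of two distinct marker symbols.\<close>

context
 fixes u v :: 'b and i :: "'a => 'b"
 assumes uv: "u ~= v" and i: "inj i"
begin

text \<open>\<open>v\<close> announces a further entry and \<open>u\<close> ends the list.\<close>

primrec code_list :: "'b list => 'b list" where
 "code_list [] = [u]"
| "code_list (x # xs) = v # x # code_list xs"

text \<open>Because codes mark their own end, no code is a proper prefix of another, and
  concatenated codes can be split uniquely.\<close>

lemma code_list_append_inject: "code_list xs @ ys = code_list xs' @ ys' ==> xs = xs' & ys = ys'"
proof (induction xs arbitrary: xs')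
 case Nil
 then show ?case using uv by (cases xs') auto
next
 case (Cons x xs)
 then show ?case using uv by (cases xs') auto
qed

primrec code_pairs :: "('b list \<times> 'a) list => 'b list" where
 "code_pairs [] = [u]"
| "code_pairs (q # qs) = v # i (snd q) # code_list (fst q) @ code_pairs qs"

lemma inj_code_pairs: "inj code_pairs"
proof (rule injI)
 show "qs = qs'" if "code_pairs qs = code_pairs qs'" for qs qs' using that
 proof (induction qs arbitrary: qs')
  case Nil
  then show ?case using uv by (cases qs') auto
 next
  case (Cons q qs)
  then obtain q' rs where qs': "qs' = q' # rs" using uv by (cases qs') auto
  then have "i (snd q) = i (snd q')" "code_list (fst q) @ code_pairs qs = code_list (fst q') @ code_pairs rs" using Cons.prems by auto
  then have "snd q = snd q'" "fst q = fst q' & code_pairs qs = code_pairs rs" using injD[OF i] code_list_append_inject by blast+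
  then show ?case using Cons.IH[of rs] qs' by (simp add: prod_eq_iff)
 qed
qed

text \<open>This is the counting argument: finitely supported functions on lists are no more
  numerous than lists. Consequently lists can index a generating family of any submodule of the free
  module on lists.\<close>

lemma finite_support_enumeration:
 "EX f :: 'b list => ('b list => 'a). ALL c. finite {b. c b ~= z} --> c\<in>range f"
proof (intro exI allI impI)
 \<comment> \<open>A list is decoded to an association list, which is read as a function with
   default value \<open>z\<close>.\<close>
 let ?f = "%x b. case map_of (inv_into UNIV code_pairs x) b of None => z | Some a => a"
 fix c :: "'b list => 'a" assume "finite {b. c b ~= z}"
 then obtain bs where bs: "set bs = {b. c b ~= z}" using finite_list by blast
 let ?qs = "map (%b. (b, c b)) bs"
 have e: "c b = (case map_of ?qs b of None => z | Some a => a)" for b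
  using bs by (auto simp: map_of_map_restrict restrict_map_def)
 have "c = ?f (code_pairs ?qs)" unfolding inv_into_f_f[OF inj_code_pairs UNIV_I] by (rule ext) (rule e)
 then show "c\<in>range ?f" by blast
qed

end

text \<open>\<open>free_module\<close> uses the basis elements themselves as indices, so the
  generators have to be pairwise distinct; this is where zero and one must differ.\<close>

lemma free_on_free_module:
 assumes R: "cring R" and ne: "\<zero>\<^sub>R ~= \<one>\<^sub>R"
 shows "free_module R (free_on R (UNIV :: 'b set))"
proof -
 let ?F = "free_on R (UNIV :: 'b set)" let ?g = "generator R :: 'b => _"
 interpret R: cring R by fact
 have F: "module R ?F" by (rule free_on_module[OF R])
 interpret F: module R ?F by fact
 have ginj: "inj ?g" by (rule injI) (metis generator_def ne)
 have gc: "?g b\<in>carrier ?F" for b by (rule generator_carrier[OF R]) simp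
 have sum: "(\<Oplus>\<^bsub>?F\<^esub> f\<in>{f\<in>range ?g. c f ~= \<zero>\<^sub>R}. c f \<odot>\<^sub>?F f) = (%b. c (?g b))"
  if c: "c\<in>range ?g \<rightarrow> carrier R" "finite {f\<in>range ?g. c f ~= \<zero>\<^sub>R}" for c
 proof -
  let ?S = "{b. c (?g b) ~= \<zero>\<^sub>R}"
  have S: "{f\<in>range ?g. c f ~= \<zero>\<^sub>R} = ?g ` ?S" by auto
  have fin: "finite ?S" using c(2) ginj unfolding S by (metis finite_imageD inj_on_subset subset_UNIV)
  have cc: "(%b. c (?g b))\<in>carrier ?F" using c(1) fin by auto
  have "(\<Oplus>\<^bsub>?F\<^esub> f\<in>?g ` ?S. c f \<odot>\<^sub>?F f) = (\<Oplus>\<^bsub>?F\<^esub> b\<in>?S. c (?g b) \<odot>\<^sub>?F ?g b)"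
  proof (rule F.M.finsum_reindex)
   show "(%f. c f \<odot>\<^sub>?F f)\<in>?g ` ?S \<rightarrow> carrier ?F"
    by (intro funcsetI F.smult_closed) (use c(1) gc in "auto simp del: free_on_simps")
   show "inj_on ?g ?S" using ginj by (rule inj_on_subset) simp
  qed
  also have "... = lin_ext R ?F ?g (%b. c (?g b))" by (simp add: lin_ext_def)
  also have "... = (%b. c (?g b))" by (rule free_on_expand[OF R cc, symmetric])
  finally show ?thesis unfolding S .
 qed
 have "\<exists>!c. c\<in>range ?g \<rightarrow>\<^sub>E carrier R & finite {f\<in>range ?g. c f ~= \<zero>\<^sub>R} &
   m = (\<Oplus>\<^bsub>?F\<^esub> f\<in>{f\<in>range ?g. c f ~= \<zero>\<^sub>R}. c f \<odot>\<^sub>?F f)" if m: "m\<in>carrier ?F" for m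
 proof (rule ex1I)
  let ?c = "\<lambda>f\<in>range ?g. m (inv_into UNIV ?g f)"
  have cg: "?c (?g b) = m b" for b using ginj by simp
  have c1: "?c\<in>range ?g \<rightarrow>\<^sub>E carrier R" using m by auto
  have "{f\<in>range ?g. ?c f ~= \<zero>\<^sub>R} = ?g ` {b. m b ~= \<zero>\<^sub>R}" using cg by (auto simp: inj_eq[OF ginj])
  then have c2: "finite {f\<in>range ?g. ?c f ~= \<zero>\<^sub>R}" using m by simp
  have "m = (\<Oplus>\<^bsub>?F\<^esub> f\<in>{f\<in>range ?g. ?c f ~= \<zero>\<^sub>R}. ?c f \<odot>\<^sub>?F f)"
   using sum[of ?c] c1 c2 unfolding cg by (auto simp: PiE_def)
  then show "?c\<in>range ?g \<rightarrow>\<^sub>E carrier R & finite {f\<in>range ?g. ?c f ~= \<zero>\<^sub>R} &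
    m = (\<Oplus>\<^bsub>?F\<^esub> f\<in>{f\<in>range ?g. ?c f ~= \<zero>\<^sub>R}. ?c f \<odot>\<^sub>?F f)" using c1 c2 by blast
  fix c assume c: "c\<in>range ?g \<rightarrow>\<^sub>E carrier R & finite {f\<in>range ?g. c f ~= \<zero>\<^sub>R} &
    m = (\<Oplus>\<^bsub>?F\<^esub> f\<in>{f\<in>range ?g. c f ~= \<zero>\<^sub>R}. c f \<odot>\<^sub>?F f)"
  then have "c\<in>range ?g \<rightarrow> carrier R" "finite {f\<in>range ?g. c f ~= \<zero>\<^sub>R}" by auto
  from sum[OF this] have "m = (%b. c (?g b))" using c by simp
  then have "c f = ?c f" if "f\<in>range ?g" for f using that cg by auto
  then show "c = ?c" using c by (intro extensionalityI[of c "range ?g"]) (auto simp: PiE_def)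
 qed
 then show ?thesis unfolding free_module_def using F gc by (intro conjI exI[of _ "range ?g"]) auto
qed

lemma zero_module_free:
 assumes M: "module R M" shows "free_module R (zero_module M)" unfolding free_module_def
proof (intro conjI exI[of _ "{}"] ballI)
 have ZM: "module R (zero_module M)" by (rule zero_module_module[OF M])
 show "module R (zero_module M)" by (rule ZM)
 interpret Z: module R "zero_module M" by (rule ZM)
 fix m assume m: "m\<in>carrier (zero_module M)"
 show "\<exists>!c. c\<in>{} \<rightarrow>\<^sub>E carrier R & finite {b\<in>{}. c b ~= \<zero>\<^sub>R} &
   m = (\<Oplus>\<^bsub>zero_module M\<^esub> b\<in>{b\<in>{}. c b ~= \<zero>\<^sub>R}. c b \<odot>\<^bsub>zero_module M\<^esub> b)"
  using m by (intro ex1I[of _ "%_. undefined"]) (auto simp: PiE_def extensional_def)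
qed simp

lemma lin_ext_image:
 fixes R :: "('a, 'r) ring_scheme" and M :: "('a, 'm) module" and \<phi> :: "'b => 'm"
 assumes M: "module R M" and Z: "submodule Z R M" and \<phi>: "range \<phi> = Z"
 shows "lin_ext R M \<phi>\<in>mod_hom R (free_on R UNIV) M" "lin_ext R M \<phi> ` carrier (free_on R UNIV) = Z"
proof -
 interpret M: module R M by fact
 note Zm = submodule_mem[OF M Z]
 have \<phi>Z: "\<phi> b\<in>Z" for b using \<phi> by blast
 have \<phi>c: "\<phi> b\<in>carrier M" for b by (rule subsetD[OF Zm(1) \<phi>Z])
 show l: "lin_ext R M \<phi>\<in>mod_hom R (free_on R UNIV) M" by (rule lin_ext_hom[OF M \<phi>c])
 show "lin_ext R M \<phi> ` carrier (free_on R UNIV) = Z"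
 proof
  show "lin_ext R M \<phi> ` carrier (free_on R UNIV) <= Z"
  proof (rule image_subsetI)
   fix c :: "'b => 'a" assume c: "c\<in>carrier (free_on R UNIV)"
   show "lin_ext R M \<phi> c\<in>Z"
    unfolding lin_ext_def by (rule finsum_mem_submodule[OF M Z free_on_supp(1)[OF c] Zm(4)[OF free_on_supp(3)[OF c] \<phi>Z]])
  qed
  show "Z <= lin_ext R M \<phi> ` carrier (free_on R UNIV)"
  proof
   fix y assume "y\<in>Z"
   then obtain b where "y = \<phi> b" using \<phi> by blast
   then have "y = lin_ext R M \<phi> (generator R b)" using lin_ext_generator[where \<phi> = \<phi>, OF M UNIV_I \<phi>c] by simp
   then show "y\<in>lin_ext R M \<phi> ` carrier (free_on R UNIV)" by (rule image_eqI[OF _ generator_carrier[OF M.R.is_cring UNIV_I]])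
  qed
 qed
qed

text \<open>The same free module \<open>F0\<close> on all lists is used in every degree up to zero.
  Both \<open>N\<close> and every submodule of \<open>F0\<close> are images of \<open>F0\<close>, so
  each kernel can be covered by \<open>F0\<close> again.\<close>

theorem free_resolution_exists:
 fixes R :: "('a, 'r) ring_scheme" and N :: "('a, 'n) module"
 assumes R: "cring R" and N: "module R N" and ne: "\<zero>\<^sub>R ~= \<one>\<^sub>R"
 shows "is_free_resolution R N (free_resolution R N)"
proof -
 define F0 :: "('a, ('a + 'n) list => 'a) module" where "F0 = free_on R UNIV"
 interpret N: module R N by fact
 have FM: "module R F0" unfolding F0_def by (rule free_on_module[OF R])
 interpret F: module R F0 by (rule FM)
 have neInl: "Inl \<zero>\<^sub>R ~= (Inl \<one>\<^sub>R :: 'a + 'n)" using ne by simp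
 obtain \<Phi> :: "('a + 'n) list => (('a + 'n) list => 'a)" where \<Phi>: "!!c. finite {b. c b ~= \<zero>\<^sub>R} ==> c\<in>range \<Phi>"
  using finite_support_enumeration[OF neInl inj_Inl, of "\<zero>\<^sub>R"] by blast
 have cover: "EX D. D\<in>mod_hom R F0 F0 & D ` carrier F0 = Z" if Z: "submodule Z R F0" for Z
 proof -
  note Zm = submodule_mem[OF FM Z]
  let ?f = "%b. if \<Phi> b\<in>Z then \<Phi> b else \<zero>\<^sub>F0"
  have "range ?f = Z"
  proof
   show "range ?f <= Z" using Zm(2) by auto
   show "Z <= range ?f"
   proof
    fix c assume c: "c\<in>Z"
    then have "c\<in>carrier F0" using Zm(1) by blast
    then have "c\<in>range \<Phi>" using \<Phi> by (simp add: F0_def)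
    then obtain b where "c = \<Phi> b" by blast
    then show "c\<in>range ?f" using c by (intro range_eqI[of _ _ b]) simp
   qed
  qed
  from lin_ext_image[OF FM Z this] show ?thesis unfolding F0_def by blast
 qed
 \<comment> \<open>One-letter lists \<open>[Inr n]\<close> index the elements of \<open>N\<close>,
   and every other list is sent to zero.\<close>
 let ?fN = "%l. case l of [Inr n] => (if n\<in>carrier N then n else \<zero>\<^sub>N) | _ => \<zero>\<^sub>N"
 have rN: "range ?fN = carrier N"
 proof
  show "range ?fN <= carrier N" by (auto split: list.splits sum.splits)
  show "carrier N <= range ?fN"
  proof
   fix n assume "n\<in>carrier N"
   then show "n\<in>range ?fN" by (intro range_eqI[of _ _ "[Inr n]"]) simp
  qed
 qed
 obtain g where g: "g\<in>mod_hom R F0 N" "g ` carrier F0 = carrier N" using lin_ext_image[OF N N.carrier_is_submodule rN] unfolding F0_def by blast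
 define ker where "ker D = {y\<in>carrier F0. D y = \<zero>\<^sub>F0}" for D :: "_ => ('a + 'n) list => 'a"
 define pick where "pick Z = (SOME D. D\<in>mod_hom R F0 F0 & D ` carrier F0 = Z)" for Z
 have pick: "pick Z\<in>mod_hom R F0 F0" "pick Z ` carrier F0 = Z" if "submodule Z R F0" for Z
  using someI_ex[OF cover[OF that]] unfolding pick_def by auto
 \<comment> \<open>\<open>D k\<close> is the differential from degree \<open>- k - 1\<close> to
   \<open>- k\<close>: the first maps onto the kernel of \<open>g\<close>, each later one onto the
   kernel of its predecessor.\<close>
 define D where "D = rec_nat (pick {y\<in>carrier F0. g y = \<zero>\<^sub>N}) (%k D. pick (ker D))"
 have D0: "D 0 = pick {y\<in>carrier F0. g y = \<zero>\<^sub>N}" and DS: "D (Suc k) = pick (ker (D k))" for k by (simp_all add: D_def)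
 have Dh: "D k\<in>mod_hom R F0 F0" for k
 proof (induction k)
  case 0
  show ?case unfolding D0 by (rule pick(1)[OF kernel_submodule[OF FM N g(1)]])
 next
  case (Suc k)
  show ?case unfolding DS ker_def by (rule pick(1)[OF kernel_submodule[OF FM FM Suc]])
 qed
 have im0: "D 0 ` carrier F0 = {y\<in>carrier F0. g y = \<zero>\<^sub>N}" unfolding D0 by (rule pick(2)[OF kernel_submodule[OF FM N g(1)]])
 have imS: "D (Suc k) ` carrier F0 = ker (D k)" for k unfolding DS ker_def by (rule pick(2)[OF kernel_submodule[OF FM FM Dh]])
 define F where "F = \<lparr>obj = (%j::int. if j \<le> 0 then F0 else zero_module F0),
  diff = (%j y. if j < 0 then D (nat (- j - 1)) y else \<zero>\<^sub>F0)\<rparr>"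
 have Fo: "obj F j = (if j \<le> 0 then F0 else zero_module F0)" and Fd: "diff F j y = (if j < 0 then D (nat (- j - 1)) y else \<zero>\<^sub>F0)" for j y
  by (simp_all add: F_def)
 have Fz: "\<zero>\<^bsub>obj F j\<^esub> = \<zero>\<^sub>F0" for j by (simp add: Fo)
 have Foc: "y\<in>carrier (obj F j) ==> y\<in>carrier F0" for j y by (auto simp: Fo split: if_splits)
 have imD: "D (Suc k) y\<in>ker (D k)" if "y\<in>carrier F0" for k y using imS[of k] that by blast
 have C: "cochain_complex R F"
 proof (rule complexI)
  fix j
  show "module R (obj F j)" using FM zero_module_module[OF FM] by (simp add: Fo)
  show "diff F j\<in>mod_hom R (obj F j) (obj F (j + 1))"
  proof (cases "j < 0")
   case True
   then have "diff F j = D (nat (- j - 1))" by (simp add: Fd fun_eq_iff)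
   then show ?thesis using True Dh by (simp add: Fo)
  next
   case False
   then have "diff F j = (%y. \<zero>\<^sub>F0)" by (simp add: Fd fun_eq_iff)
   moreover have "(%y. \<zero>\<^sub>F0)\<in>mod_hom R (obj F j) (obj F (j + 1))" by (rule mod_homI) (auto simp: Fo)
   ultimately show ?thesis by simp
  qed
  fix y assume y: "y\<in>carrier (obj F j)"
  show "diff F (j + 1) (diff F j y) = \<zero>\<^bsub>obj F (j + 1 + 1)\<^esub>"
  proof (cases "j + 1 < 0")
   case True
   then have e: "nat (- j - 1) = Suc (nat (- (j + 1) - 1))" by simp
   have "D (Suc (nat (- (j + 1) - 1))) y\<in>ker (D (nat (- (j + 1) - 1)))" by (rule imD[OF Foc[OF y]])
   then show ?thesis using True by (simp add: Fd Fz e ker_def)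
  qed (simp add: Fd Fz)
 qed
 have stalk: "cochain_complex R (stalk_complex N)" by (rule complex_stalk[OF N])
 define h where "h j y = (if j = 0 then g y else \<zero>\<^sub>N)" for j :: int and y
 have cm: "chain_map R F (stalk_complex N) h" unfolding chain_map_def
 proof (intro allI conjI ballI)
  fix j
  show "h j\<in>mod_hom R (obj F j) (obj (stalk_complex N) j)"
  proof (cases "j = 0")
   case True
   then have "h j = g" by (simp add: h_def fun_eq_iff)
   then show ?thesis using True g(1) by (simp add: Fo stalk_simps)
  next
   case False
   then have "h j = (%y. \<zero>\<^sub>N)" by (simp add: h_def fun_eq_iff)
   moreover have "(%y. \<zero>\<^sub>N)\<in>mod_hom R (obj F j) (obj (stalk_complex N) j)" by (rule mod_homI) (auto simp: stalk_simps)
   ultimately show ?thesis by simp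
  qed
  fix y assume y: "y\<in>carrier (obj F j)"
  show "h (j + 1) (diff F j y) = diff (stalk_complex N) j (h j y)"
  proof (cases "j = - 1")
   case True
   then have "diff F j y\<in>D 0 ` carrier F0" using Foc[OF y] by (simp add: Fd)
   then show ?thesis using True unfolding im0 by (simp add: h_def stalk_simps)
  qed (auto simp: h_def stalk_simps)
 qed
 note sb = stalk_boundaries[OF N] and sc = stalk_cycles[OF N]
 have bz: "\<zero>\<^sub>F0\<in>boundaries F j" for j using submodule_mem(2)[OF complexD(1)[OF C] boundaries_submodule[OF C], of j] by (simp add: Fz)
 have "quasi_iso R F (stalk_complex N) h" unfolding quasi_iso_iff[OF C stalk]
 proof (intro conjI cm allI ballI impI)
  fix j z assume z: "z\<in>cycles F j" and b: "h j z\<in>boundaries (stalk_complex N) j"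
  have zc: "z\<in>carrier F0" using z Foc by (auto simp: cycles_def)
  have e1: "carrier (obj F (j - 1)) = carrier F0" if "j \<le> 0" using that by (simp add: Fo)
  have e2: "diff F (j - 1) ` carrier F0 = D (nat (- j)) ` carrier F0" if "j \<le> 0" using that by (simp add: Fd)
  consider "j = 0" | "j < 0" | "j > 0" by linarith
  then show "z\<in>boundaries F j"
  proof cases
   case 1
   then have "g z = \<zero>\<^sub>N" using b unfolding sb by (simp add: h_def)
   then show ?thesis using 1 zc im0 e1 e2 by (simp add: boundaries_def)
  next
   case 2
   then have e: "nat (- j) = Suc (nat (- j - 1))" by simp
   have "D (nat (- j - 1)) z = \<zero>\<^sub>F0" using z 2 by (simp add: cycles_def Fd Fz)
   then have "z\<in>D (nat (- j)) ` carrier F0" unfolding e imS ker_def using zc by blast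
   then show ?thesis using 2 e1 e2 by (simp add: boundaries_def)
  next
   case 3
   then have "z = \<zero>\<^sub>F0" using z by (auto simp: cycles_def Fo)
   then show ?thesis using bz by simp
  qed
 next
  fix j w assume w: "w\<in>cycles (stalk_complex N) j"
  show "EX z:cycles F j. w \<ominus>\<^bsub>obj (stalk_complex N) j\<^esub> h j z\<in>boundaries (stalk_complex N) j"
  proof (cases "j = 0")
   case True
   then have wN: "w\<in>carrier N" using w unfolding sc by (simp add: stalk_simps)
   then obtain z where z: "z\<in>carrier F0" "w = g z" using g(2) by blast
   have "z\<in>cycles F 0" using z(1) by (simp add: cycles_def Fo Fd)
   moreover have "w \<ominus>\<^sub>N h 0 z = \<zero>\<^sub>N" using wN z(2) minus_eq_zero_iff[OF N wN wN] by (simp add: h_def)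
   ultimately show ?thesis using True unfolding sb by (auto simp: stalk_simps)
  next
   case False
   then have w0: "w = \<zero>\<^sub>N" using w unfolding sc by (simp add: stalk_simps)
   have ZM: "module R (zero_module N)" by (rule zero_module_module[OF N])
   have zc: "\<zero>\<^sub>N\<in>carrier (zero_module N)" by simp
   have "\<zero>\<^sub>F0\<in>cycles F j" using submodule_mem(2)[OF complexD(1)[OF C] cycles_submodule[OF C], of j] by (simp add: Fz)
   moreover have "w \<ominus>\<^bsub>zero_module N\<^esub> h j \<zero>\<^sub>F0 = \<zero>\<^sub>N"
    using False w0 minus_eq_zero_iff[OF ZM zc zc] by (simp add: h_def)
   ultimately show ?thesis using False unfolding sb by (auto simp: stalk_simps)
  qed
 qed
 moreover have "free_module R (obj F j)" for j
  by (cases "j \<le> 0") (simp_all add: Fo F0_def free_on_free_module[OF R ne] zero_module_free[OF FM, unfolded F0_def])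
 ultimately have "is_free_resolution R N F" unfolding is_free_resolution_def using C by (auto simp: Fo)
 then show ?thesis unfolding free_resolution_def by (rule someI)
qed

section \<open>Tensoring a complex with zero differential\<close>

context
 fixes R :: "('a, 'r) ring_scheme" and X :: "('a, 'm) cochain" and F :: "('a, 'f) cochain"
 assumes R: "cring R" and X: "cochain_complex R X" and F: "cochain_complex R F"
  and zero: "!!i y. y\<in>carrier (obj X i) ==> diff X i y = \<zero>\<^bsub>obj X (i + 1)\<^esub>"
begin

private abbreviation "G i k \<equiv> tensor R (obj X i) (obj F k)"
private abbreviation "TC \<equiv> tensor_complex R X F"

private lemma G: "module R (G i k)" by (rule tensor_module[OF complexD(1)[OF X] complexD(1)[OF F]])

private lemma td: "tensor_diff R (obj X i) F k\<in>mod_hom R (G i k) (G i (k + 1))" by (rule tensor_diff_hom[OF F complexD(1)[OF X]])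

private lemma obj_TC: "obj TC n = direct_sum_module (%i. G i (n - i))" by (simp add: tensor_complex_def)

private lemma diff_TC:
 assumes u: "u\<in>carrier (obj TC n)"
 shows "diff TC n u j = signed (G j (n - j + 1)) j (tensor_diff R (obj X j) F (n - j) (u j))"
proof -
 have e: "n + 1 - j = n - j + 1" "n - (j - 1) = n - j + 1" by simp_all
 have uc: "u i\<in>carrier (G i (n - i))" for i using u by (simp add: obj_TC)
 have uc': "u (j - 1)\<in>carrier (G (j - 1) (n - j + 1))" using uc[of "j - 1"] by (simp only: e)
 interpret T: module R "G j (n - j + 1)" by (rule G)
 have z: "tensor_map R (obj X (j - 1)) (obj F (n - j + 1)) (obj X j) (obj F (n - j + 1)) (diff X (j - 1)) (%y. y) (u (j - 1)) = \<zero>\<^bsub>G j (n - j + 1)\<^esub>"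
  by (rule tensor_map_zero_left[OF complexD(1)[OF X] complexD(1)[OF F] complexD(1)[OF X] complexD(1)[OF F]
     complexD(3)[OF X] hom_id _ uc']) (use zero[of _ "j - 1"] in simp)
 have "signed (G j (n - j + 1)) j (tensor_diff R (obj X j) F (n - j) (u j))\<in>carrier (G j (n - j + 1))"
  by (rule signed_closed[OF G hom_closed[OF td uc]])
 then show ?thesis by (simp add: tensor_complex_def Let_def e z)
qed

private lemma TC_complex: "cochain_complex R TC"
proof (rule complexI)
 show "module R (obj TC n)" for n unfolding obj_TC by (rule direct_sum_module_module[OF R G])
 have uc: "u i\<in>carrier (G i (n - i))" if "u\<in>carrier (obj TC n)" for u i n using that by (simp add: obj_TC)
 have e: "n + 1 - j = n - j + 1" for n j :: int by simp
 show d: "diff TC n\<in>mod_hom R (obj TC n) (obj TC (n + 1))" for n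
 proof (rule mod_homI)
  fix u assume u: "u\<in>carrier (obj TC n)"
  have "diff TC n u j = \<zero>\<^bsub>G j (n - j + 1)\<^esub>" if "u j = \<zero>\<^bsub>G j (n - j)\<^esub>" for j
   unfolding diff_TC[OF u] that hom_zero[OF G G td] by (rule signed_zero[OF G])
  then have "{j. diff TC n u j ~= \<zero>\<^bsub>G j (n - j + 1)\<^esub>} <= {j. u j ~= \<zero>\<^bsub>G j (n - j)\<^esub>}" by auto
  moreover have "finite {j. u j ~= \<zero>\<^bsub>G j (n - j)\<^esub>}" using u by (simp add: obj_TC)
  ultimately have "finite {j. diff TC n u j ~= \<zero>\<^bsub>G j (n - j + 1)\<^esub>}" by (rule finite_subset)
  moreover have "diff TC n u j\<in>carrier (G j (n - j + 1))" for j unfolding diff_TC[OF u] by (rule signed_closed[OF G hom_closed[OF td uc[OF u]]])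
  ultimately show "diff TC n u\<in>carrier (obj TC (n + 1))" by (simp add: obj_TC e)
  fix v assume v: "v\<in>carrier (obj TC n)"
  interpret D: module R "obj TC n" by fact
  show "diff TC n (u \<oplus>\<^bsub>obj TC n\<^esub> v) = diff TC n u \<oplus>\<^bsub>obj TC (n + 1)\<^esub> diff TC n v"
  proof
   fix j
   have "diff TC n (u \<oplus>\<^bsub>obj TC n\<^esub> v) j = diff TC n u j \<oplus>\<^bsub>G j (n - j + 1)\<^esub> diff TC n v j"
    unfolding diff_TC[OF D.M.a_closed[OF u v]] diff_TC[OF u] diff_TC[OF v]
    by (simp add: obj_TC hom_add[OF td uc[OF u] uc[OF v]] signed_add[OF G hom_closed[OF td uc[OF u]] hom_closed[OF td uc[OF v]]])
   then show "diff TC n (u \<oplus>\<^bsub>obj TC n\<^esub> v) j = (diff TC n u \<oplus>\<^bsub>obj TC (n + 1)\<^esub> diff TC n v) j"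
    by (simp add: obj_TC e)
  qed
 next
  fix r u assume r: "r\<in>carrier R" and u: "u\<in>carrier (obj TC n)"
  interpret D: module R "obj TC n" by fact
  show "diff TC n (r \<odot>\<^bsub>obj TC n\<^esub> u) = r \<odot>\<^bsub>obj TC (n + 1)\<^esub> diff TC n u"
  proof
   fix j
   have "diff TC n (r \<odot>\<^bsub>obj TC n\<^esub> u) j = r \<odot>\<^bsub>G j (n - j + 1)\<^esub> diff TC n u j"
    unfolding diff_TC[OF D.smult_closed[OF r u]] diff_TC[OF u]
    by (simp add: obj_TC hom_smult[OF td r uc[OF u]] signed_smult[OF G hom_closed[OF td uc[OF u]] r])
   then show "diff TC n (r \<odot>\<^bsub>obj TC n\<^esub> u) j = (r \<odot>\<^bsub>obj TC (n + 1)\<^esub> diff TC n u) j" by (simp add: obj_TC e)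
  qed
 qed
 fix n u assume u: "u\<in>carrier (obj TC n)"
 have du: "diff TC n u\<in>carrier (obj TC (n + 1))" by (rule hom_closed[OF d u])
 have "diff TC (n + 1) (diff TC n u) j = \<zero>\<^bsub>G j (n - j + 1 + 1)\<^esub>" for j
  unfolding diff_TC[OF du] e diff_TC[OF u] hom_signed[OF G G td hom_closed[OF td uc[OF u]]]
   tensor_diff_diff[OF F complexD(1)[OF X] uc[OF u]] signed_zero[OF G] ..
 then show "diff TC (n + 1) (diff TC n u) = \<zero>\<^bsub>obj TC (n + 1 + 1)\<^esub>"
  by (simp only: obj_TC direct_sum_module_simps e fun_eq_iff) simp
qed

text \<open>With zero differential on \<open>X\<close> the total complex is, up to signs, the direct
  sum over \<open>i\<close> of the complexes obtained by tensoring \<open>obj X i\<close> with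
  \<open>F\<close>.\<close>

lemma tensor_complex_acyclic_iff: "acyclic_complex TC \<longleftrightarrow> (ALL i. tensor_exact R (obj X i) F)"
proof
 have e: "n + 1 - j = n - j + 1" for n j :: int by simp
 { assume ac: "acyclic_complex TC"
  show "ALL i. tensor_exact R (obj X i) F" unfolding tensor_exact_def
  proof (intro allI ballI impI)
   fix i j t assume t: "t\<in>carrier (G i (j + 1))" and dt: "tensor_diff R (obj X i) F (j + 1) t = \<zero>\<^bsub>G i (j + 1 + 1)\<^esub>"
   define n where "n = j + i"
   have n: "n - i = j" by (simp add: n_def)
   define u where "u = (%k. if k = i then t else \<zero>\<^bsub>G k (n + 1 - k)\<^esub>)"
   have "{k. u k ~= \<zero>\<^bsub>G k (n + 1 - k)\<^esub>} <= {i}" by (auto simp: u_def)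
   moreover have "u k\<in>carrier (G k (n + 1 - k))" for k
    using t module.axioms(2)[OF G[of k "n + 1 - k"], THEN abelian_group.axioms(1), THEN abelian_monoid.zero_closed] by (simp add: u_def e n)
   ultimately have u: "u\<in>carrier (obj TC (n + 1))" by (simp add: obj_TC finite_subset)
   have "diff TC (n + 1) u k = \<zero>\<^bsub>G k (n + 1 - k + 1)\<^esub>" for k
   proof (cases "k = i")
    case True
    have ui: "u i = t" by (simp add: u_def)
    show ?thesis unfolding diff_TC[OF u] True ui e n dt by (rule signed_zero[OF G])
   next
    case False
    then have "u k = \<zero>\<^bsub>G k (n + 1 - k)\<^esub>" by (simp add: u_def)
    then show ?thesis unfolding diff_TC[OF u] by (simp only: hom_zero[OF G G td] signed_zero[OF G])
   qed
   then have "diff TC (n + 1) u = \<zero>\<^bsub>obj TC (n + 1 + 1)\<^esub>" by (simp only: obj_TC direct_sum_module_simps fun_eq_iff e) simp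
   then have "u\<in>cycles TC (n + 1)" using u unfolding cycles_def by blast
   then have "u\<in>boundaries TC (n + 1)" using ac unfolding acyclic_complex_iff[OF TC_complex] by blast
   then obtain w where w: "w\<in>carrier (obj TC n)" "u = diff TC n w" by (auto simp: boundaries_def)
   have wi: "w i\<in>carrier (G i j)" using w(1) n by (auto simp: obj_TC)
   have "t = signed (G i (j + 1)) i (tensor_diff R (obj X i) F j (w i))" using diff_TC[OF w(1), of i] fun_cong[OF w(2), of i] by (simp add: u_def n)
   also have "... = tensor_diff R (obj X i) F j (signed (G i j) i (w i))" by (rule hom_signed[OF G G td wi, symmetric])
   finally show "t\<in>tensor_diff R (obj X i) F j ` carrier (G i j)" using signed_closed[OF G wi] by blast
  qed }
 { assume ex: "ALL i. tensor_exact R (obj X i) F"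
  have "z\<in>boundaries TC n" if z: "z\<in>cycles TC n" for z n
  proof -
   have zc: "z\<in>carrier (obj TC n)" and dz: "diff TC n z = \<zero>\<^bsub>obj TC (n + 1)\<^esub>" using z by (auto simp: cycles_def)
   have zi: "z i\<in>carrier (G i (n - i))" for i using zc by (simp add: obj_TC)
   have e': "n - 1 - i = n - i - 1" "n - i - 1 + 1 = n - i" for i by simp_all
   have td': "tensor_map R (obj X i) (obj F (n - i - 1)) (obj X i) (obj F (n - i)) (%y. y) (diff F (n - i - 1))\<in>mod_hom R (G i (n - i - 1)) (G i (n - i))" for i
    using td[of i "n - i - 1"] by (simp only: e')
   \<comment> \<open>A preimage is chosen in each coordinate. Demanding zero wherever the cycle is
     zero keeps the support finite, so that the choices form an element of the direct sum.\<close>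
   have "EX w. w\<in>carrier (G i (n - i - 1)) & (z i = \<zero>\<^bsub>G i (n - i)\<^esub> --> w = \<zero>\<^bsub>G i (n - i - 1)\<^esub>) &
     z i = signed (G i (n - i)) i (tensor_map R (obj X i) (obj F (n - i - 1)) (obj X i) (obj F (n - i)) (%y. y) (diff F (n - i - 1)) w)" for i
   proof (cases "z i = \<zero>\<^bsub>G i (n - i)\<^esub>")
    case True
    interpret W: module R "G i (n - i - 1)" by (rule G)
    show ?thesis by (rule exI[of _ "\<zero>\<^bsub>G i (n - i - 1)\<^esub>"]) (simp add: True hom_zero[OF G G td'] signed_zero[OF G])
   next
    case False
    have "signed (G i (n - i + 1)) i (tensor_diff R (obj X i) F (n - i) (z i)) = \<zero>\<^bsub>G i (n - i + 1)\<^esub>"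
     using diff_TC[OF zc, of i] fun_cong[OF dz, of i] by (simp add: obj_TC e)
    then have "tensor_diff R (obj X i) F (n - i) (z i) = \<zero>\<^bsub>G i (n - i + 1)\<^esub>"
     using signed_eq_zero_iff[OF G hom_closed[OF td zi]] by blast
    from tensor_exactD[OF ex[rule_format] zi this] obtain w where w: "w\<in>carrier (G i (n - i - 1))"
     "z i = tensor_map R (obj X i) (obj F (n - i - 1)) (obj X i) (obj F (n - i)) (%y. y) (diff F (n - i - 1)) w" .
    show ?thesis by (rule exI[of _ "signed (G i (n - i - 1)) i w"])
      (use False w signed_closed[OF G w(1)] hom_signed[OF G G td' w(1)] signed_signed[OF G hom_closed[OF td' w(1)]] in simp)
   qed
   then obtain w where w: "!!i. w i\<in>carrier (G i (n - i - 1))" "!!i. z i = \<zero>\<^bsub>G i (n - i)\<^esub> ==> w i = \<zero>\<^bsub>G i (n - i - 1)\<^esub>"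
    "!!i. z i = signed (G i (n - i)) i (tensor_map R (obj X i) (obj F (n - i - 1)) (obj X i) (obj F (n - i)) (%y. y) (diff F (n - i - 1)) (w i))"
    by metis
   have "{i. w i ~= \<zero>\<^bsub>G i (n - i - 1)\<^esub>} <= {i. z i ~= \<zero>\<^bsub>G i (n - i)\<^esub>}" using w(2) by blast
   moreover have "finite {i. z i ~= \<zero>\<^bsub>G i (n - i)\<^esub>}" using zc by (simp add: obj_TC)
   ultimately have "w\<in>carrier (obj TC (n - 1))" using w(1) by (simp add: obj_TC e' finite_subset)
   moreover from diff_TC[OF this] have "diff TC (n - 1) w = z" by (intro ext) (simp only: e' w(3)[symmetric])
   ultimately show ?thesis unfolding boundaries_def by blast
  qed
  then show "acyclic_complex TC" unfolding acyclic_complex_iff[OF TC_complex] by blast }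
qed

end

section \<open>Residue fields\<close>

lemma restrict_scalars_self_module:
 assumes R: "cring R" and K: "cring K" and f: "f\<in>ring_hom R K"
 shows "module R (restrict_scalars f (self_module K))"
proof -
 interpret K: cring K by (rule K)
 interpret h: ring_hom_ring R K f by (rule ring_hom_ringI2[OF cring.axioms(1)[OF R] K.ring_axioms f])
 show ?thesis
 proof (rule moduleI[OF R])
  show "abelian_group (restrict_scalars f (self_module K))" by (rule abelian_group_eqI[OF K.abelian_group_axioms]) (auto simp: restrict_scalars_def)
 qed (auto simp: restrict_scalars_def K.l_distr K.r_distr K.m_assoc)
qed

context localization_at
begin

abbreviation k where "k \<equiv> residue_module R p"

text \<open>The generated ideal stays inside \<open>?q\<close>, the fractions with numerator in
  \<open>p\<close>. One is not of this form: clearing denominators would put a product of elements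
  outside \<open>p\<close> into \<open>p\<close>.\<close>

lemma loc_prime_proper: "ideal (loc_prime R p) L" "\<one>\<^sub>L ~: loc_prime R p"
proof -
 interpret L: cring L by (rule loc_ring_cring)
 have sub: "loc_map R p ` p <= carrier L" using loc_map_hom(1) P.a_subset by blast
 show "ideal (loc_prime R p) L" unfolding loc_prime_def by (rule L.genideal_ideal[OF sub])
 let ?q = "{A. EX a:p. EX s:S. A = frac R p (self_module R) a s}"
 note pR = subsetD[OF P.a_subset]
 have "ideal ?q L"
 proof (rule cring_idealI[OF loc_ring_cring])
  show "?q <= carrier L" unfolding loc_ring_carrier[abs_def] subset_eq mem_Collect_eq using pR by blast
  have "\<zero>\<^sub>L = frac R p (self_module R) \<zero>\<^sub>R \<one>\<^sub>R" using loc_module_zero[OF self_mod S_one] by (simp add: loc_ring_simps)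
  then show "\<zero>\<^sub>L\<in>?q" using S_one additive_subgroup.zero_closed[OF P.is_additive_subgroup] by blast
  fix A B assume "A\<in>?q" "B\<in>?q"
  then obtain a s b t where ab: "a\<in>p" "s\<in>S" "A = frac R p (self_module R) a s" "b\<in>p" "t\<in>S" "B = frac R p (self_module R) b t" by blast
  have "A \<oplus>\<^sub>L B = frac R p (self_module R) (t \<otimes>\<^sub>R a \<oplus>\<^sub>R s \<otimes>\<^sub>R b) (s \<otimes>\<^sub>R t)"
   unfolding ab(3,6) loc_ring_simps(2) using frac_add[OF self_mod _ ab(2) _ ab(5), of a b] pR ab(1,4) by simp
  moreover have "t \<otimes>\<^sub>R a \<oplus>\<^sub>R s \<otimes>\<^sub>R b\<in>p" using ab P.I_l_closed by simp
  ultimately show "A \<oplus>\<^sub>L B\<in>?q" using S_mult[OF ab(2,5)] by blast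
 next
  fix A B assume "A\<in>carrier L" "B\<in>?q"
  then obtain a s b t where ab: "a\<in>carrier R" "s\<in>S" "A = frac R p (self_module R) a s" "b\<in>p" "t\<in>S" "B = frac R p (self_module R) b t"
   unfolding loc_ring_carrier by blast
  have "A \<otimes>\<^sub>L B = frac R p (self_module R) (a \<otimes>\<^sub>R b) (s \<otimes>\<^sub>R t)"
   unfolding ab(3,6) loc_ring_simps(4) using frac_smult[OF self_mod ab(1,2) _ ab(5), of b] pR ab(4) by simp
  then show "A \<otimes>\<^sub>L B\<in>?q" using S_mult[OF ab(2,5)] P.I_l_closed[OF ab(4,1)] by blast
 qed
 moreover have "loc_map R p ` p <= ?q" using S_one by (auto simp: loc_map_def)
 ultimately have le: "loc_prime R p <= ?q" unfolding loc_prime_def by (rule L.genideal_minimal)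
 show "\<one>\<^sub>L ~: loc_prime R p"
 proof
  assume "\<one>\<^sub>L\<in>loc_prime R p"
  then obtain a s where as: "a\<in>p" "s\<in>S" "frac R p (self_module R) \<one>\<^sub>R \<one>\<^sub>R = frac R p (self_module R) a s"
   using le unfolding loc_ring_simps(5) by blast
  then obtain u where u: "u\<in>S" "(u \<otimes>\<^sub>R s) \<otimes>\<^sub>R \<one>\<^sub>R = (u \<otimes>\<^sub>R \<one>\<^sub>R) \<otimes>\<^sub>R a"
   using frac_eq_iff[OF self_mod _ _ S_one as(2), of "\<one>\<^sub>R" a] pR by auto
  have "u \<otimes>\<^sub>R s\<in>S" by (rule S_mult[OF u(1) as(2)])
  moreover have "u \<otimes>\<^sub>R s\<in>p" using u as(1,2) P.I_l_closed[OF as(1), of u] by simp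
  ultimately show False by blast
 qed
qed

text \<open>These are the properties of \<open>k(p)\<close> that the later arguments rely on. The
  last one reflects that it is the field of fractions of \<open>R / p\<close>, with \<open>u\<close>
  as one: every element is a fraction \<open>a / s\<close>.\<close>

lemma residue_module_facts:
 shows "module R k"
  and "s\<in>p ==> y\<in>carrier k ==> s \<odot>\<^sub>k y = \<zero>\<^sub>k"
  and "s\<in>S ==> bij_betw (%y. s \<odot>\<^sub>k y) (carrier k) (carrier k)"
  and "EX u:carrier k. u ~= \<zero>\<^sub>k & (ALL y:carrier k. EX a:carrier R. EX s:S. s \<odot>\<^sub>k y = a \<odot>\<^sub>k u)"
proof -
 interpret L: cring L by (rule loc_ring_cring)
 interpret I: ideal "loc_prime R p" L by (rule loc_prime_proper)
 let ?K = "residue_field R p" and ?g = "%A. loc_prime R p +>\<^bsub>L\<^esub> A"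
 let ?f = "%r. ?g (loc_map R p r)"
 have K: "cring ?K" unfolding residue_field_def by (rule I.quotient_is_cring[OF loc_ring_cring])
 interpret K: cring ?K by (rule K)
 have g: "?g\<in>ring_hom L ?K" unfolding residue_field_def by (rule I.rcos_ring_hom)
 have "loc_map R p\<in>ring_hom R L" by (rule ring_hom_memI) (simp_all add: loc_map_hom)
 then have "?g \<circ> loc_map R p\<in>ring_hom R ?K" by (rule ring_hom_trans[OF _ g])
 then have f: "?f\<in>ring_hom R ?K" by (simp add: comp_def)
 have k: "carrier k = carrier ?K" "\<zero>\<^sub>k = \<zero>\<^sub>?K" "!!r y. r \<odot>\<^sub>k y = ?f r \<otimes>\<^sub>?K y"
  by (simp_all add: residue_module_def restrict_scalars_def)
 have K01: "\<one>\<^sub>?K = ?g \<one>\<^sub>L" "\<zero>\<^sub>?K = loc_prime R p" by (simp_all add: residue_field_def FactRing_def)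
 have coset0: "?g A = \<zero>\<^sub>?K" if "A\<in>loc_prime R p" for A using L.a_coset_join2[OF I.Icarr[OF that] I.a_subgroup that] unfolding K01 .
 show "module R k" unfolding residue_module_def by (rule restrict_scalars_self_module[OF R.is_cring K f])
 show "s \<odot>\<^sub>k y = \<zero>\<^sub>k" if "s\<in>p" "y\<in>carrier k" for s y
 proof -
  have "loc_map R p ` p <= carrier L" using loc_map_hom(1) P.a_subset by blast
  then have "loc_map R p s\<in>loc_prime R p" unfolding loc_prime_def using L.genideal_self that(1) by blast
  then show ?thesis using that(2) by (simp add: k coset0)
 qed
 have inv: "EX i:carrier ?K. i \<otimes>\<^sub>?K ?f s = \<one>\<^sub>?K" if "s\<in>S" for s
  using loc_inverse[OF that] ring_hom_closed[OF g] ring_hom_mult[OF g _ loc_map_hom(1)[OF S_carrier[OF that]]] ring_hom_one[OF g] by metis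
 show "bij_betw (%y. s \<odot>\<^sub>k y) (carrier k) (carrier k)" if s: "s\<in>S" for s
 proof -
  obtain i where i: "i\<in>carrier ?K" "i \<otimes>\<^sub>?K ?f s = \<one>\<^sub>?K" using inv[OF s] by blast
  have fs: "?f s\<in>carrier ?K" by (rule ring_hom_closed[OF f S_carrier[OF s]])
  have i': "?f s \<otimes>\<^sub>?K i = \<one>\<^sub>?K" using i fs by (simp only: K.m_comm)
  show ?thesis unfolding k by (rule bij_betw_byWitness[of _ "%y. i \<otimes>\<^sub>?K y"])
    (use i i' fs in "auto simp flip: K.m_assoc")
 qed
 show "EX u:carrier k. u ~= \<zero>\<^sub>k & (ALL y:carrier k. EX a:carrier R. EX s:S. s \<odot>\<^sub>k y = a \<odot>\<^sub>k u)"
  unfolding k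
 proof (intro bexI[of _ "\<one>\<^sub>?K"] conjI ballI)
  show "\<one>\<^sub>?K ~= \<zero>\<^sub>?K"
  proof
   assume "\<one>\<^sub>?K = \<zero>\<^sub>?K"
   then have "?g \<one>\<^sub>L = loc_prime R p" unfolding K01 .
   moreover have "\<one>\<^sub>L\<in>?g \<one>\<^sub>L" by (rule I.a_rcos_self[OF L.one_closed])
   ultimately show False using loc_prime_proper(2) by simp
  qed
  fix y assume "y\<in>carrier ?K"
  then obtain A where "A\<in>carrier L" "y = ?g A" by (auto simp: residue_field_def FactRing_def A_RCOSETS_def' a_r_coset_def')
  then obtain a s where as: "a\<in>carrier R" "s\<in>S" "y = ?g (frac R p (self_module R) a s)" unfolding loc_ring_carrier by blast
  have "?f s \<otimes>\<^sub>?K y = ?f a" unfolding as(3) loc_ring_frac[OF as(1,2), symmetric]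
   by (rule ring_hom_mult[OF g, symmetric]) (use as loc_map_hom(1) loc_ring_carrier in blast)+
  then have "?f s \<otimes>\<^sub>?K y = ?f a \<otimes>\<^sub>?K \<one>\<^sub>?K" using ring_hom_closed[OF f as(1)] by simp
  then show "EX a:carrier R. EX s:S. ?f s \<otimes>\<^sub>?K y = ?f a \<otimes>\<^sub>?K \<one>\<^sub>?K" using as(1,2) by blast
 qed simp
qed

end

section \<open>Noetherian rings\<close>

lemma noetherian_maximal:
 assumes R: "noetherian_ring R" and ne: "\<S> ~= {}" and id: "!!I. I\<in>\<S> ==> ideal I R"
 obtains M where "M\<in>\<S>" "!!I. I\<in>\<S> ==> M <= I ==> I = M"
proof -
 have "EX U:\<S>. ALL X:C. X <= U" if C: "subset.chain \<S> C" for C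
 proof (cases "C = {}")
  case True
  then show ?thesis using ne by blast
 next
  case False
  have "subset.chain {I. ideal I R} C" using C id by (auto simp: pred_on.chain_def)
  then have "\<Union>C\<in>C" by (rule noetherian_ring.ideal_chain_is_trivial[OF R False])
  then show ?thesis using C by (auto simp: pred_on.chain_def)
 qed
 then have "EX M:\<S>. ALL X:\<S>. M <= X --> X = M" by (rule subset_Zorn)
 then show thesis using that by blast
qed

context
 fixes R :: "('a, 'r) ring_scheme"
 assumes R: "cring R"
begin

interpretation R: cring R by (rule R)

text \<open>A product of elements, one from each \<open>Q\<close> and outside \<open>P\<close>, lies
  in every \<open>Q\<close> and, \<open>P\<close> being prime, outside \<open>P\<close>.\<close>

private lemma prime_avoids_intersection:
 assumes P: "primeideal P R" and "finite \<Q>" and id: "!!Q. Q\<in>\<Q> ==> ideal Q R" and no: "!!Q. Q\<in>\<Q> ==> \<not> Q <= P"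
 shows "EX q:carrier R - P. ALL Q:\<Q>. q\<in>Q" using assms(2) id no
proof (induction \<Q> rule: finite_induct)
 case empty
 interpret P: primeideal P R by (rule P)
 show ?case using P.I_notcarr P.one_imp_carrier by blast
next
 case (insert Q \<Q>)
 interpret P: primeideal P R by (rule P)
 obtain q where q: "q\<in>carrier R - P" "!!Q. Q\<in>\<Q> ==> q\<in>Q" using insert by auto
 obtain r where r: "r\<in>Q" "r ~: P" using insert.prems by blast
 have rR: "r\<in>carrier R" using ideal.Icarr[OF insert.prems(1) r(1)] by simp
 have "r \<otimes>\<^sub>R q ~: P" using P.I_prime[of r q] q r rR by blast
 moreover have "r \<otimes>\<^sub>R q\<in>Q'" if "Q'\<in>insert Q \<Q>" for Q'
  using that ideal.I_l_closed[OF insert.prems(1)[OF that], of q r] ideal.I_r_closed[OF insert.prems(1)[OF that], of r q] q r rR by auto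
 ultimately show ?case using q(1) rR by auto
qed

text \<open>Prime avoidance by induction. If \<open>s\<close> avoids the other primes but lies in
  \<open>P\<close>, it is replaced by \<open>s + q n\<close> with \<open>n\<close> in
  \<open>N\<close> outside \<open>P\<close> and \<open>q\<close> outside \<open>P\<close> but in all
  the other primes; incomparability provides \<open>q\<close>.\<close>

private lemma antichain_avoidance:
 assumes N: "ideal N R" and "finite \<P>" and pr: "!!P. P\<in>\<P> ==> primeideal P R"
  and anti: "!!P Q. P\<in>\<P> ==> Q\<in>\<P> ==> P <= Q ==> P = Q" and no: "!!P. P\<in>\<P> ==> \<not> N <= P"
 shows "EX s:N. ALL P:\<P>. s ~: P" using assms(2) pr anti no
proof (induction \<P> rule: finite_induct)
 case empty
 show ?case using additive_subgroup.zero_closed[OF ideal.axioms(1)[OF N]] by blast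
next
 case (insert P \<P>)
 interpret N: ideal N R by (rule N)
 interpret P: primeideal P R using insert.prems(1) by simp
 have "EX s:N. ALL P:\<P>. s ~: P" by (rule insert.IH) (use insert.prems in auto)
 then obtain s where s: "s\<in>N" "!!P. P\<in>\<P> ==> s ~: P" by blast
 show ?case
 proof (cases "s\<in>P")
  case False
  then show ?thesis using s by blast
 next
  case True
  have "EX q:carrier R - P. ALL Q:\<P>. q\<in>Q"
  proof (rule prime_avoids_intersection[OF P.primeideal insert.hyps(1)])
   show "ideal Q R" if "Q\<in>\<P>" for Q using primeideal.axioms(1)[OF insert.prems(1)] that by simp
   show "\<not> Q <= P" if "Q\<in>\<P>" for Q using insert.prems(2)[of Q P] insert.hyps(2) that by auto
  qed
  then obtain q where q: "q\<in>carrier R - P" "!!Q. Q\<in>\<P> ==> q\<in>Q" by blast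
  obtain n where n: "n\<in>N" "n ~: P" using insert.prems(3)[of P] by blast
  have nR: "n\<in>carrier R" and sR: "s\<in>carrier R" using N.Icarr n(1) s(1) by auto
  have qn: "q \<otimes>\<^sub>R n ~: P" using P.I_prime[of q n] q n nR by blast
  have diff: "q \<otimes>\<^sub>R n = (s \<oplus>\<^sub>R q \<otimes>\<^sub>R n) \<ominus>\<^sub>R s" "s = (s \<oplus>\<^sub>R q \<otimes>\<^sub>R n) \<ominus>\<^sub>R q \<otimes>\<^sub>R n"
   using sR nR q(1) by (simp_all add: R.minus_eq R.a_ac R.r_neg R.r_neg1 R.r_neg2)
  have "s \<oplus>\<^sub>R q \<otimes>\<^sub>R n ~: P'" if P': "P'\<in>insert P \<P>" for P'
  proof
   assume mem: "s \<oplus>\<^sub>R q \<otimes>\<^sub>R n\<in>P'"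
   interpret P': primeideal P' R using insert.prems(1) P' by simp
   show False
   proof (cases "P' = P")
    case True
    have "(s \<oplus>\<^sub>R q \<otimes>\<^sub>R n) \<ominus>\<^sub>R s\<in>P"
     using mem \<open>s\<in>P\<close> True additive_subgroup.a_closed[OF P.is_additive_subgroup] additive_subgroup.a_inv_closed[OF P.is_additive_subgroup] by (simp add: R.minus_eq)
    then show False using qn diff(1) by simp
   next
    case False
    then have P'': "P'\<in>\<P>" using P' by simp
    then have "q \<otimes>\<^sub>R n\<in>P'" using P'.I_r_closed[OF q(2) nR] by simp
    then have "(s \<oplus>\<^sub>R q \<otimes>\<^sub>R n) \<ominus>\<^sub>R q \<otimes>\<^sub>R n\<in>P'"
     using mem additive_subgroup.a_closed[OF P'.is_additive_subgroup] additive_subgroup.a_inv_closed[OF P'.is_additive_subgroup] by (simp add: R.minus_eq)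
    then show False using s(2)[OF P''] diff(2) by simp
   qed
  qed
  moreover have "s \<oplus>\<^sub>R q \<otimes>\<^sub>R n\<in>N" using additive_subgroup.a_closed[OF N.is_additive_subgroup s(1) N.I_l_closed[OF n(1)]] q(1) by simp
  ultimately show ?thesis by blast
 qed
qed

definition colon :: "'a set => 'a => 'a set" where
 "colon I c = {r\<in>carrier R. r \<otimes>\<^sub>R c\<in>I}"

lemma colon_ideal: "ideal I R ==> c\<in>carrier R ==> ideal (colon I c) R"
 by (rule cring_idealI[OF R]) (auto simp: colon_def R.l_distr R.m_assoc additive_subgroup.zero_closed[OF ideal.axioms(1)]
   additive_subgroup.a_closed[OF ideal.axioms(1)] ideal.I_l_closed)

text \<open>The maximal ones among the proper colon ideals \<open>(I : c)\<close> are prime, and there are only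
 finitely many of them: if the elements \<open>c\<close> of a finite set generate the same ideal as all those
 belonging to maximal colon ideals, then the intersection of the corresponding colon ideals is
 contained in every maximal one.\<close>

lemma nonzerodivisor_or_colon:
 assumes noeth: "noetherian_ring R" and I: "ideal I R" and N: "primeideal N R"
  and sat: "!!c r. c\<in>carrier R ==> r\<in>carrier R - N ==> r \<otimes>\<^sub>R c\<in>I ==> c\<in>I"
 shows "(EX s:N. ALL c:carrier R. s \<otimes>\<^sub>R c\<in>I --> c\<in>I) \<or> (EX c:carrier R - I. colon I c = N)"
proof -
 interpret I: ideal I R by (rule I)
 interpret N: primeideal N R by (rule N)
 let ?C = "carrier R - I"
 define mx where "mx c \<longleftrightarrow> c\<in>?C & (ALL d:?C. colon I c <= colon I d --> colon I d = colon I c)" for c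
 have above: "EX d. mx d & colon I c <= colon I d" if c: "c\<in>?C" for c
 proof -
  obtain J where J: "J\<in>{colon I d | d. d\<in>?C & colon I c <= colon I d}"
   "!!K. K\<in>{colon I d | d. d\<in>?C & colon I c <= colon I d} ==> J <= K ==> K = J"
   by (rule noetherian_maximal[OF noeth, of "{colon I d | d. d\<in>?C & colon I c <= colon I d}"]) (use c colon_ideal[OF I] in auto)
  then obtain d where d: "d\<in>?C" "colon I c <= colon I d" "J = colon I d" by blast
  have "mx d" unfolding mx_def using J(2) d by blast
  then show ?thesis using d(2) by blast
 qed
 have prime: "primeideal (colon I c) R" if c: "mx c" for c
 proof (rule primeidealI[OF colon_ideal[OF I] R])
  show "c\<in>carrier R" using c by (simp add: mx_def)
  show "carrier R ~= colon I c"
  proof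
   assume "carrier R = colon I c"
   then have "\<one>\<^sub>R\<in>colon I c" using R.one_closed by blast
   then show False using c by (simp add: mx_def colon_def)
  qed
  fix a b assume ab: "a\<in>carrier R" "b\<in>carrier R" "a \<otimes>\<^sub>R b\<in>colon I c"
  show "a\<in>colon I c \<or> b\<in>colon I c"
  proof (rule disjCI)
   assume "b ~: colon I c"
   then have bc: "b \<otimes>\<^sub>R c\<in>?C" using ab(2) c by (auto simp: colon_def mx_def)
   have "colon I c <= colon I (b \<otimes>\<^sub>R c)"
   proof
    fix r assume "r\<in>colon I c"
    then show "r\<in>colon I (b \<otimes>\<^sub>R c)"
     using ab(2) c I.I_l_closed[of "r \<otimes>\<^sub>R c" b] R.m_lcomm[of r b c] by (simp add: colon_def mx_def)
   qed
   then have "colon I (b \<otimes>\<^sub>R c) = colon I c" using c bc by (simp add: mx_def)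
   moreover have "a\<in>colon I (b \<otimes>\<^sub>R c)" using ab c by (auto simp: colon_def mx_def R.m_assoc)
   ultimately show "a\<in>colon I c" by simp
  qed
 qed
 \<comment> \<open>Among the ideals generated by finitely many elements satisfying \<open>mx\<close>
   there is a maximal one, since \<open>R\<close> is noetherian; it contains all such
   elements.\<close>
 obtain C0 where C0: "finite C0" "C0 <= {c. mx c}" "{c. mx c} <= Idl\<^bsub>R\<^esub> C0"
 proof -
  let ?\<S> = "{Idl\<^bsub>R\<^esub> C | C. finite C & C <= {c. mx c}}"
  have id: "C <= {c. mx c} ==> C <= carrier R" for C by (auto simp: mx_def)
  obtain J where J: "J\<in>?\<S>" "!!K. K\<in>?\<S> ==> J <= K ==> K = J"
   by (rule noetherian_maximal[OF noeth, of ?\<S>]) (use R.genideal_ideal[OF id] in auto)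
  then obtain C where C: "finite C" "C <= {c. mx c}" "J = Idl\<^bsub>R\<^esub> C" by blast
  have "c\<in>J" if c: "mx c" for c
  proof -
   have sub: "insert c C <= {c. mx c}" using c C(2) by simp
   have "C <= Idl\<^bsub>R\<^esub> (insert c C)" using R.genideal_self[OF id[OF sub]] by blast
   then have "J <= Idl\<^bsub>R\<^esub> (insert c C)" unfolding C(3) by (rule R.genideal_minimal[OF R.genideal_ideal[OF id[OF sub]]])
   moreover have "Idl\<^bsub>R\<^esub> (insert c C)\<in>?\<S>" using sub C(1) by blast
   ultimately have "Idl\<^bsub>R\<^esub> (insert c C) = J" using J(2) by blast
   then show ?thesis using R.genideal_self[OF id[OF sub]] by blast
  qed
  then show thesis using C by (intro that[of C]) auto
 qed
 let ?\<P> = "colon I ` C0"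
 have all: "colon I c\<in>?\<P>" if c: "mx c" for c
 proof (rule ccontr)
  assume n: "colon I c ~: ?\<P>"
  have "EX q:carrier R - colon I c. ALL Q:?\<P>. q\<in>Q"
  proof (rule prime_avoids_intersection[OF prime[OF c]])
   fix Q assume "Q\<in>?\<P>"
   then obtain d where d: "d\<in>C0" "Q = colon I d" by blast
   then have "mx d" using C0(2) by blast
   then show "ideal Q R" using d colon_ideal[OF I] by (simp add: mx_def)
   show "\<not> Q <= colon I c"
   proof
    assume "Q <= colon I c"
    then have "colon I c = Q" using \<open>mx d\<close> c unfolding d(2) mx_def by blast
    then show False using n \<open>Q\<in>?\<P>\<close> by simp
   qed
  qed (use C0 in simp)
  then obtain q where q: "q\<in>carrier R" "q ~: colon I c" "!!d. d\<in>C0 ==> q \<otimes>\<^sub>R d\<in>I" by (auto simp: colon_def)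
  have "C0 <= colon I q"
  proof
   fix d assume d: "d\<in>C0"
   then have "d\<in>carrier R" using C0(2) by (auto simp: mx_def)
   then show "d\<in>colon I q" using q(1) q(3)[OF d] by (simp add: colon_def R.m_comm[of d q])
  qed
  then have "Idl\<^bsub>R\<^esub> C0 <= colon I q" by (rule R.genideal_minimal[OF colon_ideal[OF I q(1)]])
  then have "c\<in>colon I q" using C0(3) c by blast
  then show False using q(1,2) by (auto simp: colon_def R.m_comm[of c q])
 qed
 \<comment> \<open>If \<open>N\<close> lies in one of the finitely many maximal colon ideals,
   equality follows because \<open>sat\<close> puts proper colon ideals inside \<open>N\<close>.
   Otherwise some \<open>s\<close> in \<open>N\<close> avoids all of them; since every proper colon
   ideal is contained in a maximal one, \<open>s\<close> is no zero divisor modulo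
   \<open>I\<close>.\<close>
 show ?thesis
 proof (cases "EX P:?\<P>. N <= P")
  case True
  then obtain c where c: "mx c" "N <= colon I c" using C0(2) by blast
  have "colon I c <= N" using sat[of c] c(1) by (auto simp: colon_def mx_def)
  then show ?thesis using c by (auto simp: mx_def)
 next
  case False
  have "EX s:N. ALL P:?\<P>. s ~: P"
  proof (rule antichain_avoidance[OF N.is_ideal])
   show "primeideal P R" if "P\<in>?\<P>" for P using that C0(2) prime by blast
   show "P = Q" if "P\<in>?\<P>" "Q\<in>?\<P>" "P <= Q" for P Q using that C0(2) unfolding mx_def by blast
  qed (use C0 False in auto)
  then obtain s where s: "s\<in>N" "!!c. c\<in>C0 ==> s ~: colon I c" by blast
  have "c\<in>I" if c: "c\<in>carrier R" "s \<otimes>\<^sub>R c\<in>I" for c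
  proof (rule ccontr)
   assume "c ~: I"
   then obtain d where d: "mx d" "colon I c <= colon I d" using above c by blast
   have "s\<in>colon I c" using c N.Icarr[OF s(1)] by (simp add: colon_def)
   then show False using all[OF d(1)] d(2) s(2) by blast
  qed
  then show ?thesis using s(1) by blast
 qed
qed

end

section \<open>The injective hull of a residue ring\<close>

lemma smult_left_commute:
 assumes "module R M" "r\<in>carrier R" "s\<in>carrier R" "m\<in>carrier M"
 shows "r \<odot>\<^sub>M (s \<odot>\<^sub>M m) = s \<odot>\<^sub>M (r \<odot>\<^sub>M m)"
proof -
 interpret M: module R M by fact
 show ?thesis using assms(2-4) by (simp flip: M.smult_assoc1 add: M.R.m_comm)
qed

lemma free_resolution_tensor_exact:
 assumes N: "module R N" and F: "is_free_resolution R N F" and A: "module R A"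
 shows "s\<in>carrier R ==> (!!y. y\<in>carrier N ==> s \<odot>\<^sub>N y = \<zero>\<^sub>N) ==>
   bij_betw (%a. s \<odot>\<^sub>A a) (carrier A) (carrier A) ==> tensor_exact R A F"
  and "s\<in>carrier R ==> bij_betw (%y. s \<odot>\<^sub>N y) (carrier N) (carrier N) ==>
   (!!a. a\<in>carrier A ==> EX k::nat. (s [^]\<^bsub>R\<^esub> k) \<odot>\<^sub>A a = \<zero>\<^sub>A) ==> tensor_exact R A F"
  and "module R P ==> tensor_exact R A F ==> bilinear_map R A N P f ==> a\<in>carrier A ==> y\<in>carrier N ==>
   f a y = \<zero>\<^sub>P"
proof -
 obtain g where res: "cochain_complex R F" "!!j. free_module R (obj F j)"
  "!!j. j > 0 ==> carrier (obj F j) = {\<zero>\<^bsub>obj F j\<^esub>}"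
  "g\<in>mod_hom R (obj F 0) N" "carrier N <= g ` carrier (obj F 0)"
  "!!y. y\<in>carrier (obj F 0) ==> g y = \<zero>\<^sub>N \<longleftrightarrow> y\<in>boundaries F 0"
  "!!j y. j ~= 0 ==> y\<in>cycles F j ==> y\<in>boundaries F j" using free_resolution_facts[OF N F] by metis
 show "s\<in>carrier R ==> (!!y. y\<in>carrier N ==> s \<odot>\<^sub>N y = \<zero>\<^sub>N) ==>
   bij_betw (%a. s \<odot>\<^sub>A a) (carrier A) (carrier A) ==> tensor_exact R A F"
  by (rule resolution_smult_null[OF N res _ _ A])
 show "s\<in>carrier R ==> bij_betw (%y. s \<odot>\<^sub>N y) (carrier N) (carrier N) ==>
   (!!a. a\<in>carrier A ==> EX k::nat. (s [^]\<^bsub>R\<^esub> k) \<odot>\<^sub>A a = \<zero>\<^sub>A) ==> tensor_exact R A F"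
  by (rule resolution_smult_iso[OF N res _ _ A])
 show "module R P ==> tensor_exact R A F ==> bilinear_map R A N P f ==> a\<in>carrier A ==> y\<in>carrier N ==>
   f a y = \<zero>\<^sub>P" by (rule tensor_exact_bilinear_zero[OF N res A])
qed

text \<open>\<open>e0\<close> generates the copy of \<open>R / nn\<close> inside the hull.
  Essentiality is stated on elements; that \<open>a\<close> lies outside \<open>nn\<close> says that
  the common multiple \<open>a e0\<close> is nonzero.\<close>

locale injective_hull_at = R: cring R + P: primeideal nn R
 for R :: "('a, 'r) ring_scheme" and nn +
 fixes E :: "('a, 'e) module" and e0
 assumes noeth: "noetherian_ring R" and baer: "baer_module R E" and e0: "e0\<in>carrier E"
  and ann_e0: "r\<in>carrier R ==> r \<odot>\<^sub>E e0 = \<zero>\<^sub>E \<longleftrightarrow> r\<in>nn"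
  and ess: "e\<in>carrier E ==> e ~= \<zero>\<^sub>E ==> EX r:carrier R. EX a:carrier R - nn. r \<odot>\<^sub>E e = a \<odot>\<^sub>E e0"

text \<open>\<open>e0\<close> is the image of the class of one, and essentiality is tested on the
  cyclic submodules \<open>R e\<close>.\<close>

lemma injective_hull_at_exists:
 fixes R :: "('a, 'r) ring_scheme"
 assumes R: "cring R" and noeth: "noetherian_ring R" and P: "primeideal nn R"
  and hull: "injective_hull TYPE('a) R (quot_module (self_module R) nn) E"
 obtains e0 where "injective_hull_at R nn E e0"
proof -
 interpret R: cring R by (rule R)
 interpret P: primeideal nn R by (rule P)
 let ?S = "self_module R" let ?Q = "quot_module ?S nn"
 have inj: "injective_module TYPE('a) R E" using hull by (simp add: injective_hull_def)
 have baer: "baer_module R E" by (rule injective_imp_baer[OF inj])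
 have M: "module R E" using baer by (simp add: baer_module_def)
 interpret E: module R E by (rule M)
 have S: "module R ?S" by (rule module_self[OF R])
 have sub: "submodule nn R ?S" by (rule submodule_self_ideal[OF R P.is_ideal])
 have Q: "module R ?Q" by (rule quot_module_module[OF S sub])
 obtain j where j: "j\<in>mod_hom R ?Q E" "inj_on j (carrier ?Q)" "essential_submodule R (j ` carrier ?Q) E"
  using hull unfolding injective_hull_def by (elim conjE bexE) (rule that)
 have one: "nn +>\<^bsub>?S\<^esub> \<one>\<^sub>R\<in>carrier ?Q" unfolding mem_quot_module by auto
 define e0 where "e0 = j (nn +>\<^bsub>?S\<^esub> \<one>\<^sub>R)"
 have e0: "e0\<in>carrier E" unfolding e0_def by (rule hom_closed[OF j(1) one])
 have re0: "r \<odot>\<^sub>E e0 = j (nn +>\<^bsub>?S\<^esub> r)" if r: "r\<in>carrier R" for r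
  using hom_smult[OF j(1) r one] quot_module_smult[OF S sub _ r, of "\<one>\<^sub>R"] r by (simp add: e0_def)
 have j0: "j nn = \<zero>\<^sub>E" using hom_zero[OF Q M j(1)] by simp
 have ann: "r \<odot>\<^sub>E e0 = \<zero>\<^sub>E \<longleftrightarrow> r\<in>nn" if r: "r\<in>carrier R" for r
 proof -
  have "nn +>\<^bsub>?S\<^esub> r\<in>carrier ?Q" "nn\<in>carrier ?Q" unfolding mem_quot_module using r coset_zero[OF S sub] by auto
  then have "j (nn +>\<^bsub>?S\<^esub> r) = j nn \<longleftrightarrow> nn +>\<^bsub>?S\<^esub> r = nn" using inj_on_eq_iff[OF j(2)] by blast
  then show ?thesis unfolding re0[OF r] j0 using coset_eq_zero_iff[OF S sub, of r] r by simp
 qed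
 have "EX r:carrier R. EX a:carrier R - nn. r \<odot>\<^sub>E e = a \<odot>\<^sub>E e0" if e: "e\<in>carrier E" "e ~= \<zero>\<^sub>E" for e
 proof -
  have "(%r. r \<odot>\<^sub>E e)\<in>mod_hom R ?S E" using e(1) by (intro mod_homI) (auto simp: E.smult_l_distr E.smult_assoc1)
  then have U: "submodule ((%r. r \<odot>\<^sub>E e) ` carrier ?S) R E" by (rule image_submodule[OF S M])
  have "e\<in>(%r. r \<odot>\<^sub>E e) ` carrier ?S" using e(1) by (intro image_eqI[of _ _ "\<one>\<^sub>R"]) auto
  then have "(%r. r \<odot>\<^sub>E e) ` carrier ?S ~= {\<zero>\<^sub>E}" using e(2) by blast
  then have "j ` carrier ?Q \<inter> (%r. r \<odot>\<^sub>E e) ` carrier ?S ~= {\<zero>\<^sub>E}"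
   using j(3) U unfolding essential_submodule_def by blast
  moreover have "\<zero>\<^sub>E\<in>j ` carrier ?Q \<inter> (%r. r \<odot>\<^sub>E e) ` carrier ?S"
   using submodule_mem(2)[OF M U] submodule_mem(2)[OF M image_submodule[OF Q M j(1)]] by blast
  ultimately obtain y where y: "y\<in>j ` carrier ?Q" "y\<in>(%r. r \<odot>\<^sub>E e) ` carrier ?S" "y ~= \<zero>\<^sub>E" by blast
  obtain A where A: "A\<in>carrier ?Q" "y = j A" using y(1) by blast
  then obtain a where a: "a\<in>carrier R" "A = nn +>\<^bsub>?S\<^esub> a" unfolding mem_quot_module by auto
  have ya: "y = a \<odot>\<^sub>E e0" unfolding A(2) a(2) re0[OF a(1)] ..
  then have an: "a\<in>carrier R - nn" using y(3) ann[OF a(1)] a(1) by simp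
  obtain r where "r\<in>carrier R" "y = r \<odot>\<^sub>E e" using y(2) by auto
  then show ?thesis using an ya by metis
 qed
 then show thesis using that[of e0] e0 ann by (simp add: injective_hull_at_def injective_hull_at_axioms_def R P noeth baer)
qed

context injective_hull_at
begin

lemma E_module: "module R E" using baer by (simp add: baer_module_def)

sublocale E: module R E by (rule E_module)

lemma e0_nonzero: "e0 ~= \<zero>\<^sub>E"
 using ann_e0[OF R.one_closed] e0 P.I_notcarr P.one_imp_carrier by auto

text \<open>A nonzero \<open>e\<close> has a multiple \<open>a e0\<close> with \<open>a\<close>
  outside \<open>nn\<close>. If \<open>s\<close> killed \<open>e\<close>, then \<open>s a\<close>
  would kill \<open>e0\<close>, against primality of \<open>nn\<close>.\<close>

lemma unit_smult_zero:
 assumes s: "s\<in>carrier R - nn" and e: "e\<in>carrier E" "s \<odot>\<^sub>E e = \<zero>\<^sub>E" shows "e = \<zero>\<^sub>E"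
proof (rule ccontr)
 assume "e ~= \<zero>\<^sub>E"
 from ess[OF e(1) this] obtain r a where ra: "r\<in>carrier R" "a\<in>carrier R - nn" "r \<odot>\<^sub>E e = a \<odot>\<^sub>E e0" by blast
 have "(s \<otimes>\<^sub>R a) \<odot>\<^sub>E e0 = s \<odot>\<^sub>E (r \<odot>\<^sub>E e)" using s ra e0 by (simp add: E.smult_assoc1)
 also have "... = r \<odot>\<^sub>E (s \<odot>\<^sub>E e)" using s ra(1) e(1) by (intro smult_left_commute[OF E_module]) auto
 finally have "s \<otimes>\<^sub>R a\<in>nn" using ann_e0[of "s \<otimes>\<^sub>R a"] s ra e by simp
 then show False using P.I_prime[of s a] s ra by blast
qed

lemma unit_smult_inj:
 assumes s: "s\<in>carrier R - nn" and e: "e\<in>carrier E" "f\<in>carrier E" "s \<odot>\<^sub>E e = s \<odot>\<^sub>E f" shows "e = f"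
proof -
 have "s \<odot>\<^sub>E (e \<ominus>\<^sub>E f) = \<zero>\<^sub>E" using hom_minus[OF E_module E_module hom_smult_self[OF E_module, of s] e(1,2)] s e
  by (simp add: minus_eq_zero_iff[OF E_module])
 then show ?thesis using unit_smult_zero[OF s, of "e \<ominus>\<^sub>E f"] e minus_eq_zero_iff[OF E_module e(1,2)] by simp
qed

text \<open>The annihilators of \<open>t^k e\<close> increase and so become stationary. At that
  stage a multiple \<open>r (t^k e) = a e0\<close> with \<open>a\<close> outside \<open>nn\<close>
  is impossible: \<open>t\<close> kills \<open>a e0\<close>, so \<open>r\<close> annihilates
  \<open>t^(k+1) e\<close>, hence already \<open>t^k e\<close>. By essentiality \<open>t^k e\<close>
  is zero.\<close>

lemma torsion:
 assumes t: "t\<in>nn" and e: "e\<in>carrier E"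
 shows "EX k::nat. (t [^]\<^bsub>R\<^esub> k) \<odot>\<^sub>E e = \<zero>\<^sub>E"
proof -
 have tR: "t\<in>carrier R" by (rule P.Icarr[OF t])
 let ?f = "%k::nat. (t [^]\<^bsub>R\<^esub> k) \<odot>\<^sub>E e"
 have f: "?f k\<in>carrier E" for k using tR e by simp
 obtain J where J: "J\<in>range (%k. annihilator R E (?f k))" "!!K. K\<in>range (%k. annihilator R E (?f k)) ==> J <= K ==> K = J"
  by (rule noetherian_maximal[OF noeth, of "range (%k. annihilator R E (?f k))"]) (use annihilator_ideal[OF E_module f] in auto)
 then obtain k where k: "J = annihilator R E (?f k)" by blast
 have step: "?f (Suc k) = t \<odot>\<^sub>E ?f k" using tR e by (simp add: E.smult_assoc1 R.m_comm)
 have comm: "r \<odot>\<^sub>E (t \<odot>\<^sub>E ?f k) = t \<odot>\<^sub>E (r \<odot>\<^sub>E ?f k)" if "r\<in>carrier R" for r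
  by (rule smult_left_commute[OF E_module that tR f])
 have eq: "annihilator R E (t \<odot>\<^sub>E ?f k) = annihilator R E (?f k)"
 proof -
  have "J <= annihilator R E (?f (Suc k))" unfolding k step using comm tR by (auto simp: annihilator_def)
  then have "annihilator R E (?f (Suc k)) = J" by (intro J(2)) blast
  then show ?thesis unfolding step k .
 qed
 have "?f k = \<zero>\<^sub>E"
 proof (rule ccontr)
  assume "?f k ~= \<zero>\<^sub>E"
  from ess[OF f this] obtain r a where ra: "r\<in>carrier R" "a\<in>carrier R - nn" "r \<odot>\<^sub>E ?f k = a \<odot>\<^sub>E e0" by blast
  have "t \<odot>\<^sub>E (a \<odot>\<^sub>E e0) = (t \<otimes>\<^sub>R a) \<odot>\<^sub>E e0" using tR ra e0 by (simp add: E.smult_assoc1)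
  also have "... = \<zero>\<^sub>E" using ann_e0[of "t \<otimes>\<^sub>R a"] P.I_r_closed[OF t, of a] tR ra by simp
  finally have "r\<in>annihilator R E (t \<odot>\<^sub>E ?f k)" using ra(1) comm[OF ra(1)] ra(3) by (simp add: annihilator_def)
  then have "a \<odot>\<^sub>E e0 = \<zero>\<^sub>E" unfolding eq using ra(3) by (simp add: annihilator_def)
  then show False using ann_e0[of a] ra by blast
 qed
 then show ?thesis by blast
qed

text \<open>For an ideal in place of \<open>S\<close> this is \<open>Hom (R / S, E)\<close>. The
  module \<open>M\<close> is the case of \<open>{x}\<close>.\<close>

abbreviation killed :: "'a set => ('a, 'e) module" where
 "killed S \<equiv> E\<lparr>carrier := {e\<in>carrier E. ALL i:S. i \<odot>\<^sub>E e = \<zero>\<^sub>E}\<rparr>"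

lemma killed_module:
 assumes "S <= carrier R" shows "module R (killed S)"
proof (rule submodule_module[OF E_module], rule E.submoduleI)
 fix r e assume r: "r\<in>carrier R" and e: "e\<in>{e\<in>carrier E. ALL i:S. i \<odot>\<^sub>E e = \<zero>\<^sub>E}"
 have "i \<odot>\<^sub>E (r \<odot>\<^sub>E e) = \<zero>\<^sub>E" if "i\<in>S" for i
  using smult_left_commute[OF E_module, of i r e] that assms r e by auto
 then show "r \<odot>\<^sub>E e\<in>{e\<in>carrier E. ALL i:S. i \<odot>\<^sub>E e = \<zero>\<^sub>E}" using r e by simp
qed (use assms in "auto simp: E.smult_r_distr E.smult_r_minus module_neg_zero[OF E_module] subset_eq")

text \<open>Elements outside \<open>nn\<close> act injectively on \<open>E\<close>, hence also
  surjectively: \<open>r s = 0\<close> forces \<open>r e = 0\<close>, so \<open>e\<close> can be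
  divided by \<open>s\<close>. The result is killed by \<open>S\<close> again because
  \<open>s\<close> acts injectively.\<close>

lemma killed_bij:
 assumes S: "S <= carrier R" and s: "s\<in>carrier R - nn"
 shows "bij_betw (%e. s \<odot>\<^sub>E e) (carrier (killed S)) (carrier (killed S))" unfolding bij_betw_def
proof (intro conjI equalityI subsetI)
 show "inj_on (%e. s \<odot>\<^sub>E e) (carrier (killed S))" by (rule inj_onI, rule unit_smult_inj[OF s]) auto
 show "e\<in>carrier (killed S)" if "e\<in>(%e. s \<odot>\<^sub>E e) ` carrier (killed S)" for e
  using that module.smult_closed[OF killed_module[OF S], of s] s by auto
 fix e assume e: "e\<in>carrier (killed S)"
 have z: "r \<odot>\<^sub>E e = \<zero>\<^sub>E" if r: "r\<in>carrier R" "r \<otimes>\<^sub>R s\<in>{\<zero>\<^sub>R}" for r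
 proof (rule unit_smult_zero[OF s])
  show "s \<odot>\<^sub>E (r \<odot>\<^sub>E e) = \<zero>\<^sub>E" using r s e by (simp flip: E.smult_assoc1 add: R.m_comm[of s r])
 qed (use r e in simp)
 obtain f where f: "f\<in>carrier E" "s \<odot>\<^sub>E f = e" by (rule baer_lift[OF baer R.zeroideal, of s e]) (use s e z in auto)
 have "i \<odot>\<^sub>E f = \<zero>\<^sub>E" if i: "i\<in>S" for i
 proof (rule unit_smult_zero[OF s])
  have iR: "i\<in>carrier R" using S i by blast
  have "s \<odot>\<^sub>E (i \<odot>\<^sub>E f) = i \<odot>\<^sub>E e" unfolding f(2)[symmetric] using iR s f(1) by (simp flip: E.smult_assoc1 add: R.m_comm)
  then show "s \<odot>\<^sub>E (i \<odot>\<^sub>E f) = \<zero>\<^sub>E" using e i by simp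
 qed (use S i f(1) in auto)
 then show "e\<in>(%e. s \<odot>\<^sub>E e) ` carrier (killed S)" using f by (intro image_eqI[of _ _ f]) auto
qed

text \<open>If \<open>killed I \<otimes>\<^sup>L k(nn)\<close> is acyclic and \<open>s\<in>nn\<close> is regular on \<open>R / I\<close>, then
 \<open>killed (I + (s))\<close> has the same property, because \<open>s\<close> maps \<open>killed I\<close> onto itself.  So for \<open>I\<close>
 maximal, \<open>nn = (I : c)\<close>, and multiplication with \<open>c\<close> gives a nonzero bilinear map on
 \<open>killed I \<times> k(nn)\<close>.\<close>

lemma killed_not_tensor_exact:
 fixes F :: "('a, 'f) cochain"
 assumes S: "S <= nn" and F: "is_free_resolution R (residue_module R nn) F"
 shows "\<not> tensor_exact R (killed S) F"
proof
 assume ex: "tensor_exact R (killed S) F"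
 interpret L: localization_at R nn by unfold_locales
 let ?k = "residue_module R nn"
 have k: "module R ?k" by (rule L.residue_module_facts(1))
 have C: "cochain_complex R F" and free: "!!j. free_module R (obj F j)" using F unfolding is_free_resolution_def by blast+
 \<comment> \<open>\<open>cl T\<close> is the largest set with the same \<open>killed\<close> module
   as \<open>T\<close>. Passing to it replaces arbitrary sets by ideals, among which a maximal one
   can be chosen.\<close>
 define cl where "cl T = {r\<in>carrier R. ALL e:carrier (killed T). r \<odot>\<^sub>E e = \<zero>\<^sub>E}" for T
 have nnR: "T <= nn ==> T <= carrier R" for T using P.a_subset by blast
 have cl_ideal: "ideal (cl T) R" for T by (rule cring_idealI[OF R.is_cring]) (auto simp: cl_def E.smult_l_distr E.smult_assoc1)
 have cl_sub: "T <= nn ==> T <= cl T" for T using nnR by (auto simp: cl_def)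
 have cl_nn: "T <= nn ==> cl T <= nn" for T
 proof
  fix r assume T: "T <= nn" and r: "r\<in>cl T"
  have "e0\<in>carrier (killed T)" using e0 ann_e0 T nnR[OF T] by auto
  then show "r\<in>nn" using r ann_e0[of r] by (auto simp: cl_def)
 qed
 have killed_cl: "killed (cl T) = killed T" if T: "T <= nn" for T
 proof -
  have "{e\<in>carrier E. ALL i:cl T. i \<odot>\<^sub>E e = \<zero>\<^sub>E} = {e\<in>carrier E. ALL i:T. i \<odot>\<^sub>E e = \<zero>\<^sub>E}"
   using cl_sub[OF T] by (auto simp: cl_def)
  then show ?thesis by simp
 qed
 let ?\<S> = "{cl T | T. T <= nn & tensor_exact R (killed T) F}"
 obtain I where I: "I\<in>?\<S>" "!!J. J\<in>?\<S> ==> I <= J ==> J = I"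
  by (rule noetherian_maximal[OF noeth, of ?\<S>]) (use ex S cl_ideal in auto)
 then obtain T where T: "T <= nn" "tensor_exact R (killed T) F" "I = cl T" by blast
 have Iid: "ideal I R" and Inn: "I <= nn" using T cl_ideal cl_nn by auto
 have exI: "tensor_exact R (killed I) F" unfolding T(3) killed_cl[OF T(1)] by (rule T(2))
 have IR: "I <= carrier R" by (rule nnR[OF Inn])
 \<comment> \<open>\<open>I\<close> is saturated with respect to \<open>nn\<close>, because it is an
   annihilator and elements outside \<open>nn\<close> act injectively on \<open>E\<close>.\<close>
 have "c\<in>I" if c: "c\<in>carrier R" "r\<in>carrier R - nn" "r \<otimes>\<^sub>R c\<in>I" for c r
 proof -
  have "c \<odot>\<^sub>E e = \<zero>\<^sub>E" if e: "e\<in>carrier (killed T)" for e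
  proof (rule unit_smult_zero[OF c(2)])
   have "(r \<otimes>\<^sub>R c) \<odot>\<^sub>E e = \<zero>\<^sub>E" using c(3) e unfolding T(3) cl_def by blast
   then show "r \<odot>\<^sub>E (c \<odot>\<^sub>E e) = \<zero>\<^sub>E" using c e by (simp add: E.smult_assoc1)
  qed (use c e in simp)
  then show ?thesis using c(1) unfolding T(3) cl_def by blast
 qed
 then have "(EX s:nn. ALL c:carrier R. s \<otimes>\<^sub>R c\<in>I --> c\<in>I) \<or> (EX c:carrier R - I. colon R I c = nn)"
  by (rule nonzerodivisor_or_colon[OF R.is_cring noeth Iid P.primeideal])
 then show False
 proof
  assume "EX s:nn. ALL c:carrier R. s \<otimes>\<^sub>R c\<in>I --> c\<in>I"
  then obtain s where s: "s\<in>nn" "!!c. c\<in>carrier R ==> s \<otimes>\<^sub>R c\<in>I ==> c\<in>I" by blast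
  have sR: "s\<in>carrier R" by (rule P.Icarr[OF s(1)])
  have K: "insert s I <= nn" using s(1) Inn by blast
  have mI: "module R (killed I)" by (rule killed_module[OF IR])
  have sub: "carrier (killed (insert s I)) <= carrier (killed I)" by auto
  \<comment> \<open>The short exact sequence is the inclusion of \<open>killed (insert s I)\<close>
    in \<open>killed I\<close> followed by multiplication by \<open>s\<close>, which is onto because
    \<open>s\<close> is regular modulo \<open>I\<close>.\<close>
  have "tensor_exact R (killed (insert s I)) F"
  proof (rule tensor_exact_sub[OF C free killed_module[OF nnR[OF K]] mI mI _ hom_smult_self[OF mI sR]])
   show "(%e. e)\<in>mod_hom R (killed (insert s I)) (killed I)" by (rule mod_homI) auto
   show "carrier (killed I) <= (%e. s \<odot>\<^bsub>killed I\<^esub> e) ` carrier (killed I)"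
   proof
    fix e assume e: "e\<in>carrier (killed I)"
    have z: "r \<odot>\<^sub>E e = \<zero>\<^sub>E" if "r\<in>carrier R" "r \<otimes>\<^sub>R s\<in>I" for r
     using s(2)[OF that(1)] that(2) R.m_comm[OF that(1) sR] e by simp
    obtain f where "f\<in>carrier E" "s \<odot>\<^sub>E f = e" "!!r. r\<in>I ==> r \<odot>\<^sub>E f = \<zero>\<^sub>E"
     by (rule baer_lift[OF baer Iid sR, of e]) (use e z in auto)
    then show "e\<in>(%e. s \<odot>\<^bsub>killed I\<^esub> e) ` carrier (killed I)" by (intro image_eqI[of _ _ f]) auto
   qed
  qed (use exI in auto)
  then have "cl (insert s I)\<in>?\<S>" using K by blast
  moreover have "I <= cl (insert s I)" using cl_sub[OF K] by blast
  \<comment> \<open>Maximality absorbs \<open>s\<close> into \<open>I\<close>, and then regularity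
    of \<open>s\<close> puts one into \<open>I\<close>.\<close>
  ultimately have "s\<in>I" using I(2)[of "cl (insert s I)"] cl_sub[OF K] by blast
  then have "\<one>\<^sub>R\<in>I" using s(2)[OF R.one_closed] sR by simp
  then show False using Inn P.I_notcarr P.one_imp_carrier by blast
 next
  assume "EX c:carrier R - I. colon R I c = nn"
  then obtain c where c: "c\<in>carrier R" "colon R I c = nn" by blast
  have z: "r \<odot>\<^sub>E e0 = \<zero>\<^sub>E" if "r\<in>carrier R" "r \<otimes>\<^sub>R c\<in>I" for r
   using ann_e0[OF that(1)] that c(2) by (auto simp: colon_def[OF R.is_cring])
  \<comment> \<open>Since \<open>(I : c) = nn\<close>, multiplication by \<open>c\<close> embeds
    \<open>R / nn\<close> in \<open>R / I\<close>, and \<open>e0\<close> is \<open>c\<close> times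
    an element \<open>e\<close> of \<open>killed I\<close>. At \<open>e\<close> and \<open>u\<close>
    the bilinear map below takes the value \<open>e0\<close>.\<close>
  obtain e where e: "e\<in>carrier E" "c \<odot>\<^sub>E e = e0" "!!r. r\<in>I ==> r \<odot>\<^sub>E e = \<zero>\<^sub>E"
   by (rule baer_lift[OF baer Iid c(1) e0]) (use z in auto)
  obtain u where u: "u\<in>carrier ?k" "u ~= \<zero>\<^sub>?k"
   "!!y. y\<in>carrier ?k ==> EX a:carrier R. EX s:carrier R - nn. s \<odot>\<^sub>?k y = a \<odot>\<^sub>?k u"
   using L.residue_module_facts(4) by blast
  interpret k: module R ?k by (rule k)
  \<comment> \<open>For each \<open>y\<close> some multiple \<open>s y\<close> with \<open>s\<close>
    outside \<open>nn\<close> is a multiple of \<open>u\<close>, and \<open>s\<close> acts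
    injectively on \<open>E\<close>; so maps from \<open>?k\<close> to \<open>E\<close> are
    determined at \<open>u\<close>. This yields bilinearity of \<open>v\<close>, although its maps
    are merely chosen.\<close>
  have uniq: "w y = w' y" if h: "w\<in>mod_hom R ?k E" "w'\<in>mod_hom R ?k E" "w u = w' u" and y: "y\<in>carrier ?k" for w w' y
  proof -
   obtain a s where as: "a\<in>carrier R" "s\<in>carrier R - nn" "s \<odot>\<^sub>?k y = a \<odot>\<^sub>?k u" using u(3)[OF y] by blast
   have sR: "s\<in>carrier R" using as(2) by blast
   have "s \<odot>\<^sub>E w y = s \<odot>\<^sub>E w' y"
    using hom_smult[OF h(1) sR y] hom_smult[OF h(2) sR y] hom_smult[OF h(1) as(1) u(1)] hom_smult[OF h(2) as(1) u(1)] as(3) h(3) by simp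
   then show ?thesis by (rule unit_smult_inj[OF as(2) hom_closed[OF h(1) y] hom_closed[OF h(2) y]])
  qed
  \<comment> \<open>An \<open>r\<close> killing \<open>u\<close> lies in \<open>nn\<close>, so
    \<open>r c\<close> lies in \<open>I\<close> and kills \<open>f\<close>. Hence sending
    \<open>u\<close> to \<open>c f\<close> is well defined on the multiples of \<open>u\<close> and
    extends by injectivity of \<open>E\<close>.\<close>
  have ex_hom: "EX w:mod_hom R ?k E. w u = c \<odot>\<^sub>E f" if f: "f\<in>carrier (killed I)" for f
  proof -
   have "EX w:mod_hom R ?k E. ALL r:carrier (self_module R). w (r \<odot>\<^sub>?k u) = r \<odot>\<^sub>E (c \<odot>\<^sub>E f)"
   proof (rule injective_factor[OF baer_criterion[OF baer] module_self[OF R.is_cring] k])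
    show "(%r. r \<odot>\<^sub>?k u)\<in>mod_hom R (self_module R) ?k" using u(1) by (intro mod_homI) (auto simp: k.smult_l_distr k.smult_assoc1)
    show "(%r. r \<odot>\<^sub>E (c \<odot>\<^sub>E f))\<in>mod_hom R (self_module R) E" using f c(1) by (intro mod_homI) (auto simp: E.smult_l_distr E.smult_assoc1)
    fix r assume r: "r\<in>carrier (self_module R)" "r \<odot>\<^sub>?k u = \<zero>\<^sub>?k"
    have "r\<in>nn"
    proof (rule ccontr)
     assume "r ~: nn"
     then have "inj_on (%y. r \<odot>\<^sub>?k y) (carrier ?k)" using L.residue_module_facts(3)[of r] r(1) by (simp add: bij_betw_def)
     from inj_onD[OF this, of u "\<zero>\<^sub>?k"] show False using u(1,2) r by simp
    qed
    then have "r \<otimes>\<^sub>R c\<in>I" using c(2) by (auto simp: colon_def[OF R.is_cring])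
    then have "(r \<otimes>\<^sub>R c) \<odot>\<^sub>E f = \<zero>\<^sub>E" using f by simp
    then show "r \<odot>\<^sub>E (c \<odot>\<^sub>E f) = \<zero>\<^sub>E" using r(1) c(1) f by (simp add: E.smult_assoc1)
   qed
   then obtain w where "w\<in>mod_hom R ?k E" "w (\<one>\<^sub>R \<odot>\<^sub>?k u) = \<one>\<^sub>R \<odot>\<^sub>E (c \<odot>\<^sub>E f)" by auto
   then show ?thesis using u(1) c(1) f by auto
  qed
  define v where "v f = (SOME w. w\<in>mod_hom R ?k E & w u = c \<odot>\<^sub>E f)" for f
  have v: "v f\<in>mod_hom R ?k E" "v f u = c \<odot>\<^sub>E f" if "f\<in>carrier (killed I)" for f
   using someI_ex[of "%w. w\<in>mod_hom R ?k E & w u = c \<odot>\<^sub>E f"] ex_hom[OF that] unfolding v_def by blast+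
  interpret K: module R "killed I" by (rule killed_module[OF IR])
  have "bilinear_map R (killed I) ?k E v" unfolding bilinear_map_def
  proof (intro conjI ballI)
   fix y assume y: "y\<in>carrier ?k"
   show "(%f. v f y)\<in>mod_hom R (killed I) E"
   proof (rule mod_homI)
    fix f assume f: "f\<in>carrier (killed I)"
    show "v f y\<in>carrier E" by (rule hom_closed[OF v(1)[OF f] y])
    fix g assume g: "g\<in>carrier (killed I)"
    show "v (f \<oplus>\<^bsub>killed I\<^esub> g) y = v f y \<oplus>\<^sub>E v g y"
     by (rule uniq[OF v(1)[OF K.M.a_closed[OF f g]] hom_add_map[OF E_module v(1)[OF f] v(1)[OF g]] _ y])
      (use v(2)[OF K.M.a_closed[OF f g]] v(2)[OF f] v(2)[OF g] f g c(1) in "simp add: E.smult_r_distr")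
   next
    fix r f assume r: "r\<in>carrier R" and f: "f\<in>carrier (killed I)"
    show "v (r \<odot>\<^bsub>killed I\<^esub> f) y = r \<odot>\<^sub>E v f y"
     by (rule uniq[OF v(1)[OF K.smult_closed[OF r f]] hom_smult_map[OF E_module v(1)[OF f] r] _ y])
      (use v(2)[OF K.smult_closed[OF r f]] v(2)[OF f] r f c(1) in "simp flip: E.smult_assoc1 add: R.m_comm")
   qed
  qed (rule v(1))
  moreover have eI: "e\<in>carrier (killed I)" using e by simp
  ultimately have "v e u = \<zero>\<^sub>E" using free_resolution_tensor_exact(3)[OF k F killed_module[OF IR] E_module exI _ eI u(1)] by blast
  then show False using v(2)[OF eI] e(2) e0_nonzero by simp
 qed
qed

lemma killed_tensor_exact_iff:
 assumes S: "S <= nn" and p: "primeideal p R"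
 shows "tensor_exact R (killed S) (free_resolution R (residue_module R p)) \<longleftrightarrow> p ~= nn"
proof -
 interpret L: localization_at R p by (rule localization_at.intro[OF R.is_cring p])
 let ?k = "residue_module R p" let ?F = "free_resolution R ?k"
 have k: "module R ?k" by (rule L.residue_module_facts(1))
 have "\<zero>\<^sub>R ~= \<one>\<^sub>R" using P.I_notcarr P.one_imp_carrier additive_subgroup.zero_closed[OF P.is_additive_subgroup] by metis
 then have res: "is_free_resolution R ?k ?F" by (rule free_resolution_exists[OF R.is_cring k])
 have SR: "S <= carrier R" using S P.a_subset by blast
 have m: "module R (killed S)" by (rule killed_module[OF SR])
 have "tensor_exact R (killed S) ?F" if ne: "p ~= nn"
 proof -
  \<comment> \<open>In the first case \<open>s\<close> kills \<open>k(p)\<close> and is bijective on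
    \<open>killed S\<close>; in the second it is bijective on \<open>k(p)\<close> and locally
    nilpotent on \<open>killed S\<close>.\<close>
  from ne consider s where "s\<in>p" "s ~: nn" | s where "s\<in>nn" "s ~: p" by blast
  then show ?thesis
  proof cases
   case 1
   have sR: "s\<in>carrier R" by (rule L.P.Icarr[OF 1(1)])
   show ?thesis
    by (rule free_resolution_tensor_exact(1)[OF k res m sR L.residue_module_facts(2)[OF 1(1)]]) (use killed_bij[OF SR, of s] sR 1 in simp_all)
  next
   case 2
   have sR: "s\<in>carrier R" by (rule P.Icarr[OF 2(1)])
   show ?thesis by (rule free_resolution_tensor_exact(2)[OF k res m sR L.residue_module_facts(3)]) (use torsion[OF 2(1)] sR 2 in simp_all)
  qed
 qed
 then show ?thesis using killed_not_tensor_exact[OF S] res by blast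
qed

end

section \<open>Shifts, products, minimality and contractibility of complexes\<close>

lemma quasi_iso_shift:
 assumes C: "cochain_complex R C" and D: "cochain_complex R D" and q: "quasi_iso R C D f"
 shows "quasi_iso R (shift_complex i C) (shift_complex i D) (shift_map i f)"
proof -
 note q' = q[unfolded quasi_iso_iff[OF C D]]
 have cm: "chain_map R C D f" using q' by blast
 have e: "n + 1 + i = n + i + 1" for n by simp
 have "chain_map R (shift_complex i C) (shift_complex i D) (shift_map i f)" unfolding chain_map_def
 proof (intro allI conjI ballI)
  fix n
  show "shift_map i f n\<in>mod_hom R (obj (shift_complex i C) n) (obj (shift_complex i D) n)" using chain_map_hom[OF cm] by (simp add: shift_map_def)
  fix y assume "y\<in>carrier (obj (shift_complex i C) n)"
  then have y: "y\<in>carrier (obj C (n + i))" by simp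
  show "shift_map i f (n + 1) (diff (shift_complex i C) n y) = diff (shift_complex i D) n (shift_map i f n y)"
   unfolding shift_map_def shift_simps e chain_map_comm[OF cm y, symmetric]
   by (rule hom_signed[OF complexD(1)[OF C] complexD(1)[OF D] chain_map_hom[OF cm]
      hom_closed[OF complexD(2)[OF C] y]])
 qed
 then show ?thesis unfolding quasi_iso_iff[OF complex_shift[OF C] complex_shift[OF D]] cycles_shift[OF C] cycles_shift[OF D]
   boundaries_shift[OF C] boundaries_shift[OF D] shift_map_def shift_simps using q' by blast
qed

text \<open>Products are exact: cycles and boundaries are formed coordinatewise, so representatives
  are compared and chosen in each coordinate.\<close>

lemma quasi_iso_prod:
 assumes R: "cring R" and C: "!!i. cochain_complex R (C i)" and D: "!!i. cochain_complex R (D i)"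
  and q: "!!i. quasi_iso R (C i) (D i) (f i)"
 shows "quasi_iso R (prod_complex C) (prod_complex D) (prod_map f)"
proof -
 note q' = q[unfolded quasi_iso_iff[OF C D]]
 have cm: "chain_map R (C i) (D i) (f i)" for i using q' by blast
 have fh: "f i n\<in>mod_hom R (obj (C i) n) (obj (D i) n)" for i n by (rule chain_map_hom[OF cm])
 have PC: "cochain_complex R (prod_complex C)" and PD: "cochain_complex R (prod_complex D)" by (rule complex_prod[OF R C], rule complex_prod[OF R D])
 have "chain_map R (prod_complex C) (prod_complex D) (prod_map f)" unfolding chain_map_def
 proof (intro allI conjI ballI)
  fix n
  show "prod_map f n\<in>mod_hom R (obj (prod_complex C) n) (obj (prod_complex D) n)"
   by (rule mod_homI) (use hom_closed[OF fh] hom_add[OF fh] hom_smult[OF fh] in "simp_all add: prod_map_def")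
  show "prod_map f (n + 1) (diff (prod_complex C) n u) = diff (prod_complex D) n (prod_map f n u)"
   if "u\<in>carrier (obj (prod_complex C) n)" for u unfolding prod_map_def prod_simps by (rule ext, rule chain_map_comm[OF cm]) (use that in simp)
 qed
 moreover have "EX z:cycles (prod_complex C) n. w \<ominus>\<^bsub>obj (prod_complex D) n\<^esub> prod_map f n z\<in>boundaries (prod_complex D) n"
  if w: "w\<in>cycles (prod_complex D) n" for n w
 proof -
  have "ALL i. EX z:cycles (C i) n. w i \<ominus>\<^bsub>obj (D i) n\<^esub> f i n z\<in>boundaries (D i) n"
   using q' w unfolding cycles_prod by blast
  then obtain z where z: "!!i. z i\<in>cycles (C i) n" "!!i. w i \<ominus>\<^bsub>obj (D i) n\<^esub> f i n (z i)\<in>boundaries (D i) n" by metis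
  have "prod_map f n z\<in>carrier (prod_module (%i. obj (D i) n))" using hom_closed[OF fh] z(1) by (simp add: prod_map_def cycles_def)
  then have "w \<ominus>\<^bsub>obj (prod_complex D) n\<^esub> prod_map f n z = (%i. w i \<ominus>\<^bsub>obj (D i) n\<^esub> f i n (z i))"
   using prod_module_minus[OF R complexD(1)[OF D]] by (simp add: prod_map_def)
  then show ?thesis using z by (intro bexI[of _ z]) (simp_all add: cycles_prod boundaries_prod)
 qed
 moreover have "z\<in>boundaries (prod_complex C) n" if "z\<in>cycles (prod_complex C) n" "prod_map f n z\<in>boundaries (prod_complex D) n" for n z
  using that q' unfolding cycles_prod boundaries_prod prod_map_def by blast
 ultimately show ?thesis unfolding quasi_iso_iff[OF PC PD] by blast
qed

text \<open>Take a nonzero \<open>u\<close> in the given submodule: either \<open>x u\<close> is a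
  nonzero cycle in it, or \<open>x u\<close> vanishes and \<open>u\<close> itself is a
  cycle.\<close>

lemma minimal_complex_smult:
 assumes C: "cochain_complex R C" and x: "x\<in>carrier R"
  and dx: "!!n u. u\<in>carrier (obj C n) ==> diff C n (x \<odot>\<^bsub>obj C n\<^esub> u) = \<zero>\<^bsub>obj C (n + 1)\<^esub>"
  and d0: "!!n u. u\<in>carrier (obj C n) ==> x \<odot>\<^bsub>obj C n\<^esub> u = \<zero>\<^bsub>obj C n\<^esub> ==> diff C n u = \<zero>\<^bsub>obj C (n + 1)\<^esub>"
 shows "minimal_complex R C" unfolding minimal_complex_def essential_submodule_def
proof (intro allI conjI impI)
 fix n
 show "submodule (cycles C n) R (obj C n)" by (rule cycles_submodule[OF C])
 fix U assume U: "submodule U R (obj C n) & U ~= {\<zero>\<^bsub>obj C n\<^esub>}"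
 note Um = submodule_mem[OF complexD(1)[OF C] conjunct1[OF U]]
 obtain u where u: "u\<in>U" "u ~= \<zero>\<^bsub>obj C n\<^esub>" using U Um(2) by blast
 have uc: "u\<in>carrier (obj C n)" using Um(1) u(1) by blast
 have "EX w:U \<inter> cycles C n. w ~= \<zero>\<^bsub>obj C n\<^esub>"
 proof (cases "x \<odot>\<^bsub>obj C n\<^esub> u = \<zero>\<^bsub>obj C n\<^esub>")
  case True
  then show ?thesis using u uc d0 by (auto simp: cycles_def)
 next
  case False
  then show ?thesis using Um(4)[OF x u(1)] Um(1) dx[OF uc] by (auto simp: cycles_def)
 qed
 then show "cycles C n \<inter> U ~= {\<zero>\<^bsub>obj C n\<^esub>}" by blast
qed

text \<open>The map from \<open>C\<close> to zero is a quasi-isomorphism, so every cycle of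
  \<open>Hom(C, C)\<close> is a boundary up to one that factors through zero. Applied to the
  identity this is a contraction. \<open>C\<close> is itself a test complex here, which fixes the
  test type.\<close>

lemma homotopically_injective_acyclic_contractible:
 fixes C :: "('a, 't) cochain"
 assumes R: "cring R" and C: "cochain_complex R C" and ac: "acyclic_complex C" and hi: "homotopically_injective TYPE('t) R C"
 shows "contractible_complex R C"
proof -
 \<comment> \<open>A zero complex made from the zeros of \<open>C\<close>, so that it lives in the
   same type as \<open>C\<close> and can serve as a test complex next to it.\<close>
 define Z :: "('a, 't) cochain" where "Z = \<lparr>obj = (%n. zero_module (obj C n)), diff = (%n y. \<zero>\<^bsub>obj C (n + 1)\<^esub>)\<rparr>"
 let ?f = "%n (y :: 't). \<zero>\<^bsub>obj C n\<^esub>"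
 note CM = complexD(1)[OF C] and ZM = zero_module_module[OF complexD(1)[OF C]]
 have Zo: "obj Z n = zero_module (obj C n)" and Zd: "diff Z n y = \<zero>\<^bsub>obj C (n + 1)\<^esub>" for n y by (simp_all add: Z_def)
 have Z: "cochain_complex R Z"
 proof (rule complexI)
  show "diff Z n\<in>mod_hom R (obj Z n) (obj Z (n + 1))" for n using hom_zero_map[OF ZM[of "n + 1"]] by (simp add: Zo Z_def)
 qed (simp_all add: Zo Zd ZM)
 have cm: "chain_map R C Z ?f" unfolding chain_map_def
 proof (intro allI conjI ballI)
  show "(%y. \<zero>\<^bsub>obj C n\<^esub>)\<in>mod_hom R (obj C n) (obj Z n)" for n
   using hom_zero_map[OF ZM[of n], where M = "obj C n"] by (simp add: Zo)
 qed (simp add: Zd)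
 have "quasi_iso R C Z ?f" unfolding quasi_iso_iff[OF C Z]
 proof (intro conjI cm allI ballI impI)
  show "z\<in>boundaries C n" if "z\<in>cycles C n" for n z using ac that unfolding acyclic_complex_iff[OF C] by blast
  fix n w assume "w\<in>cycles Z n"
  then have w: "w = \<zero>\<^bsub>obj C n\<^esub>" by (simp add: cycles_def Zo)
  have "w \<ominus>\<^bsub>obj Z n\<^esub> \<zero>\<^bsub>obj C n\<^esub> = \<zero>\<^bsub>obj Z n\<^esub>" unfolding Zo w using minus_eq_zero_iff[OF ZM[of n], of "\<zero>\<^bsub>obj C n\<^esub>"] by simp
  then have "w \<ominus>\<^bsub>obj Z n\<^esub> \<zero>\<^bsub>obj C n\<^esub>\<in>boundaries Z n"
   using submodule_mem(2)[OF complexD(1)[OF Z] boundaries_submodule[OF Z]] by simp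
  then show "EX z:cycles C n. w \<ominus>\<^bsub>obj Z n\<^esub> \<zero>\<^bsub>obj C n\<^esub>\<in>boundaries Z n"
   using submodule_mem(2)[OF CM cycles_submodule[OF C]] by blast
 qed
 then have q: "quasi_iso R (hom_complex R Z C) (hom_complex R C C) (hom_precomp C ?f)" using hi C Z unfolding homotopically_injective_def by blast
 note H = complex_hom[OF R C C] and HZ = complex_hom[OF R Z C]
 let ?g = "%i. \<lambda>y\<in>carrier (obj C i). y"
 have s0: "obj (shift_complex 0 C) i = obj C i" "diff (shift_complex 0 C) i y = diff C i y" for i y by (simp_all add: signed_def)
 have g: "?g\<in>carrier (obj (hom_complex R C C) 0)" unfolding hom_complex_carrier using hom_restrict[OF CM hom_id] by simp
 have "chain_map R C (shift_complex 0 C) ?g" unfolding chain_map_def s0 using g hom_closed[OF complexD(2)[OF C]] unfolding hom_complex_carrier by simp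
 then have "?g\<in>cycles (hom_complex R C C) 0" unfolding hom_cycles_iff[OF R C C g] .
 then obtain u where u: "u\<in>cycles (hom_complex R Z C) 0"
  "?g \<ominus>\<^bsub>obj (hom_complex R C C) 0\<^esub> hom_precomp C ?f 0 u\<in>boundaries (hom_complex R C C) 0"
  using q unfolding quasi_iso_iff[OF HZ H] by blast
 have "u i \<zero>\<^bsub>obj C i\<^esub> = \<zero>\<^bsub>obj C i\<^esub>" for i
 proof -
  have "u\<in>carrier (obj (hom_complex R Z C) 0)" using u(1) by (simp only: cycles_def mem_Collect_eq)
  then have "u i\<in>mod_hom R (obj Z i) (obj C i)" unfolding hom_complex_carrier by simp
  from hom_zero[OF complexD(1)[OF Z] CM this] show ?thesis by (simp add: Zo)
 qed
 then have "hom_precomp C ?f 0 u = \<zero>\<^bsub>obj (hom_complex R C C) 0\<^esub>" by (simp add: hom_precomp_def)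
 moreover interpret Hm: module R "obj (hom_complex R C C) 0" by (rule complexD(1)[OF H])
 have "?g \<ominus>\<^bsub>obj (hom_complex R C C) 0\<^esub> \<zero>\<^bsub>obj (hom_complex R C C) 0\<^esub> = ?g"
  unfolding a_minus_def module_neg_zero[OF Hm.module_axioms] by (rule Hm.M.r_zero[OF g])
 ultimately have "?g\<in>boundaries (hom_complex R C C) 0" using u(2) by simp
 then obtain h where h: "!!i. h i\<in>mod_hom R (obj C i) (obj (shift_complex 0 C) (i - 1))"
  "!!i y. y\<in>carrier (obj C i) ==> ?g i y = diff (shift_complex 0 C) (i - 1) (h i y) \<oplus>\<^bsub>obj (shift_complex 0 C) i\<^esub> h (i + 1) (diff C i y)"
  by (rule hom_boundariesD[OF R C C]) blast
 show ?thesis unfolding contractible_complex_def by (intro exI[of _ h] conjI allI ballI) (use h in "simp_all only: s0 restrict_apply if_True")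
qed

section \<open>The complex with multiplication by \<open>x\<close>\<close>

text \<open>\<open>q\<close> witnesses that \<open>nn\<close> is not minimal.\<close>

locale mult_complex_at = injective_hull_at R nn E e0
 for R :: "('a, 'r) ring_scheme" and nn and E :: "('a, 'e) module" and e0 +
 fixes x q
 assumes x: "x\<in>carrier R" and ann_x: "{r\<in>carrier R. r \<otimes>\<^sub>R x = \<zero>\<^sub>R} = PIdl\<^bsub>R\<^esub> x"
  and q: "primeideal q R" "q <= nn" "q ~= nn"
begin

abbreviation J where "J \<equiv> mult_complex x E"
abbreviation M where "M \<equiv> E\<lparr>carrier := {e\<in>carrier E. x \<odot>\<^sub>E e = \<zero>\<^sub>E}\<rparr>"
abbreviation X where "X \<equiv> prod_complex (%i. shift_complex i (stalk_complex M))"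
abbreviation I where "I \<equiv> prod_complex (%i. shift_complex i J)"

lemma xx: "x \<otimes>\<^sub>R x = \<zero>\<^sub>R"
 using R.cgenideal_self[OF x] unfolding ann_x[symmetric] by simp

lemma x_in_prime:
 assumes "primeideal p R" shows "x\<in>p"
 using primeideal.I_prime[OF assms x x] additive_subgroup.zero_closed[OF ideal.axioms(1)[OF primeideal.axioms(1)[OF assms]]] xx by auto

lemma xxe: "e\<in>carrier E ==> x \<odot>\<^sub>E (x \<odot>\<^sub>E e) = \<zero>\<^sub>E"
 using x by (simp flip: E.smult_assoc1 add: xx)

lemma J_simps [simp]: "smult (obj J n) = smult E" "\<zero>\<^bsub>obj J n\<^esub> = \<zero>\<^sub>E" "add (obj J n) = add E"
 "carrier (obj J n) = (if n < 0 then {\<zero>\<^sub>E} else carrier E)"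
 "diff J n e = (if n < 0 then \<zero>\<^sub>E else x \<odot>\<^sub>E e)" by (simp_all add: mult_complex_def)

lemma J_module: "module R (obj J n)"
 using zero_module_module[OF E_module] E_module by (simp add: mult_complex_def)

lemma J_complex: "cochain_complex R J"
proof (rule complexI[OF J_module])
 show "diff J n\<in>mod_hom R (obj J n) (obj J (n + 1))" for n
  by (rule mod_homI) (use x in "auto simp: E.smult_r_distr simp flip: E.smult_assoc1 simp: R.m_comm")
qed (use x in "auto simp: xxe")

lemma J_baer: "baer_module R (obj J n)"
 using baer baer_trivial_module[OF zero_module_module[OF E_module]] by (simp add: mult_complex_def)

text \<open>If \<open>x z = 0\<close> and \<open>r x = 0\<close>, then \<open>r\<close> is a
  multiple of \<open>x\<close>, so \<open>r z = 0\<close>; thus \<open>z\<close> can be divided by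
  \<open>x\<close> in \<open>E\<close>. This is where the annihilator of \<open>x\<close> has to be
  no larger than \<open>(x)\<close>.\<close>

lemma J_cycles: "n ~= 0 ==> z\<in>cycles J n ==> z\<in>boundaries J n" "cycles J 0 = carrier M" "boundaries J 0 = {\<zero>\<^sub>E}"
proof -
 show "cycles J 0 = carrier M" "boundaries J 0 = {\<zero>\<^sub>E}" by (auto simp: cycles_def boundaries_def)
 assume n: "n ~= 0" and z: "z\<in>cycles J n"
 show "z\<in>boundaries J n"
 proof (cases "n < 0")
  case True
  then have "z = \<zero>\<^bsub>obj J n\<^esub>" using z by (simp add: cycles_def)
  then show ?thesis using submodule_mem(2)[OF J_module boundaries_submodule[OF J_complex]] by simp
 next
  case False
  then have zE: "z\<in>carrier E" "x \<odot>\<^sub>E z = \<zero>\<^sub>E" using z by (auto simp: cycles_def)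
  have rz: "r \<odot>\<^sub>E z = \<zero>\<^sub>E" if "r\<in>carrier R" "r \<otimes>\<^sub>R x\<in>{\<zero>\<^sub>R}" for r
  proof -
   have "r\<in>PIdl\<^bsub>R\<^esub> x" unfolding ann_x[symmetric] using that by simp
   then obtain a where "a\<in>carrier R" "r = a \<otimes>\<^sub>R x" by (auto simp: cgenideal_def)
   then show ?thesis using zE x by (simp add: E.smult_assoc1)
  qed
  obtain e where "e\<in>carrier E" "x \<odot>\<^sub>E e = z" by (rule baer_lift[OF baer R.zeroideal x zE(1)]) (use rz in auto)
  then show ?thesis unfolding boundaries_def using n False by (intro image_eqI[of _ _ e]) auto
 qed
qed

lemma M_module: "module R M"
 using killed_module[of "{x}"] x by simp

lemma inclusion_quasi_iso: "quasi_iso R (stalk_complex M) J (%n e. e)"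
 unfolding quasi_iso_iff[OF complex_stalk[OF M_module] J_complex]
proof (intro conjI allI ballI impI)
 show "chain_map R (stalk_complex M) J (%n e. e)" unfolding chain_map_def
 proof (intro allI conjI ballI)
  fix n
  show "(%e. e)\<in>mod_hom R (obj (stalk_complex M) n) (obj J n)" by (rule mod_homI) (auto simp: stalk_simps split: if_splits)
  show "diff (stalk_complex M) n y = diff J n y" if "y\<in>carrier (obj (stalk_complex M) n)" for y
   using that x by (auto simp: stalk_simps split: if_splits)
 qed
 show "z\<in>boundaries (stalk_complex M) n" if "z\<in>cycles (stalk_complex M) n" "z\<in>boundaries J n" for n z
  using that unfolding stalk_cycles[OF M_module] stalk_boundaries[OF M_module] by (cases "n = 0") (auto simp: stalk_simps J_cycles(3))
 fix n w assume w: "w\<in>cycles J n"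
 have wc: "w\<in>carrier (obj J n)" using w unfolding cycles_def by blast
 show "EX z:cycles (stalk_complex M) n. w \<ominus>\<^bsub>obj J n\<^esub> z\<in>boundaries J n"
 proof (cases "n = 0")
  case True
  have "w \<ominus>\<^bsub>obj J n\<^esub> w = \<zero>\<^bsub>obj J n\<^esub>" using minus_eq_zero_iff[OF J_module wc wc] by simp
  then have "w \<ominus>\<^bsub>obj J n\<^esub> w\<in>boundaries J n" using submodule_mem(2)[OF J_module boundaries_submodule[OF J_complex]] by simp
  moreover have "w\<in>cycles (stalk_complex M) n" using w J_cycles(2) by (simp add: True stalk_cycles[OF M_module] stalk_simps)
  ultimately show ?thesis by blast
 next
  case False
  interpret Jn: module R "obj J n" by (rule J_module)
  have "w \<ominus>\<^bsub>obj J n\<^esub> \<zero>\<^bsub>obj J n\<^esub> = w" unfolding a_minus_def module_neg_zero[OF J_module] by (rule Jn.M.r_zero[OF wc])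
  then have "w \<ominus>\<^bsub>obj J n\<^esub> \<zero>\<^bsub>obj J n\<^esub>\<in>boundaries J n" using J_cycles(1)[OF False w] by simp
  moreover have "\<zero>\<^bsub>obj J n\<^esub>\<in>cycles (stalk_complex M) n" using False by (simp add: stalk_cycles[OF M_module] stalk_simps)
  ultimately show ?thesis by blast
 qed
qed

lemma J_minimal: "minimal_complex R J"
 by (rule minimal_complex_smult[OF J_complex x]) (auto simp: xxe split: if_splits)

lemma resolution: "minimal_injective_resolution TYPE('t) R M J (%n e. e)"
 unfolding minimal_injective_resolution_def by (intro conjI allI impI J_complex baer_criterion[OF J_baer] inclusion_quasi_iso J_minimal) simp

text \<open>The constraint singles out the infinitely many coordinates that carry \<open>E\<close>
  in degree \<open>n\<close>; the construction of further associated primes uses one of them for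
  every power of \<open>t\<close>.\<close>

lemma I_simps:
 "u\<in>carrier (obj I n) \<longleftrightarrow> (ALL i. u i\<in>carrier E & (n + i < 0 --> u i = \<zero>\<^sub>E))"
 "\<zero>\<^bsub>obj I n\<^esub> = (%i. \<zero>\<^sub>E)" "r \<odot>\<^bsub>obj I n\<^esub> u = (%i. r \<odot>\<^sub>E u i)"
proof -
 have "e\<in>carrier (obj J k) \<longleftrightarrow> e\<in>carrier E & (k < 0 --> e = \<zero>\<^sub>E)" for e k by auto
 then show "u\<in>carrier (obj I n) \<longleftrightarrow> (ALL i. u i\<in>carrier E & (n + i < 0 --> u i = \<zero>\<^sub>E))"
  by (simp only: prod_simps prod_module_simps mem_Collect_eq shift_simps)
qed simp_all

lemma I_complex: "cochain_complex R I"
 by (rule complex_prod[OF R.is_cring complex_shift[OF J_complex]])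

lemma I_module: "module R (obj I n)" by (rule complexD(1)[OF I_complex])

lemma I_baer: "baer_module R (obj I n)"
 unfolding prod_simps by (rule baer_prod_module[OF R.is_cring]) (simp only: shift_simps J_baer)

lemma I_diff_zero:
 assumes "!!i. x \<odot>\<^sub>E u i = \<zero>\<^sub>E" shows "diff I n u = \<zero>\<^bsub>obj I (n + 1)\<^esub>"
proof
 fix i
 have "signed (obj J (n + i + 1)) i (diff J (n + i) (u i)) = \<zero>\<^bsub>obj J (n + i + 1)\<^esub>"
  using signed_zero[OF J_module, of "n + i + 1" i] assms by simp
 then show "diff I n u i = \<zero>\<^bsub>obj I (n + 1)\<^esub> i" by simp
qed

lemma I_minimal: "minimal_complex R I"
proof (rule minimal_complex_smult[OF I_complex x])
 show "diff I n (x \<odot>\<^bsub>obj I n\<^esub> u) = \<zero>\<^bsub>obj I (n + 1)\<^esub>" if "u\<in>carrier (obj I n)" for n u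
  by (rule I_diff_zero) (use that xxe in "simp only: I_simps")
 show "diff I n u = \<zero>\<^bsub>obj I (n + 1)\<^esub>" if "x \<odot>\<^bsub>obj I n\<^esub> u = \<zero>\<^bsub>obj I n\<^esub>" for n u
  by (rule I_diff_zero) (use that in "simp only: I_simps fun_eq_iff")
qed

text \<open>In coordinates every shift of \<open>I\<close> is a family of shifts of
  \<open>J\<close>, each bounded below by its own bound. The second condition concerns an extra
  shift by one, as required by \<open>homotopically_injectiveI\<close>.\<close>

lemma I_semi_injective: "semi_injective TYPE('t) TYPE('u) R I"
proof -
 let ?B = "%n k. shift_complex n (shift_complex k J)"
 have B: "cochain_complex R (?B n k)" for n k by (intro complex_shift J_complex)
 have c: "coordinates (shift_complex n I) (?B n)" for n by (rule coordinates_shift[OF R.is_cring complex_shift[OF J_complex] coordinates_prod])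
 have "null_homotopic_maps TYPE('u \<times> 'u) R (shift_complex n I)" for n
 proof (rule null_homotopic_maps_coordinates[OF R.is_cring B c])
  show "injective_module TYPE('u \<times> 'u) R (obj (?B n k) i)" for k i unfolding shift_simps by (rule baer_criterion[OF J_baer])
  \<comment> \<open>In degree \<open>i\<close> this factor is \<open>J\<close> in degree
    \<open>i + n + k\<close>, which vanishes when that sum is negative.\<close>
  show "EX N. ALL i<N. carrier (obj (?B n k) i) = {\<zero>\<^bsub>obj (?B n k) i\<^esub>}" for k by (rule exI[of _ "- n - k"]) simp
 qed
 moreover have "null_homotopic_maps TYPE('u \<times> 'u) R (shift_complex 1 (shift_complex n I))" for n
 proof (rule null_homotopic_maps_coordinates[OF R.is_cring complex_shift[OF B] coordinates_shift[OF R.is_cring B c]])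
  show "injective_module TYPE('u \<times> 'u) R (obj (shift_complex 1 (?B n k)) i)" for k i unfolding shift_simps by (rule baer_criterion[OF J_baer])
  show "EX N. ALL i<N. carrier (obj (shift_complex 1 (?B n k)) i) = {\<zero>\<^bsub>obj (shift_complex 1 (?B n k)) i\<^esub>}" for k
   by (rule exI[of _ "- n - k - 1"]) simp
 qed
 ultimately have "homotopically_injective TYPE('u) R I" by (rule homotopically_injectiveI[OF R.is_cring I_complex])
 then show ?thesis unfolding semi_injective_def using I_complex baer_criterion[OF I_baer] by blast
qed

lemma X_quasi_iso: "quasi_iso R X I (prod_map (%i. shift_map i (%n e. e)))"
 by (rule quasi_iso_prod[OF R.is_cring complex_shift[OF complex_stalk[OF M_module]]
    complex_shift[OF J_complex] quasi_iso_shift[OF complex_stalk[OF M_module] J_complex inclusion_quasi_iso]])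

text \<open>In degree \<open>n\<close> only the factor with \<open>i = - n\<close> is nonzero, so
  \<open>obj X n\<close> and \<open>M\<close> are isomorphic; being of different types they are
  compared through retractions in both directions.\<close>

lemma X_tensor_exact_iff:
 assumes F: "cochain_complex R F"
 shows "(ALL n. tensor_exact R (obj X n) F) \<longleftrightarrow> tensor_exact R M F"
proof -
 have Xm: "module R (obj X n)" for n by (rule complexD(1)[OF complex_prod[OF R.is_cring complex_shift[OF complex_stalk[OF M_module]]]])
 have c: "e\<in>carrier (obj (stalk_complex M) (n + i)) \<longleftrightarrow> (if i = - n then e\<in>carrier M else e = \<zero>\<^sub>E)" for e n i
 proof -
  have "n + i = 0 \<longleftrightarrow> i = - n" by auto
  then show ?thesis by (simp add: stalk_simps)
 qed
 have Xc: "u\<in>carrier (obj X n) \<longleftrightarrow> u (- n)\<in>carrier M & (ALL i. i ~= - n --> u i = \<zero>\<^sub>E)" for u n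
  unfolding prod_simps prod_module_simps mem_Collect_eq shift_simps c if_bool_eq_conj all_conj_distrib simp_thms ..
 have Xs: "add (obj X n) u v = (%i. u i \<oplus>\<^sub>E v i)" "r \<odot>\<^bsub>obj X n\<^esub> u = (%i. r \<odot>\<^sub>E u i)" for n u v r
 proof -
  have "add (obj (stalk_complex M) k) = add E" "smult (obj (stalk_complex M) k) = smult E" for k by (simp_all add: stalk_simps)
  then show "add (obj X n) u v = (%i. u i \<oplus>\<^sub>E v i)" "r \<odot>\<^bsub>obj X n\<^esub> u = (%i. r \<odot>\<^sub>E u i)"
   by (simp_all only: prod_simps prod_module_simps shift_simps)
 qed
 let ?g = "%n e i. if i = - n then e else \<zero>\<^sub>E"
 have f: "(%u. u (- n))\<in>mod_hom R (obj X n) M" for n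
 proof (rule mod_homI)
  show "u (- n)\<in>carrier M" if "u\<in>carrier (obj X n)" for u using that unfolding Xc by blast
 qed (unfold Xs, simp_all)
 have g: "?g n\<in>mod_hom R M (obj X n)" for n
 proof (rule mod_homI)
  show "?g n e\<in>carrier (obj X n)" if "e\<in>carrier M" for e using that unfolding Xc by simp
 qed (unfold Xs, auto simp: fun_eq_iff)
 have gf: "?g n (u (- n)) = u" if "u\<in>carrier (obj X n)" for n u using that unfolding Xc by (auto simp: fun_eq_iff)
 show ?thesis
 proof
  assume a: "ALL n. tensor_exact R (obj X n) F"
  show "tensor_exact R M F" by (rule tensor_exact_retract[OF F M_module Xm g f _ spec[OF a, of 0]]) simp
 next
  assume "tensor_exact R M F"
  then show "ALL n. tensor_exact R (obj X n) F" by (intro allI tensor_exact_retract[OF F Xm M_module f g] gf)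
 qed
qed

text \<open>The differential of \<open>X\<close> vanishes, so acyclicity of the derived tensor
  product is tested on the modules \<open>obj X n\<close>, hence on \<open>M = killed {x}\<close>;
  the set \<open>{x}\<close> lies in \<open>nn\<close> because \<open>x\<close> is
  nilpotent.\<close>

lemma supp_X: "supp R X = {nn}"
proof -
 have "acyclic_complex (derived_tensor R X (residue_module R p)) \<longleftrightarrow> p ~= nn" if p: "primeideal p R" for p
 proof -
  interpret L: localization_at R p by (rule localization_at.intro[OF R.is_cring p])
  let ?F = "free_resolution R (residue_module R p)"
  have "\<zero>\<^sub>R ~= \<one>\<^sub>R" using P.I_notcarr P.one_imp_carrier additive_subgroup.zero_closed[OF P.is_additive_subgroup] by metis
  then have F: "cochain_complex R ?F" using free_resolution_exists[OF R.is_cring L.residue_module_facts(1)] by (simp add: is_free_resolution_def)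
  have XC: "cochain_complex R X" by (rule complex_prod[OF R.is_cring complex_shift[OF complex_stalk[OF M_module]]])
  have zero: "diff X i y = \<zero>\<^bsub>obj X (i + 1)\<^esub>" for i y
  proof
   fix j
   show "diff X i y j = \<zero>\<^bsub>obj X (i + 1)\<^esub> j"
    using signed_zero[OF M_module, of j] signed_zero[OF zero_module_module[OF M_module], of j] by (simp add: stalk_simps)
  qed
  show ?thesis unfolding derived_tensor_def tensor_complex_acyclic_iff[OF R.is_cring XC F zero] X_tensor_exact_iff[OF F]
   using killed_tensor_exact_iff[OF _ p, of "{x}"] x_in_prime[OF P.primeideal] by simp
 qed
 then show ?thesis unfolding supp_def using P.primeideal by blast
qed

text \<open>Elements outside \<open>nn\<close> act injectively in each coordinate, so none of them
  annihilates a nonzero family; hence \<open>p\<close> lies inside \<open>nn\<close>.\<close>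

lemma ass_I:
 assumes "p\<in>ass R (obj I n)"
 obtains v where "primeideal p R" "p <= nn" "v\<in>carrier (obj I n)" "!!r. r\<in>carrier R ==> r\<in>p \<longleftrightarrow> (ALL i. r \<odot>\<^sub>E v i = \<zero>\<^sub>E)"
proof -
 obtain v where v: "primeideal p R" "v\<in>carrier (obj I n)" "p = annihilator R (obj I n) v" using assms unfolding ass_def by blast
 have mem: "r\<in>p \<longleftrightarrow> (ALL i. r \<odot>\<^sub>E v i = \<zero>\<^sub>E)" if "r\<in>carrier R" for r
  unfolding v(3) annihilator_def I_simps using that by (simp add: fun_eq_iff)
 have vE: "v i\<in>carrier E" for i using v(2) unfolding I_simps by blast
 have "p <= nn"
 proof (rule subsetI, rule ccontr)
  fix s assume s: "s\<in>p" "s ~: nn"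
  have sR: "s\<in>carrier R" using s(1) unfolding v(3) annihilator_def by blast
  have "v i = \<zero>\<^sub>E" for i using unit_smult_zero[OF _ vE, of s i] s sR mem[OF sR] by blast
  then have "\<one>\<^sub>R\<in>p" using mem[OF R.one_closed] by simp
  then show False using ideal.one_imp_carrier[OF primeideal.axioms(1)[OF v(1)]] primeideal.I_notcarr[OF v(1)] by simp
 qed
 then show thesis using that v(1,2) mem by blast
qed

lemma nn_in_ass: "nn\<in>ass R (obj I n)"
proof -
 let ?u = "%i. if n + i < 0 then \<zero>\<^sub>E else e0"
 have "nn = annihilator R (obj I n) ?u"
 proof
  show "nn <= annihilator R (obj I n) ?u" using P.Icarr ann_e0 by (auto simp only: annihilator_def I_simps fun_eq_iff) (auto simp: P.Icarr)
  show "annihilator R (obj I n) ?u <= nn"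
  proof
   fix r assume "r\<in>annihilator R (obj I n) ?u"
   then have r: "r\<in>carrier R" "(%i. r \<odot>\<^sub>E ?u i) = (%i. \<zero>\<^sub>E)" unfolding annihilator_def I_simps by blast+
   from r(2) have "r \<odot>\<^sub>E ?u (- n) = \<zero>\<^sub>E" by (rule fun_cong)
   then show "r\<in>nn" using ann_e0 r(1) by simp
  qed
 qed
 moreover have "?u\<in>carrier (obj I n)" unfolding I_simps using e0 by simp
 ultimately show ?thesis unfolding ass_def using P.primeideal by blast
qed

text \<open>For \<open>t\<in>nn\<close> outside \<open>q\<close>, no power of \<open>t\<close> kills \<open>E\<close>, hence some family is not killed by any
 power of \<open>t\<close>.  A maximal annihilator of such families is an associated prime without \<open>t\<close>.\<close>

lemma other_ass: "EX p:ass R (obj I n). p ~= nn"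
proof -
 interpret q: primeideal q R by (rule q(1))
 interpret I: module R "obj I n" by (rule I_module)
 obtain t where t: "t\<in>nn" "t ~: q" using q(2,3) by blast
 have tR: "t\<in>carrier R" by (rule P.Icarr[OF t(1)])
 have tk: "t [^]\<^bsub>R\<^esub> k\<in>carrier R" for k :: nat using tR by simp
 have tq: "t [^]\<^bsub>R\<^esub> k ~: q" for k :: nat
 proof (induction k)
  case 0
  show ?case using q.I_notcarr q.one_imp_carrier by auto
 next
  case (Suc k)
  then show ?case using q.I_prime[OF tk[of k] tR] t(2) by auto
 qed
 \<comment> \<open>Since no power of \<open>t\<close> lies in \<open>q\<close>,
   \<open>r t^k = 0\<close> puts \<open>r\<close> into \<open>q\<close> and so into
   \<open>nn\<close>, whence \<open>r\<close> kills \<open>e0\<close>. Therefore \<open>e0\<close>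
   can be divided by \<open>t^k\<close>.\<close>
 have "EX e:carrier E. (t [^]\<^bsub>R\<^esub> k) \<odot>\<^sub>E e ~= \<zero>\<^sub>E" for k :: nat
 proof -
  have z: "r \<odot>\<^sub>E e0 = \<zero>\<^sub>E" if r: "r\<in>carrier R" "r \<otimes>\<^sub>R t [^]\<^bsub>R\<^esub> k\<in>{\<zero>\<^sub>R}" for r
  proof -
   have "r\<in>q" using q.I_prime[OF r(1) tk[of k]] tq[of k] r(2) additive_subgroup.zero_closed[OF q.is_additive_subgroup] by auto
   then show ?thesis using ann_e0[OF r(1)] q(2) by blast
  qed
  obtain e where "e\<in>carrier E" "(t [^]\<^bsub>R\<^esub> k) \<odot>\<^sub>E e = e0"
   by (rule baer_lift[OF baer R.zeroideal tk[of k] e0]) (use z in auto)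
  then show ?thesis using e0_nonzero by metis
 qed
 then obtain e where e: "!!k :: nat. e k\<in>carrier E" "!!k :: nat. (t [^]\<^bsub>R\<^esub> k) \<odot>\<^sub>E e k ~= \<zero>\<^sub>E" by metis
 define good where "good v \<longleftrightarrow> v\<in>carrier (obj I n) & (ALL k :: nat. (t [^]\<^bsub>R\<^esub> k) \<odot>\<^bsub>obj I n\<^esub> v ~= \<zero>\<^bsub>obj I n\<^esub>)" for v
 \<comment> \<open>Coordinate \<open>i\<close> holds \<open>e (n + i)\<close>, so that every
   \<open>e k\<close> occurs, namely at \<open>i = k - n\<close>, and no power of \<open>t\<close>
   kills the family.\<close>
 let ?u = "%i. if n + i < 0 then \<zero>\<^sub>E else e (nat (n + i))"
 have "(t [^]\<^bsub>R\<^esub> k) \<odot>\<^bsub>obj I n\<^esub> ?u ~= \<zero>\<^bsub>obj I n\<^esub>" for k :: nat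
 proof
  assume "(t [^]\<^bsub>R\<^esub> k) \<odot>\<^bsub>obj I n\<^esub> ?u = \<zero>\<^bsub>obj I n\<^esub>"
  then have "(t [^]\<^bsub>R\<^esub> k) \<odot>\<^sub>E ?u (int k - n) = \<zero>\<^sub>E" unfolding I_simps by (rule fun_cong)
  then show False using e(2)[of k] by simp
 qed
 moreover have "?u\<in>carrier (obj I n)" unfolding I_simps using e(1) by simp
 ultimately have u: "good ?u" unfolding good_def by blast
 let ?A = "annihilator R (obj I n)"
 have ne: "?A ` {v. good v} ~= {}" using u by blast
 have id: "ideal K R" if "K\<in>?A ` {v. good v}" for K using that annihilator_ideal[OF I_module] unfolding good_def by blast
 obtain p where p: "p\<in>?A ` {v. good v}" "!!K. K\<in>?A ` {v. good v} ==> p <= K ==> K = p"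
  by (rule noetherian_maximal[OF noeth ne id]) (assumption, blast)
 then obtain v where v: "good v" "p = ?A v" by blast
 have vc: "v\<in>carrier (obj I n)" and vt: "(t [^]\<^bsub>R\<^esub> k) \<odot>\<^bsub>obj I n\<^esub> v ~= \<zero>\<^bsub>obj I n\<^esub>" for k :: nat using v(1) unfolding good_def by blast+
 have comm: "r \<odot>\<^bsub>obj I n\<^esub> (s \<odot>\<^bsub>obj I n\<^esub> w) = s \<odot>\<^bsub>obj I n\<^esub> (r \<odot>\<^bsub>obj I n\<^esub> w)" if "r\<in>carrier R" "s\<in>carrier R" "w\<in>carrier (obj I n)" for r s w
  using I.smult_assoc1[OF that] I.smult_assoc1[OF that(2,1,3)] R.m_comm[OF that(1,2)] by simp
 have sub: "p <= ?A (r \<odot>\<^bsub>obj I n\<^esub> v)" if r: "r\<in>carrier R" for r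
 proof
  fix a assume "a\<in>p"
  then have a: "a\<in>carrier R" "a \<odot>\<^bsub>obj I n\<^esub> v = \<zero>\<^bsub>obj I n\<^esub>" unfolding v(2) annihilator_def by blast+
  have "a \<odot>\<^bsub>obj I n\<^esub> (r \<odot>\<^bsub>obj I n\<^esub> v) = \<zero>\<^bsub>obj I n\<^esub>" unfolding comm[OF a(1) r vc] a(2) by (rule I.smult_r_null[OF r])
  then show "a\<in>?A (r \<odot>\<^bsub>obj I n\<^esub> v)" unfolding annihilator_def using a(1) by blast
 qed
 have "primeideal p R"
 proof (rule primeidealI)
  show "ideal p R" unfolding v(2) by (rule annihilator_ideal[OF I_module vc])
  show "cring R" by (rule R.is_cring)
  show "carrier R ~= p"
  proof
   assume "carrier R = p"
   then have "\<one>\<^sub>R \<odot>\<^bsub>obj I n\<^esub> v = \<zero>\<^bsub>obj I n\<^esub>" using R.one_closed unfolding v(2) annihilator_def by blast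
   then show False using vt[of 0] unfolding R.nat_pow_0 by blast
  qed
  fix a b assume ab: "a\<in>carrier R" "b\<in>carrier R" "a \<otimes>\<^sub>R b\<in>p"
  show "a\<in>p \<or> b\<in>p"
  \<comment> \<open>If \<open>b v\<close> is still good, maximality makes its annihilator
    \<open>p\<close>, and \<open>a\<close> belongs to it. If not, \<open>b\<close> kills some
    \<open>t^k v\<close>, which is good and so has annihilator \<open>p\<close> too.\<close>
  proof (cases "good (b \<odot>\<^bsub>obj I n\<^esub> v)")
   case True
   then have "?A (b \<odot>\<^bsub>obj I n\<^esub> v) = p" using p(2) sub[OF ab(2)] by blast
   moreover have "a \<odot>\<^bsub>obj I n\<^esub> (b \<odot>\<^bsub>obj I n\<^esub> v) = \<zero>\<^bsub>obj I n\<^esub>"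
    using ab(3) I.smult_assoc1[OF ab(1,2) vc] unfolding v(2) annihilator_def by simp
   ultimately have "a\<in>p" using ab(1) unfolding annihilator_def by blast
   then show ?thesis ..
  next
   case False
   then obtain k :: nat where k: "(t [^]\<^bsub>R\<^esub> k) \<odot>\<^bsub>obj I n\<^esub> (b \<odot>\<^bsub>obj I n\<^esub> v) = \<zero>\<^bsub>obj I n\<^esub>"
    unfolding good_def using I.smult_closed[OF ab(2) vc] by blast
   let ?w = "(t [^]\<^bsub>R\<^esub> k) \<odot>\<^bsub>obj I n\<^esub> v"
   have "(t [^]\<^bsub>R\<^esub> l) \<odot>\<^bsub>obj I n\<^esub> ?w = (t [^]\<^bsub>R\<^esub> (l + k)) \<odot>\<^bsub>obj I n\<^esub> v" for l :: nat
    using I.smult_assoc1[OF tk tk vc, of l k] R.nat_pow_mult[OF tR, of l k] by simp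
   then have "good ?w" unfolding good_def using vt I.smult_closed[OF tk vc] by metis
   then have "?A ?w = p" using p(2) sub[OF tk] by blast
   moreover have "b \<odot>\<^bsub>obj I n\<^esub> ?w = \<zero>\<^bsub>obj I n\<^esub>" using k comm[OF ab(2) tk vc] by simp
   ultimately have "b\<in>p" using ab(2) unfolding annihilator_def by blast
   then show ?thesis ..
  qed
 qed
 moreover have "t ~: p" using vt[of 1] tR unfolding v(2) annihilator_def by simp
 ultimately show ?thesis using v(2) vc t(1) unfolding ass_def by blast
qed

section \<open>Localization of \<open>I\<close> at an associated prime other than
  \<open>nn\<close>\<close>

context
 fixes p n
 assumes p: "p\<in>ass R (obj I n)" "p ~= nn"
begin

private lemma prime: "primeideal p R" by (rule ass_I[OF p(1)])

interpretation L: localization_at R p by (rule localization_at.intro[OF R.is_cring prime])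

private abbreviation "LI \<equiv> loc_complex R p I"

lemma loc_I_complex: "cochain_complex (loc_ring R p) LI"
 by (rule L.loc_complex_complex[OF I_complex])

lemma loc_I_injective: "injective_module TYPE('v) (loc_ring R p) (obj LI k)"
 unfolding L.loc_simps by (rule baer_criterion[OF L.loc_module_baer[OF noeth I_baer]])

text \<open>A cycle of degree \<open>k\<close> is a boundary in every coordinate except
  \<open>- k\<close>. There it lies in \<open>E\<close>, and a power of some \<open>t\<close> in
  \<open>nn\<close> outside \<open>p\<close> kills it; that power is a unit of the local
  ring.\<close>

lemma loc_I_acyclic: "acyclic_complex LI"
proof (rule L.loc_complex_acyclic[OF I_complex])
 fix k z assume z: "z\<in>cycles I k"
 have "p <= nn" by (rule ass_I[OF p(1)])
 then obtain t where t: "t\<in>nn" "t ~: p" using p(2) by blast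
 have tR: "t\<in>carrier R" by (rule P.Icarr[OF t(1)])
 have tS: "t [^]\<^bsub>R\<^esub> l\<in>carrier R - p" for l :: nat by (induction l) (use L.S_one L.S_mult t(2) tR in simp_all)
 have zi: "z i\<in>cycles J (k + i)" for i using z unfolding cycles_prod cycles_shift[OF J_complex] by blast
 have "z (- k)\<in>cycles J 0" using zi[of "- k"] by simp
 then have "z (- k)\<in>carrier E" unfolding J_cycles(2) by simp
 then obtain l :: nat where l: "(t [^]\<^bsub>R\<^esub> l) \<odot>\<^sub>E z (- k) = \<zero>\<^sub>E" using torsion[OF t(1)] by blast
 have "(t [^]\<^bsub>R\<^esub> l) \<odot>\<^sub>E z i\<in>boundaries J (k + i)" for i
 proof (cases "i = - k")
  case True
  then show ?thesis using l J_cycles(3) by simp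
 next
  case False
  then have "z i\<in>boundaries J (k + i)" using J_cycles(1)[OF _ zi] by simp
  then show ?thesis using submodule_mem(4)[OF J_module boundaries_submodule[OF J_complex], of "t [^]\<^bsub>R\<^esub> l" "z i" "k + i"] tS by simp
 qed
 then have "(t [^]\<^bsub>R\<^esub> l) \<odot>\<^bsub>obj I k\<^esub> z\<in>boundaries I k"
  unfolding I_simps boundaries_prod boundaries_shift[OF J_complex] by blast
 then show "EX u:carrier R - p. u \<odot>\<^bsub>obj I k\<^esub> z\<in>boundaries I k" using tS by blast
qed

text \<open>An element \<open>v\<close> with annihilator \<open>p\<close> is a cycle because \<open>x\<in>p\<close>.  A contraction would make it the
 boundary of an element that is also killed by \<open>x\<close>, hence of a cycle.\<close>

lemma loc_I_not_contractible: "\<not> contractible_complex (loc_ring R p) LI"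
proof
 assume "contractible_complex (loc_ring R p) LI"
 then obtain s where s': "ALL k. s k\<in>mod_hom (loc_ring R p) (obj LI k) (obj LI (k - 1))"
  "ALL k. ALL y:carrier (obj LI k). diff LI (k - 1) (s k y) \<oplus>\<^bsub>obj LI k\<^esub> s (k + 1) (diff LI k y) = y"
  unfolding contractible_complex_def by (elim exE conjE) (rule that)
 note s = s'(1)[rule_format] s'(2)[rule_format]
 obtain v where v: "v\<in>carrier (obj I n)" "!!r. r\<in>carrier R ==> r\<in>p \<longleftrightarrow> (ALL i. r \<odot>\<^sub>E v i = \<zero>\<^sub>E)"
  by (rule ass_I[OF p(1)]) (rule that)
 have xv: "x \<odot>\<^sub>E v i = \<zero>\<^sub>E" for i using v(2)[OF x] x_in_prime[OF prime] by blast
 note LM = complexD(1)[OF loc_I_complex]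
 let ?V = "frac R p (obj I n) v \<one>\<^sub>R"
 have Vc: "?V\<in>carrier (obj LI n)" unfolding L.loc_simps by (rule L.frac_closed[OF v(1) L.S_one])
 have zero: "frac R p (obj I k) \<zero>\<^bsub>obj I k\<^esub> t = \<zero>\<^bsub>obj LI k\<^esub>" if "t\<in>carrier R - p" for k t
  unfolding L.loc_simps by (rule L.loc_module_zero[OF I_module that, symmetric])
 interpret In: module R "obj I (n - 1)" by (rule I_module)
 interpret LI: module "loc_ring R p" "obj LI n" by (rule LM)
 have "diff LI n ?V = \<zero>\<^bsub>obj LI (n + 1)\<^esub>"
  unfolding L.loc_complex_diff_frac[OF I_complex v(1) L.S_one] I_diff_zero[OF xv] by (rule zero[OF L.S_one])
 moreover have "s (n + 1) \<zero>\<^bsub>obj LI (n + 1)\<^esub> = \<zero>\<^bsub>obj LI n\<^esub>" using hom_zero[OF LM LM s(1)[of "n + 1"]] by simp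
 moreover have wc: "s n ?V\<in>carrier (obj LI (n - 1))" by (rule hom_closed[OF s(1) Vc])
 ultimately have V: "diff LI (n - 1) (s n ?V) = ?V" using s(2)[OF Vc] LI.M.r_zero[OF hom_closed[OF complexD(3)[OF loc_I_complex] wc]] by simp
 obtain m t where mt: "m\<in>carrier (obj I (n - 1))" "t\<in>carrier R - p" "s n ?V = frac R p (obj I (n - 1)) m t"
  using wc unfolding L.loc_simps L.loc_carrier by blast
 have xL: "loc_map R p x\<in>carrier (loc_ring R p)" by (rule L.loc_map_hom(1)[OF x])
 have "x \<odot>\<^bsub>obj I n\<^esub> v = \<zero>\<^bsub>obj I n\<^esub>" unfolding I_simps using xv by blast
 then have "loc_map R p x \<odot>\<^bsub>obj LI n\<^esub> ?V = \<zero>\<^bsub>obj LI n\<^esub>"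
  unfolding loc_map_def L.loc_simps L.frac_scale[OF I_module x v(1) L.S_one] using zero[OF L.S_one, of n] by (simp only: L.loc_simps)
 then have "loc_map R p x \<odot>\<^bsub>obj LI (n - 1)\<^esub> s n ?V = \<zero>\<^bsub>obj LI (n - 1)\<^esub>"
  using hom_smult[OF s(1) xL Vc] hom_zero[OF LM LM s(1)[of n]] by simp
 then have "frac R p (obj I (n - 1)) (x \<odot>\<^bsub>obj I (n - 1)\<^esub> m) t = \<zero>\<^bsub>L.LM (obj I (n - 1))\<^esub>"
  unfolding mt(3) loc_map_def L.loc_simps L.frac_scale[OF I_module x mt(1,2)] .
 \<comment> \<open>In \<open>I\<close> itself the equation \<open>x m = 0\<close> is available only
   after multiplication by some \<open>u\<close> outside \<open>p\<close>; then \<open>u m\<close>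
   is a cycle, which makes the differential of \<open>m\<close> vanish in the localization.\<close>
 then obtain u where u: "u\<in>carrier R - p" "u \<odot>\<^bsub>obj I (n - 1)\<^esub> (x \<odot>\<^bsub>obj I (n - 1)\<^esub> m) = \<zero>\<^bsub>obj I (n - 1)\<^esub>"
  using L.frac_eq_zero_iff[OF I_module In.smult_closed[OF x mt(1)] mt(2)] by blast
 have uR: "u\<in>carrier R" using u(1) by blast
 have mE: "m i\<in>carrier E" for i using mt(1) unfolding I_simps by blast
 have "x \<odot>\<^sub>E (u \<odot>\<^bsub>obj I (n - 1)\<^esub> m) i = \<zero>\<^sub>E" for i
 proof -
  have "u \<odot>\<^sub>E (x \<odot>\<^sub>E m i) = \<zero>\<^sub>E" using fun_cong[OF u(2), of i] unfolding I_simps .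
  then show ?thesis unfolding I_simps smult_left_commute[OF E_module x uR mE] .
 qed
 then have "diff I (n - 1) (u \<odot>\<^bsub>obj I (n - 1)\<^esub> m) = \<zero>\<^bsub>obj I (n - 1 + 1)\<^esub>" by (rule I_diff_zero)
 then have "u \<odot>\<^bsub>obj I (n - 1 + 1)\<^esub> diff I (n - 1) m = \<zero>\<^bsub>obj I (n - 1 + 1)\<^esub>"
  unfolding hom_smult[OF complexD(2)[OF I_complex] uR mt(1)] .
 then have "frac R p (obj I (n - 1 + 1)) (diff I (n - 1) m) t = \<zero>\<^bsub>L.LM (obj I (n - 1 + 1))\<^esub>"
  using L.frac_eq_zero_iff[OF I_module hom_closed[OF complexD(2)[OF I_complex] mt(1)] mt(2)] u(1) by blast
 then have "?V = \<zero>\<^bsub>L.LM (obj I (n - 1 + 1))\<^esub>" using V unfolding mt(3) L.loc_complex_diff_frac[OF I_complex mt(1,2)] by simp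
 then have "?V = \<zero>\<^bsub>L.LM (obj I n)\<^esub>" by (simp only: diff_add_cancel)
 then obtain r where r: "r\<in>carrier R - p" "r \<odot>\<^bsub>obj I n\<^esub> v = \<zero>\<^bsub>obj I n\<^esub>"
  using L.frac_eq_zero_iff[OF I_module v(1) L.S_one] by blast
 have "r \<odot>\<^sub>E v i = \<zero>\<^sub>E" for i using fun_cong[OF r(2), of i] unfolding I_simps .
 then show False using v(2)[of r] r(1) by blast
qed

text \<open>The localized complex is its own witness: homotopical injectivity tested against it
  would yield a contraction. Hence the test type is the one in which it lives.\<close>

lemma loc_I_not_homotopically_injective:
 "\<not> homotopically_injective TYPE(((int => 'e) \<times> 'a) set) (loc_ring R p) LI"
 using homotopically_injective_acyclic_contractible[OF L.loc_ring_cring loc_I_complex loc_I_acyclic] loc_I_not_contractible by blast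

end

end

theorem proposition2p7:
  fixes R :: "('a, 'r) ring_scheme" and E :: "('a, 'e) module"
    and nn :: "'a set" and x :: 'a
    and M :: "('a, 'e) module" and J :: "('a, 'e) cochain" and \<iota> :: "int \<Rightarrow> 'e \<Rightarrow> 'e"
    and X I :: "('a, int \<Rightarrow> 'e) cochain"
  assumes "cring R" and "noetherian_ring R" and "krull_dim R \<ge> 1"
    and "primeideal nn R" and "\<not> minimal_prime nn R"
    and "x \<in> carrier R" and "{r \<in> carrier R. r \<otimes>\<^bsub>R\<^esub> x = \<zero>\<^bsub>R\<^esub>} = PIdl\<^bsub>R\<^esub> x"
    and "injective_hull TYPE('a) R (quot_module (self_module R) nn) E"
    and "J = mult_complex x E"
    and "M = E\<lparr>carrier := {e \<in> carrier E. x \<odot>\<^bsub>E\<^esub> e = \<zero>\<^bsub>E\<^esub>}\<rparr>"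
    and "\<iota> = (\<lambda>n e. e)"
    and "X = prod_complex (\<lambda>i. shift_complex i (stalk_complex M))"
    and "I = prod_complex (\<lambda>i. shift_complex i J)"
  shows "(minimal_injective_resolution TYPE('t) R M J \<iota>)
    \<and> (semi_injective TYPE('t) TYPE('u) R I \<and> minimal_complex R I)
    \<and> (quasi_iso R X I (prod_map (\<lambda>i. shift_map i \<iota>)))
    \<and> (\<forall>n. supp R X = {nn} \<and> {nn} \<subset> ass R (obj I n))
    \<and> (\<forall>n. \<forall>p \<in> ass R (obj I n). p \<noteq> nn \<longrightarrow>
           cochain_complex (loc_ring R p) (loc_complex R p I) \<and>
           (\<forall>k. injective_module TYPE('v) (loc_ring R p) (obj (loc_complex R p I) k)) \<and>
           acyclic_complex (loc_complex R p I) \<and>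
           \<not> contractible_complex (loc_ring R p) (loc_complex R p I) \<and>
           \<not> homotopically_injective TYPE(((int \<Rightarrow> 'e) \<times> 'a) set)
               (loc_ring R p) (loc_complex R p I))"
proof -
 obtain e0 where "injective_hull_at R nn E e0" by (rule injective_hull_at_exists[OF assms(1,2,4,8)])
 moreover obtain q where "primeideal q R" "q <= nn" "q ~= nn" using assms(4,5) unfolding minimal_prime_def by blast
 ultimately interpret mult_complex_at R nn E e0 x q by (intro mult_complex_at.intro mult_complex_at_axioms.intro assms(6,7))
 have "{nn} \<subset> ass R (obj (prod_complex (%i. shift_complex i (mult_complex x E))) n)" for n
  using nn_in_ass[of n] other_ass[of n] by blast
 then show ?thesis unfolding assms(9-13) by (intro conjI allI ballI impI resolution I_semi_injective I_minimal X_quasi_iso supp_X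
    loc_I_complex loc_I_injective loc_I_acyclic loc_I_not_contractible loc_I_not_homotopically_injective)
qed

end
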